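(* Let $\{\mu_n\}_{n=1}^\infty$ be a sequence of Borel probability measures on $\mathbb{R}^2$ and let $\{k_n\}_{n=1}^\infty$ be positive integers with $\lim_{n\to\infty}k_n=\infty$. Assume that for $j=1,2$ the free convolution powers $[\mu_n^{(j)}]^{\boxplus k_n}$ converge weakly to a $\boxplus$-infinitely divisible law $\nu_\boxplus^{\gamma_j,\sigma_j}$ on $\mathbb{R}$ (with L\'evy parameters $(\gamma_j,\sigma_j)$), and assume that the pointwise limit $R=\lim_{n\to\infty}k_nR_{\mu_n}$ exists in a product domain $\Omega$ (on which all $R_{\mu_n}$ are defined). Then there exists a unique probability law $\nu$ on $\mathbb{R}^2$ such that $R=R_\nu$ on $\Omega$.
   Context: For a Borel probability measure $\mu$ on $\mathbb{R}^2$, its marginals are $\mu^{(j)}=\mu\circ\pi_j^{-1}$, $j=1,2$, where $\pi_1(s,t)=s$, $\pi_2(s,t)=t$, and its Cauchy transform is $G_\mu(z,w)=\int_{\mathbb{R}^2}\frac{1}{(z-s)(w-t)}\,d\mu(s,t)$ for $z,w\in\mathbb{C}\setminus\mathbb{R}$. For a probability measure $m$ on $\mathbb{R}$, $G_m(z)=\int_{\mathbb{R}}\frac{1}{z-x}\,dm(x)$, $z\notin\mathbb{R}$. For $\alpha,\beta>0$ the Stolz angle is $\Delta=\Delta_{\alpha,\beta}=\{x+iy\in\mathbb{C}: y<0,\ |x|<-\alpha y,\ y>-\beta\}$, $\overline{\Delta}=\{\bar z:z\in\Delta\}$ is its reflection, and the associated product domain is $\Omega=(\Delta\cup\overline\Delta)\times(\Delta\cup\overline\Delta)$.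 The one-dimensional $R$-transform $R_m$ of a probability measure $m$ on $\mathbb{R}$ is the holomorphic function on $\Delta\cup\overline\Delta$ (for a sufficiently small Stolz angle $\Delta$) with $1/z+R_m(z)\notin\mathbb{R}$, $G_m(1/z+R_m(z))=z$, and $zR_m(z)\to0$ as $z\to0$ in $\Delta\cup\overline\Delta$. The bi-free partial $R$-transform of a probability measure $\mu$ on $\mathbb{R}^2$ is $$R_\mu(z,w)=zR_{\mu^{(1)}}(z)+wR_{\mu^{(2)}}(w)+\left[1-\frac{1}{h_\mu(z,w)}\right],\quad h_\mu(z,w)=\frac{G_\mu\left(1/z+R_{\mu^{(1)}}(z),\,1/w+R_{\mu^{(2)}}(w)\right)}{zw},$$ which is defined and holomorphic on a product domain (with $\Delta$ small enough) on which $R_{\mu^{(1)}},R_{\mu^{(2)}}$ are defined and $h_\mu$ has no zeros; $R_\mu$ also denotes the holomorphic extension of this function to a larger product domain whenever such an extension exists. $\boxplus$ denotes free additive convolution of probability measures on $\mathbb{R}$ and $m^{\boxplus k}$ the $k$-fold free convolution of $m$ with itself. For $\gamma\in\mathbb{R}$ and $\sigma$ a finite positive Borel measure on $\mathbb{R}$ (L\'evy parameters), $\nu_\boxplus^{\gamma,\sigma}$ is the unique $\boxplus$-infinitely divisible law on $\mathbb{R}$ with $R_{\nu_\boxplus^{\gamma,\sigma}}(z)=\gamma+\int_{\mathbb{R}}\frac{z+x}{1-zx}\,d\sigma(x)$, $z\notin\mathbb{R}$. *)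

theory Defs
  imports "HOL-Probability.Probability" "HOL-Complex_Analysis.Complex_Analysis"
begin

section \<open>Stolz angles and product domains\<close>

definition stolz_angle :: "real \<Rightarrow> real \<Rightarrow> complex set" where
  "stolz_angle \<alpha> \<beta> = {z. Im z < 0 \<and> \<bar>Re z\<bar> < - \<alpha> * Im z \<and> Im z > - \<beta>}"

definition stolz_pair :: "real \<Rightarrow> real \<Rightarrow> complex set" where
  "stolz_pair \<alpha> \<beta> = stolz_angle \<alpha> \<beta> \<union> cnj ` stolz_angle \<alpha> \<beta>"

definition product_domain :: "real \<Rightarrow> real \<Rightarrow> (complex \<times> complex) set" where
  "product_domain \<alpha> \<beta> = stolz_pair \<alpha> \<beta> \<times> stolz_pair \<alpha> \<beta>"

text \<open>Holomorphy in two variables: Frechet differentiability with a complex-linear derivative.\<close>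

definition holomorphic2_on :: "(complex \<times> complex \<Rightarrow> complex) \<Rightarrow> (complex \<times> complex) set \<Rightarrow> bool" where
  "holomorphic2_on F S \<longleftrightarrow>
     (\<forall>p\<in>S. \<exists>a b. (F has_derivative (\<lambda>(u, v). a * u + b * v)) (at p within S))"

section \<open>Cauchy transforms\<close>

definition borel_law2 :: "(real \<times> real) measure \<Rightarrow> bool" where
  "borel_law2 \<mu> \<longleftrightarrow> prob_space \<mu> \<and> sets \<mu> = sets borel"

definition marginal1 :: "(real \<times> real) measure \<Rightarrow> real measure" where
  "marginal1 \<mu> = distr \<mu> borel fst"

definition marginal2 :: "(real \<times> real) measure \<Rightarrow> real measure" where
  "marginal2 \<mu> = distr \<mu> borel snd"

definition cauchy_transform :: "real measure \<Rightarrow> complex \<Rightarrow> complex" where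
  "cauchy_transform m z = (LINT x|m. 1 / (z - of_real x))"

definition cauchy_transform2 :: "(real \<times> real) measure \<Rightarrow> complex \<Rightarrow> complex \<Rightarrow> complex" where
  "cauchy_transform2 \<mu> z w =
     (LINT p|\<mu>. 1 / ((z - of_real (fst p)) * (w - of_real (snd p))))"

section \<open>The one-dimensional R-transform\<close>

text \<open>
  A partial function is represented by a relation: the predicate below says that the R-transform
  of \<open>m\<close> is defined on \<open>stolz_pair \<alpha> \<beta>\<close> and is given there by \<open>R\<close>. The values of \<open>R\<close> outside
  this set are irrelevant.
\<close>

definition is_R_transform :: "real measure \<Rightarrow> real \<Rightarrow> real \<Rightarrow> (complex \<Rightarrow> complex) \<Rightarrow> bool" where
  "is_R_transform m \<alpha> \<beta> R \<longleftrightarrow>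
     R holomorphic_on stolz_pair \<alpha> \<beta> \<and>
     (\<forall>z\<in>stolz_pair \<alpha> \<beta>. 1 / z + R z \<notin> \<real> \<and> cauchy_transform m (1 / z + R z) = z) \<and>
     ((\<lambda>z. z * R z) \<longlongrightarrow> 0) (at 0 within stolz_pair \<alpha> \<beta>)"

section \<open>Free additive convolution\<close>

text \<open>
  \<open>is_free_conv m n p\<close> says that \<open>p\<close> is the free additive convolution of \<open>m\<close> and \<open>n\<close>,
  the law whose R-transform is the sum of those of \<open>m\<close> and \<open>n\<close> on a common Stolz domain.
\<close>

definition is_free_conv :: "real measure \<Rightarrow> real measure \<Rightarrow> real measure \<Rightarrow> bool" where
  "is_free_conv m n p \<longleftrightarrow>
     real_distribution m \<and> real_distribution n \<and> real_distribution p \<and>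
     (\<exists>\<alpha>>0. \<exists>\<beta>>0. \<exists>R S. is_R_transform m \<alpha> \<beta> R \<and> is_R_transform n \<alpha> \<beta> S \<and>
        is_R_transform p \<alpha> \<beta> (\<lambda>z. R z + S z))"

text \<open>\<open>is_free_conv_power m k p\<close>: \<open>p\<close> is the \<open>k\<close>-fold free convolution of \<open>m\<close> with itself, \<open>k \<ge> 1\<close>.\<close>

inductive is_free_conv_power :: "real measure \<Rightarrow> nat \<Rightarrow> real measure \<Rightarrow> bool"
  for m :: "real measure" where
  one: "real_distribution m \<Longrightarrow> is_free_conv_power m 1 m"
| step: "is_free_conv_power m k p \<Longrightarrow> is_free_conv p m q \<Longrightarrow> is_free_conv_power m (Suc k) q"

definition free_infinitely_divisible :: "real measure \<Rightarrow> bool" where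
  "free_infinitely_divisible m \<longleftrightarrow>
     real_distribution m \<and> (\<forall>k\<ge>1. \<exists>\<rho>. is_free_conv_power \<rho> k m)"

definition free_levy_R :: "real \<Rightarrow> real measure \<Rightarrow> complex \<Rightarrow> complex" where
  "free_levy_R \<gamma> \<sigma> z =
     of_real \<gamma> + (LINT x|\<sigma>. (z + of_real x) / (1 - z * of_real x))"

definition is_free_levy_law :: "real \<Rightarrow> real measure \<Rightarrow> real measure \<Rightarrow> bool" where
  "is_free_levy_law \<gamma> \<sigma> m \<longleftrightarrow>
     finite_borel_measure \<sigma> \<and> free_infinitely_divisible m \<and>
     (\<exists>\<alpha>>0. \<exists>\<beta>>0. is_R_transform m \<alpha> \<beta> (free_levy_R \<gamma> \<sigma>))"

section \<open>The bi-free partial R-transform\<close>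

definition bifree_h ::
  "(real \<times> real) measure \<Rightarrow> (complex \<Rightarrow> complex) \<Rightarrow> (complex \<Rightarrow> complex) \<Rightarrow> complex \<Rightarrow> complex \<Rightarrow> complex" where
  "bifree_h \<mu> R1 R2 z w = cauchy_transform2 \<mu> (1 / z + R1 z) (1 / w + R2 w) / (z * w)"

text \<open>The defining formula, on a product domain where all of its ingredients make sense.\<close>

definition bifree_R_formula_on ::
  "(real \<times> real) measure \<Rightarrow> real \<Rightarrow> real \<Rightarrow> (complex \<times> complex \<Rightarrow> complex) \<Rightarrow> bool" where
  "bifree_R_formula_on \<mu> \<alpha> \<beta> F \<longleftrightarrow>
     (\<exists>R1 R2. is_R_transform (marginal1 \<mu>) \<alpha> \<beta> R1 \<and> is_R_transform (marginal2 \<mu>) \<alpha> \<beta> R2 \<and>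
        (\<forall>(z, w)\<in>product_domain \<alpha> \<beta>.
           bifree_h \<mu> R1 R2 z w \<noteq> 0 \<and>
           F (z, w) = z * R1 z + w * R2 w + (1 - 1 / bifree_h \<mu> R1 R2 z w)))"

text \<open>
  The bi-free partial R-transform of \<open>\<mu>\<close> is defined on \<open>product_domain \<alpha> \<beta>\<close> and is given there
  by \<open>F\<close>, possibly as the holomorphic extension from a smaller product domain. The extension is
  unique, as each of the four connected components of the larger domain meets the smaller one.
\<close>

definition is_bifree_R_transform ::
  "(real \<times> real) measure \<Rightarrow> real \<Rightarrow> real \<Rightarrow> (complex \<times> complex \<Rightarrow> complex) \<Rightarrow> bool" where
  "is_bifree_R_transform \<mu> \<alpha> \<beta> F \<longleftrightarrow>
     holomorphic2_on F (product_domain \<alpha> \<beta>) \<and>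
     (\<exists>\<alpha>' \<beta>'. 0 < \<alpha>' \<and> \<alpha>' \<le> \<alpha> \<and> 0 < \<beta>' \<and> \<beta>' \<le> \<beta> \<and> bifree_R_formula_on \<mu> \<alpha>' \<beta>' F)"

end

theory Submission
  imports Defs
begin

text \<open>
  The bi-free convolution power of \<open>\<mu>\<^sub>n\<close> of order \<open>k\<^sub>n\<close> exists: subordination gives a
  formula for its Cauchy transform, and the positivity needed to recognise it as the transform of a
  law is that of the vacuum state on a free product. Sorted by word length, the squared norm in
  question becomes an explicit series of squared norms of tensors, so the free product itself need not
  be constructed. The law is recovered from its densities on shifted lines by the Poisson formula.

  The marginals of these laws converge, so the laws have a limit point \<open>\<nu>\<close> along a subsequence. The
  variance \<open>Im F / Im z - 1\<close>, where \<open>F = 1 / G\<close>, obeys a Harnack inequality. It shows that the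
  variances of the marginals of \<open>\<mu>\<^sub>n\<close> are of order \<open>1 / k\<^sub>n\<close>, uniformly on cones, so that \<open>F\<close> can be
  inverted on the whole given domain, where \<open>k\<^sub>n R\<^bsub>\<mu>\<^sub>n\<^esub>\<close> is therefore bounded. Hence the limit \<open>R\<close> is
  holomorphic, and passing to the limit in the formula for the powers identifies it with \<open>R\<^sub>\<nu>\<close>.

  For the uniqueness of \<open>\<nu>\<close>, letting one variable tend to zero radially isolates the marginal \<open>R\<close>-transforms;
  these and \<open>R\<close> determine the two-dimensional Cauchy transform.
\<close>

section \<open>Positivity in free products\<close>

text \<open>The transform of the power is forced. The marginal terms of the bi-free R-transform
  simply add up, so the remaining term must satisfy 1 - 1/h_k = k (1 - 1/h). At the subordinated
  points h = 1 + c, where c is the covariance of the two resolvents after each is scaled to mean 1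
  and centred; solving gives h_k = (1 + c) / (1 - \<kappa> c) with \<kappa> = k - 1. This is the
  function \<open>S\<close> of the positivity lemmas. The same scaling turns the variance of a
  resolvent into Im F / Im z - 1, and imaginary parts in the subordination equation show that
  \<kappa> times this variance is below 1 for both variables. That strict inequality makes the
  geometric series in \<kappa> converge. In the limit the obstacle is that the R-transforms in the
  hypotheses come with small domains depending on n, and that the convergence is only pointwise. For
  large n these domains therefore serve only to recognise, through the identity theorem, an explicit
  function that lives on the whole given domain.\<close>

text \<open>An identity between rational functions of p, q, c, d, tied only by the relations for p +
  cnj p and q + cnj q. Its point is the right-hand side: in the range of application it is a
  positive combination of |1 + c|^2 and \<Psi>, and \<Psi> is the closed form of the series shown to
  be nonnegative next.\<close>

lemma free_product_identity:
  fixes p q c d :: complex and X Y \<kappa> :: real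
  assumes p: "p + cnj p = of_real (1 + X)" and q: "q + cnj q = of_real (1 + Y)"
    and c: "1 - of_real \<kappa> * c \<noteq> 0" and d: "1 - of_real \<kappa> * d \<noteq> 0"
    and Y: "1 - \<kappa> * Y \<noteq> 0"
  defines "\<rho> \<equiv> q * (1 + c) + cnj q * (1 + d) - (1 + c) * (1 + d)"
    and "S \<equiv> \<lambda>u. (1 + u) / (1 - of_real \<kappa> * u)"
  defines "\<tau> \<equiv> (1 + c + of_real \<kappa> * \<rho> / of_real (1 - \<kappa> * Y)) / (1 - of_real \<kappa> * d)"
  defines "\<Psi> \<equiv> X * (cmod (1 + c))\<^sup>2 + 2 * Re (p * \<rho>) / (1 - \<kappa> * Y) + 2 * Re (p * (d - cnj c) * \<tau>)"
  shows "2 * Re (q * (cnj p * S (cnj d) + p * S c)) * (cmod (1 - of_real \<kappa> * c))\<^sup>2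
    = (1 - \<kappa> * Y) * ((1 - \<kappa> * X) * (cmod (1 + c))\<^sup>2 + (\<kappa> + 1) * \<Psi>)"
proof -
  define k :: complex where "k = of_real \<kappa>"
  define y :: complex where "y = of_real Y"
  have y: "y = q + cnj q - 1" using q by (simp add: y_def)
  have cY: "of_real (1 - \<kappa> * Y) = 1 - k * y" by (simp add: k_def y_def)
  have kc: "cnj k = k" by (simp add: k_def)
  have nz: "1 - k * c \<noteq> 0" "1 - k * d \<noteq> 0" "1 - k * cnj c \<noteq> 0" "1 - k * y \<noteq> 0"
    using c d Y by (auto simp: k_def y_def simp flip: of_real_mult)
      (metis complex_cnj_cnj complex_cnj_complex_of_real complex_cnj_mult complex_cnj_one)
  define \<tau>' where "\<tau>' = (1 - k * y) * (1 + c) + k * \<rho>"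
  have \<tau>: "(1 - k * y) * \<tau> = \<tau>' / (1 - k * d)"
  proof -
    have "a * ((u + r / a) / b) = (a * u + r) / b" if "a \<noteq> 0" for a b u r :: complex
      using that by (cases "b = 0") (simp_all add: field_simps)
    then show ?thesis using nz unfolding \<tau>_def \<tau>'_def cY k_def[symmetric] by blast
  qed
  \<comment> \<open>The identity with all denominators cleared; of the relations, only
    \<open>y = q + cnj q - 1\<close> enters.\<close>
  have poly: "(1 - k * cnj c) * (q * (1 + c) * (1 - k * d) + cnj q * (1 + d) * (1 - k * c))
      = ((1 - k * y) * (1 + c) * (1 + cnj c) + (k + 1) * \<rho>) * (1 - k * d) + (k + 1) * (d - cnj c) * \<tau>'"
    unfolding \<tau>'_def \<rho>_def y by (simp add: algebra_simps)
  have main: "(1 - k * c) * (1 - k * cnj c) * (q * S c + cnj q * S d)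
      = (1 - k * y) * (1 + c) * (1 + cnj c) + (k + 1) * \<rho> + (k + 1) * (d - cnj c) * ((1 - k * y) * \<tau>)"
    (is "?l = ?r")
  proof -
    have "?l * (1 - k * d) = (1 - k * cnj c) * (q * (1 + c) * (1 - k * d) + cnj q * (1 + d) * (1 - k * c))"
    proof -
      have "a * a' * (q * (u / a) + q' * (v / b)) * b = a' * (q * u * b + q' * v * a)"
        if "a \<noteq> 0" "b \<noteq> 0" for a a' b q q' u v :: complex
        using that by (simp add: field_simps)
      then show ?thesis using nz unfolding S_def k_def[symmetric] by blast
    qed
    also have "\<dots> = ?r * (1 - k * d)"
    proof -
      have "e * b + f * t = (e + f * (t / b)) * b" if "b \<noteq> 0" for e f t b :: complex
        using that by (simp add: field_simps)
      then show ?thesis using nz unfolding poly \<tau> by blast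
    qed
    finally show ?thesis using nz by simp
  qed
  have Sc: "cnj (S u) = S (cnj u)" for u by (simp add: S_def)
  \<comment> \<open>Conjugating the first summand under Re turns cnj p into p and S (cnj d) into S
    d, which brings the left side to the shape of \<open>main\<close>.\<close>
  have "Re (q * (cnj p * S (cnj d) + p * S c)) = Re (q * p * S c) + Re (cnj (q * (cnj p * S (cnj d))))"
    by (simp add: algebra_simps)
  also have "\<dots> = Re (p * (q * S c + cnj q * S d))"
    by (simp add: Sc algebra_simps)
  finally have 1: "Re (q * (cnj p * S (cnj d) + p * S c)) = Re (p * (q * S c + cnj q * S d))" .
  have nc: "(1 - k * c) * (1 - k * cnj c) = of_real ((cmod (1 - of_real \<kappa> * c))\<^sup>2)"
    unfolding complex_norm_square by (simp add: k_def)
  have n1: "(1 + c) * (1 + cnj c) = of_real ((cmod (1 + c))\<^sup>2)"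
    unfolding complex_norm_square by simp
  have ReM: "Re (of_real a * z) = a * Re z" for a z by simp
  have "2 * Re (q * (cnj p * S (cnj d) + p * S c)) * (cmod (1 - of_real \<kappa> * c))\<^sup>2
      = 2 * Re (of_real ((cmod (1 - of_real \<kappa> * c))\<^sup>2) * (p * (q * S c + cnj q * S d)))"
    unfolding 1 ReM by (simp add: mult_ac)
  also have "of_real ((cmod (1 - of_real \<kappa> * c))\<^sup>2) * (p * (q * S c + cnj q * S d))
      = p * ((1 - k * c) * (1 - k * cnj c) * (q * S c + cnj q * S d))"
    unfolding nc by (simp add: mult_ac)
  also have "\<dots> = of_real ((1 - \<kappa> * Y) * (cmod (1 + c))\<^sup>2) * p + of_real (\<kappa> + 1) * (p * \<rho>)
       + of_real ((\<kappa> + 1) * (1 - \<kappa> * Y)) * (p * (d - cnj c) * \<tau>)"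
    unfolding main mult.assoc[of "1 - k * y" "1 + c"] n1 of_real_mult cY
    by (simp add: k_def algebra_simps)
  also have "Re \<dots> = (1 - \<kappa> * Y) * (cmod (1 + c))\<^sup>2 * Re p + (\<kappa> + 1) * Re (p * \<rho>)
       + (\<kappa> + 1) * (1 - \<kappa> * Y) * Re (p * (d - cnj c) * \<tau>)"
    unfolding plus_complex.sel ReM ..
  also have "2 * \<dots> = (1 - \<kappa> * Y) * ((1 - \<kappa> * X) * (cmod (1 + c))\<^sup>2 + (\<kappa> + 1) * \<Psi>)"
  proof -
    have "Re (p + cnj p) = 1 + X" unfolding p by simp
    then have Rp: "Re p = (1 + X) / 2" by simp
    show ?thesis using Y unfolding \<Psi>_def Rp by (simp add: field_simps)
  qed
  finally show ?thesis .
qed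

text \<open>
  In the model behind this lemma, vectors \<open>x\<close>, \<open>y\<close>, \<open>r\<close> of a Hilbert space have inner products
  \<open>\<langle>x, x\<rangle> = X\<close>, \<open>\<langle>y, y\<rangle> = Y\<close>, \<open>\<langle>r, r\<rangle> = V\<close>, \<open>\<langle>x, y\<rangle> = d\<close>, \<open>\<langle>r, y\<rangle> = \<rho>\<close>, \<open>\<langle>x, r\<rangle> = \<sigma>\<close>, of which the hypothesis is
  the part that matters. In the proof \<open>N n\<close> is the squared norm of the tensor given by
  \<open>v\<^bsub>n+1\<^esub> = v\<^sub>n \<otimes> x + y \<otimes> \<dots> \<otimes> y \<otimes> r\<close>, and \<open>t n\<close> is its inner product with \<open>y \<otimes> \<dots> \<otimes> y\<close>.
\<close>

lemma free_product_series_nonneg: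
  fixes X Y \<kappa> V :: real and \<sigma> \<rho> d t0 :: complex
  assumes \<kappa>: "\<kappa> \<ge> 0" and X: "X \<ge> 0" "\<kappa> * X < 1" and Y: "Y > 0" "\<kappa> * Y < 1"
    and d: "\<kappa> * cmod d < 1"
    and gram: "\<And>e. (cmod (e * d + \<rho>))\<^sup>2 \<le> Y * ((cmod e)\<^sup>2 * X + 2 * Re (e * \<sigma>) + V)"
  defines "\<tau> \<equiv> (t0 + of_real \<kappa> * \<rho> / of_real (1 - \<kappa> * Y)) / (1 - of_real \<kappa> * d)"
  shows "0 \<le> X * (cmod t0)\<^sup>2 + V / (1 - \<kappa> * Y) + 2 * Re (\<sigma> * \<tau>)"
proof -
  define t where "t = rec_nat t0 (\<lambda>n u. d * u + \<rho> * of_real (Y ^ n))"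
  have t_0: "t 0 = t0" and t_Suc: "t (Suc n) = d * t n + \<rho> * of_real (Y ^ n)" for n
    by (simp_all add: t_def)
  define N where "N = rec_nat ((cmod t0)\<^sup>2) (\<lambda>n u. X * u + V * Y ^ n + 2 * Re (\<sigma> * t n))"
  have N_0: "N 0 = (cmod t0)\<^sup>2" and N_Suc: "N (Suc n) = X * N n + V * Y ^ n + 2 * Re (\<sigma> * t n)" for n
    by (simp_all add: N_def)
  \<comment> \<open>Cauchy-Schwarz for the n-th tensor against the n-fold tensor power of y, whose
    squared norm is Y^n. The induction step is \<open>gram\<close> at e = t n / Y^n.\<close>
  have inv: "(cmod (t n))\<^sup>2 \<le> N n * Y ^ n" for n
  proof (induction n)
    case 0
    then show ?case by (simp add: N_0 t_0)
  next
    case (Suc n)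
    define y where "y = Y ^ n"
    have y: "y > 0" using Y by (simp add: y_def)
    define e where "e = t n / of_real y"
    have tn: "t n = of_real y * e" using y by (simp add: e_def)
    have "y * (y * (cmod e)\<^sup>2) \<le> y * N n"
      using Suc y by (simp add: tn norm_mult power2_eq_square y_def[symmetric] mult_ac)
    then have N: "y * (cmod e)\<^sup>2 \<le> N n" using y by simp
    have ts: "t (Suc n) = of_real y * (e * d + \<rho>)"
      unfolding t_Suc tn y_def by (simp add: algebra_simps)
    have "(cmod (t (Suc n)))\<^sup>2 = y\<^sup>2 * (cmod (e * d + \<rho>))\<^sup>2"
      unfolding ts norm_mult power_mult_distrib by simp
    also have "\<dots> \<le> y\<^sup>2 * (Y * ((cmod e)\<^sup>2 * X + 2 * Re (e * \<sigma>) + V))"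
      by (rule mult_left_mono[OF gram]) simp
    also have "\<dots> = (X * (y * (cmod e)\<^sup>2) + V * y + 2 * (y * Re (e * \<sigma>))) * (Y * y)"
      by (simp add: algebra_simps power2_eq_square)
    also have "\<dots> \<le> (X * N n + V * y + 2 * (y * Re (e * \<sigma>))) * (Y * y)"
      using y Y X N by (intro mult_right_mono add_right_mono mult_left_mono) auto
    also have "y * Re (e * \<sigma>) = Re (\<sigma> * t n)"
      unfolding tn by (simp add: algebra_simps)
    finally show ?case by (simp add: N_Suc y_def)
  qed
  have N_nonneg: "N n \<ge> 0" for n
  proof -
    have "0 \<le> N n * Y ^ n" using inv[of n] by (meson order_trans zero_le_power2)
    then show ?thesis using zero_less_power[OF Y(1), of n] by (simp add: zero_le_mult_iff)
  qed
  \<comment> \<open>A common ratio for the rates \<kappa> |d| and \<kappa> Y; the value 1/2 keeps it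
    positive, since \<open>tbound\<close> divides by it. The factor linear in n in
    \<open>tbound\<close> allows for equal rates.\<close>
  define q where "q = max (max (\<kappa> * cmod d) (\<kappa> * Y)) (1/2)"
  have q: "0 < q" "q < 1" "\<kappa> * cmod d \<le> q" "\<kappa> * Y \<le> q"
    using d Y by (auto simp: q_def)
  have tbound: "cmod (of_real (\<kappa> ^ n) * t n) \<le> q ^ n * (cmod t0 + real n * (\<kappa> * cmod \<rho> / q))" for n
  proof (induction n)
    case 0
    then show ?case by (simp add: t_0)
  next
    case (Suc n)
    have "of_real (\<kappa> ^ Suc n) * t (Suc n)
        = of_real \<kappa> * d * (of_real (\<kappa> ^ n) * t n) + of_real (\<kappa> * (\<kappa> * Y) ^ n) * \<rho>"
      unfolding t_Suc by (simp add: algebra_simps power_mult_distrib)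
    also have "cmod \<dots> \<le> (\<kappa> * cmod d) * cmod (of_real (\<kappa> ^ n) * t n) + \<kappa> * (\<kappa> * Y) ^ n * cmod \<rho>"
      using norm_triangle_ineq \<kappa> Y by (metis (no_types, opaque_lifting) abs_of_nonneg less_imp_le
          mult_nonneg_nonneg norm_mult norm_of_real zero_le_power)
    also have "\<dots> \<le> q * (q ^ n * (cmod t0 + real n * (\<kappa> * cmod \<rho> / q))) + \<kappa> * q ^ n * cmod \<rho>"
      using \<kappa> Y q Suc by (intro add_mono mult_mono power_mono) auto
    also have "\<dots> = q ^ Suc n * (cmod t0 + real (Suc n) * (\<kappa> * cmod \<rho> / q))"
      using q by (simp add: field_simps)
    finally show ?case .
  qed
  have "(\<lambda>n. q ^ n * (cmod t0 + real n * (\<kappa> * cmod \<rho> / q))) \<longlonglongrightarrow> 0"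
  proof -
    have "(\<lambda>n. q ^ n * cmod t0 + real n * q ^ n * (\<kappa> * cmod \<rho> / q)) \<longlonglongrightarrow> 0 * cmod t0 + 0 * (\<kappa> * cmod \<rho> / q)"
      using q by (intro tendsto_intros powser_times_n_limit_0 LIMSEQ_power_zero) auto
    then show ?thesis by (simp add: algebra_simps)
  qed
  then have t_lim: "(\<lambda>n. of_real (\<kappa> ^ n) * t n) \<longlonglongrightarrow> 0"
    by (rule Lim_null_comparison[rotated]) (use tbound in auto)
  have nz: "1 - of_real \<kappa> * d \<noteq> 0"
  proof
    assume "1 - of_real \<kappa> * d = 0"
    then have "cmod (of_real \<kappa> * d) = 1" by (metis eq_iff_diff_eq_0 norm_one)
    then show False using d \<kappa> by (simp add: norm_mult)
  qed
  have geo: "(\<lambda>m. \<Sum>n<m. (\<kappa> * Y) ^ n) \<longlonglongrightarrow> 1 / (1 - \<kappa> * Y)"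
  proof -
    have "(\<lambda>n. (\<kappa> * Y) ^ n) sums (1 / (1 - \<kappa> * Y))"
      using \<kappa> Y by (intro geometric_sums) auto
    then show ?thesis by (simp add: sums_def)
  qed
  define T where "T = (\<lambda>m. \<Sum>n<m. of_real (\<kappa> ^ n) * t n)"
  have T: "T m = (t0 + of_real \<kappa> * \<rho> * of_real (\<Sum>n<m. (\<kappa> * Y) ^ n) - of_real (\<kappa> ^ m) * t m) / (1 - of_real \<kappa> * d)" for m
  proof -
    have "T m + of_real (\<kappa> ^ m) * t m
        = t0 + of_real \<kappa> * \<rho> * of_real (\<Sum>n<m. (\<kappa> * Y) ^ n) + of_real \<kappa> * d * T m"
    proof (induction m)
      case 0
      then show ?case by (simp add: T_def t_0)
    next
      case (Suc m)
      have TS: "T (Suc m) = T m + of_real (\<kappa> ^ m) * t m" by (simp add: T_def)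
      have "T (Suc m) + of_real (\<kappa> ^ Suc m) * t (Suc m)
          = (t0 + of_real \<kappa> * \<rho> * of_real (\<Sum>n<m. (\<kappa> * Y) ^ n) + of_real \<kappa> * d * T m)
            + of_real (\<kappa> ^ Suc m) * (d * t m + \<rho> * of_real (Y ^ m))"
        by (simp only: TS t_Suc Suc)
      then show ?case by (simp add: TS algebra_simps power_mult_distrib)
    qed
    then have "T m * (1 - of_real \<kappa> * d)
        = t0 + of_real \<kappa> * \<rho> * of_real (\<Sum>n<m. (\<kappa> * Y) ^ n) - of_real (\<kappa> ^ m) * t m"
      by (simp add: algebra_simps)
    then show ?thesis using nz by (metis nonzero_mult_div_cancel_right)
  qed
  have T_lim: "T \<longlonglongrightarrow> \<tau>"
  proof -
    have "(\<lambda>m. (t0 + of_real \<kappa> * \<rho> * of_real (\<Sum>n<m. (\<kappa> * Y) ^ n) - of_real (\<kappa> ^ m) * t m) / (1 - of_real \<kappa> * d))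
      \<longlonglongrightarrow> (t0 + of_real \<kappa> * \<rho> * of_real (1 / (1 - \<kappa> * Y)) - 0) / (1 - of_real \<kappa> * d)"
      by (intro tendsto_intros t_lim geo nz)
    then show ?thesis unfolding T[symmetric] \<tau>_def by simp
  qed
  \<comment> \<open>With A the sum of \<kappa>^n N (n + 1), summing the recursion for N shows that
    (1 - \<kappa> X) A is at most the right-hand side, and A is nonnegative.\<close>
  have bound: "0 \<le> X * (cmod t0)\<^sup>2 + V * (\<Sum>n<m. (\<kappa> * Y) ^ n) + 2 * Re (\<sigma> * T m)" for m
  proof -
    define A where "A = (\<Sum>n<m. \<kappa> ^ n * N (Suc n))"
    have A0: "A \<ge> 0" unfolding A_def using N_nonneg \<kappa> by (intro sum_nonneg) auto
    have "(\<Sum>n<m. \<kappa> ^ n * N n) + \<kappa> ^ m * N m = N 0 + \<kappa> * A"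
      unfolding A_def by (induction m) (simp_all add: algebra_simps)
    then have le: "(\<Sum>n<m. \<kappa> ^ n * N n) \<le> N 0 + \<kappa> * A"
      using N_nonneg[of m] \<kappa> by (metis add_le_same_cancel1 add.commute le_add_same_cancel1 mult_nonneg_nonneg zero_le_power)
    have "A = X * (\<Sum>n<m. \<kappa> ^ n * N n) + V * (\<Sum>n<m. (\<kappa> * Y) ^ n) + 2 * Re (\<sigma> * T m)"
      unfolding A_def T_def N_Suc
      by (induction m) (simp_all add: algebra_simps power_mult_distrib)
    also have "\<dots> \<le> X * (N 0 + \<kappa> * A) + V * (\<Sum>n<m. (\<kappa> * Y) ^ n) + 2 * Re (\<sigma> * T m)"
      using X le by (intro add_right_mono mult_left_mono) auto
    finally have "(1 - \<kappa> * X) * A \<le> X * N 0 + V * (\<Sum>n<m. (\<kappa> * Y) ^ n) + 2 * Re (\<sigma> * T m)"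
      by (simp add: algebra_simps)
    moreover have "0 \<le> (1 - \<kappa> * X) * A" using A0 X by simp
    ultimately show ?thesis by (simp add: N_0)
  qed
  have "(\<lambda>m. X * (cmod t0)\<^sup>2 + V * (\<Sum>n<m. (\<kappa> * Y) ^ n) + 2 * Re (\<sigma> * T m))
     \<longlonglongrightarrow> X * (cmod t0)\<^sup>2 + V * (1 / (1 - \<kappa> * Y)) + 2 * Re (\<sigma> * \<tau>)"
    by (intro tendsto_intros T_lim geo)
  then show ?thesis
    using bound by (intro LIMSEQ_le_const[of _ _ 0]) auto
qed

text \<open>The series lemma applies with \<sigma> = p (d - cnj c), V = 2 Re (p \<rho>) and start
  value t0 = 1 + c, so \<Psi> is nonnegative and the identity gives the sign. The denominators do
  not vanish because |\<kappa> c|^2 is at most (\<kappa> X) (\<kappa> Y) < 1, and likewise for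
  d.\<close>

lemma free_product_nonneg:
  fixes p q c d :: complex and X Y \<kappa> :: real
  assumes p: "p + cnj p = of_real (1 + X)" and q: "q + cnj q = of_real (1 + Y)"
    and \<kappa>: "\<kappa> \<ge> 0" and X: "X \<ge> 0" "\<kappa> * X < 1" and Y: "Y \<ge> 0" "\<kappa> * Y < 1"
    and c: "(cmod c)\<^sup>2 \<le> X * Y" and d: "(cmod d)\<^sup>2 \<le> X * Y"
  defines "\<rho> \<equiv> q * (1 + c) + cnj q * (1 + d) - (1 + c) * (1 + d)"
    and "S \<equiv> \<lambda>u. (1 + u) / (1 - of_real \<kappa> * u)"
  assumes gram: "\<And>e. (cmod (e * d + \<rho>))\<^sup>2
      \<le> Y * ((cmod e)\<^sup>2 * X + 2 * Re (e * (p * (d - cnj c))) + 2 * Re (p * \<rho>))"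
  shows "0 \<le> Re (q * (cnj p * S (cnj d) + p * S c))"
\<comment> \<open>The series lemma divides by powers of Y. For Y = 0 both c and d vanish, S is 1 and
  the claim becomes Re q (1 + X) >= 0 with Re q = 1/2.\<close>
proof (cases "Y = 0")
  case True
  then have 0: "c = 0" "d = 0" using c d by auto
  have "Re (q * (cnj p + p)) = Re q * (1 + X)"
    using p by (simp add: add.commute mult.commute[of q])
  moreover have "Re (q + cnj q) = 1" unfolding q using True by simp
  ultimately show ?thesis using X unfolding S_def 0 by simp
next
  case False
  then have Y0: "Y > 0" using Y by simp
  have small: "\<kappa> * cmod u < 1" if "(cmod u)\<^sup>2 \<le> X * Y" for u
  proof -
    have "(\<kappa> * cmod u)\<^sup>2 \<le> (\<kappa> * X) * (\<kappa> * Y)"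
      using mult_left_mono[OF that, of "\<kappa>\<^sup>2"] by (simp add: power_mult_distrib power2_eq_square mult_ac)
    also have "\<dots> < 1 * 1"
      using X Y \<kappa> by (intro mult_strict_mono') auto
    finally show ?thesis by (simp add: power_less_one_iff abs_square_less_1)
  qed
  have nz: "1 - of_real \<kappa> * u \<noteq> 0" if "(cmod u)\<^sup>2 \<le> X * Y" for u
  proof
    assume "1 - of_real \<kappa> * u = 0"
    then have "cmod (of_real \<kappa> * u) = 1" by (metis eq_iff_diff_eq_0 norm_one)
    then show False using small[OF that] \<kappa> by (simp add: norm_mult)
  qed
  define \<tau> where "\<tau> = (1 + c + of_real \<kappa> * \<rho> / of_real (1 - \<kappa> * Y)) / (1 - of_real \<kappa> * d)"
  define \<Psi> where "\<Psi> = X * (cmod (1 + c))\<^sup>2 + 2 * Re (p * \<rho>) / (1 - \<kappa> * Y) + 2 * Re (p * (d - cnj c) * \<tau>)"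
  have "0 \<le> \<Psi>"
    unfolding \<Psi>_def \<tau>_def
    by (rule free_product_series_nonneg) (use \<kappa> X Y0 Y small[OF d] gram in auto)
  moreover have "2 * Re (q * (cnj p * S (cnj d) + p * S c)) * (cmod (1 - of_real \<kappa> * c))\<^sup>2
    = (1 - \<kappa> * Y) * ((1 - \<kappa> * X) * (cmod (1 + c))\<^sup>2 + (\<kappa> + 1) * \<Psi>)"
    unfolding \<Psi>_def \<tau>_def \<rho>_def S_def
    by (rule free_product_identity) (use p q nz[OF c] nz[OF d] Y in auto)
  ultimately have "0 \<le> 2 * Re (q * (cnj p * S (cnj d) + p * S c)) * (cmod (1 - of_real \<kappa> * c))\<^sup>2"
    using X Y \<kappa> by simp
  then show ?thesis using nz[OF c] by (simp add: zero_le_mult_iff)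
qed

section \<open>Resolvents of random variables\<close>

text \<open>A Cauchy transform of X with a complex weight. The weight lets a transform in two
  variables be read as one in a single variable, the resolvent of the other variable being the
  weight.\<close>

definition wct :: "'a measure \<Rightarrow> ('a \<Rightarrow> real) \<Rightarrow> ('a \<Rightarrow> complex) \<Rightarrow> complex \<Rightarrow> complex" where
  "wct M X \<phi> z = (LINT p|M. \<phi> p / (z - of_real (X p)))"

lemma Im_le_norm_diff_of_real: "\<bar>Im z\<bar> \<le> cmod (z - of_real x)"
  using abs_Im_le_cmod[of "z - of_real x"] by simp

lemma diff_of_real_nonzero: "Im z \<noteq> 0 \<Longrightarrow> z - of_real x \<noteq> 0"
  by (auto simp: complex_eq_iff)

lemma norm_divide_diff_of_real_le:
  assumes "Im z \<noteq> 0" "cmod a \<le> B"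
  shows "cmod (a / (z - of_real x)) \<le> B / \<bar>Im z\<bar>"
  unfolding norm_divide using assms Im_le_norm_diff_of_real[of z x] order_trans[OF norm_ge_zero assms(2)]
  by (intro frac_le) auto

lemma inverse_diff_of_real_diff:
  assumes "Im z \<noteq> 0" "Im w \<noteq> 0"
  shows "a / (z - of_real x) - a / (w - of_real x) = (w - z) * (a / ((z - of_real x) * (w - of_real x)))"
  using diff_of_real_nonzero[of z x] diff_of_real_nonzero[of w x] assms by (simp add: field_simps)

locale weighted_variable = finite_measure M for M :: "'a measure" +
  fixes X :: "'a \<Rightarrow> real" and \<phi> :: "'a \<Rightarrow> complex" and B :: real
  assumes X_meas [measurable]: "X \<in> borel_measurable M"
    and \<phi>_meas [measurable]: "\<phi> \<in> borel_measurable M"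
    and \<phi>_bound: "cmod (\<phi> p) \<le> B"
begin

lemma B_nonneg: "B \<ge> 0"
  by (rule order_trans[OF norm_ge_zero \<phi>_bound])

lemma integrable_divide:
  assumes "Im z \<noteq> 0"
  shows "integrable M (\<lambda>p. \<phi> p / (z - of_real (X p)))"
proof (rule integrable_const_bound)
  show "AE p in M. cmod (\<phi> p / (z - of_real (X p))) \<le> B / \<bar>Im z\<bar>"
    by (rule AE_I2) (rule norm_divide_diff_of_real_le[OF assms \<phi>_bound])
qed measurable

lemma wct_norm_le:
  assumes "Im z \<noteq> 0"
  shows "cmod (wct M X \<phi> z) \<le> measure M (space M) * B / \<bar>Im z\<bar>"
proof -
  have "cmod (wct M X \<phi> z) \<le> (LINT p|M. cmod (\<phi> p / (z - of_real (X p))))"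
    unfolding wct_def by (rule integral_norm_bound)
  also have "\<dots> \<le> (LINT p|M. B / \<bar>Im z\<bar>)"
    by (intro integral_mono integrable_norm integrable_divide assms norm_divide_diff_of_real_le \<phi>_bound integrable_const)
  finally show ?thesis by simp
qed

lemma weighted_divide:
  assumes "Im w \<noteq> 0"
  shows "weighted_variable M X (\<lambda>p. \<phi> p / (w - of_real (X p))) (B / \<bar>Im w\<bar>)"
proof unfold_locales
  show "(\<lambda>p. \<phi> p / (w - of_real (X p))) \<in> borel_measurable M" by measurable
  show "cmod (\<phi> p / (w - of_real (X p))) \<le> B / \<bar>Im w\<bar>" for p
    by (rule norm_divide_diff_of_real_le[OF assms \<phi>_bound])
qed (rule X_meas)

lemma wct_diff:
  assumes "Im z \<noteq> 0" "Im w \<noteq> 0"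
  shows "wct M X \<phi> z - wct M X \<phi> w = (w - z) * wct M X (\<lambda>p. \<phi> p / (w - of_real (X p))) z"
proof -
  have "wct M X \<phi> z - wct M X \<phi> w = (LINT p|M. \<phi> p / (z - of_real (X p)) - \<phi> p / (w - of_real (X p)))"
    unfolding wct_def using assms by (subst Bochner_Integration.integral_diff) (auto intro: integrable_divide)
  also have "\<dots> = (LINT p|M. (w - z) * (\<phi> p / (w - of_real (X p)) / (z - of_real (X p))))"
    by (subst inverse_diff_of_real_diff[OF assms]) (simp add: mult_ac)
  finally show ?thesis unfolding wct_def integral_mult_right_zero .
qed

text \<open>The resolvent identity writes the difference quotient as a transform with weight \<phi>
  / (z - X); applied a second time it bounds the error by a multiple of |w - z|.\<close>

lemma wct_has_field_derivative:
  assumes "Im z \<noteq> 0"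
  shows "(wct M X \<phi> has_field_derivative - wct M X (\<lambda>p. \<phi> p / (z - of_real (X p))) z) (at z)"
proof -
  interpret W: weighted_variable M X "\<lambda>p. \<phi> p / (z - of_real (X p))" "B / \<bar>Im z\<bar>"
    by (rule weighted_divide[OF assms])
  interpret W2: weighted_variable M X "\<lambda>p. \<phi> p / (z - of_real (X p)) / (z - of_real (X p))" "B / \<bar>Im z\<bar> / \<bar>Im z\<bar>"
    by (rule W.weighted_divide[OF assms])
  define U where "U = measure M (space M) * (B / \<bar>Im z\<bar> / \<bar>Im z\<bar>)"
  have U: "U \<ge> 0" using B_nonneg by (simp add: U_def)
  have "eventually (\<lambda>w. w \<in> ball z (\<bar>Im z\<bar> / 2) - {z}) (at z)"
    using eventually_at_ball'[of "\<bar>Im z\<bar> / 2" z UNIV] assms by simp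
  then have "eventually (\<lambda>w. cmod ((wct M X \<phi> w - wct M X \<phi> z) / (w - z)
      + wct M X (\<lambda>p. \<phi> p / (z - of_real (X p))) z) \<le> cmod (w - z) * (U / (\<bar>Im z\<bar> / 2))) (at z)"
  proof (rule eventually_mono)
    fix w assume w: "w \<in> ball z (\<bar>Im z\<bar> / 2) - {z}"
    have "\<bar>Im z - Im w\<bar> < \<bar>Im z\<bar> / 2"
      using w abs_Im_le_cmod[of "z - w"] by (simp add: dist_norm)
    then have Iw: "\<bar>Im w\<bar> \<ge> \<bar>Im z\<bar> / 2" by linarith
    then have w0: "Im w \<noteq> 0" using assms by auto
    have "(wct M X \<phi> w - wct M X \<phi> z) / (w - z) = - wct M X (\<lambda>p. \<phi> p / (z - of_real (X p))) w"
      unfolding wct_diff[OF w0 assms] using w by (simp add: divide_simps) (simp add: algebra_simps)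
    then have "(wct M X \<phi> w - wct M X \<phi> z) / (w - z) + wct M X (\<lambda>p. \<phi> p / (z - of_real (X p))) z
      = (w - z) * wct M X (\<lambda>p. \<phi> p / (z - of_real (X p)) / (z - of_real (X p))) w"
      using W.wct_diff[OF w0 assms] by (simp add: algebra_simps)
    also have "cmod \<dots> \<le> cmod (w - z) * (U / \<bar>Im w\<bar>)"
      unfolding norm_mult U_def using W2.wct_norm_le[OF w0] by (intro mult_left_mono) auto
    also have "\<dots> \<le> cmod (w - z) * (U / (\<bar>Im z\<bar> / 2))"
      using Iw U assms by (intro mult_left_mono divide_left_mono) auto
    finally show "cmod ((wct M X \<phi> w - wct M X \<phi> z) / (w - z)
      + wct M X (\<lambda>p. \<phi> p / (z - of_real (X p))) z) \<le> cmod (w - z) * (U / (\<bar>Im z\<bar> / 2))" .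
  qed
  moreover have "((\<lambda>w. cmod (w - z) * (U / (\<bar>Im z\<bar> / 2))) \<longlongrightarrow> 0) (at z)"
    using assms by (auto intro!: tendsto_eq_intros)
  ultimately have "((\<lambda>w. (wct M X \<phi> w - wct M X \<phi> z) / (w - z)
      + wct M X (\<lambda>p. \<phi> p / (z - of_real (X p))) z) \<longlongrightarrow> 0) (at z)"
    by (rule Lim_null_comparison)
  then show ?thesis
    unfolding has_field_derivative_iff by (subst LIM_zero_iff[symmetric]) simp
qed

lemma wct_holomorphic: "wct M X \<phi> holomorphic_on {z. Im z \<noteq> 0}"
  using wct_has_field_derivative
  by (subst holomorphic_on_open) (auto intro!: open_Collect_neq continuous_intros)

text \<open>Inside the cone the factor Z / (Z - X) stays bounded, so dominated convergence
  applies.\<close>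

lemma wct_nontangential_limit:
  assumes "filterlim Z at_infinity sequentially" "\<And>n. cmod (Z n) \<le> C * \<bar>Im (Z n)\<bar>"
  shows "(\<lambda>n. Z n * wct M X \<phi> (Z n)) \<longlonglongrightarrow> (LINT p|M. \<phi> p)"
proof -
  have "(\<lambda>n. LINT p|M. Z n * (\<phi> p / (Z n - of_real (X p)))) \<longlonglongrightarrow> (LINT p|M. \<phi> p)"
  proof (rule integral_dominated_convergence[where w = "\<lambda>_. B * \<bar>C\<bar>"])
    show "AE p in M. (\<lambda>n. Z n * (\<phi> p / (Z n - of_real (X p)))) \<longlonglongrightarrow> \<phi> p"
    proof (rule AE_I2)
      fix p
      have "(\<lambda>n. inverse (Z n)) \<longlonglongrightarrow> 0"
        by (rule filterlim_compose[OF tendsto_inverse_0 assms(1)])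
      then have "(\<lambda>n. \<phi> p / (1 - inverse (Z n) * of_real (X p))) \<longlonglongrightarrow> \<phi> p / (1 - 0 * of_real (X p))"
        by (intro tendsto_intros) auto
      moreover have "eventually (\<lambda>n. Z n \<noteq> 0) sequentially"
        by (rule filterlim_at_infinity_imp_eventually_ne[OF assms(1)])
      then have "eventually (\<lambda>n. \<phi> p / (1 - inverse (Z n) * of_real (X p)) = Z n * (\<phi> p / (Z n - of_real (X p)))) sequentially"
        by eventually_elim (simp add: field_simps)
      ultimately show "(\<lambda>n. Z n * (\<phi> p / (Z n - of_real (X p)))) \<longlonglongrightarrow> \<phi> p"
        by (simp add: Lim_transform_eventually)
    qed
    show "AE p in M. cmod (Z n * (\<phi> p / (Z n - of_real (X p)))) \<le> B * \<bar>C\<bar>" for n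
    proof (rule AE_I2, cases "Im (Z n) = 0")
      case True
      then show "cmod (Z n * (\<phi> p / (Z n - of_real (X p)))) \<le> B * \<bar>C\<bar>" for p
        using assms(2)[of n] B_nonneg by simp
    next
      case False
      fix p
      have "cmod (Z n * (\<phi> p / (Z n - of_real (X p)))) \<le> (\<bar>C\<bar> * \<bar>Im (Z n)\<bar>) * (B / \<bar>Im (Z n)\<bar>)"
        unfolding norm_mult using order_trans[OF assms(2)[of n] mult_right_mono[OF abs_ge_self abs_ge_zero]] False
        by (intro mult_mono norm_divide_diff_of_real_le \<phi>_bound) auto
      then show "cmod (Z n * (\<phi> p / (Z n - of_real (X p)))) \<le> B * \<bar>C\<bar>"
        using False by (simp add: field_simps)
    qed
  qed auto
  then show ?thesis unfolding wct_def integral_mult_right_zero .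
qed

end

lemma (in finite_measure) integrable_bounded_complex:
  fixes f :: "'a \<Rightarrow> complex"
  assumes "f \<in> borel_measurable M" "\<And>p. cmod (f p) \<le> B"
  shows "integrable M f"
  using assms by (intro integrable_const_bound[where B = B]) auto

lemma (in finite_measure) Cauchy_Schwarz_complex:
  fixes u v :: "'a \<Rightarrow> complex"
  assumes [measurable]: "u \<in> borel_measurable M" "v \<in> borel_measurable M"
    and u: "\<And>p. cmod (u p) \<le> A" and v: "\<And>p. cmod (v p) \<le> B"
  shows "(cmod (LINT p|M. u p * v p))\<^sup>2 \<le> (LINT p|M. (cmod (u p))\<^sup>2) * (LINT p|M. (cmod (v p))\<^sup>2)"
proof -
  define c where "c = (LINT p|M. u p * v p)"
  define a where "a = (LINT p|M. (cmod (u p))\<^sup>2)"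
  define b where "b = (LINT p|M. (cmod (v p))\<^sup>2)"
  have a0: "a \<ge> 0" and b0: "b \<ge> 0" by (simp_all add: a_def b_def)
  have iu: "integrable M (\<lambda>p. (cmod (u p))\<^sup>2)"
    by (rule integrable_const_bound[where B = "A\<^sup>2"]) (auto intro!: power_mono u)
  have iv: "integrable M (\<lambda>p. (cmod (v p))\<^sup>2)"
    by (rule integrable_const_bound[where B = "B\<^sup>2"]) (auto intro!: power_mono v)
  have iuv: "integrable M (\<lambda>p. u p * v p)"
    by (rule integrable_bounded_complex[where B = "A * B"])
      (auto simp: norm_mult intro!: mult_mono u v order_trans[OF norm_ge_zero u])
  \<comment> \<open>The integral of |s u - c cnj v|^2 for real s. Below, s = |c|^2 / a minimises it,
    and for a = 0 the choice s = b + 1 forces c = 0.\<close>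
  have quad: "0 \<le> s\<^sup>2 * a - 2 * s * (cmod c)\<^sup>2 + (cmod c)\<^sup>2 * b" for s :: real
  proof -
    define h where "h = (\<lambda>p. Re (cnj c * (u p * v p)))"
    have pt: "(cmod (of_real s * u p - c * cnj (v p)))\<^sup>2
        = s\<^sup>2 * (cmod (u p))\<^sup>2 - 2 * s * h p + (cmod c)\<^sup>2 * (cmod (v p))\<^sup>2" for p
      unfolding h_def by (simp only: cmod_power2) (simp add: algebra_simps power2_eq_square)
    have ih: "integrable M h" unfolding h_def by (intro integrable_Re integrable_mult_right iuv)
    have "0 \<le> (LINT p|M. (cmod (of_real s * u p - c * cnj (v p)))\<^sup>2)" by simp
    also have "\<dots> = s\<^sup>2 * a - 2 * s * (LINT p|M. h p) + (cmod c)\<^sup>2 * b"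
      unfolding pt a_def b_def using iu iv ih by simp
    also have "(LINT p|M. h p) = Re (cnj c * c)"
      unfolding h_def c_def integral_mult_right_zero[symmetric] by (intro integral_Re integrable_mult_right iuv)
    also have "Re (cnj c * c) = (cmod c)\<^sup>2"
      by (metis Re_complex_of_real complex_norm_square mult.commute)
    finally show ?thesis .
  qed
  have "(cmod c)\<^sup>2 \<le> a * b"
  proof (cases "a = 0")
    case True
    have "0 \<le> - ((b + 2) * (cmod c)\<^sup>2)"
      using quad[of "b + 1"] True by (simp add: algebra_simps)
    then have "(b + 2) * (cmod c)\<^sup>2 \<le> 0" by simp
    then show ?thesis using b0 True by (simp add: mult_le_0_iff)
  next
    case False
    then have a: "a > 0" using a0 by simp
    have "0 \<le> ((cmod c)\<^sup>2 / a)\<^sup>2 * a - 2 * ((cmod c)\<^sup>2 / a) * (cmod c)\<^sup>2 + (cmod c)\<^sup>2 * b"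
      by (rule quad)
    also have "\<dots> = (cmod c)\<^sup>2 * (a * b - (cmod c)\<^sup>2) / a"
      using a by (simp add: field_simps power2_eq_square)
    finally have "0 \<le> (cmod c)\<^sup>2 * (a * b - (cmod c)\<^sup>2)"
      using a by (simp add: zero_le_divide_iff)
    then show ?thesis using a0 b0
      by (cases "c = 0") (auto simp: zero_le_mult_iff)
  qed
  then show ?thesis by (simp add: a_def b_def c_def)
qed

section \<open>Scaled and centred resolvents of one real variable\<close>

locale real_variable = prob_space M for M :: "'a measure" +
  fixes X :: "'a \<Rightarrow> real"
  assumes X_measurable [measurable]: "X \<in> borel_measurable M"
begin

sublocale one: weighted_variable M X "\<lambda>_. 1" 1
  by unfold_locales auto

definition G :: "complex \<Rightarrow> complex" where "G z = wct M X (\<lambda>_. 1) z"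

definition F :: "complex \<Rightarrow> complex" where "F z = 1 / G z"

text \<open>The resolvent scaled to mean 1, then centred. In these coordinates the two-variable
  transform is G G (1 + covariance), and \<open>rvar\<close> is the variance of the scaled
  resolvent.\<close>

definition cres :: "complex \<Rightarrow> 'a \<Rightarrow> complex" where
  "cres z p = F z / (z - of_real (X p)) - 1"

definition rvar :: "complex \<Rightarrow> real" where
  "rvar z = (LINT p|M. (cmod (cres z p))\<^sup>2)"

lemma G_cnj: "G (cnj z) = cnj (G z)"
  unfolding G_def wct_def Bochner_Integration.integral_cnj[symmetric] by simp

lemma F_cnj: "F (cnj z) = cnj (F z)"
  by (simp add: F_def G_cnj)

lemma cres_cnj: "cres (cnj z) p = cnj (cres z p)"
  by (simp add: cres_def F_cnj)

lemma rvar_cnj: "rvar (cnj z) = rvar z"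
  by (simp add: rvar_def cres_cnj)

lemma rvar_nonneg: "rvar z \<ge> 0"
  by (simp add: rvar_def)

lemma G_norm_le: "Im z \<noteq> 0 \<Longrightarrow> cmod (G z) \<le> 1 / \<bar>Im z\<bar>"
  using one.wct_norm_le[of z] by (simp add: G_def prob_space)

lemma Im_G_neg:
  assumes "Im z > 0"
  shows "Im (G z) < 0"
proof -
  have int: "integrable M (\<lambda>p. Im (1 / (z - of_real (X p))))"
    using one.integrable_divide[of z] assms by (intro integrable_Im) auto
  have neg: "Im (1 / (z - of_real (X p))) < 0" for p
    using assms by (simp add: Im_divide divide_neg_pos sum_power2_gt_zero_iff)
  have "Im (G z) = (LINT p|M. Im (1 / (z - of_real (X p))))"
    using one.integrable_divide[of z] assms by (simp add: G_def wct_def)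
  also have "\<dots> < (LINT p|M. 0)"
    by (rule integral_less_AE_space) (use int neg emeasure_space_1 in \<open>auto simp: less_imp_le\<close>)
  finally show ?thesis by simp
qed

lemma Im_G_sign: "Im z \<noteq> 0 \<Longrightarrow> Im z * Im (G z) < 0"
  using Im_G_neg[of z] Im_G_neg[of "cnj z"] G_cnj[of z]
  by (cases "Im z > 0") (auto simp: mult_less_0_iff)

lemma G_nonzero: "Im z \<noteq> 0 \<Longrightarrow> G z \<noteq> 0"
  using Im_G_sign[of z] by auto

lemma G_holomorphic: "G holomorphic_on {z. Im z \<noteq> 0}"
  using one.wct_holomorphic unfolding G_def[abs_def] .

lemma F_holomorphic: "F holomorphic_on {z. Im z \<noteq> 0}"
  unfolding F_def using G_nonzero by (intro holomorphic_intros G_holomorphic) auto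

lemma cres_measurable [measurable]: "cres z \<in> borel_measurable M"
  unfolding cres_def[abs_def] by measurable

lemma cres_bounded:
  assumes "Im z \<noteq> 0"
  shows "cmod (cres z p) \<le> cmod (F z) / \<bar>Im z\<bar> + 1"
proof -
  have "cmod (cres z p) \<le> cmod (F z / (z - of_real (X p))) + 1"
    unfolding cres_def by (rule order_trans[OF norm_triangle_ineq4]) simp
  then show ?thesis using norm_divide_diff_of_real_le[OF assms order_refl, of "F z" "X p"] by linarith
qed

lemma cres_integrable: "Im z \<noteq> 0 \<Longrightarrow> integrable M (cres z)"
  by (rule integrable_bounded_complex[OF cres_measurable cres_bounded])

lemma cres_mean: assumes "Im z \<noteq> 0" shows "(LINT p|M. cres z p) = 0"
proof -
  have "(LINT p|M. cres z p) = (LINT p|M. F z * (1 / (z - of_real (X p))) - 1)"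
    by (simp add: cres_def)
  also have "\<dots> = F z * G z - 1"
    unfolding G_def wct_def using one.integrable_divide[OF assms]
    by (subst Bochner_Integration.integral_diff) (auto simp: prob_space simp del: times_divide_eq_right)
  finally show ?thesis using G_nonzero[OF assms] by (simp add: F_def)
qed

text \<open>The resolvent identity after scaling: the integral of the product of two such functions
  is the difference quotient of F - id. At w = cnj z this yields the formula for Im F; with
  Cauchy-Schwarz it controls the displacement of F.\<close>

lemma cres_mult_integral:
  assumes "Im z \<noteq> 0" "Im w \<noteq> 0"
  shows "F z - F w - (z - w) = (z - w) * (LINT p|M. cres z p * cres w p)"
proof -
  have i: "integrable M (\<lambda>p. 1 / (z - of_real (X p)) / (w - of_real (X p)))"
    using weighted_variable.integrable_divide[OF one.weighted_divide[OF assms(1)] assms(2)] .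
  define h where "h = (\<lambda>p. 1 / (z - of_real (X p)) / (w - of_real (X p)))"
  have cc: "cres z p * cres w p = F z * F w * h p - 1 - cres z p - cres w p" for p
    by (simp add: cres_def h_def algebra_simps)
  have "(LINT p|M. cres z p * cres w p) = F z * F w * (LINT p|M. h p) - 1"
    unfolding cc using i[folded h_def] cres_integrable[OF assms(1)] cres_integrable[OF assms(2)]
    by (simp add: cres_mean assms prob_space)
  also have "(z - w) * \<dots> = F z * F w * ((z - w) * (LINT p|M. h p)) - (z - w)"
    by (simp add: algebra_simps)
  also have "(z - w) * (LINT p|M. h p) = G w - G z"
    using one.wct_diff[OF assms(2,1)] unfolding G_def h_def wct_def by (rule sym)
  also have "F z * F w * (G w - G z) - (z - w) = F z - F w - (z - w)"
    using G_nonzero[OF assms(1)] G_nonzero[OF assms(2)] by (simp add: F_def field_simps)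
  finally show ?thesis by simp
qed

lemma cres_covariance_le:
  assumes "Im z \<noteq> 0" "Im w \<noteq> 0"
  shows "cmod (LINT p|M. cres z p * cres w p) \<le> sqrt (rvar z * rvar w)"
  using Cauchy_Schwarz_complex[OF cres_measurable cres_measurable cres_bounded[OF assms(1)] cres_bounded[OF assms(2)]]
  unfolding rvar_def by (simp add: real_le_rsqrt)

lemma Im_F:
  assumes "Im z \<noteq> 0"
  shows "Im (F z) = Im z * (1 + rvar z)"
proof -
  have "F z - F (cnj z) - (z - cnj z) = (z - cnj z) * (LINT p|M. of_real ((cmod (cres z p))\<^sup>2))"
    using cres_mult_integral[of z "cnj z"] assms unfolding cres_cnj complex_norm_square[symmetric] by simp
  also have "\<dots> = (z - cnj z) * of_real (rvar z)"
    unfolding integral_complex_of_real rvar_def ..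
  finally have "F z - cnj (F z) = (z - cnj z) * (1 + of_real (rvar z))"
    unfolding F_cnj by (simp add: algebra_simps)
  then have "Im (F z - cnj (F z)) = Im ((z - cnj z) * (1 + of_real (rvar z)))" by simp
  then show ?thesis by simp
qed

lemma F_displacement_diff:
  assumes "Im z \<noteq> 0" "Im w \<noteq> 0"
  shows "cmod ((F z - z) - (F w - w)) \<le> cmod (z - w) * sqrt (rvar z * rvar w)"
proof -
  have "(F z - z) - (F w - w) = (z - w) * (LINT p|M. cres z p * cres w p)"
    using cres_mult_integral[OF assms] by (simp add: algebra_simps)
  then show ?thesis
    using cres_covariance_le[OF assms] by (simp add: norm_mult mult_left_mono)
qed

text \<open>F - id strictly shrinks the distance of two distinct points of variance below 1. The
  estimate compares the points directly, also across the real axis, so it covers the whole set at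
  once.\<close>

lemma F_injective:
  assumes "Im z \<noteq> 0" "Im w \<noteq> 0" "rvar z < 1" "rvar w < 1" "F z = F w"
  shows "z = w"
proof (rule ccontr)
  assume "z \<noteq> w"
  have "cmod (z - w) \<le> cmod (z - w) * sqrt (rvar z * rvar w)"
    using F_displacement_diff[OF assms(1,2)] assms(5) by (simp add: norm_minus_commute)
  then have "1 \<le> sqrt (rvar z * rvar w)" using \<open>z \<noteq> w\<close> by simp
  moreover have "rvar z * rvar w < 1 * 1"
    using assms(3,4) rvar_nonneg by (intro mult_strict_mono') auto
  ultimately show False by (simp add: real_sqrt_ge_1_iff)
qed

text \<open>Derived from the Cauchy-Schwarz inequality instead of a Poisson kernel.\<close>

lemma rvar_Harnack:
  assumes z: "Im z > 0" and w: "Im w > 0"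
  shows "Im z * rvar z \<le> 2 * (Im w + (cmod (z - w))\<^sup>2 / Im z) * rvar w"
proof -
  define d where "d = cmod (z - w)"
  define a where "a = sqrt (rvar z)"
  define b where "b = sqrt (rvar w)"
  have ab: "rvar z = a\<^sup>2" "rvar w = b\<^sup>2" "a \<ge> 0" "b \<ge> 0"
    using rvar_nonneg by (simp_all add: a_def b_def)
  have "Im z * rvar z - Im w * rvar w = Im ((F z - z) - (F w - w))"
    using Im_F[of z] Im_F[of w] z w by (simp add: algebra_simps)
  also have "\<dots> \<le> cmod ((F z - z) - (F w - w))" by (rule order_trans[OF abs_ge_self abs_Im_le_cmod])
  also have "\<dots> \<le> d * (a * b)"
    using F_displacement_diff[of z w] z w by (simp add: d_def a_def b_def real_sqrt_mult)
  finally have 1: "Im z * a\<^sup>2 \<le> Im w * b\<^sup>2 + d * (a * b)" by (simp add: ab)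
  \<comment> \<open>Absorbs the mixed term d a b into half of Im z a^2.\<close>
  have "0 \<le> (Im z * a - d * b)\<^sup>2 / (2 * Im z)" using z by simp
  also have "\<dots> = Im z * a\<^sup>2 / 2 + d\<^sup>2 * b\<^sup>2 / (2 * Im z) - d * (a * b)"
    using z by (simp add: field_simps power2_eq_square)
  finally have "d * (a * b) \<le> Im z * a\<^sup>2 / 2 + d\<^sup>2 * b\<^sup>2 / (2 * Im z)" by simp
  with 1 have "Im z * a\<^sup>2 \<le> 2 * (Im w * b\<^sup>2) + d\<^sup>2 * b\<^sup>2 / Im z"
    by (simp add: field_simps)
  also have "\<dots> \<le> 2 * (Im w + d\<^sup>2 / Im z) * b\<^sup>2"
    using z by (simp add: algebra_simps divide_right_mono)
  finally show ?thesis by (simp add: ab d_def)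
qed

lemma G_times_limit:
  assumes "filterlim Z at_infinity sequentially" "\<And>n. cmod (Z n) \<le> C * \<bar>Im (Z n)\<bar>"
  shows "(\<lambda>n. Z n * G (Z n)) \<longlonglongrightarrow> 1"
  using one.wct_nontangential_limit[OF assms] by (simp add: G_def prob_space)

text \<open>The product of the resolvents at z and cnj z is a multiple of their difference, so
  |cres|^2 is affine in cres and its conjugate. Longer products then reduce to a short list of
  monomials.\<close>

lemma cres_square:
  assumes "Im z > 0"
  defines "\<theta> \<equiv> \<i> * cnj (F z) / of_real (2 * Im z)"
  shows "of_real ((cmod (cres z p))\<^sup>2) = of_real (rvar z) + (\<theta> - 1) * cres z p + cnj ((\<theta> - 1) * cres z p)"
    and "\<theta> + cnj \<theta> = of_real (1 + rvar z)"
proof -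
  show th: "\<theta> + cnj \<theta> = of_real (1 + rvar z)"
    using assms Im_F[of z] by (simp add: complex_eq_iff \<theta>_def)
  have z0: "z - of_real (X p) \<noteq> 0" "cnj z - of_real (X p) \<noteq> 0" "of_real (Im z) \<noteq> (0 :: complex)"
    using assms by (auto simp: complex_eq_iff)
  have zz: "z - cnj z = 2 * \<i> * of_real (Im z)" by (simp add: complex_eq_iff)
  have gen: "\<i> * v / (2 * m) * (u / a) + (- \<i>) * u / (2 * m) * (v / b) = (u / a) * (v / b)"
    if "a \<noteq> 0" "b \<noteq> 0" "m \<noteq> 0" "a - b = 2 * \<i> * m" for a b m u v :: complex
  proof -
    have "\<i> * v / (2 * m) * (u / a) + (- \<i>) * u / (2 * m) * (v / b) = - \<i> * u * v * (a - b) / (2 * m * a * b)"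
      using that(1-3) by (simp add: field_simps)
    then show ?thesis unfolding that(4) using that(1-3) by (simp add: field_simps)
  qed
  have "\<theta> * (F z / (z - of_real (X p))) + cnj (\<theta> * (F z / (z - of_real (X p))))
      = F z / (z - of_real (X p)) * cnj (F z / (z - of_real (X p)))"
    using gen[of "z - of_real (X p)" "cnj z - of_real (X p)" "of_real (Im z)" "cnj (F z)" "F z"] z0 zz
    by (simp add: \<theta>_def)
  then have 1: "\<theta> * (1 + cres z p) + cnj (\<theta> * (1 + cres z p)) = (1 + cres z p) * cnj (1 + cres z p)"
    by (simp add: cres_def)
  have "(cres z p) * cnj (cres z p) = (1 + cres z p) * cnj (1 + cres z p) - 1 - cres z p - cnj (cres z p)"
    by (simp add: algebra_simps)
  also have "\<dots> = (\<theta> + cnj \<theta>) - 1 + (\<theta> - 1) * cres z p + cnj ((\<theta> - 1) * cres z p)"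
    unfolding 1[symmetric] by (simp add: algebra_simps)
  finally show "of_real ((cmod (cres z p))\<^sup>2) = of_real (rvar z) + (\<theta> - 1) * cres z p + cnj ((\<theta> - 1) * cres z p)"
    unfolding complex_norm_square th by simp
qed

end

section \<open>Covariance of the resolvents of two variables\<close>

locale real_pair = prob_space M for M :: "'a measure" +
  fixes X Y :: "'a \<Rightarrow> real"
  assumes X_meas [measurable]: "X \<in> borel_measurable M"
    and Y_meas [measurable]: "Y \<in> borel_measurable M"
begin

sublocale A: real_variable M X by unfold_locales measurable
sublocale B: real_variable M Y by unfold_locales measurable

definition cov :: "complex \<Rightarrow> complex \<Rightarrow> complex" where
  "cov z w = (LINT p|M. A.cres z p * B.cres w p)"

definition G2 :: "complex \<Rightarrow> complex \<Rightarrow> complex" where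
  "G2 z w = (LINT p|M. 1 / ((z - of_real (X p)) * (w - of_real (Y p))))"

lemma cres_cross_integrable:
  assumes "Im z \<noteq> 0" "Im w \<noteq> 0"
  shows "integrable M (\<lambda>p. A.cres z p * B.cres w p)"
proof (rule integrable_bounded_complex)
  show "cmod (A.cres z p * B.cres w p) \<le> (cmod (A.F z) / \<bar>Im z\<bar> + 1) * (cmod (B.F w) / \<bar>Im w\<bar> + 1)" for p
    unfolding norm_mult using A.cres_bounded[OF assms(1)] B.cres_bounded[OF assms(2)]
    by (intro mult_mono) (auto intro: order_trans[OF norm_ge_zero])
qed measurable

lemma cov_cnj: "cov (cnj z) (cnj w) = cnj (cov z w)"
  unfolding cov_def A.cres_cnj B.cres_cnj complex_cnj_mult[symmetric] Bochner_Integration.integral_cnj ..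

lemma cov_le:
  assumes "Im z \<noteq> 0" "Im w \<noteq> 0"
  shows "(cmod (cov z w))\<^sup>2 \<le> A.rvar z * B.rvar w"
  unfolding cov_def A.rvar_def B.rvar_def
  by (rule Cauchy_Schwarz_complex[OF A.cres_measurable B.cres_measurable
        A.cres_bounded[OF assms(1)] B.cres_bounded[OF assms(2)]])

lemma G2_eq:
  assumes "Im z \<noteq> 0" "Im w \<noteq> 0"
  shows "G2 z w = A.G z * B.G w * (1 + cov z w)"
proof -
  have FA: "1 / (z - of_real (X p)) = A.G z * (1 + A.cres z p)" for p
    using A.G_nonzero[OF assms(1)] by (simp add: A.cres_def A.F_def)
  have FB: "1 / (w - of_real (Y p)) = B.G w * (1 + B.cres w p)" for p
    using B.G_nonzero[OF assms(2)] by (simp add: B.cres_def B.F_def)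
  have "1 / ((z - of_real (X p)) * (w - of_real (Y p))) = (1 / (z - of_real (X p))) * (1 / (w - of_real (Y p)))" for p
    by simp
  then have *: "1 / ((z - of_real (X p)) * (w - of_real (Y p)))
      = A.G z * B.G w * (1 + A.cres z p + B.cres w p + A.cres z p * B.cres w p)" for p
    unfolding FA FB by (simp add: algebra_simps)
  show ?thesis
    unfolding G2_def * integral_mult_right_zero cov_def
    using A.cres_integrable[OF assms(1)] B.cres_integrable[OF assms(2)] cres_cross_integrable[OF assms]
    by (simp add: A.cres_mean B.cres_mean assms prob_space)
qed

text \<open>
  The positivity of the mass that the bi-free convolution power puts on product sets: up to
  a positive factor, the expression is the squared norm of a product of two resolvents applied to
  the vacuum vector of a free product Hilbert space.
\<close>

lemma bifree_power_nonneg: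
  assumes z: "Im z > 0" and w: "Im w > 0" and \<kappa>: "\<kappa> \<ge> 0"
    and rz: "\<kappa> * A.rvar z < 1" and rw: "\<kappa> * B.rvar w < 1"
  defines "S \<equiv> \<lambda>u. (1 + u) / (1 - of_real \<kappa> * u)"
  shows "0 \<le> Re (cnj (A.G z) * B.G w * S (cov (cnj z) w) - A.G z * B.G w * S (cov z w))"
proof -
  have z0: "Im z \<noteq> 0" and w0: "Im w \<noteq> 0" using z w by auto
  have z0': "Im (cnj z) \<noteq> 0" and w0': "Im (cnj w) \<noteq> 0" using z w by auto
  define x where "x = A.cres z"
  define y where "y = B.cres w"
  define p where "p = \<i> * cnj (A.F z) / of_real (2 * Im z)"
  define q where "q = \<i> * cnj (B.F w) / of_real (2 * Im w)"
  define c where "c = cov z w"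
  define d where "d = cov z (cnj w)"
  define \<rho> where "\<rho> = q * (1 + c) + cnj q * (1 + d) - (1 + c) * (1 + d)"
  \<comment> \<open>The vector r of the series lemma, realised in L2: \<open>Ery\<close>,
    \<open>Exr\<close> and \<open>Err\<close> compute its inner products with y, x and itself, which
    come out as \<rho>, p (d - cnj c) and 2 Re (p \<rho>).\<close>
  define r where "r = (\<lambda>s. (1 + x s) * (y s - c))"
  have x_meas [measurable]: "x \<in> borel_measurable M" and y_meas [measurable]: "y \<in> borel_measurable M"
    unfolding x_def y_def by measurable
  have r_meas [measurable]: "r \<in> borel_measurable M" unfolding r_def by measurable
  obtain U where xb: "\<And>s. cmod (x s) \<le> U"
    using A.cres_bounded[OF z0] unfolding x_def by blast
  obtain V where yb: "\<And>s. cmod (y s) \<le> V"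
    using B.cres_bounded[OF w0] unfolding y_def by blast
  have xx: "x s * cnj (x s) = of_real (A.rvar z) + (p - 1) * x s + cnj (p - 1) * cnj (x s)" for s
    using A.cres_square(1)[OF z, of s] unfolding x_def p_def complex_norm_square complex_cnj_mult .
  have yy: "y s * cnj (y s) = of_real (B.rvar w) + (q - 1) * y s + cnj (q - 1) * cnj (y s)" for s
    using B.cres_square(1)[OF w, of s] unfolding y_def q_def complex_norm_square complex_cnj_mult .
  have p: "p + cnj p = of_real (1 + A.rvar z)" unfolding p_def by (rule A.cres_square(2)[OF z])
  have q: "q + cnj q = of_real (1 + B.rvar w)" unfolding q_def by (rule B.cres_square(2)[OF w])
  have pX: "of_real (A.rvar z) = p + cnj p - 1" and qY: "of_real (B.rvar w) = q + cnj q - 1"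
    using p q by simp_all
  have ints: "integrable M x" "integrable M (\<lambda>s. cnj (x s))" "integrable M y" "integrable M (\<lambda>s. cnj (y s))"
    "integrable M (\<lambda>s. x s * y s)" "integrable M (\<lambda>s. cnj (x s) * cnj (y s))"
    "integrable M (\<lambda>s. x s * cnj (y s))" "integrable M (\<lambda>s. cnj (x s) * y s)"
    using A.cres_integrable[OF z0] A.cres_integrable[OF z0'] B.cres_integrable[OF w0] B.cres_integrable[OF w0']
      cres_cross_integrable[OF z0 w0] cres_cross_integrable[OF z0' w0]
      cres_cross_integrable[OF z0 w0'] cres_cross_integrable[OF z0' w0']
    unfolding x_def y_def A.cres_cnj[abs_def] B.cres_cnj[abs_def] by simp_all
  have means: "(LINT s|M. x s) = 0" "(LINT s|M. y s) = 0" "(LINT s|M. x s * y s) = c"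
    "(LINT s|M. x s * cnj (y s)) = d"
    "(LINT s|M. cnj (x s) * cnj (y s)) = cnj c" "(LINT s|M. cnj (x s) * y s) = cnj d"
    unfolding x_def y_def c_def d_def cov_cnj[symmetric]
    by (simp_all add: A.cres_mean z0 B.cres_mean w0 cov_def A.cres_cnj B.cres_cnj)
  \<comment> \<open>Reducing |x|^2 and |y|^2 by \<open>xx\<close> and \<open>yy\<close> leaves these
    nine monomials, whose integrals are known.\<close>
  have lin: "(LINT s|M. a0 + a1 * x s + a2 * cnj (x s) + a3 * y s + a4 * cnj (y s) + a5 * (x s * y s)
      + a6 * (cnj (x s) * cnj (y s)) + a7 * (x s * cnj (y s)) + a8 * (cnj (x s) * y s))
      = a0 + a5 * c + a6 * cnj c + a7 * d + a8 * cnj d" for a0 a1 a2 a3 a4 a5 a6 a7 a8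
    using ints by (simp add: means prob_space)
  have ry: "r s * cnj (y s) = (q + cnj q - 1) + (q + cnj q - 1) * x s + 0 * cnj (x s) + (q - 1) * y s + (cnj q - 1 - c) * cnj (y s)
      + (q - 1) * (x s * y s) + 0 * (cnj (x s) * cnj (y s)) + (cnj q - 1 - c) * (x s * cnj (y s)) + 0 * (cnj (x s) * y s)" for s
  proof -
    have "r s * cnj (y s) = (1 + x s) * (y s * cnj (y s) - c * cnj (y s))" by (simp add: r_def algebra_simps)
    then show ?thesis unfolding yy qY by (simp add: algebra_simps)
  qed
  have Ery: "(LINT s|M. r s * cnj (y s)) = \<rho>"
    unfolding ry lin \<rho>_def by (simp add: algebra_simps)
  have xr: "x s * cnj (r s) = - ((p + cnj p - 1) * cnj c) + (- p * cnj c) * x s + (- (cnj p - 1) * cnj c) * cnj (x s) + 0 * y s + (p + cnj p - 1) * cnj (y s)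
      + 0 * (x s * y s) + (cnj p - 1) * (cnj (x s) * cnj (y s)) + p * (x s * cnj (y s)) + 0 * (cnj (x s) * y s)" for s
  proof -
    have "x s * cnj (r s) = (x s + x s * cnj (x s)) * (cnj (y s) - cnj c)" by (simp add: r_def algebra_simps)
    then show ?thesis unfolding xx pX by (simp add: algebra_simps)
  qed
  have Exr: "(LINT s|M. x s * cnj (r s)) = p * (d - cnj c)"
    unfolding xr lin by (simp add: algebra_simps)
  define K where "K = q + cnj q - 1 + c * cnj c"
  define b where "b = q - 1 - cnj c"
  have rr: "r s * cnj (r s) = (p + cnj p) * K + (p * K) * x s + (cnj p * K) * cnj (x s)
      + ((p + cnj p) * b) * y s + ((p + cnj p) * cnj b) * cnj (y s)
      + (p * b) * (x s * y s) + (cnj p * cnj b) * (cnj (x s) * cnj (y s)) + (p * cnj b) * (x s * cnj (y s)) + (cnj p * b) * (cnj (x s) * y s)" for s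
  proof -
    have "r s * cnj (r s) = (1 + x s + cnj (x s) + x s * cnj (x s)) * (y s * cnj (y s) - c * cnj (y s) - cnj c * y s + c * cnj c)"
      by (simp add: r_def algebra_simps)
    also have "\<dots> = (p * (1 + x s) + cnj p * (1 + cnj (x s))) * (K + b * y s + cnj b * cnj (y s))"
      unfolding xx yy pX qY K_def b_def by (simp add: algebra_simps)
    finally show ?thesis by (simp add: algebra_simps)
  qed
  have Err: "(LINT s|M. r s * cnj (r s)) = p * \<rho> + cnj (p * \<rho>)"
    unfolding rr lin K_def b_def \<rho>_def by (simp add: algebra_simps)
  \<comment> \<open>Cauchy-Schwarz for e x + r against y, with the squared norm of e x + r
    expanded.\<close>
  have gram: "(cmod (e * d + \<rho>))\<^sup>2
      \<le> B.rvar w * ((cmod e)\<^sup>2 * A.rvar z + 2 * Re (e * (p * (d - cnj c))) + 2 * Re (p * \<rho>))" for e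
  proof -
    have rb: "cmod (r s) \<le> (1 + U) * (V + cmod c)" for s
      unfolding r_def norm_mult
      using norm_triangle_ineq[of 1 "x s"] norm_triangle_ineq4[of "y s" c] xb[of s] yb[of s]
      using order_trans[OF norm_ge_zero xb[of s]] by (intro mult_mono) auto
    have bd: "cmod (e * x s + r s) \<le> cmod e * U + (1 + U) * (V + cmod c)" for s
      using norm_triangle_ineq[of "e * x s" "r s"] rb[of s] mult_left_mono[OF xb[of s] norm_ge_zero[of e]]
      by (simp add: norm_mult)
    have ir: "integrable M (\<lambda>s. r s * cnj (y s))" "integrable M (\<lambda>s. x s * cnj (r s))" "integrable M (\<lambda>s. r s * cnj (r s))"
      unfolding ry xr rr using ints by (simp_all del: distrib_left distrib_right)
    have "(LINT s|M. (e * x s + r s) * cnj (y s)) = (LINT s|M. e * (x s * cnj (y s)) + r s * cnj (y s))"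
      by (simp add: algebra_simps)
    also have "\<dots> = e * d + \<rho>"
      using ir ints by (simp add: means Ery)
    finally have 1: "(LINT s|M. (e * x s + r s) * cnj (y s)) = e * d + \<rho>" .
    have ix: "integrable M (\<lambda>s. x s * cnj (x s))" unfolding xx using ints by simp
    have "of_real (LINT s|M. (cmod (e * x s + r s))\<^sup>2) = (LINT s|M. of_real ((cmod (e * x s + r s))\<^sup>2) :: complex)"
      by (rule integral_complex_of_real[symmetric])
    also have "\<dots> = (LINT s|M. e * cnj e * (x s * cnj (x s)) + e * (x s * cnj (r s)) + cnj (e * (x s * cnj (r s))) + r s * cnj (r s))"
      unfolding complex_norm_square by (simp add: algebra_simps)
    also have "\<dots> = e * cnj e * (LINT s|M. x s * cnj (x s)) + e * (p * (d - cnj c)) + cnj (e * (p * (d - cnj c))) + (p * \<rho> + cnj (p * \<rho>))"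
    proof -
      define f where "f = (\<lambda>s. x s * cnj (r s))"
      define g where "g = (\<lambda>s. r s * cnj (r s))"
      define h where "h = (\<lambda>s. x s * cnj (x s))"
      have i: "integrable M f" "integrable M g" "integrable M h" using ir ix by (simp_all add: f_def g_def h_def)
      have E: "(LINT s|M. f s) = p * (d - cnj c)" "(LINT s|M. g s) = p * \<rho> + cnj (p * \<rho>)"
        unfolding f_def g_def by (rule Exr Err)+
      have "(LINT s|M. e * cnj e * h s + e * f s + cnj (e * f s) + g s)
        = e * cnj e * (LINT s|M. h s) + e * (LINT s|M. f s) + cnj (e * (LINT s|M. f s)) + (LINT s|M. g s)"
        using i by simp
      then show ?thesis unfolding E unfolding f_def g_def h_def .
    qed
    also have "(LINT s|M. x s * cnj (x s)) = of_real (A.rvar z)"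
      unfolding A.rvar_def x_def complex_norm_square[symmetric] by (rule integral_complex_of_real)
    also have "e * cnj e * of_real (A.rvar z) + e * (p * (d - cnj c)) + cnj (e * (p * (d - cnj c))) + (p * \<rho> + cnj (p * \<rho>))
      = of_real ((cmod e)\<^sup>2 * A.rvar z + 2 * Re (e * (p * (d - cnj c))) + 2 * Re (p * \<rho>))"
      unfolding of_real_add of_real_mult complex_norm_square add.assoc complex_add_cnj by (simp add: add.assoc[symmetric] complex_add_cnj)
    finally have 2: "(LINT s|M. (cmod (e * x s + r s))\<^sup>2) = (cmod e)\<^sup>2 * A.rvar z + 2 * Re (e * (p * (d - cnj c))) + 2 * Re (p * \<rho>)"
      unfolding of_real_eq_iff .
    have "(cmod (LINT s|M. (e * x s + r s) * cnj (y s)))\<^sup>2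
        \<le> (LINT s|M. (cmod (e * x s + r s))\<^sup>2) * (LINT s|M. (cmod (cnj (y s)))\<^sup>2)"
    proof (rule Cauchy_Schwarz_complex[OF _ _ bd])
      show "(\<lambda>s. cnj (y s)) \<in> borel_measurable M"
        using ints(4) by (rule borel_measurable_integrable)
      show "cmod (cnj (y s)) \<le> V" for s using yb by simp
    qed measurable
    then have "(cmod (e * d + \<rho>))\<^sup>2
      \<le> ((cmod e)\<^sup>2 * A.rvar z + 2 * Re (e * (p * (d - cnj c))) + 2 * Re (p * \<rho>)) * B.rvar w"
      unfolding 1 2 complex_mod_cnj unfolding y_def B.rvar_def[symmetric] .
    then show ?thesis by (subst mult.commute)
  qed
  have "0 \<le> Re (q * (cnj p * S (cnj d) + p * S c))"
    unfolding S_def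
    by (rule free_product_nonneg[OF p q \<kappa> A.rvar_nonneg rz B.rvar_nonneg rw])
      (use cov_le[OF z0 w0] cov_le[OF z0 w0'] gram in \<open>auto simp: c_def d_def \<rho>_def B.rvar_cnj\<close>)
  \<comment> \<open>Each transform is a positive multiple of -i p, respectively -i q. Both terms
    thus share the factor 4 Im z Im w |G|^2 |G|^2, the minus sign of the second being cancelled by
    (-2i)^2 = -4.\<close>
  moreover have "cnj (A.G z) * B.G w * S (cov (cnj z) w) - A.G z * B.G w * S (cov z w)
     = of_real (4 * Im z * Im w * (cmod (A.G z))\<^sup>2 * (cmod (B.G w))\<^sup>2) * (q * (cnj p * S (cnj d) + p * S c))"
  proof -
    have gz: "A.G z = - 2 * \<i> * of_real (Im z) * of_real ((cmod (A.G z))\<^sup>2) * p"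
      unfolding complex_norm_square p_def A.F_def using A.G_nonzero[OF z0] z0 by (simp, simp add: complex_eq_iff)
    have gw: "B.G w = - 2 * \<i> * of_real (Im w) * of_real ((cmod (B.G w))\<^sup>2) * q"
      unfolding complex_norm_square q_def B.F_def using B.G_nonzero[OF w0] w0 by (simp, simp add: complex_eq_iff)
    have cd: "cov (cnj z) w = cnj d" "cov z w = c" unfolding c_def d_def cov_cnj[symmetric] by simp_all
    define g where "g = (cmod (A.G z))\<^sup>2"
    define h where "h = (cmod (B.G w))\<^sup>2"
    have gz: "A.G z = - 2 * \<i> * of_real (Im z) * of_real g * p" using gz g_def by simp
    have gw: "B.G w = - 2 * \<i> * of_real (Im w) * of_real h * q" using gw h_def by simp
    show ?thesis unfolding cd g_def[symmetric] h_def[symmetric] unfolding gz gw by (simp add: algebra_simps)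
  qed
  moreover have "Re (of_real a * u) = a * Re u" for a u by simp
  ultimately show ?thesis using z w by (metis less_imp_le mult_nonneg_nonneg zero_le_numeral zero_le_power2)
qed

end

section \<open>R-transforms and free convolution powers\<close>

definition rcauchy :: "real measure \<Rightarrow> complex \<Rightarrow> complex" where
  "rcauchy m z = 1 / cauchy_transform m z"

text \<open>Written through the transform alone, so that it depends only on the Cauchy transform of
  the law; off the real axis it is the variance \<open>rvar\<close> of the scaled resolvent.\<close>

definition rvariance :: "real measure \<Rightarrow> complex \<Rightarrow> real" where
  "rvariance m z = Im (rcauchy m z) / Im z - 1"

lemma (in real_variable) rvar_eq: "Im z \<noteq> 0 \<Longrightarrow> rvar z = Im (F z) / Im z - 1"
  by (simp add: Im_F)

lemma cauchy_transform_eq_wct: "cauchy_transform m z = wct m (\<lambda>x. x) (\<lambda>_. 1) z"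
  by (simp add: cauchy_transform_def wct_def)

context real_distribution
begin

interpretation id: real_variable M "\<lambda>x. x"
  by unfold_locales simp

lemma id_G: "id.G = cauchy_transform M"
  by (simp add: fun_eq_iff id.G_def cauchy_transform_eq_wct)

lemma id_F: "id.F = rcauchy M"
  by (simp add: fun_eq_iff id.F_def rcauchy_def id_G)

lemma id_rvar: "Im z \<noteq> 0 \<Longrightarrow> id.rvar z = rvariance M z"
  by (simp add: id.rvar_eq id_F rvariance_def)

lemmas cauchy_cnj = id.G_cnj[unfolded id_G]
lemmas cauchy_nonzero = id.G_nonzero[unfolded id_G]
lemmas cauchy_norm_le = id.G_norm_le[unfolded id_G]
lemmas cauchy_sign = id.Im_G_sign[unfolded id_G]
lemmas cauchy_holomorphic = id.G_holomorphic[unfolded id_G]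
lemmas cauchy_times_limit = id.G_times_limit[unfolded id_G]
lemmas rcauchy_cnj = id.F_cnj[unfolded id_F]
lemmas rcauchy_holomorphic = id.F_holomorphic[unfolded id_F]

lemma rvariance_nonneg: "Im z \<noteq> 0 \<Longrightarrow> rvariance M z \<ge> 0"
  using id.rvar_nonneg[of z] by (simp add: id_rvar)

lemma Im_rcauchy: "Im z \<noteq> 0 \<Longrightarrow> Im (rcauchy M z) = Im z * (1 + rvariance M z)"
  by (simp add: rvariance_def)

lemma rcauchy_injective:
  assumes "Im z \<noteq> 0" "Im w \<noteq> 0" "rvariance M z < 1" "rvariance M w < 1" "rcauchy M z = rcauchy M w"
  shows "z = w"
  using id.F_injective[of z w] assms by (simp add: id_F id_rvar)

lemma rcauchy_displacement_diff:
  assumes "Im z \<noteq> 0" "Im w \<noteq> 0"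
  shows "cmod ((rcauchy M z - z) - (rcauchy M w - w)) \<le> cmod (z - w) * sqrt (rvariance M z * rvariance M w)"
  using id.F_displacement_diff[OF assms] assms by (simp add: id_F id_rvar)

lemma rvariance_Harnack:
  assumes "Im z > 0" "Im w > 0"
  shows "Im z * rvariance M z \<le> 2 * (Im w + (cmod (z - w))\<^sup>2 / Im z) * rvariance M w"
  using id.rvar_Harnack[OF assms] assms by (simp add: id_rvar)

end

section \<open>Stolz angles and uniqueness of the one-variable R-transform\<close>

lemma stolz_pair_iff:
  "z \<in> stolz_pair \<alpha> \<beta> \<longleftrightarrow> Im z \<noteq> 0 \<and> \<bar>Re z\<bar> < \<alpha> * \<bar>Im z\<bar> \<and> \<bar>Im z\<bar> < \<beta>"
proof -
  have "z \<in> cnj ` stolz_angle \<alpha> \<beta> \<longleftrightarrow> cnj z \<in> stolz_angle \<alpha> \<beta>"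
    by (metis (no_types, lifting) complex_cnj_cnj image_iff)
  then show ?thesis by (auto simp: stolz_pair_def stolz_angle_def)
qed

lemma stolz_pair_mono: "\<alpha>' \<le> \<alpha> \<Longrightarrow> \<beta>' \<le> \<beta> \<Longrightarrow> stolz_pair \<alpha>' \<beta>' \<subseteq> stolz_pair \<alpha> \<beta>"
proof
  fix z assume "\<alpha>' \<le> \<alpha>" "\<beta>' \<le> \<beta>" and z: "z \<in> stolz_pair \<alpha>' \<beta>'"
  then have "\<alpha>' * \<bar>Im z\<bar> \<le> \<alpha> * \<bar>Im z\<bar>" by (intro mult_right_mono) auto
  moreover have "\<bar>Re z\<bar> < \<alpha>' * \<bar>Im z\<bar>" using z by (simp add: stolz_pair_iff)
  ultimately have "\<bar>Re z\<bar> < \<alpha> * \<bar>Im z\<bar>" by linarith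
  then show "z \<in> stolz_pair \<alpha> \<beta>" using z \<open>\<beta>' \<le> \<beta>\<close> by (auto simp: stolz_pair_iff)
qed

lemma open_stolz_angle: "open (stolz_angle \<alpha> \<beta>)"
  unfolding stolz_angle_def by (intro open_Collect_conj open_Collect_less continuous_intros)

lemma convex_stolz_angle: "convex (stolz_angle \<alpha> \<beta>)"
proof -
  have "stolz_angle \<alpha> \<beta> = {z. Im z < 0} \<inter> {z. Im z > - \<beta>} \<inter> {z. inner (Complex 1 \<alpha>) z < 0} \<inter> {z. inner (Complex (-1) \<alpha>) z < 0}"
    by (auto simp: stolz_angle_def inner_complex_def abs_less_iff)
  then show ?thesis
    by (auto intro!: convex_Int convex_halfspace_Im_lt convex_halfspace_Im_gt convex_halfspace_lt)
qed

lemma open_cnj_image: "open S \<Longrightarrow> open (cnj ` S)"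
proof -
  assume "open S"
  moreover have "cnj ` S = cnj -` S" by (metis (no_types, lifting) complex_cnj_cnj image_iff set_eqI vimage_eq)
  ultimately show ?thesis by (simp add: open_vimage continuous_on_cnj)
qed

lemma open_stolz_pair: "open (stolz_pair \<alpha> \<beta>)"
  unfolding stolz_pair_def by (intro open_Un open_cnj_image open_stolz_angle)

lemma stolz_angle_nonempty: "\<alpha> > 0 \<Longrightarrow> \<beta> > 0 \<Longrightarrow> stolz_angle \<alpha> \<beta> \<noteq> {}"
proof -
  assume "\<alpha> > 0" "\<beta> > 0"
  then have "Complex 0 (- \<beta> / 2) \<in> stolz_angle \<alpha> \<beta>" by (simp add: stolz_angle_def)
  then show ?thesis by blast
qed

text \<open>The pair is not connected, but each half is convex and meets the smaller pair, so the
  identity theorem applies to the halves separately.\<close>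

lemma stolz_pair_identity:
  assumes f: "f holomorphic_on stolz_pair \<alpha> \<beta>" and g: "g holomorphic_on stolz_pair \<alpha> \<beta>"
    and pos: "0 < \<alpha>'" "\<alpha>' \<le> \<alpha>" "0 < \<beta>'" "\<beta>' \<le> \<beta>"
    and eq: "\<And>z. z \<in> stolz_pair \<alpha>' \<beta>' \<Longrightarrow> f z = g z"
    and z: "z \<in> stolz_pair \<alpha> \<beta>"
  shows "f z = g z"
proof -
  have sub: "stolz_angle \<alpha>' \<beta>' \<subseteq> stolz_angle \<alpha> \<beta>"
  proof
    fix u assume u: "u \<in> stolz_angle \<alpha>' \<beta>'"
    have "\<alpha>' * (- Im u) \<le> \<alpha> * (- Im u)" using pos u by (intro mult_right_mono) (auto simp: stolz_angle_def)
    moreover have "\<bar>Re u\<bar> < \<alpha>' * (- Im u)" using u by (simp add: stolz_angle_def)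
    ultimately have "\<bar>Re u\<bar> < \<alpha> * (- Im u)" by linarith
    then show "u \<in> stolz_angle \<alpha> \<beta>" using u pos by (auto simp: stolz_angle_def)
  qed
  have lin: "linear cnj" by (rule bounded_linear.linear[OF bounded_linear_cnj])
  consider "z \<in> stolz_angle \<alpha> \<beta>" | "z \<in> cnj ` stolz_angle \<alpha> \<beta>"
    using z by (auto simp: stolz_pair_def)
  then show ?thesis
  proof cases
    case 1
    show ?thesis
      by (rule analytic_continuation_open[OF open_stolz_angle open_stolz_angle stolz_angle_nonempty[OF pos(1,3)] _ sub _ _ _ 1])
        (use f g eq in \<open>auto simp: stolz_pair_def convex_connected convex_stolz_angle elim: holomorphic_on_subset\<close>)
  next
    case 2
    show ?thesis
    proof (rule analytic_continuation_open[OF open_cnj_image[OF open_stolz_angle] open_cnj_image[OF open_stolz_angle] _ _ _ _ _ _ 2])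
      show "cnj ` stolz_angle \<alpha>' \<beta>' \<noteq> {}" using stolz_angle_nonempty[OF pos(1,3)] by simp
      show "connected (cnj ` stolz_angle \<alpha> \<beta>)"
        by (intro convex_connected convex_linear_image lin convex_stolz_angle)
    qed (use f g eq sub in \<open>auto simp: stolz_pair_def elim: holomorphic_on_subset\<close>)
  qed
qed

lemma stolz_pair_norm_le:
  assumes "z \<in> stolz_pair \<alpha> \<beta>"
  shows "cmod z \<le> (1 + \<alpha>) * \<bar>Im z\<bar>"
  using assms cmod_le[of z] by (auto simp: stolz_pair_iff algebra_simps)

lemma stolz_pair_alpha_pos: "z \<in> stolz_pair \<alpha> \<beta> \<Longrightarrow> \<alpha> > 0"
proof -
  assume "z \<in> stolz_pair \<alpha> \<beta>"
  then have "0 < \<alpha> * \<bar>Im z\<bar>" "\<bar>Im z\<bar> > 0" using abs_ge_zero[of "Re z"] by (auto simp: stolz_pair_iff simp del: abs_ge_zero)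
  then show "\<alpha> > 0" by (simp add: zero_less_mult_iff)
qed

lemma norm_inverse_le_Im_inverse:
  assumes "z \<in> stolz_pair \<alpha> \<beta>"
  shows "cmod (1 / z) \<le> (1 + \<alpha>) * \<bar>Im (1 / z)\<bar>"
proof -
  have z0: "z \<noteq> 0" using assms by (auto simp: stolz_pair_iff)
  have i: "\<bar>Im (1 / z)\<bar> = \<bar>Im z\<bar> / (cmod z)\<^sup>2"
    by (simp add: Im_divide cmod_power2)
  have "cmod (1 / z) = cmod z / (cmod z)\<^sup>2"
    using z0 by (simp add: norm_divide power2_eq_square)
  also have "\<dots> \<le> (1 + \<alpha>) * \<bar>Im z\<bar> / (cmod z)\<^sup>2"
    by (intro divide_right_mono stolz_pair_norm_le[OF assms]) simp
  finally show ?thesis unfolding i by simp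
qed

lemma is_R_transform_mono:
  assumes "is_R_transform m \<alpha> \<beta> R" "\<alpha>' \<le> \<alpha>" "\<beta>' \<le> \<beta>"
  shows "is_R_transform m \<alpha>' \<beta>' R"
  using assms(1) stolz_pair_mono[OF assms(2,3)] unfolding is_R_transform_def
  by (auto intro: holomorphic_on_subset tendsto_within_subset)

lemma is_R_transform_cong:
  assumes "is_R_transform m \<alpha> \<beta> R" "\<And>z. z \<in> stolz_pair \<alpha> \<beta> \<Longrightarrow> R z = S z"
  shows "is_R_transform m \<alpha> \<beta> S"
proof -
  have "((\<lambda>z. z * S z) \<longlongrightarrow> 0) (at 0 within stolz_pair \<alpha> \<beta>)"
    by (rule Lim_transform_within[where f = "\<lambda>z. z * R z" and d = 1])
      (use assms in \<open>auto simp: is_R_transform_def\<close>)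
  moreover have "S holomorphic_on stolz_pair \<alpha> \<beta>"
    by (rule holomorphic_transform[of R]) (use assms in \<open>auto simp: is_R_transform_def\<close>)
  ultimately show ?thesis using assms unfolding is_R_transform_def by auto
qed

lemma R_transform_rcauchy:
  assumes "is_R_transform m \<alpha> \<beta> R" "z \<in> stolz_pair \<alpha> \<beta>"
  shows "Im (1 / z + R z) \<noteq> 0" "cauchy_transform m (1 / z + R z) = z" "rcauchy m (1 / z + R z) = 1 / z"
  using assms by (auto simp: is_R_transform_def complex_is_Real_iff rcauchy_def)

lemma R_transform_eventually_small:
  assumes "is_R_transform m \<alpha> \<beta> R" "\<epsilon> > 0" "\<alpha> > 0" "\<beta> > 0"
  obtains \<delta> where "0 < \<delta>" "\<delta> \<le> \<beta>" "\<And>z. z \<in> stolz_pair \<alpha> \<delta> \<Longrightarrow> cmod (z * R z) < \<epsilon>"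
proof -
  have "((\<lambda>z. z * R z) \<longlongrightarrow> 0) (at 0 within stolz_pair \<alpha> \<beta>)" using assms(1) by (simp add: is_R_transform_def)
  then have "eventually (\<lambda>z. cmod (z * R z) < \<epsilon>) (at 0 within stolz_pair \<alpha> \<beta>)"
    using assms(2) by (auto dest: tendstoD)
  then obtain d where d: "d > 0" "\<And>z. z \<in> stolz_pair \<alpha> \<beta> \<Longrightarrow> z \<noteq> 0 \<Longrightarrow> cmod z < d \<Longrightarrow> cmod (z * R z) < \<epsilon>"
    unfolding eventually_at by auto
  \<comment> \<open>In the pair |z| is at most (1 + \<alpha>) |Im z|, so a bound on the height is a
    bound on |z|.\<close>
  define \<delta> where "\<delta> = min \<beta> (d / (1 + \<alpha>))"
  show ?thesis
  proof (rule that[of \<delta>])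
    show "0 < \<delta>" "\<delta> \<le> \<beta>" using assms d by (auto simp: \<delta>_def)
    fix z assume z: "z \<in> stolz_pair \<alpha> \<delta>"
    have "\<bar>Im z\<bar> < d / (1 + \<alpha>)" using z by (simp add: stolz_pair_iff \<delta>_def)
    then have "(1 + \<alpha>) * \<bar>Im z\<bar> < d" using assms(3) by (simp add: field_simps)
    then have "cmod z < d" using stolz_pair_norm_le[OF z] by linarith
    moreover have "z \<in> stolz_pair \<alpha> \<beta>" using stolz_pair_mono[of \<alpha> \<alpha> \<delta> \<beta>] z by (auto simp: \<delta>_def)
    moreover have "z \<noteq> 0" using z by (auto simp: stolz_pair_iff)
    ultimately show "cmod (z * R z) < \<epsilon>" using d by blast
  qed
qed

text \<open>As z R(z) tends to 0, the point A = 1/z + R(z) has imaginary part close to that of 1/z,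
  and F(A) = 1/z makes the variance at A equal to Im (1/z) / Im A - 1. In the constant 1 / (2 (1 +
  \<alpha>)) the factor 1 + \<alpha> pays for |1/z| against |Im (1/z)|, and 1/2 brings the ratio
  below 2.\<close>

lemma (in real_distribution) R_transform_rvariance_small:
  assumes R: "is_R_transform M \<alpha> \<beta> R" and pos: "\<alpha> > 0" "\<beta> > 0"
  obtains \<delta> where "0 < \<delta>" "\<delta> \<le> \<beta>" "\<And>z. z \<in> stolz_pair \<alpha> \<delta> \<Longrightarrow> rvariance M (1 / z + R z) < 1"
proof -
  have "1 / (2 * (1 + \<alpha>)) > 0" using pos by simp
  from R_transform_eventually_small[OF R this pos] obtain \<delta>
    where \<delta>: "0 < \<delta>" "\<delta> \<le> \<beta>" and e: "\<And>z. z \<in> stolz_pair \<alpha> \<delta> \<Longrightarrow> cmod (z * R z) < 1 / (2 * (1 + \<alpha>))" by blast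
  show ?thesis
  proof (rule that[OF \<delta>])
    fix z assume z: "z \<in> stolz_pair \<alpha> \<delta>"
    have zb: "z \<in> stolz_pair \<alpha> \<beta>" using stolz_pair_mono[of \<alpha> \<alpha> \<delta> \<beta>] z \<delta> by auto
    have z0: "z \<noteq> 0" "Im z \<noteq> 0" using z by (auto simp: stolz_pair_iff)
    define A where "A = 1 / z + R z"
    have A: "Im A \<noteq> 0" "rcauchy M A = 1 / z"
      using R_transform_rcauchy[OF R zb] by (simp_all add: A_def)
    have "\<bar>Im A - Im (1 / z)\<bar> \<le> cmod (R z)"
      using abs_Im_le_cmod[of "R z"] by (simp add: A_def)
    also have "\<dots> = cmod (z * R z) * cmod (1 / z)" using z0 by (simp add: norm_mult norm_divide)
    also have "\<dots> \<le> cmod (z * R z) * ((1 + \<alpha>) * \<bar>Im (1 / z)\<bar>)"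
      by (intro mult_left_mono norm_inverse_le_Im_inverse[OF z]) simp
    also have "\<dots> < 1 / (2 * (1 + \<alpha>)) * ((1 + \<alpha>) * \<bar>Im (1 / z)\<bar>)"
      using z0 pos by (intro mult_strict_right_mono e[OF z] mult_pos_pos)
        (auto simp: Im_divide intro!: divide_pos_pos add_nonneg_pos)
    also have "\<dots> = \<bar>Im (1 / z)\<bar> / 2" using pos by (simp add: field_simps)
    finally have "\<bar>Im A - Im (1 / z)\<bar> < \<bar>Im (1 / z)\<bar> / 2" .
    then have "Im (1 / z) / Im A < 2"
      using A(1) by (cases "Im A > 0") (auto simp: divide_simps abs_if split: if_splits)
    then show "rvariance M (1 / z + R z) < 1"
      unfolding A_def[symmetric] rvariance_def A(2) by simp
  qed
qed

text \<open>Near 0 both candidates put 1/z + R(z) into the set of variance below 1, on which F is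
  injective; the identity theorem then covers the whole domain.\<close>

lemma (in real_distribution) R_transform_unique:
  assumes R: "is_R_transform M \<alpha> \<beta> R" and S: "is_R_transform M \<alpha> \<beta> S"
    and z: "z \<in> stolz_pair \<alpha> \<beta>"
  shows "R z = S z"
proof -
  have pos: "\<alpha> > 0" "\<beta> > 0" using stolz_pair_alpha_pos[OF z] z by (auto simp: stolz_pair_iff)
  obtain \<delta>1 where 1: "0 < \<delta>1" "\<delta>1 \<le> \<beta>" "\<And>z. z \<in> stolz_pair \<alpha> \<delta>1 \<Longrightarrow> rvariance M (1 / z + R z) < 1"
    by (rule R_transform_rvariance_small[OF R pos]) (rule that)
  obtain \<delta>2 where 2: "0 < \<delta>2" "\<delta>2 \<le> \<beta>" "\<And>z. z \<in> stolz_pair \<alpha> \<delta>2 \<Longrightarrow> rvariance M (1 / z + S z) < 1"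
    by (rule R_transform_rvariance_small[OF S pos]) (rule that)
  define \<delta> where "\<delta> = min \<delta>1 \<delta>2"
  have \<delta>: "0 < \<delta>" "\<delta> \<le> \<beta>" using 1 2 by (auto simp: \<delta>_def)
  have eq: "R u = S u" if u: "u \<in> stolz_pair \<alpha> \<delta>" for u
  proof -
    have u': "u \<in> stolz_pair \<alpha> \<delta>1" "u \<in> stolz_pair \<alpha> \<delta>2" "u \<in> stolz_pair \<alpha> \<beta>"
      using u \<delta> by (auto simp: stolz_pair_iff \<delta>_def)
    have "1 / u + R u = 1 / u + S u"
      by (rule rcauchy_injective[OF R_transform_rcauchy(1)[OF R u'(3)] R_transform_rcauchy(1)[OF S u'(3)]
            1(3)[OF u'(1)] 2(3)[OF u'(2)]])
        (simp only: R_transform_rcauchy(3)[OF R u'(3)] R_transform_rcauchy(3)[OF S u'(3)])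
    then show ?thesis by simp
  qed
  show ?thesis
    by (rule stolz_pair_identity[OF _ _ pos(1) order_refl \<delta> eq z])
      (use R S in \<open>auto simp: is_R_transform_def\<close>)
qed

text \<open>The base case of the inductive definition provides no R-transform, so k = 1 stays a
  separate alternative. Each further step shrinks the common domain, on which uniqueness identifies
  the R-transforms taken from different steps.\<close>

lemma free_conv_power_R_transform:
  assumes "is_free_conv_power m k p"
  shows "real_distribution m \<and> real_distribution p \<and> (k = 1 \<and> p = m \<or>
    (\<exists>\<alpha>>0. \<exists>\<beta>>0. \<exists>R. is_R_transform m \<alpha> \<beta> R \<and> is_R_transform p \<alpha> \<beta> (\<lambda>z. of_nat k * R z)))"
  using assms
proof (induction rule: is_free_conv_power.induct)
  case (one)
  then show ?case by simp
next
  case (step k p q)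
  then have rd: "real_distribution m" "real_distribution p" by simp_all
  from step(2) obtain \<alpha> \<beta> R S where pos: "\<alpha> > 0" "\<beta> > 0" and q: "real_distribution q"
    and R: "is_R_transform p \<alpha> \<beta> R" and S: "is_R_transform m \<alpha> \<beta> S"
    and RS: "is_R_transform q \<alpha> \<beta> (\<lambda>z. R z + S z)"
    by (auto simp: is_free_conv_def)
  show ?case
  proof (cases "k = 1 \<and> p = m")
    case True
    have eq: "R z = S z" if "z \<in> stolz_pair \<alpha> \<beta>" for z
      by (rule real_distribution.R_transform_unique[OF rd(1) _ S that]) (use R True in simp)
    have "is_R_transform q \<alpha> \<beta> (\<lambda>z. of_nat (Suc k) * S z)"
      by (rule is_R_transform_cong[OF RS]) (use True eq in simp)
    then show ?thesis using pos S rd q by blast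
  next
    case False
    with step obtain \<alpha>' \<beta>' T where pos': "\<alpha>' > 0" "\<beta>' > 0"
      and T: "is_R_transform m \<alpha>' \<beta>' T" "is_R_transform p \<alpha>' \<beta>' (\<lambda>z. of_nat k * T z)"
      by auto
    define a where "a = min \<alpha> \<alpha>'"
    define b where "b = min \<beta> \<beta>'"
    have ab: "a > 0" "b > 0" "a \<le> \<alpha>" "a \<le> \<alpha>'" "b \<le> \<beta>" "b \<le> \<beta>'"
      using pos pos' by (auto simp: a_def b_def)
    note R' = is_R_transform_mono[OF R ab(3,5)] and S' = is_R_transform_mono[OF S ab(3,5)]
      and RS' = is_R_transform_mono[OF RS ab(3,5)]
      and T' = is_R_transform_mono[OF T(1) ab(4,6)] is_R_transform_mono[OF T(2) ab(4,6)]
    have "R z = of_nat k * T z" "S z = T z" if "z \<in> stolz_pair a b" for z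
      using real_distribution.R_transform_unique[OF rd(2) R' T'(2) that]
        real_distribution.R_transform_unique[OF rd(1) S' T'(1) that] by simp_all
    then have "is_R_transform q a b (\<lambda>z. of_nat (Suc k) * T z)"
      by (intro is_R_transform_cong[OF RS']) (simp add: algebra_simps)
    then show ?thesis using ab T'(1) rd q by blast
  qed
qed

text \<open>K(z) = 1/z + R(z) has the Cauchy transform as left inverse, hence is injective and open,
  and it exchanges the half-planes. Equality on its image therefore spreads to each
  half-plane.\<close>

lemma R_transform_image_identity:
  assumes R: "is_R_transform m \<alpha> \<beta> R" and pos: "\<alpha> > 0" "\<beta> > 0"
    and f: "f holomorphic_on {z. Im z \<noteq> 0}" and g: "g holomorphic_on {z. Im z \<noteq> 0}" and m: "real_distribution m"
    and eq: "\<And>z. z \<in> stolz_pair \<alpha> \<beta> \<Longrightarrow> f (1 / z + R z) = g (1 / z + R z)" and u: "Im u \<noteq> 0"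
  shows "f u = g u"
proof -
  interpret real_distribution m by fact
  define K where "K = (\<lambda>z. 1 / z + R z)"
  have K: "Im (K z) \<noteq> 0" "cauchy_transform m (K z) = z" if "z \<in> stolz_pair \<alpha> \<beta>" for z
    using R_transform_rcauchy[OF R that] by (simp_all add: K_def)
  have sgn: "Im (K z) * Im z < 0" if "z \<in> stolz_pair \<alpha> \<beta>" for z
    using cauchy_sign[OF K(1)[OF that]] K(2)[OF that] by simp
  have Khol: "K holomorphic_on stolz_pair \<alpha> \<beta>"
    unfolding K_def using R by (intro holomorphic_intros) (auto simp: is_R_transform_def stolz_pair_iff)
  have opn: "open (K ` S)" if "S \<subseteq> stolz_pair \<alpha> \<beta>" "open S" for S
    by (rule open_mapping_thm3[OF holomorphic_on_subset[OF Khol that(1)] that(2)])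
      (use K(2) that(1) in \<open>metis inj_on_def subsetD\<close>)
  show ?thesis
  proof (cases "Im u > 0")
    case True
    show ?thesis
    proof (rule analytic_continuation_open[where s = "K ` stolz_angle \<alpha> \<beta>" and s' = "{z. Im z > 0}" and f = f and g = g])
      show "open (K ` stolz_angle \<alpha> \<beta>)" by (rule opn[OF _ open_stolz_angle]) (auto simp: stolz_pair_def)
      show "K ` stolz_angle \<alpha> \<beta> \<noteq> {}" using stolz_angle_nonempty[OF pos] by simp
      show "K ` stolz_angle \<alpha> \<beta> \<subseteq> {z. Im z > 0}"
      proof
        fix v assume "v \<in> K ` stolz_angle \<alpha> \<beta>"
        then obtain z where "z \<in> stolz_angle \<alpha> \<beta>" "v = K z" by blast
        then show "v \<in> {z. Im z > 0}" using sgn[of z] by (auto simp: stolz_pair_def stolz_angle_def mult_less_0_iff)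
      qed
    qed (use True f g eq in \<open>auto simp: K_def stolz_pair_def open_halfspace_Im_gt convex_connected convex_halfspace_Im_gt elim: holomorphic_on_subset\<close>)
  next
    case False
    then have u': "Im u < 0" using u by simp
    show ?thesis
    proof (rule analytic_continuation_open[where s = "K ` cnj ` stolz_angle \<alpha> \<beta>" and s' = "{z. Im z < 0}" and f = f and g = g])
      show "open (K ` cnj ` stolz_angle \<alpha> \<beta>)" by (rule opn[OF _ open_cnj_image[OF open_stolz_angle]]) (auto simp: stolz_pair_def)
      show "K ` cnj ` stolz_angle \<alpha> \<beta> \<noteq> {}" using stolz_angle_nonempty[OF pos] by simp
      show "K ` cnj ` stolz_angle \<alpha> \<beta> \<subseteq> {z. Im z < 0}"
      proof
        fix v assume "v \<in> K ` cnj ` stolz_angle \<alpha> \<beta>"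
        then obtain z where "z \<in> stolz_angle \<alpha> \<beta>" "v = K (cnj z)" by blast
        then show "v \<in> {z. Im z < 0}" using sgn[of "cnj z"] by (auto simp: stolz_pair_def stolz_angle_def mult_less_0_iff zero_less_mult_iff)
      qed
    qed (use u' f g eq in \<open>auto simp: K_def stolz_pair_def open_halfspace_Im_lt convex_connected convex_halfspace_Im_lt elim: holomorphic_on_subset\<close>)
  qed
qed

section \<open>Subordination for free convolution powers\<close>

text \<open>Let v = G(z) for the power p and let R belong to the base law, so that z = 1/v + k R(v).
  The point 1/v + R(v), at which the base law has transform v, is then (z + (k - 1) F(z)) / k
  because F(z) = 1/v.\<close>

definition subord :: "nat \<Rightarrow> real measure \<Rightarrow> complex \<Rightarrow> complex" where
  "subord k p z = (z + (of_nat k - 1) * rcauchy p z) / of_nat k"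

lemma subord_Im:
  assumes "real_distribution p" "k \<ge> 1" "Im z \<noteq> 0"
  shows "Im (subord k p z) = Im z * (1 + (1 - 1 / real k) * rvariance p z)"
    "Im (subord k p z) \<noteq> 0" "\<bar>Im z\<bar> \<le> \<bar>Im (subord k p z)\<bar>" "Im z > 0 \<Longrightarrow> Im (subord k p z) > 0"
proof -
  interpret real_distribution p by fact
  have "Im (subord k p z) = (Im z + (real k - 1) * Im (rcauchy p z)) / real k"
    unfolding subord_def by (simp add: Im_divide_of_nat)
  also have "\<dots> = Im z * (1 + (1 - 1 / real k) * rvariance p z)"
    unfolding Im_rcauchy[OF assms(3)] using assms(2) by (simp add: field_simps)
  finally show 1: "Im (subord k p z) = Im z * (1 + (1 - 1 / real k) * rvariance p z)" .
  have 2: "(1 - 1 / real k) * rvariance p z \<ge> 0" using assms(2) rvariance_nonneg[OF assms(3)] by simp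
  show "Im (subord k p z) \<noteq> 0" "Im z > 0 \<Longrightarrow> Im (subord k p z) > 0" unfolding 1 using 2 assms(3) by (auto simp: zero_less_mult_iff)
  show "\<bar>Im z\<bar> \<le> \<bar>Im (subord k p z)\<bar>" unfolding 1 abs_mult using 2 by (simp add: mult_le_cancel_left1)
qed

lemma subord_cnj: "real_distribution p \<Longrightarrow> subord k p (cnj z) = cnj (subord k p z)"
  by (simp add: subord_def real_distribution.rcauchy_cnj)

lemma subord_holomorphic:
  assumes "real_distribution p" "k \<ge> 1"
  shows "subord k p holomorphic_on {z. Im z \<noteq> 0}"
  unfolding subord_def[abs_def] using real_distribution.rcauchy_holomorphic[OF assms(1)] assms(2)
  by (intro holomorphic_intros) auto

text \<open>On the image of a Stolz domain this is the scaling of R to k R. Both sides are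
  holomorphic off the real axis since \<open>subord\<close> preserves the half-planes.\<close>

theorem free_conv_power_subordination:
  assumes conv: "is_free_conv_power m k p" and k: "k \<ge> 2" and z: "Im z \<noteq> 0"
  shows "cauchy_transform m (subord k p z) = cauchy_transform p z"
proof -
  have m: "real_distribution m" and p: "real_distribution p"
    using free_conv_power_R_transform[OF conv] by simp_all
  interpret m: real_distribution m by fact
  interpret p: real_distribution p by fact
  obtain \<alpha> \<beta> R where pos: "\<alpha> > 0" "\<beta> > 0" and R: "is_R_transform m \<alpha> \<beta> R"
    and Rp: "is_R_transform p \<alpha> \<beta> (\<lambda>z. of_nat k * R z)"
    using free_conv_power_R_transform[OF conv] k by auto
  have "(cauchy_transform m \<circ> subord k p) holomorphic_on {z. Im z \<noteq> 0}"
    by (rule holomorphic_on_compose_gen[OF subord_holomorphic[OF p] m.cauchy_holomorphic]) (use subord_Im(2)[OF p] k in auto)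
  then have hol: "(\<lambda>z. cauchy_transform m (subord k p z)) holomorphic_on {z. Im z \<noteq> 0}" by (simp add: comp_def)
  show ?thesis
  proof (rule R_transform_image_identity[OF Rp pos hol p.cauchy_holomorphic p _ z])
    fix u assume u: "u \<in> stolz_pair \<alpha> \<beta>"
    have "subord k p (1 / u + of_nat k * R u) = 1 / u + R u"
      unfolding subord_def R_transform_rcauchy(3)[OF Rp u] using k by (simp add: field_simps diff_divide_distrib)
    then show "cauchy_transform m (subord k p (1 / u + of_nat k * R u)) = cauchy_transform p (1 / u + of_nat k * R u)"
      using R_transform_rcauchy(2)[OF R u] R_transform_rcauchy(2)[OF Rp u] by simp
  qed
qed

section \<open>Separately holomorphic functions\<close>

text \<open>Cauchy's estimate on discs of radius r/4 around points of the half-size ball, which stay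
  inside the given ball.\<close>

lemma holomorphic_bounded_Lipschitz:
  assumes f: "f holomorphic_on ball a r" and r: "r > 0"
    and M: "\<And>z. z \<in> ball a r \<Longrightarrow> cmod (f z) \<le> M"
    and z: "z \<in> ball a (r / 2)" and w: "w \<in> ball a (r / 2)"
  shows "cmod (f z - f w) \<le> 4 * M / r * cmod (z - w)"
proof (rule field_differentiable_bound[of "ball a (r/2)" f "deriv f"])
  fix u assume u: "u \<in> ball a (r / 2)"
  have "cball u (r / 4) \<subseteq> ball a r"
  proof
    fix v assume "v \<in> cball u (r / 4)"
    then show "v \<in> ball a r" using u r dist_triangle[of a v u] by auto
  qed
  then have sub: "cball u (r / 4) \<subseteq> ball a r" .
  show "(f has_field_derivative deriv f u) (at u within ball a (r / 2))"
    by (rule has_field_derivative_at_within[OF holomorphic_derivI[OF f open_ball]]) (use u r in auto)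
  have "cmod ((deriv ^^ 1) f u) \<le> fact 1 * M / (r / 4) ^ 1"
  proof (rule Cauchy_inequality)
    show "f holomorphic_on ball u (r / 4)" by (rule holomorphic_on_subset[OF f subset_trans[OF ball_subset_cball sub]])
    show "continuous_on (cball u (r / 4)) f"
      by (rule continuous_on_subset[OF holomorphic_on_imp_continuous_on[OF f] sub])
    show "cmod (f x) \<le> M" if "cmod (u - x) = r / 4" for x
      using that sub by (intro M) (auto simp: dist_norm subset_iff)
  qed (use r in auto)
  then show "cmod (deriv f u) \<le> 4 * M / r" by (simp add: mult.commute)
qed (use z w in auto)

text \<open>Local boundedness, at hand for the functions considered here, makes joint
  differentiability elementary and stands in for Hartogs' theorem.\<close>

locale separately_holomorphic =
  fixes f :: "complex \<Rightarrow> complex \<Rightarrow> complex" and A B :: "complex set"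
  assumes open_A: "open A" and open_B: "open B"
    and hol1: "w \<in> B \<Longrightarrow> (\<lambda>z. f z w) holomorphic_on A"
    and hol2: "z \<in> A \<Longrightarrow> f z holomorphic_on B"
    and locally_bounded: "z \<in> A \<Longrightarrow> w \<in> B \<Longrightarrow>
      \<exists>r>0. \<exists>M. \<forall>z'\<in>A. \<forall>w'\<in>B. dist z z' < r \<longrightarrow> dist w w' < r \<longrightarrow> cmod (f z' w') \<le> M"
begin

lemma bounded_polydisc:
  assumes "a \<in> A" "b \<in> B"
  obtains r M where "r > 0" "M \<ge> 0" "ball a r \<subseteq> A" "ball b r \<subseteq> B"
    "\<And>z w. z \<in> ball a r \<Longrightarrow> w \<in> ball b r \<Longrightarrow> cmod (f z w) \<le> M"
proof -
  obtain r M where r: "r > 0" and M: "\<And>z w. z \<in> A \<Longrightarrow> w \<in> B \<Longrightarrow> dist a z < r \<Longrightarrow> dist b w < r \<Longrightarrow> cmod (f z w) \<le> M"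
    using locally_bounded[OF assms] by blast
  obtain s where s: "s > 0" "ball a s \<subseteq> A" using open_A assms by (auto elim: openE)
  obtain t where t: "t > 0" "ball b t \<subseteq> B" using open_B assms by (auto elim: openE)
  define q where "q = min r (min s t)"
  have q: "q > 0" "ball a q \<subseteq> A" "ball b q \<subseteq> B" using r s t by (auto simp: q_def)
  have M': "cmod (f z w) \<le> M" if "z \<in> ball a q" "w \<in> ball b q" for z w
    using that q by (intro M) (auto simp: q_def)
  have "0 \<le> M" by (rule order_trans[OF norm_ge_zero M'[of a b]]) (use q in auto)
  then show ?thesis using that q M' by blast
qed

lemma double_difference:
  assumes "a \<in> A" "b \<in> B"
  obtains r K where "r > 0" "K \<ge> 0" "ball a r \<subseteq> A" "ball b r \<subseteq> B"
    "\<And>z w. z \<in> ball a r \<Longrightarrow> w \<in> ball b r \<Longrightarrow> cmod (f z w - f a w) \<le> K * cmod (z - a)"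
    "\<And>z w. z \<in> ball a r \<Longrightarrow> w \<in> ball b r \<Longrightarrow> cmod (f z w - f z b) \<le> K * cmod (w - b)"
    "\<And>z w. z \<in> ball a r \<Longrightarrow> w \<in> ball b r \<Longrightarrow>
      cmod (f z w - f a w - (f z b - f a b)) \<le> K * cmod (z - a) * cmod (w - b)"
proof -
  obtain r M where r: "r > 0" and M0: "M \<ge> 0" and sub: "ball a r \<subseteq> A" "ball b r \<subseteq> B"
    and M: "\<And>z w. z \<in> ball a r \<Longrightarrow> w \<in> ball b r \<Longrightarrow> cmod (f z w) \<le> M"
    by (rule bounded_polydisc[OF assms]) (rule that)
  have L1: "cmod (f z w - f a w) \<le> 4 * M / r * cmod (z - a)" if z: "z \<in> ball a (r / 2)" and w: "w \<in> ball b r" for z w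
  proof (rule holomorphic_bounded_Lipschitz[of "\<lambda>z. f z w" a r])
    show "(\<lambda>z. f z w) holomorphic_on ball a r"
      using sub w by (intro holomorphic_on_subset[OF hol1]) auto
  qed (use z w r M in auto)
  have L2: "cmod (f z w - f z b) \<le> 4 * M / r * cmod (w - b)" if w: "w \<in> ball b (r / 2)" and z: "z \<in> ball a r" for z w
  proof (rule holomorphic_bounded_Lipschitz[of "f z" b r])
    show "f z holomorphic_on ball b r"
      using sub z by (intro holomorphic_on_subset[OF hol2]) auto
  qed (use z w r M in auto)
  \<comment> \<open>The first Lipschitz estimate serves as the bound for the second, applied to the
    function f z w - f a w of w.\<close>
  have L3: "cmod (f z w - f a w - (f z b - f a b)) \<le> 4 * (4 * M / r * cmod (z - a)) / r * cmod (w - b)"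
    if z: "z \<in> ball a (r / 2)" and w: "w \<in> ball b (r / 2)" for z w
  proof (rule holomorphic_bounded_Lipschitz[of "\<lambda>w. f z w - f a w" b r _ w b])
    have "z \<in> A" "a \<in> A" using z sub r assms by auto
    then show "(\<lambda>w. f z w - f a w) holomorphic_on ball b r"
      using sub by (intro holomorphic_intros) (auto intro: holomorphic_on_subset[OF hol2])
  qed (use z w r L1 in auto)
  define K where "K = 4 * M / r + 4 * (4 * M / r) / r"
  have K: "4 * M / r \<le> K" "4 * (4 * M / r) / r \<le> K" "K \<ge> 0" using r M0 by (auto simp: K_def)
  show ?thesis
  proof (rule that[of "r / 2" K])
    fix z w assume z: "z \<in> ball a (r / 2)" and w: "w \<in> ball b (r / 2)"
    have zr: "z \<in> ball a r" "w \<in> ball b r" using z w r by auto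
    show "cmod (f z w - f a w) \<le> K * cmod (z - a)"
      using L1[OF z zr(2)] mult_right_mono[OF K(1) norm_ge_zero, of "z - a"] by linarith
    show "cmod (f z w - f z b) \<le> K * cmod (w - b)"
      using L2[OF w zr(1)] mult_right_mono[OF K(1) norm_ge_zero, of "w - b"] by linarith
    have "4 * (4 * M / r * cmod (z - a)) / r * cmod (w - b) = 4 * (4 * M / r) / r * (cmod (z - a) * cmod (w - b))"
      by simp
    also have "\<dots> \<le> K * (cmod (z - a) * cmod (w - b))" by (rule mult_right_mono[OF K(2)]) simp
    finally show "cmod (f z w - f a w - (f z b - f a b)) \<le> K * cmod (z - a) * cmod (w - b)"
      using L3[OF z w] by simp
  qed (use r K sub in \<open>auto intro: subset_trans[OF subset_ball]\<close>)
qed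

text \<open>The mixed second difference is of order |z - a| |w - b| and so has derivative 0 at (a,
  b). What remains of f is a sum of two functions of one variable each.\<close>

lemma jointly_differentiable:
  assumes ab: "a \<in> A" "b \<in> B"
  shows "((\<lambda>p. f (fst p) (snd p)) has_derivative
    (\<lambda>p. deriv (\<lambda>z. f z b) a * fst p + deriv (f a) b * snd p)) (at (a, b))"
proof -
  obtain r K where r: "r > 0" and K: "K \<ge> 0" and sub: "ball a r \<subseteq> A" "ball b r \<subseteq> B"
    and dd: "\<And>z w. z \<in> ball a r \<Longrightarrow> w \<in> ball b r \<Longrightarrow>
      cmod (f z w - f a w - (f z b - f a b)) \<le> K * cmod (z - a) * cmod (w - b)"
    by (rule double_difference[OF ab]) (rule that)
  have d1: "((\<lambda>z. f z b) has_derivative (\<lambda>h. deriv (\<lambda>z. f z b) a * h)) (at a)"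
    using holomorphic_derivI[OF hol1[OF ab(2)] open_A ab(1)] by (simp add: has_field_derivative_def)
  have d2: "(f a has_derivative (\<lambda>h. deriv (f a) b * h)) (at b)"
    using holomorphic_derivI[OF hol2[OF ab(1)] open_B ab(2)] by (simp add: has_field_derivative_def)
  have D1: "((\<lambda>p. f (fst p) b) has_derivative (\<lambda>p. deriv (\<lambda>z. f z b) a * fst p)) (at (a, b))"
    by (rule has_derivative_compose[of fst fst "(a, b)" UNIV "\<lambda>z. f z b"]) (use d1 in \<open>auto intro: derivative_intros\<close>)
  have D2: "((\<lambda>p. f a (snd p)) has_derivative (\<lambda>p. deriv (f a) b * snd p)) (at (a, b))"
    by (rule has_derivative_compose[of snd snd "(a, b)" UNIV "f a"]) (use d2 in \<open>auto intro: derivative_intros\<close>)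
  define g where "g = (\<lambda>p. f (fst p) (snd p) - f a (snd p) - (f (fst p) b - f a b))"
  have D3: "(g has_derivative (\<lambda>p. 0)) (at (a, b))"
    unfolding has_derivative_at
  proof (intro conjI)
    show "((\<lambda>h. norm (g ((a, b) + h) - g (a, b) - 0) / norm h) \<longlongrightarrow> 0) (at 0)"
    proof (rule Lim_null_comparison)
      show "eventually (\<lambda>h. norm (norm (g ((a, b) + h) - g (a, b) - 0) / norm h) \<le> K * norm h) (at 0)"
        unfolding eventually_at
      proof (intro exI conjI ballI impI)
        fix h :: "complex \<times> complex" assume h: "h \<noteq> 0 \<and> dist h 0 < r"
        have n: "norm (fst h) \<le> norm h" "norm (snd h) \<le> norm h"
          by (metis norm_fst_le prod.collapse, metis norm_snd_le prod.collapse)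
        have "cmod (g ((a, b) + h)) \<le> K * cmod (fst h) * cmod (snd h)"
          using dd[of "a + fst h" "b + snd h"] n h by (simp add: g_def dist_norm)
        also have "\<dots> \<le> K * norm h * norm h"
          using K n by (intro mult_mono) auto
        finally show "norm (norm (g ((a, b) + h) - g (a, b) - 0) / norm h) \<le> K * norm h"
          using h by (simp add: g_def divide_simps)
      qed (rule r)
      show "((\<lambda>h. K * norm h) \<longlongrightarrow> 0) (at (0 :: complex \<times> complex))" by (auto intro!: tendsto_eq_intros)
    qed
  qed simp
  have "((\<lambda>p. g p + f (fst p) b + f a (snd p) - f a b) has_derivative
    (\<lambda>p. 0 + deriv (\<lambda>z. f z b) a * fst p + deriv (f a) b * snd p - 0)) (at (a, b))"
    by (rule has_derivative_diff[OF has_derivative_add[OF has_derivative_add[OF D3 D1] D2] has_derivative_const])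
  moreover have "(\<lambda>p. g p + f (fst p) b + f a (snd p) - f a b) = (\<lambda>p. f (fst p) (snd p))"
    by (simp add: g_def fun_eq_iff)
  ultimately show ?thesis by (simp only: add_0 diff_0_right)
qed

lemma jointly_continuous: "continuous_on (A \<times> B) (\<lambda>p. f (fst p) (snd p))"
proof (intro continuous_at_imp_continuous_on ballI)
  fix p assume "p \<in> A \<times> B"
  then have "isCont (\<lambda>p. f (fst p) (snd p)) (fst p, snd p)"
    by (intro has_derivative_continuous[OF jointly_differentiable]) (simp_all add: mem_Times_iff)
  then show "isCont (\<lambda>p. f (fst p) (snd p)) p" by (simp only: prod.collapse)
qed

end

section \<open>The Cauchy transform of a bi-free convolution power\<close>

lemma borel_law2_measurable:
  assumes "borel_law2 \<mu>" "f \<in> borel_measurable borel"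
  shows "f \<in> borel_measurable \<mu>"
  using assms by (simp add: borel_law2_def measurable_cong_sets[of \<mu> borel borel borel])

lemma borel_law2_real_pair:
  assumes "borel_law2 \<mu>"
  shows "real_pair \<mu> fst snd"
proof -
  interpret prob_space \<mu> using assms by (simp add: borel_law2_def)
  show ?thesis
    by unfold_locales (intro borel_law2_measurable[OF assms] borel_measurable_continuous_onI continuous_intros)+
qed

lemma marginal_real_distribution:
  assumes "borel_law2 \<mu>"
  shows "real_distribution (marginal1 \<mu>)" "real_distribution (marginal2 \<mu>)"
proof -
  interpret real_pair \<mu> fst snd by (rule borel_law2_real_pair[OF assms])
  show "real_distribution (marginal1 \<mu>)" unfolding marginal1_def by (rule real_distribution_distr) (rule X_meas)
  show "real_distribution (marginal2 \<mu>)" unfolding marginal2_def by (rule real_distribution_distr) (rule Y_meas)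
qed

lemma real_pair_G:
  assumes "borel_law2 \<mu>"
  shows "real_variable.G \<mu> fst = cauchy_transform (marginal1 \<mu>)"
    "real_variable.G \<mu> snd = cauchy_transform (marginal2 \<mu>)"
    "real_pair.G2 \<mu> fst snd = cauchy_transform2 \<mu>"
proof -
  interpret real_pair \<mu> fst snd by (rule borel_law2_real_pair[OF assms])
  show "A.G = cauchy_transform (marginal1 \<mu>)"
    unfolding fun_eq_iff A.G_def wct_def cauchy_transform_def marginal1_def
    by (subst integral_distr) auto
  show "B.G = cauchy_transform (marginal2 \<mu>)"
    unfolding fun_eq_iff B.G_def wct_def cauchy_transform_def marginal2_def
    by (subst integral_distr) auto
  show "G2 = cauchy_transform2 \<mu>" by (simp add: fun_eq_iff G2_def cauchy_transform2_def)
qed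

lemma real_pair_F:
  assumes "borel_law2 \<mu>"
  shows "real_variable.F \<mu> fst = rcauchy (marginal1 \<mu>)"
    "real_variable.F \<mu> snd = rcauchy (marginal2 \<mu>)"
proof -
  interpret real_pair \<mu> fst snd by (rule borel_law2_real_pair[OF assms])
  show "A.F = rcauchy (marginal1 \<mu>)" "B.F = rcauchy (marginal2 \<mu>)"
    by (simp_all add: fun_eq_iff A.F_def B.F_def rcauchy_def real_pair_G[OF assms])
qed

lemma real_pair_rvar:
  assumes "borel_law2 \<mu>" "Im z \<noteq> 0"
  shows "real_variable.rvar \<mu> fst z = rvariance (marginal1 \<mu>) z"
    "real_variable.rvar \<mu> snd z = rvariance (marginal2 \<mu>) z"
proof -
  interpret real_pair \<mu> fst snd by (rule borel_law2_real_pair[OF assms(1)])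
  show "A.rvar z = rvariance (marginal1 \<mu>) z" "B.rvar z = rvariance (marginal2 \<mu>) z"
    by (simp_all add: A.rvar_eq B.rvar_eq assms(2) rvariance_def real_pair_F[OF assms(1)])
qed

lemma open_Im_nonzero: "open {z. Im z \<noteq> 0}"
  by (intro open_Collect_neq continuous_intros)

text \<open>The covariance \<open>cov\<close> of the two coordinates, written through transforms
  alone.\<close>

definition bicov :: "(real \<times> real) measure \<Rightarrow> complex \<Rightarrow> complex \<Rightarrow> complex" where
  "bicov \<mu> z w = cauchy_transform2 \<mu> z w * rcauchy (marginal1 \<mu>) z * rcauchy (marginal2 \<mu>) w - 1"

context
  fixes \<mu> :: "(real \<times> real) measure"
  assumes law: "borel_law2 \<mu>"
begin

interpretation real_pair \<mu> fst snd by (rule borel_law2_real_pair[OF law])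

lemma bicov_eq_cov: "Im z \<noteq> 0 \<Longrightarrow> Im w \<noteq> 0 \<Longrightarrow> bicov \<mu> z w = cov z w"
  using G2_eq[of z w] A.G_nonzero[of z] B.G_nonzero[of w]
  by (simp add: bicov_def rcauchy_def real_pair_G[OF law])

lemma cauchy_transform2_eq:
  assumes "Im z \<noteq> 0" "Im w \<noteq> 0"
  shows "cauchy_transform2 \<mu> z w = cauchy_transform (marginal1 \<mu>) z * cauchy_transform (marginal2 \<mu>) w * (1 + bicov \<mu> z w)"
  using G2_eq[OF assms] by (simp add: bicov_eq_cov assms real_pair_G[OF law])

lemma bicov_cnj: "Im z \<noteq> 0 \<Longrightarrow> Im w \<noteq> 0 \<Longrightarrow> bicov \<mu> (cnj z) (cnj w) = cnj (bicov \<mu> z w)"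
  by (simp add: bicov_eq_cov cov_cnj)

lemma bicov_le:
  assumes "Im z \<noteq> 0" "Im w \<noteq> 0"
  shows "(cmod (bicov \<mu> z w))\<^sup>2 \<le> rvariance (marginal1 \<mu>) z * rvariance (marginal2 \<mu>) w"
  using cov_le[OF assms] by (simp add: bicov_eq_cov real_pair_rvar[OF law] assms)

lemma bicov_power_nonneg:
  assumes z: "Im z > 0" and w: "Im w > 0" and \<kappa>: "\<kappa> \<ge> 0"
    and rz: "\<kappa> * rvariance (marginal1 \<mu>) z < 1" and rw: "\<kappa> * rvariance (marginal2 \<mu>) w < 1"
  defines "S \<equiv> \<lambda>u. (1 + u) / (1 - of_real \<kappa> * u)"
  shows "0 \<le> Re (cnj (cauchy_transform (marginal1 \<mu>) z) * cauchy_transform (marginal2 \<mu>) w * S (bicov \<mu> (cnj z) w)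
    - cauchy_transform (marginal1 \<mu>) z * cauchy_transform (marginal2 \<mu>) w * S (bicov \<mu> z w))"
  using bifree_power_nonneg[OF z w \<kappa>] z w rz rw
  by (simp add: bicov_eq_cov real_pair_rvar[OF law] real_pair_G[OF law] S_def)

lemma law_weight1: "Im z \<noteq> 0 \<Longrightarrow> weighted_variable \<mu> snd (\<lambda>p. 1 / (z - of_real (fst p))) (1 / \<bar>Im z\<bar>)"
  and law_weight2: "Im z \<noteq> 0 \<Longrightarrow> weighted_variable \<mu> fst (\<lambda>p. 1 / (z - of_real (snd p))) (1 / \<bar>Im z\<bar>)"
proof -
  assume z: "Im z \<noteq> 0"
  show "weighted_variable \<mu> snd (\<lambda>p. 1 / (z - of_real (fst p))) (1 / \<bar>Im z\<bar>)"
  proof unfold_locales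
    show "cmod (1 / (z - of_real (fst p))) \<le> 1 / \<bar>Im z\<bar>" for p :: "real \<times> real"
      by (rule norm_divide_diff_of_real_le[OF z]) simp
  qed measurable
  show "weighted_variable \<mu> fst (\<lambda>p. 1 / (z - of_real (snd p))) (1 / \<bar>Im z\<bar>)"
  proof unfold_locales
    show "cmod (1 / (z - of_real (snd p))) \<le> 1 / \<bar>Im z\<bar>" for p :: "real \<times> real"
      by (rule norm_divide_diff_of_real_le[OF z]) simp
  qed measurable
qed

lemma cauchy_transform2_wct:
  "cauchy_transform2 \<mu> z w = wct \<mu> snd (\<lambda>p. 1 / (z - of_real (fst p))) w"
  "cauchy_transform2 \<mu> z w = wct \<mu> fst (\<lambda>p. 1 / (w - of_real (snd p))) z"
  by (simp_all add: cauchy_transform2_def wct_def mult.commute)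

lemma cauchy_transform2_holomorphic:
  "Im z \<noteq> 0 \<Longrightarrow> cauchy_transform2 \<mu> z holomorphic_on {w. Im w \<noteq> 0}"
  "Im w \<noteq> 0 \<Longrightarrow> (\<lambda>z. cauchy_transform2 \<mu> z w) holomorphic_on {z. Im z \<noteq> 0}"
  using weighted_variable.wct_holomorphic[OF law_weight1, of z] weighted_variable.wct_holomorphic[OF law_weight2, of w]
  unfolding cauchy_transform2_wct(1)[of z, abs_def] cauchy_transform2_wct(2)[of _ w, abs_def] by simp_all

lemma cauchy_transform2_norm_le:
  assumes "Im z \<noteq> 0" "Im w \<noteq> 0"
  shows "cmod (cauchy_transform2 \<mu> z w) \<le> 1 / (\<bar>Im z\<bar> * \<bar>Im w\<bar>)"
  using weighted_variable.wct_norm_le[OF law_weight1[OF assms(1)] assms(2)]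
  by (simp add: cauchy_transform2_wct(1) prob_space)

lemma cauchy_transform2_cnj: "cauchy_transform2 \<mu> (cnj z) (cnj w) = cnj (cauchy_transform2 \<mu> z w)"
  unfolding cauchy_transform2_def Bochner_Integration.integral_cnj[symmetric] by simp

lemma bicov_holomorphic:
  "Im z \<noteq> 0 \<Longrightarrow> bicov \<mu> z holomorphic_on {w. Im w \<noteq> 0}"
  "Im w \<noteq> 0 \<Longrightarrow> (\<lambda>z. bicov \<mu> z w) holomorphic_on {z. Im z \<noteq> 0}"
  unfolding bicov_def[abs_def]
  by (intro holomorphic_intros cauchy_transform2_holomorphic
      real_distribution.rcauchy_holomorphic marginal_real_distribution[OF law]; simp)+

end

locale bifree_power =
  fixes \<mu> :: "(real \<times> real) measure" and k :: nat and p1 p2 :: "real measure"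
  assumes law: "borel_law2 \<mu>" and k: "k \<ge> 2"
    and conv1: "is_free_conv_power (marginal1 \<mu>) k p1"
    and conv2: "is_free_conv_power (marginal2 \<mu>) k p2"
begin

sublocale m1: real_distribution "marginal1 \<mu>" by (rule marginal_real_distribution[OF law])
sublocale m2: real_distribution "marginal2 \<mu>" by (rule marginal_real_distribution[OF law])

lemma rd1: "real_distribution p1" and rd2: "real_distribution p2"
  using free_conv_power_R_transform[OF conv1] free_conv_power_R_transform[OF conv2] by simp_all

sublocale p1: real_distribution p1 by (rule rd1)
sublocale p2: real_distribution p2 by (rule rd2)

lemma k1: "k \<ge> 1" using k by simp

lemma subordination1: "Im z \<noteq> 0 \<Longrightarrow> cauchy_transform (marginal1 \<mu>) (subord k p1 z) = cauchy_transform p1 z"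
  and subordination2: "Im z \<noteq> 0 \<Longrightarrow> cauchy_transform (marginal2 \<mu>) (subord k p2 z) = cauchy_transform p2 z"
  by (rule free_conv_power_subordination[OF conv1 k] free_conv_power_subordination[OF conv2 k]; assumption)+

text \<open>Imaginary parts in k u = z + (k - 1) F(u), where u is the subordinated point and F
  belongs to the base law. The strict bound is what the positivity lemmas ask for. The last estimate
  gains a factor 1 - X, where X is k - 1 times the variance; it later cancels the small denominator
  of \<open>H\<close>.\<close>

lemma subord_variance:
  assumes m: "real_distribution m" and p: "real_distribution p" and z: "Im z \<noteq> 0"
    and eq: "cauchy_transform m (subord k p z) = cauchy_transform p z"
  shows "1 - (real k - 1) * rvariance m (subord k p z) = Im z / Im (subord k p z)"
    "0 \<le> (real k - 1) * rvariance m (subord k p z)" "(real k - 1) * rvariance m (subord k p z) < 1"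
    "(cmod (cauchy_transform p z))\<^sup>2 \<le> (1 - (real k - 1) * rvariance m (subord k p z)) / (Im z)\<^sup>2"
proof -
  define u where "u = subord k p z"
  have u: "Im u \<noteq> 0" "\<bar>Im z\<bar> \<le> \<bar>Im u\<bar>" using subord_Im[OF p k1 z] by (simp_all add: u_def)
  have sgn: "Im z / Im u > 0" "Im z / Im u = \<bar>Im z\<bar> / \<bar>Im u\<bar>"
  proof -
    have "(1 - 1 / real k) * rvariance p z \<ge> 0"
      using k1 real_distribution.rvariance_nonneg[OF p z] by simp
    moreover have "Im u = Im z * (1 + (1 - 1 / real k) * rvariance p z)" unfolding u_def by (rule subord_Im(1)[OF p k1 z])
    ultimately show "Im z / Im u > 0" using z by simp
    then show "Im z / Im u = \<bar>Im z\<bar> / \<bar>Im u\<bar>" by (metis abs_divide abs_of_pos)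
  qed
  have F: "rcauchy m u = rcauchy p z" using eq by (simp add: rcauchy_def u_def)
  have "of_nat k * u = z + (of_nat k - 1) * rcauchy m u"
    unfolding F using k by (simp add: u_def subord_def)
  then have "Im (of_nat k * u) = Im (z + (of_nat k - 1) * rcauchy m u)" by simp
  then have "real k * Im u = Im z + (real k - 1) * Im (rcauchy m u)" by simp
  also have "Im (rcauchy m u) = Im u * (1 + rvariance m u)" by (rule real_distribution.Im_rcauchy[OF m u(1)])
  finally show 1: "1 - (real k - 1) * rvariance m (subord k p z) = Im z / Im (subord k p z)"
    using u(1) unfolding u_def[symmetric] by (simp add: field_simps)
  show "0 \<le> (real k - 1) * rvariance m (subord k p z)"
    using k real_distribution.rvariance_nonneg[OF m u(1)] by (simp add: u_def)
  show "(real k - 1) * rvariance m (subord k p z) < 1"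
    using 1 sgn(1) unfolding u_def by linarith
  have "(cmod (cauchy_transform p z))\<^sup>2 = cmod (cauchy_transform m u) * cmod (cauchy_transform p z)"
    using eq by (simp add: u_def power2_eq_square)
  also have "\<dots> \<le> (1 / \<bar>Im u\<bar>) * (1 / \<bar>Im z\<bar>)"
    by (intro mult_mono real_distribution.cauchy_norm_le[OF m u(1)] real_distribution.cauchy_norm_le[OF p z]) auto
  also have "\<dots> = (\<bar>Im z\<bar> / \<bar>Im u\<bar>) / (Im z)\<^sup>2"
    using z u(1) by (simp add: field_simps power2_eq_square)
  finally show "(cmod (cauchy_transform p z))\<^sup>2 \<le> (1 - (real k - 1) * rvariance m (subord k p z)) / (Im z)\<^sup>2"
    unfolding 1 unfolding u_def[symmetric] sgn(2) .
qed

lemmas variance1 = subord_variance[OF m1.real_distribution_axioms rd1 _ subordination1]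
lemmas variance2 = subord_variance[OF m2.real_distribution_axioms rd2 _ subordination2]

definition c :: "complex \<Rightarrow> complex \<Rightarrow> complex" where
  "c z w = bicov \<mu> (subord k p1 z) (subord k p2 w)"

text \<open>The Cauchy transform of the bi-free convolution power, whose existence is yet to be shown.\<close>

definition H :: "complex \<Rightarrow> complex \<Rightarrow> complex" where
  "H z w = cauchy_transform p1 z * cauchy_transform p2 w * ((1 + c z w) / (1 - of_real (real k - 1) * c z w))"

lemma subord_nonreal: "Im z \<noteq> 0 \<Longrightarrow> Im (subord k p1 z) \<noteq> 0" "Im z \<noteq> 0 \<Longrightarrow> Im (subord k p2 z) \<noteq> 0"
  using subord_Im(2)[OF rd1 k1] subord_Im(2)[OF rd2 k1] by auto

lemma c_le:
  assumes "Im z \<noteq> 0" "Im w \<noteq> 0"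
  shows "((real k - 1) * cmod (c z w))\<^sup>2
    \<le> ((real k - 1) * rvariance (marginal1 \<mu>) (subord k p1 z)) * ((real k - 1) * rvariance (marginal2 \<mu>) (subord k p2 w))"
  using mult_left_mono[OF bicov_le[OF law subord_nonreal(1)[OF assms(1)] subord_nonreal(2)[OF assms(2)]], of "(real k - 1)\<^sup>2"]
  by (simp add: c_def power_mult_distrib power2_eq_square mult_ac)

lemma c_small:
  assumes "Im z \<noteq> 0" "Im w \<noteq> 0"
  shows "(real k - 1) * cmod (c z w) < 1" "cmod (c z w) < 1" "1 - of_real (real k - 1) * c z w \<noteq> 0"
proof -
  have "((real k - 1) * cmod (c z w))\<^sup>2 < 1 * 1"
    by (rule le_less_trans[OF c_le[OF assms]])
      (intro mult_strict_mono' variance1 variance2 assms)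
  then show 1: "(real k - 1) * cmod (c z w) < 1" by (simp add: abs_square_less_1 abs_less_iff)
  have "1 * cmod (c z w) \<le> (real k - 1) * cmod (c z w)" using k by (intro mult_right_mono) auto
  then show "cmod (c z w) < 1" using 1 by linarith
  show "1 - of_real (real k - 1) * c z w \<noteq> 0"
  proof
    assume "1 - of_real (real k - 1) * c z w = 0"
    then have "cmod (of_real (real k - 1) * c z w) = 1" by (metis eq_iff_diff_eq_0 norm_one)
    then show False using 1 k by (simp only: norm_mult norm_of_real)
  qed
qed

text \<open>The denominator of \<open>H\<close> is at least 1 - t with t = (k - 1) |c|, and t^2 is
  at most X Y. By the arithmetic-geometric mean (1 - X) (1 - Y) is at most (1 - t)^2, so the factors
  gained by the two marginal transforms cancel the denominator uniformly in k. The 2 bounds |1 +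
  c|.\<close>

lemma H_norm_le:
  assumes z: "Im z \<noteq> 0" and w: "Im w \<noteq> 0"
  shows "cmod (H z w) \<le> 2 / (\<bar>Im z\<bar> * \<bar>Im w\<bar>)"
proof -
  define X where "X = (real k - 1) * rvariance (marginal1 \<mu>) (subord k p1 z)"
  define Y where "Y = (real k - 1) * rvariance (marginal2 \<mu>) (subord k p2 w)"
  define t where "t = (real k - 1) * cmod (c z w)"
  have X: "0 \<le> X" "X < 1" "(cmod (cauchy_transform p1 z))\<^sup>2 \<le> (1 - X) / (Im z)\<^sup>2"
    using variance1[OF z z] by (simp_all add: X_def)
  have Y: "0 \<le> Y" "Y < 1" "(cmod (cauchy_transform p2 w))\<^sup>2 \<le> (1 - Y) / (Im w)\<^sup>2"
    using variance2[OF w w] by (simp_all add: Y_def)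
  have t: "t\<^sup>2 \<le> X * Y" "0 \<le> t" "t < 1" using c_le[OF z w] c_small(1)[OF z w] k by (simp_all add: t_def X_def Y_def)
  have "(1 - X) * (1 - Y) \<le> (1 - t)\<^sup>2"
  proof -
    have st: "sqrt ((1 - X) * (1 - Y)) \<le> 1 - sqrt (X * Y)"
    proof (rule real_le_lsqrt)
      have a: "sqrt (X * Y) < 1"
        using X Y mult_strict_mono'[of X 1 Y 1] by (simp add: real_sqrt_lt_1_iff)
      then show "0 \<le> 1 - sqrt (X * Y)" by simp
      have "2 * sqrt (X * Y) \<le> X + Y"
        using arith_geo_mean_sqrt[OF X(1) Y(1)] by simp
      then show "(1 - X) * (1 - Y) \<le> (1 - sqrt (X * Y))\<^sup>2"
        using X Y by (simp add: power2_eq_square algebra_simps)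
    qed
    have "t \<le> sqrt (X * Y)" using t by (simp add: real_le_rsqrt)
    with st have "sqrt ((1 - X) * (1 - Y)) \<le> 1 - t" by linarith
    then have "(sqrt ((1 - X) * (1 - Y)))\<^sup>2 \<le> (1 - t)\<^sup>2" using X Y by (intro power_mono) auto
    then show ?thesis using X Y by simp
  qed
  have "(cmod (cauchy_transform p1 z) * cmod (cauchy_transform p2 w))\<^sup>2 \<le> ((1 - X) / (Im z)\<^sup>2) * ((1 - Y) / (Im w)\<^sup>2)"
    unfolding power_mult_distrib using X Y by (intro mult_mono) auto
  also have "\<dots> = (1 - X) * (1 - Y) / (Im z * Im w)\<^sup>2" by (simp add: power_mult_distrib)
  also have "\<dots> \<le> (1 - t)\<^sup>2 / (Im z * Im w)\<^sup>2"
    using \<open>(1 - X) * (1 - Y) \<le> (1 - t)\<^sup>2\<close> by (intro divide_right_mono) auto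
  also have "\<dots> = ((1 - t) / (\<bar>Im z\<bar> * \<bar>Im w\<bar>))\<^sup>2" by (simp add: power_divide power_mult_distrib)
  finally have le: "cmod (cauchy_transform p1 z) * cmod (cauchy_transform p2 w) \<le> (1 - t) / (\<bar>Im z\<bar> * \<bar>Im w\<bar>)"
    by (rule power2_le_imp_le) (use t in auto)
  have den: "1 - t \<le> cmod (1 - of_real (real k - 1) * c z w)"
  proof -
    have "cmod (of_real (real k - 1) * c z w) = t" using k by (simp only: t_def norm_mult norm_of_real)
    then show ?thesis using norm_triangle_ineq2[of 1 "of_real (real k - 1) * c z w"] by simp
  qed
  have num: "cmod (1 + c z w) \<le> 2" using norm_triangle_ineq[of 1 "c z w"] c_small(2)[OF z w] by simp
  have "cmod (H z w) = cmod (cauchy_transform p1 z) * cmod (cauchy_transform p2 w) * (cmod (1 + c z w) / cmod (1 - of_real (real k - 1) * c z w))"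
    by (simp only: H_def norm_mult norm_divide)
  also have "\<dots> \<le> (1 - t) / (\<bar>Im z\<bar> * \<bar>Im w\<bar>) * (2 / (1 - t))"
    using den num t le by (intro mult_mono frac_le) auto
  also have "\<dots> = 2 / (\<bar>Im z\<bar> * \<bar>Im w\<bar>)"
  proof -
    have "a / b * (2 / a) = 2 / b" if "a \<noteq> 0" for a b :: real using that by simp
    from this[of "1 - t"] show ?thesis using t(3) by (metis diff_gt_0_iff_gt less_irrefl)
  qed
  finally show ?thesis .
qed

lemma c_cnj:
  assumes "Im z \<noteq> 0" "Im w \<noteq> 0"
  shows "c (cnj z) (cnj w) = cnj (c z w)"
  unfolding c_def subord_cnj[OF rd1] subord_cnj[OF rd2]
  by (rule bicov_cnj[OF law subord_nonreal(1)[OF assms(1)] subord_nonreal(2)[OF assms(2)]])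

lemma H_cnj:
  assumes "Im z \<noteq> 0" "Im w \<noteq> 0"
  shows "H (cnj z) (cnj w) = cnj (H z w)"
  unfolding H_def c_cnj[OF assms] p1.cauchy_cnj p2.cauchy_cnj by simp

lemma c_holomorphic1: "Im w \<noteq> 0 \<Longrightarrow> (\<lambda>z. c z w) holomorphic_on {z. Im z \<noteq> 0}"
  and c_holomorphic2: "Im z \<noteq> 0 \<Longrightarrow> c z holomorphic_on {w. Im w \<noteq> 0}"
proof -
  assume "Im w \<noteq> 0"
  then show "(\<lambda>z. c z w) holomorphic_on {z. Im z \<noteq> 0}"
    using holomorphic_on_compose_gen[OF subord_holomorphic[OF rd1 k1] bicov_holomorphic(2)[OF law subord_nonreal(2)]]
      subord_nonreal(1)
    unfolding c_def comp_def by auto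
next
  assume "Im z \<noteq> 0"
  then show "c z holomorphic_on {w. Im w \<noteq> 0}"
    using holomorphic_on_compose_gen[OF subord_holomorphic[OF rd2 k1] bicov_holomorphic(1)[OF law subord_nonreal(1)]]
      subord_nonreal(2)
    unfolding c_def[abs_def] comp_def by auto
qed

lemma H_holomorphic1:
  assumes "Im w \<noteq> 0" shows "(\<lambda>z. H z w) holomorphic_on {z. Im z \<noteq> 0}"
  unfolding H_def
  by (intro holomorphic_intros p1.cauchy_holomorphic c_holomorphic1 assms) (use c_small(3)[OF _ assms] in auto)

lemma H_holomorphic2:
  assumes "Im z \<noteq> 0" shows "H z holomorphic_on {w. Im w \<noteq> 0}"
  unfolding H_def[abs_def]
  by (intro holomorphic_intros p2.cauchy_holomorphic c_holomorphic2 assms) (use c_small(3)[OF assms] in auto)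

text \<open>The positivity for the base law at the subordinated points, with \<kappa> = k -
  1.\<close>

lemma H_nonneg:
  assumes "Im z > 0" "Im w > 0"
  shows "0 \<le> Re (H (cnj z) w - H z w)"
proof -
  have z0: "Im z \<noteq> 0" "Im w \<noteq> 0" using assms by auto
  have "0 \<le> Re (cnj (cauchy_transform (marginal1 \<mu>) (subord k p1 z)) * cauchy_transform (marginal2 \<mu>) (subord k p2 w)
        * ((1 + bicov \<mu> (cnj (subord k p1 z)) (subord k p2 w)) / (1 - of_real (real k - 1) * bicov \<mu> (cnj (subord k p1 z)) (subord k p2 w)))
      - cauchy_transform (marginal1 \<mu>) (subord k p1 z) * cauchy_transform (marginal2 \<mu>) (subord k p2 w)
        * ((1 + bicov \<mu> (subord k p1 z) (subord k p2 w)) / (1 - of_real (real k - 1) * bicov \<mu> (subord k p1 z) (subord k p2 w))))"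
    by (rule bicov_power_nonneg[OF law subord_Im(4)[OF rd1 k1 z0(1) assms(1)] subord_Im(4)[OF rd2 k1 z0(2) assms(2)]])
      (use k variance1(3)[OF z0(1) z0(1)] variance2(3)[OF z0(2) z0(2)] in auto)
  then show ?thesis
    unfolding H_def c_def subordination1[OF z0(1)] subordination2[OF z0(2)] subord_cnj[OF rd1] p1.cauchy_cnj .
qed

end

section \<open>Laws with a prescribed Cauchy transform\<close>

definition poisson :: "complex \<Rightarrow> real \<Rightarrow> real" where
  "poisson z x = Im z / (pi * (cmod (of_real x - z))\<^sup>2)"

lemma poisson_measurable [measurable]: "poisson z \<in> borel_measurable borel"
  unfolding poisson_def by measurable

lemma poisson_nonneg: "Im z > 0 \<Longrightarrow> poisson z x \<ge> 0"
  by (simp add: poisson_def)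

lemma cmod_of_real_diff_square: "(cmod (of_real x - z))\<^sup>2 = (x - Re z)\<^sup>2 + (Im z)\<^sup>2"
  by (simp add: cmod_power2)

lemma poisson_has_integral:
  assumes z: "Im z > 0"
  shows "integrable lborel (poisson z)" "(LINT x|lborel. poisson z x) = 1"
proof -
  define b where "b = Im z"
  have b: "b > 0" using z by (simp add: b_def)
  define F where "F = (\<lambda>x. arctan ((x - Re z) / b) / pi)"
  have D: "(F has_real_derivative poisson z x) (at x)" for x
  proof -
    have sq: "(b\<^sup>2 + (x - Re z)\<^sup>2) \<noteq> 0" using b by (simp add: sum_power2_eq_zero_iff)
    have "((\<lambda>x. (x - Re z) / b) has_real_derivative 1 / b) (at x)"
      using b by (auto intro!: derivative_eq_intros)
    from DERIV_cdivide[OF DERIV_chain'[OF this DERIV_arctan], of pi]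
    have "(F has_real_derivative (1 / (1 + ((x - Re z) / b)\<^sup>2) * (1 / b)) / pi) (at x)"
      using b unfolding F_def by (simp add: inverse_eq_divide)
    also have "(1 / (1 + ((x - Re z) / b)\<^sup>2) * (1 / b)) / pi = poisson z x"
      using b sq unfolding poisson_def cmod_of_real_diff_square b_def[symmetric]
      by (simp add: field_simps power2_eq_square)
    finally show ?thesis .
  qed
  have cont: "isCont (poisson z) x" for x
    unfolding poisson_def cmod_of_real_diff_square using z by (intro continuous_intros) (auto simp: sum_power2_eq_zero_iff)
  have top: "((F \<circ> real_of_ereal) \<longlongrightarrow> 1/2) (at_left \<infinity>)"
  proof -
    have "((\<lambda>x. arctan ((x - Re z) / b) / pi) \<longlongrightarrow> (pi / 2) / pi) at_top"
    proof (intro tendsto_intros filterlim_compose[OF tendsto_arctan_at_top])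
      show "LIM x at_top. (x - Re z) / b :> at_top"
        using b by real_asymp
    qed simp
    then show ?thesis by (simp add: F_def ereal_tendsto_simps)
  qed
  have bot: "((F \<circ> real_of_ereal) \<longlongrightarrow> -1/2) (at_right (-\<infinity>))"
  proof -
    have "((\<lambda>x. arctan ((x - Re z) / b) / pi) \<longlongrightarrow> (- (pi / 2)) / pi) at_bot"
    proof (intro tendsto_intros filterlim_compose[OF tendsto_arctan_at_bot])
      show "LIM x at_bot. (x - Re z) / b :> at_bot"
        using b by real_asymp
    qed simp
    then show ?thesis by (simp add: F_def ereal_tendsto_simps)
  qed
  have "set_integrable lborel (einterval (-\<infinity>) \<infinity>) (poisson z)" "(LBINT x=-\<infinity>..\<infinity>. poisson z x) = 1/2 - (-1/2)"
    by (rule interval_integral_FTC_nonneg[where F = F]; use D cont top bot poisson_nonneg[OF z] in simp)+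
  then show "integrable lborel (poisson z)" "(LINT x|lborel. poisson z x) = 1"
    by (simp_all add: set_integrable_def interval_lebesgue_integral_def einterval_def set_lebesgue_integral_def)
qed

lemma poisson_bounded_integrable:
  fixes f :: "real \<Rightarrow> complex"
  assumes z: "Im z > 0" and [measurable]: "f \<in> borel_measurable borel" and B: "\<And>x. cmod (f x) \<le> B"
  shows "integrable lborel (\<lambda>x. of_real (poisson z x) * f x)"
proof (rule Bochner_Integration.integrable_bound)
  show "integrable lborel (\<lambda>x. poisson z x * B)" using poisson_has_integral[OF z] by simp
  show "AE x in lborel. cmod (of_real (poisson z x) * f x) \<le> norm (poisson z x * B)"
    using poisson_nonneg[OF z] B order_trans[OF norm_ge_zero B]
    by (intro AE_I2) (simp add: norm_mult mult_left_mono)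
qed measurable

text \<open>Subtracting f(z) removes the pole at z, and D excludes cnj z, so the quotient h
  integrates to 0 along a closed half-circle. On the real line h is a multiple of the Poisson kernel
  times f - f(z); on the arc it is of order 1 / R^2 against a length \<pi> R.\<close>

theorem poisson_formula:
  assumes f: "f holomorphic_on {\<xi>. Im \<xi> > - \<delta>}" and \<delta>: "\<delta> > 0"
    and B: "\<And>\<xi>. Im \<xi> \<ge> 0 \<Longrightarrow> cmod (f \<xi>) \<le> B" and z: "Im z > 0"
  shows "integrable lborel (\<lambda>x. of_real (poisson z x) * f (of_real x))"
    "(LINT x|lborel. of_real (poisson z x) * f (of_real x)) = f z"
proof -
  define D where "D = {\<xi>. Im \<xi> > - min \<delta> (Im z)}"
  have D: "open D" "convex D" unfolding D_def by (auto simp: open_halfspace_Im_gt convex_halfspace_Im_gt)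
  have fD: "f holomorphic_on D" by (rule holomorphic_on_subset[OF f]) (auto simp: D_def)
  have fcont: "continuous_on UNIV (\<lambda>x. f (of_real x))"
    using \<delta> by (intro continuous_on_compose2[OF holomorphic_on_imp_continuous_on[OF f]] continuous_intros) auto
  have fmeas [measurable]: "(\<lambda>x. f (of_real x)) \<in> borel_measurable borel"
    by (rule borel_measurable_continuous_onI[OF fcont])
  have fB: "cmod (f (of_real x)) \<le> B" for x by (rule B) simp
  show int: "integrable lborel (\<lambda>x. of_real (poisson z x) * f (of_real x))"
    by (rule poisson_bounded_integrable[OF z fmeas fB])
  define q where "q = (\<lambda>\<xi>. (if \<xi> = z then deriv f z else (f \<xi> - f z) / (\<xi> - z)))"
  have q: "q holomorphic_on D" unfolding q_def by (rule pole_lemma_open[OF fD D(1)])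
  define h where "h = (\<lambda>\<xi>. q \<xi> / (\<xi> - cnj z))"
  have h: "h holomorphic_on D"
    unfolding h_def using z by (intro holomorphic_intros q) (auto simp: D_def)
  have hx: "h (of_real x) = of_real (pi / Im z) * (of_real (poisson z x) * (f (of_real x) - f z))" for x
  proof -
    have nz: "of_real x \<noteq> z" "of_real x - z \<noteq> 0" "of_real x - cnj z \<noteq> 0" using z by (auto simp: complex_eq_iff)
    have "of_real ((cmod (of_real x - z))\<^sup>2) = (of_real x - z) * (of_real x - cnj z)"
      unfolding complex_norm_square by simp
    then have "of_real (poisson z x) = of_real (Im z) / (of_real pi * ((of_real x - z) * (of_real x - cnj z)))"
      unfolding poisson_def of_real_divide of_real_mult by simp
    note pois = this
    have hq: "h (of_real x) = (f (of_real x) - f z) / (of_real x - z) / (of_real x - cnj z)"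
      using nz(1) by (simp add: h_def q_def)
    have gen: "fd / c = p / m * (m / (p * c) * fd)" if "m \<noteq> 0" "p \<noteq> 0" for c m p fd :: complex
      using that by (cases "c = 0") (auto simp: field_simps)
    show ?thesis unfolding hq pois of_real_divide divide_divide_eq_left by (rule gen) (use z in auto)
  qed
  have B0: "B \<ge> 0" by (rule order_trans[OF norm_ge_zero fB])
  have bound: "cmod (integral {- R..R} (\<lambda>x. h (of_real x))) \<le> 2 * B / (R - cmod z)\<^sup>2 * R * pi" if R: "R > cmod z" for R :: real
  proof -
    have R0: "R > 0" using R norm_ge_zero[of z] by linarith
    define g where "g = linepath (- of_real R) (of_real R) +++ part_circlepath 0 R 0 pi"
    have pim: "path_image (part_circlepath 0 R 0 pi) = {R * exp (\<i> * of_real t) |t. 0 \<le> t \<and> t \<le> pi}"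
      using path_image_part_circlepath[OF pi_ge_zero, of 0 R] by simp
    have arc: "Im \<xi> \<ge> 0" "cmod \<xi> = R" if "\<xi> \<in> path_image (part_circlepath 0 R 0 pi)" for \<xi>
      using that R0 unfolding pim by (auto simp: Im_exp norm_mult sin_ge_zero)
    have ends: "pathstart (part_circlepath 0 R 0 pi) = of_real R" "pathfinish (part_circlepath 0 R 0 pi) = - of_real R"
      by simp_all
    have "(h has_contour_integral 0) g"
    proof (rule Cauchy_theorem_convex_simple[OF h D(2)])
      show "valid_path g" unfolding g_def by (intro valid_path_join) simp_all
      have "path_image (linepath (- of_real R) (of_real R)) \<subseteq> D"
      proof -
        have "closed_segment (- complex_of_real R) (of_real R) \<subseteq> D"
          by (rule closed_segment_subset[OF _ _ D(2)]) (use \<delta> z in \<open>auto simp: D_def\<close>)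
        then show ?thesis by simp
      qed
      moreover have "path_image (part_circlepath 0 R 0 pi) \<subseteq> D"
        using arc(1) \<delta> z by (force simp: D_def)
      ultimately show "path_image g \<subseteq> D"
        unfolding g_def by (intro subset_path_image_join)
      show "pathfinish g = pathstart g" by (simp add: g_def)
    qed
    moreover have i1: "h contour_integrable_on linepath (- of_real R) (of_real R)"
    proof (rule contour_integrable_continuous_linepath)
      have "closed_segment (- complex_of_real R) (of_real R) \<subseteq> D"
        by (rule closed_segment_subset[OF _ _ D(2)]) (use \<delta> z in \<open>auto simp: D_def\<close>)
      then show "continuous_on (closed_segment (- complex_of_real R) (of_real R)) h"
        by (rule continuous_on_subset[OF holomorphic_on_imp_continuous_on[OF h]])
    qed
    moreover have i2: "h contour_integrable_on part_circlepath 0 R 0 pi"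
    proof (rule contour_integrable_continuous_part_circlepath)
      have "path_image (part_circlepath 0 R 0 pi) \<subseteq> D" using arc(1) \<delta> z by (force simp: D_def)
      then show "continuous_on (path_image (part_circlepath 0 R 0 pi)) h"
        by (rule continuous_on_subset[OF holomorphic_on_imp_continuous_on[OF h]])
    qed
    ultimately have "contour_integral (linepath (- of_real R) (of_real R)) h + contour_integral (part_circlepath 0 R 0 pi) h = 0"
      unfolding g_def by (metis contour_integral_join contour_integral_unique ends(1) pathfinish_linepath valid_path_linepath valid_path_part_circlepath)
    moreover have "contour_integral (linepath (- of_real R) (of_real R)) h = integral {- R..R} (\<lambda>x. h (of_real x))"
      using R0 by (subst contour_integral_linepath_Reals_eq) auto
    ultimately have "cmod (integral {- R..R} (\<lambda>x. h (of_real x))) = cmod (contour_integral (part_circlepath 0 R 0 pi) h)"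
      by (metis add_eq_0_iff norm_minus_cancel)
    also have "\<dots> \<le> 2 * B / (R - cmod z)\<^sup>2 * R * \<bar>pi - 0\<bar>"
    proof (rule contour_integral_bound_part_circlepath[OF i2])
      fix \<xi> assume \<xi>: "\<xi> \<in> path_image (part_circlepath 0 R 0 pi)"
      have ne: "\<xi> \<noteq> z" using arc(2)[OF \<xi>] R by auto
      have d: "R - cmod z \<le> cmod (\<xi> - z)" "R - cmod z \<le> cmod (\<xi> - cnj z)"
        using norm_triangle_ineq2[of \<xi> z] norm_triangle_ineq2[of \<xi> "cnj z"] arc(2)[OF \<xi>] by auto
      have "cmod (h \<xi>) = cmod (f \<xi> - f z) / (cmod (\<xi> - z) * cmod (\<xi> - cnj z))"
        using ne by (simp add: h_def q_def norm_divide norm_mult)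
      also have "\<dots> \<le> 2 * B / ((R - cmod z) * (R - cmod z))"
        using norm_triangle_ineq4[of "f \<xi>" "f z"] B[OF arc(1)[OF \<xi>]] B[of z] z d R B0
        by (intro frac_le mult_mono) auto
      finally show "cmod (h \<xi>) \<le> 2 * B / (R - cmod z)\<^sup>2" by (simp add: power2_eq_square)
    qed (use B0 R0 in auto)
    finally show ?thesis using pi_ge_zero by simp
  qed
  have hint: "integrable lborel (\<lambda>x. h (of_real x))"
    unfolding hx using int poisson_has_integral[OF z]
    by (intro integrable_mult_right) (simp add: right_diff_distrib)
  have lim1: "(\<lambda>n. integral {- real n..real n} (\<lambda>x. h (of_real x))) \<longlonglongrightarrow> (LINT x|lborel. h (of_real x))"
  proof -
    have eq: "integral {- real n..real n} (\<lambda>x. h (of_real x)) = (LINT x|lborel. indicator {- real n..real n} x *\<^sub>R h (of_real x))" for n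
    proof -
      have "set_integrable lborel {- real n..real n} (\<lambda>x. h (of_real x))"
        unfolding set_integrable_def by (rule integrable_mult_indicator[OF _ hint]) simp
      from set_borel_integral_eq_integral(2)[OF this] show ?thesis
        by (simp add: set_lebesgue_integral_def)
    qed
    show ?thesis
      unfolding eq
    proof (rule integral_dominated_convergence[where w = "\<lambda>x. cmod (h (of_real x))"])
      show "AE x in lborel. (\<lambda>n. indicator {- real n..real n} x *\<^sub>R h (of_real x)) \<longlonglongrightarrow> h (of_real x)"
      proof (rule AE_I2)
        fix x :: real
        obtain N where N: "\<bar>x\<bar> \<le> real N" using real_arch_simple by blast
        have "eventually (\<lambda>n. indicator {- real n..real n} x *\<^sub>R h (of_real x) = h (of_real x)) sequentially"
          using eventually_ge_at_top[of N]
        proof eventually_elim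
          case (elim n)
          then have "\<bar>x\<bar> \<le> real n" using N by linarith
          then show ?case by (simp add: indicator_def abs_le_iff)
        qed
        then show "(\<lambda>n. indicator {- real n..real n} x *\<^sub>R h (of_real x)) \<longlonglongrightarrow> h (of_real x)"
          by (rule tendsto_eventually)
      qed
    qed (use hint in \<open>auto simp: indicator_def\<close>)
  qed
  have lim2: "(\<lambda>n. integral {- real n..real n} (\<lambda>x. h (of_real x))) \<longlonglongrightarrow> 0"
  proof (rule Lim_null_comparison)
    obtain N where N: "cmod z < real N" using reals_Archimedean2 by blast
    show "eventually (\<lambda>n. cmod (integral {- real n..real n} (\<lambda>x. h (of_real x))) \<le> 2 * B / (real n - cmod z)\<^sup>2 * real n * pi) sequentially"
      using eventually_ge_at_top[of N] by eventually_elim (rule bound, use N in linarith)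
    show "(\<lambda>n. 2 * B / (real n - cmod z)\<^sup>2 * real n * pi) \<longlonglongrightarrow> 0" by real_asymp
  qed
  have "0 = (LINT x|lborel. h (of_real x))" by (rule LIMSEQ_unique[OF lim2 lim1])
  also have "\<dots> = of_real (pi / Im z) * (LINT x|lborel. of_real (poisson z x) * f (of_real x) - of_real (poisson z x) * f z)"
    unfolding hx integral_mult_right_zero by (simp add: right_diff_distrib)
  also have "(LINT x|lborel. of_real (poisson z x) * f (of_real x) - of_real (poisson z x) * f z)
      = (LINT x|lborel. of_real (poisson z x) * f (of_real x)) - (LINT x|lborel. of_real (poisson z x) * f z)"
    using int poisson_has_integral[OF z] by (intro Bochner_Integration.integral_diff) auto
  also have "(LINT x|lborel. of_real (poisson z x) * f z) = f z"
    using poisson_has_integral[OF z] by simp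
  finally show "(LINT x|lborel. of_real (poisson z x) * f (of_real x)) = f z" using z by simp
qed

lemma poisson_formula_nonneg:
  assumes f: "f holomorphic_on {\<xi>. Im \<xi> > - \<delta>}" and \<delta>: "\<delta> > 0"
    and B: "\<And>\<xi>. Im \<xi> \<ge> 0 \<Longrightarrow> cmod (f \<xi>) \<le> B" and z: "Im z > 0"
    and nonneg: "\<And>x. Re (f (of_real x)) \<ge> 0"
  shows "(\<integral>\<^sup>+x. ennreal (poisson z x * Re (f (of_real x))) \<partial>lborel) = ennreal (Re (f z))"
proof -
  have R: "poisson z x * Re (f (of_real x)) = Re (of_real (poisson z x) * f (of_real x))" for x by simp
  have "(\<integral>\<^sup>+x. ennreal (poisson z x * Re (f (of_real x))) \<partial>lborel)
      = ennreal (LINT x|lborel. poisson z x * Re (f (of_real x)))"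
  proof (rule nn_integral_eq_integral)
    show "integrable lborel (\<lambda>x. poisson z x * Re (f (of_real x)))"
      unfolding R by (intro integrable_Re poisson_formula(1)[OF f \<delta> B z])
  qed (use nonneg poisson_nonneg[OF z] in auto)
  also have "(LINT x|lborel. poisson z x * Re (f (of_real x))) = Re (f z)"
    using integral_Re[OF poisson_formula(1)[OF f \<delta> B z]] poisson_formula(2)[OF f \<delta> B z] unfolding R by simp
  finally show ?thesis .
qed

text \<open>A vanishing real part makes the function constant by the open mapping theorem, and the
  decay along the imaginary axis makes the constant 0.\<close>

lemma zero_real_part_decay_imp_zero:
  assumes f: "f holomorphic_on {z. Im z > 0}" and Re: "\<And>z. Im z > 0 \<Longrightarrow> Re (f z) = 0"
    and decay: "\<And>z. Im z > 0 \<Longrightarrow> cmod (f z) \<le> K / Im z" and z: "Im z > 0"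
  shows "f z = 0"
proof -
  have "f constant_on {z. Im z > 0}"
  proof (rule ccontr)
    assume nc: "\<not> f constant_on {z. Im z > 0}"
    have "open (f ` {z. Im z > 0})"
      by (rule open_mapping_thm[OF f _ _ _ order_refl nc])
        (auto simp: open_halfspace_Im_gt convex_connected convex_halfspace_Im_gt)
    moreover have "f z \<in> f ` {z. Im z > 0}" using z by simp
    ultimately obtain e where e: "e > 0" "ball (f z) e \<subseteq> f ` {z. Im z > 0}" by (meson open_contains_ball)
    have "f z + of_real (e / 2) \<in> ball (f z) e" using e by (simp add: dist_norm)
    then obtain w where "Im w > 0" "f w = f z + of_real (e / 2)" using e(2) by auto
    then show False using Re[of w] Re[OF z] e by simp
  qed
  then obtain a where a: "\<And>z. Im z > 0 \<Longrightarrow> f z = a" by (auto simp: constant_on_def)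
  have "eventually (\<lambda>n. cmod a \<le> K / real n) sequentially"
    using eventually_gt_at_top[of 0]
  proof eventually_elim
    case (elim n)
    then show ?case using decay[of "Complex 0 (real n)"] a[of "Complex 0 (real n)"] by simp
  qed
  moreover have "(\<lambda>n. K / real n) \<longlonglongrightarrow> 0" by real_asymp
  ultimately have "cmod a \<le> 0" by (intro tendsto_lowerbound) auto
  then show ?thesis using a[OF z] by simp
qed

definition shift :: "real \<Rightarrow> complex \<Rightarrow> complex" where
  "shift \<epsilon> z = Complex (Re z) (Im z + \<epsilon> * sgn (Im z))"

lemma shift_cnj: "shift \<epsilon> (cnj z) = cnj (shift \<epsilon> z)"
  by (simp add: shift_def complex_eq_iff)

lemma shift_upper: "Im z > 0 \<Longrightarrow> shift \<epsilon> z = z + \<i> * of_real \<epsilon>"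
  by (simp add: shift_def complex_eq_iff)

lemma shift_nonreal:
  assumes "\<epsilon> \<ge> 0" "Im z \<noteq> 0"
  shows "\<bar>Im (shift \<epsilon> z)\<bar> = \<bar>Im z\<bar> + \<epsilon>" "Im (shift \<epsilon> z) \<noteq> 0"
  using assms by (auto simp: shift_def sgn_if)

lemma shift_holomorphic: "shift \<epsilon> holomorphic_on {z. Im z > 0}"
  by (rule holomorphic_transform[of "\<lambda>z. z + \<i> * of_real \<epsilon>"]) (auto simp: shift_upper intro: holomorphic_intros)

section \<open>From positive boundary densities to a law\<close>

text \<open>The properties that force H to be the transform of a law. Bound and positivity give
  nonnegative densities on lines parallel to the real axis; the limits along the imaginary axis fix
  the marginals and thereby total mass 1.\<close>

locale plane_transform =
  fixes H :: "complex \<Rightarrow> complex \<Rightarrow> complex" and C :: real and p1 p2 :: "real measure"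
  assumes rd1: "real_distribution p1" and rd2: "real_distribution p2"
    and H_hol1: "Im w \<noteq> 0 \<Longrightarrow> (\<lambda>z. H z w) holomorphic_on {z. Im z \<noteq> 0}"
    and H_hol2: "Im z \<noteq> 0 \<Longrightarrow> H z holomorphic_on {w. Im w \<noteq> 0}"
    and H_bound: "Im z \<noteq> 0 \<Longrightarrow> Im w \<noteq> 0 \<Longrightarrow> cmod (H z w) \<le> C / (\<bar>Im z\<bar> * \<bar>Im w\<bar>)"
    and H_conj: "Im z \<noteq> 0 \<Longrightarrow> Im w \<noteq> 0 \<Longrightarrow> H (cnj z) (cnj w) = cnj (H z w)"
    and H_pos: "Im z > 0 \<Longrightarrow> Im w > 0 \<Longrightarrow> 0 \<le> Re (H (cnj z) w - H z w)"
    and H_lim1: "Im z \<noteq> 0 \<Longrightarrow> ((\<lambda>y. \<i> * of_real y * H z (\<i> * of_real y)) \<longlongrightarrow> cauchy_transform p1 z) at_top"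
    and H_lim2: "Im w \<noteq> 0 \<Longrightarrow> ((\<lambda>y. \<i> * of_real y * H (\<i> * of_real y) w) \<longlongrightarrow> cauchy_transform p2 w) at_top"
begin

sublocale p1: real_distribution p1 by (rule rd1)
sublocale p2: real_distribution p2 by (rule rd2)

lemma C_nonneg: "C \<ge> 0"
  using order_trans[OF norm_ge_zero H_bound[of \<i> \<i>]] by simp

sublocale sep: separately_holomorphic H "{z. Im z \<noteq> 0}" "{z. Im z \<noteq> 0}"
proof unfold_locales
  fix z w assume z: "z \<in> {z. Im z \<noteq> 0}" and w: "w \<in> {z. Im z \<noteq> 0}"
  define r where "r = min \<bar>Im z\<bar> \<bar>Im w\<bar> / 2"
  have r: "r > 0" using z w by (simp add: r_def)
  have "cmod (H z' w') \<le> C / (r * r)" if "z' \<in> {z. Im z \<noteq> 0}" "w' \<in> {z. Im z \<noteq> 0}" "dist z z' < r" "dist w w' < r" for z' w'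
  proof -
    have "r \<le> \<bar>Im z'\<bar>" using that(3) abs_Im_le_cmod[of "z - z'"] unfolding r_def dist_norm by auto
    moreover have "r \<le> \<bar>Im w'\<bar>" using that(4) abs_Im_le_cmod[of "w - w'"] unfolding r_def dist_norm by auto
    ultimately have "C / (\<bar>Im z'\<bar> * \<bar>Im w'\<bar>) \<le> C / (r * r)"
      using r C_nonneg by (intro divide_left_mono mult_mono mult_pos_pos) auto
    then show ?thesis using H_bound[of z' w'] that by auto
  qed
  then show "\<exists>r>0. \<exists>M. \<forall>z'\<in>{z. Im z \<noteq> 0}. \<forall>w'\<in>{z. Im z \<noteq> 0}. dist z z' < r \<longrightarrow> dist w w' < r \<longrightarrow> cmod (H z' w') \<le> M"
    using r by blast
qed (use H_hol1 H_hol2 open_Im_nonzero in auto)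

text \<open>If H is the transform of a law, then U(z, w) is \<pi>^2 times the integral of the
  product of the Poisson kernels at z and w. This form exhibits U as the real part of a holomorphic
  function of z, and \<open>U_alt\<close> as that of one of w; each is used for the Poisson formula
  in its variable.\<close>

definition U :: "complex \<Rightarrow> complex \<Rightarrow> real" where
  "U z w = Re (H z (cnj w) - H z w) / 2"

lemma U_alt: "Im z \<noteq> 0 \<Longrightarrow> Im w \<noteq> 0 \<Longrightarrow> U z w = Re (H (cnj z) w - H z w) / 2"
  using H_conj[of "cnj z" w] by (simp add: U_def)

lemma U_nonneg: "Im z > 0 \<Longrightarrow> Im w > 0 \<Longrightarrow> U z w \<ge> 0"
  using H_pos[of z w] by (simp add: U_alt)

lemma U_poisson2:
  assumes z: "Im z > 0" and \<epsilon>: "\<epsilon> > 0" and w: "Im w > 0"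
  shows "(\<integral>\<^sup>+y. ennreal (poisson w y * U z (of_real y + \<i> * of_real \<epsilon>)) \<partial>lborel) = ennreal (U z (w + \<i> * of_real \<epsilon>))"
proof -
  define f where "f = (\<lambda>\<xi>. (H (cnj z) (\<xi> + \<i> * of_real \<epsilon>) - H z (\<xi> + \<i> * of_real \<epsilon>)) / 2)"
  have U: "U z (\<xi> + \<i> * of_real \<epsilon>) = Re (f \<xi>)" if "Im \<xi> > - \<epsilon>" for \<xi>
    using that z by (simp add: U_alt f_def)
  have hol: "(\<lambda>\<xi>. H u (\<xi> + \<i> * of_real \<epsilon>)) holomorphic_on {\<xi>. Im \<xi> > - \<epsilon>}" if "Im u \<noteq> 0" for u
  proof -
    have "(\<lambda>\<xi>. \<xi> + \<i> * of_real \<epsilon>) holomorphic_on {\<xi>. Im \<xi> > - \<epsilon>}" by (intro holomorphic_intros)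
    from holomorphic_on_compose_gen[OF this H_hol2[OF that]] show ?thesis
      by (simp add: comp_def image_subset_iff)
  qed
  have b: "cmod (H u (\<xi> + \<i> * of_real \<epsilon>)) \<le> C / (\<bar>Im u\<bar> * \<epsilon>)" if "Im u \<noteq> 0" "Im \<xi> \<ge> 0" for u \<xi>
  proof -
    have "cmod (H u (\<xi> + \<i> * of_real \<epsilon>)) \<le> C / (\<bar>Im u\<bar> * \<bar>Im (\<xi> + \<i> * of_real \<epsilon>)\<bar>)"
      using that \<epsilon> by (intro H_bound) auto
    also have "\<dots> \<le> C / (\<bar>Im u\<bar> * \<epsilon>)"
      using that \<epsilon> C_nonneg by (intro divide_left_mono mult_left_mono) auto
    finally show ?thesis .
  qed
  have "(\<integral>\<^sup>+y. ennreal (poisson w y * Re (f (of_real y))) \<partial>lborel) = ennreal (Re (f w))"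
  proof (rule poisson_formula_nonneg[OF _ \<epsilon> _ w])
    show "f holomorphic_on {\<xi>. Im \<xi> > - \<epsilon>}"
      unfolding f_def using z by (intro holomorphic_intros hol) auto
    show "cmod (f \<xi>) \<le> C / (\<bar>Im z\<bar> * \<epsilon>)" if "Im \<xi> \<ge> 0" for \<xi>
    proof -
      have "cmod (f \<xi>) \<le> (cmod (H (cnj z) (\<xi> + \<i> * of_real \<epsilon>)) + cmod (H z (\<xi> + \<i> * of_real \<epsilon>))) / 2"
        unfolding f_def norm_divide using norm_triangle_ineq4 by (simp add: divide_right_mono)
      moreover have "cmod (H (cnj z) (\<xi> + \<i> * of_real \<epsilon>)) \<le> C / (\<bar>Im z\<bar> * \<epsilon>)" "cmod (H z (\<xi> + \<i> * of_real \<epsilon>)) \<le> C / (\<bar>Im z\<bar> * \<epsilon>)"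
        using b[of "cnj z" \<xi>] b[of z \<xi>] z that by simp_all
      moreover have "a \<le> K" if "a \<le> (b + c) / 2" "b \<le> K" "c \<le> K" for a b c K :: real
        using that by (simp add: field_simps)
      ultimately show ?thesis by blast
    qed
    show "Re (f (of_real x)) \<ge> 0" for x
      using U_nonneg[OF z, of "of_real x + \<i> * of_real \<epsilon>"] U[of "of_real x"] \<epsilon> by simp
  qed
  then show ?thesis using U[of w] U[of "of_real _"] \<epsilon> w by simp
qed

lemma U_poisson1:
  assumes z: "Im z > 0" and \<epsilon>: "\<epsilon> > 0" and w: "Im w > 0"
  shows "(\<integral>\<^sup>+x. ennreal (poisson z x * U (of_real x + \<i> * of_real \<epsilon>) w) \<partial>lborel) = ennreal (U (z + \<i> * of_real \<epsilon>) w)"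
proof -
  define f where "f = (\<lambda>\<xi>. (H (\<xi> + \<i> * of_real \<epsilon>) (cnj w) - H (\<xi> + \<i> * of_real \<epsilon>) w) / 2)"
  have U: "U (\<xi> + \<i> * of_real \<epsilon>) w = Re (f \<xi>)" for \<xi>
    by (simp add: U_def f_def)
  have hol: "(\<lambda>\<xi>. H (\<xi> + \<i> * of_real \<epsilon>) u) holomorphic_on {\<xi>. Im \<xi> > - \<epsilon>}" if "Im u \<noteq> 0" for u
  proof -
    have "(\<lambda>\<xi>. \<xi> + \<i> * of_real \<epsilon>) holomorphic_on {\<xi>. Im \<xi> > - \<epsilon>}" by (intro holomorphic_intros)
    from holomorphic_on_compose_gen[OF this H_hol1[OF that]] show ?thesis
      by (simp add: comp_def image_subset_iff)
  qed
  have b: "cmod (H (\<xi> + \<i> * of_real \<epsilon>) u) \<le> C / (\<epsilon> * \<bar>Im u\<bar>)" if "Im u \<noteq> 0" "Im \<xi> \<ge> 0" for u \<xi>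
  proof -
    have "cmod (H (\<xi> + \<i> * of_real \<epsilon>) u) \<le> C / (\<bar>Im (\<xi> + \<i> * of_real \<epsilon>)\<bar> * \<bar>Im u\<bar>)"
      using that \<epsilon> by (intro H_bound) auto
    also have "\<dots> \<le> C / (\<epsilon> * \<bar>Im u\<bar>)"
      using that \<epsilon> C_nonneg by (intro divide_left_mono mult_right_mono) auto
    finally show ?thesis .
  qed
  have "(\<integral>\<^sup>+x. ennreal (poisson z x * Re (f (of_real x))) \<partial>lborel) = ennreal (Re (f z))"
  proof (rule poisson_formula_nonneg[OF _ \<epsilon> _ z])
    show "f holomorphic_on {\<xi>. Im \<xi> > - \<epsilon>}"
      unfolding f_def using w by (intro holomorphic_intros hol) auto
    show "cmod (f \<xi>) \<le> C / (\<epsilon> * \<bar>Im w\<bar>)" if "Im \<xi> \<ge> 0" for \<xi>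
    proof -
      have "cmod (f \<xi>) \<le> (cmod (H (\<xi> + \<i> * of_real \<epsilon>) (cnj w)) + cmod (H (\<xi> + \<i> * of_real \<epsilon>) w)) / 2"
        unfolding f_def norm_divide using norm_triangle_ineq4 by (simp add: divide_right_mono)
      moreover have "cmod (H (\<xi> + \<i> * of_real \<epsilon>) (cnj w)) \<le> C / (\<epsilon> * \<bar>Im w\<bar>)" "cmod (H (\<xi> + \<i> * of_real \<epsilon>) w) \<le> C / (\<epsilon> * \<bar>Im w\<bar>)"
        using b[of "cnj w" \<xi>] b[of w \<xi>] w that by simp_all
      moreover have "a \<le> K" if "a \<le> (b + c) / 2" "b \<le> K" "c \<le> K" for a b c K :: real
        using that by (simp add: field_simps)
      ultimately show ?thesis by blast
    qed
    show "Re (f (of_real x)) \<ge> 0" for x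
      using U_nonneg[OF _ w, of "of_real x + \<i> * of_real \<epsilon>"] U[of "of_real x"] \<epsilon> by simp
  qed
  then show ?thesis by (simp add: U)
qed

definition dens :: "real \<Rightarrow> real \<times> real \<Rightarrow> real" where
  "dens \<epsilon> p = U (of_real (fst p) + \<i> * of_real \<epsilon>) (of_real (snd p) + \<i> * of_real \<epsilon>) / pi\<^sup>2"

lemma dens_measurable [measurable]:
  assumes "\<epsilon> > 0" shows "dens \<epsilon> \<in> borel_measurable borel"
proof (rule borel_measurable_continuous_onI)
  have H: "continuous_on UNIV (\<lambda>p. H (of_real (fst p) + \<i> * of_real \<epsilon>) (of_real (snd p) + \<i> * of_real a))" if "a \<noteq> 0"
    for a :: real
    using assms that
    by (intro continuous_on_compose2[OF sep.jointly_continuous, of UNIV "\<lambda>p. (of_real (fst p) + \<i> * of_real \<epsilon>, of_real (snd p) + \<i> * of_real a)", simplified])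
      (auto intro!: continuous_intros)
  have eq: "dens \<epsilon> = (\<lambda>p. Re (H (of_real (fst p) + \<i> * of_real \<epsilon>) (of_real (snd p) + \<i> * of_real (- \<epsilon>))
      - H (of_real (fst p) + \<i> * of_real \<epsilon>) (of_real (snd p) + \<i> * of_real \<epsilon>)) / 2 / pi\<^sup>2)"
    by (simp add: fun_eq_iff dens_def U_def)
  show "continuous_on UNIV (dens \<epsilon>)"
    unfolding eq using assms by (intro continuous_intros H) auto
qed

definition law :: "real \<Rightarrow> (real \<times> real) measure" where
  "law \<epsilon> = density lborel (\<lambda>p. ennreal (dens \<epsilon> p))"

text \<open>The Poisson formula in one variable after the other, by Tonelli since U is
  nonnegative.\<close>

lemma law_poisson:
  assumes \<epsilon>: "\<epsilon> > 0" and z: "Im z > 0" and w: "Im w > 0"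
  shows "(\<integral>\<^sup>+p. ennreal (poisson z (fst p) * poisson w (snd p)) \<partial>law \<epsilon>)
    = ennreal (U (z + \<i> * of_real \<epsilon>) (w + \<i> * of_real \<epsilon>) / pi\<^sup>2)"
proof -
  note [measurable] = dens_measurable[OF \<epsilon>]
  define V where "V = (\<lambda>x y. U (of_real x + \<i> * of_real \<epsilon>) (of_real y + \<i> * of_real \<epsilon>))"
  have V0: "V x y \<ge> 0" for x y unfolding V_def by (rule U_nonneg) (use \<epsilon> in auto)
  have dV: "dens \<epsilon> (x, y) = V x y / pi\<^sup>2" for x y by (simp add: dens_def V_def)
  have dm: "(\<lambda>p. dens \<epsilon> p) \<in> borel_measurable (lborel \<Otimes>\<^sub>M lborel)"
    unfolding lborel_prod by measurable
  have Vm: "(\<lambda>y. V x y) \<in> borel_measurable borel" for x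
  proof -
    have "(\<lambda>y. dens \<epsilon> (x, y) * pi\<^sup>2) \<in> borel_measurable borel"
      by (intro borel_measurable_times borel_measurable_const measurable_compose[OF _ dens_measurable[OF \<epsilon>]]
        borel_measurable_continuous_onI continuous_intros)
    then show ?thesis by (simp add: dV)
  qed
  have pm: "(\<lambda>p. poisson z (fst p) * poisson w (snd p)) \<in> borel_measurable (lborel \<Otimes>\<^sub>M lborel)"
    by measurable
  have pm': "(\<lambda>p. poisson z (fst p) * poisson w (snd p)) \<in> borel_measurable borel"
    using pm unfolding lborel_prod by simp
  have "(\<integral>\<^sup>+p. ennreal (poisson z (fst p) * poisson w (snd p)) \<partial>law \<epsilon>)
      = (\<integral>\<^sup>+p. ennreal (dens \<epsilon> p) * ennreal (poisson z (fst p) * poisson w (snd p)) \<partial>lborel)"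
    unfolding law_def using pm' by (subst nn_integral_density) auto
  also have "\<dots> = (\<integral>\<^sup>+p. ennreal (dens \<epsilon> p) * ennreal (poisson z (fst p) * poisson w (snd p)) \<partial>(lborel \<Otimes>\<^sub>M lborel))"
    by (simp only: lborel_prod)
  also have "\<dots> = (\<integral>\<^sup>+x. \<integral>\<^sup>+y. ennreal (dens \<epsilon> (x, y)) * ennreal (poisson z x * poisson w y) \<partial>lborel \<partial>lborel)"
    using dm pm by (subst lborel.nn_integral_fst[symmetric]) simp_all
  also have "\<dots> = (\<integral>\<^sup>+x. \<integral>\<^sup>+y. ennreal (poisson z x / pi\<^sup>2) * ennreal (poisson w y * V x y) \<partial>lborel \<partial>lborel)"
    by (intro nn_integral_cong)
      (simp add: dV ennreal_mult[symmetric] V0 poisson_nonneg z w mult_ac)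
  also have "\<dots> = (\<integral>\<^sup>+x. ennreal (poisson z x / pi\<^sup>2) * ennreal (U (of_real x + \<i> * of_real \<epsilon>) (w + \<i> * of_real \<epsilon>)) \<partial>lborel)"
    using U_poisson2[OF _ \<epsilon> w] \<epsilon> Vm by (intro nn_integral_cong, subst nn_integral_cmult) (auto simp: V_def)
  also have "\<dots> = (\<integral>\<^sup>+x. ennreal (1 / pi\<^sup>2) * ennreal (poisson z x * U (of_real x + \<i> * of_real \<epsilon>) (w + \<i> * of_real \<epsilon>)) \<partial>lborel)"
  proof (rule nn_integral_cong)
    fix x
    have "U (of_real x + \<i> * of_real \<epsilon>) (w + \<i> * of_real \<epsilon>) \<ge> 0" by (rule U_nonneg) (use \<epsilon> w in auto)
    then show "ennreal (poisson z x / pi\<^sup>2) * ennreal (U (of_real x + \<i> * of_real \<epsilon>) (w + \<i> * of_real \<epsilon>))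
      = ennreal (1 / pi\<^sup>2) * ennreal (poisson z x * U (of_real x + \<i> * of_real \<epsilon>) (w + \<i> * of_real \<epsilon>))"
      by (simp add: ennreal_mult[symmetric] poisson_nonneg z)
  qed
  also have "\<dots> = ennreal (1 / pi\<^sup>2) * ennreal (U (z + \<i> * of_real \<epsilon>) (w + \<i> * of_real \<epsilon>))"
  proof (subst nn_integral_cmult)
    have "(\<lambda>x. U (of_real x + \<i> * of_real \<epsilon>) (w + \<i> * of_real \<epsilon>)) \<in> borel_measurable borel"
    proof (rule borel_measurable_continuous_onI)
      have "continuous_on UNIV (\<lambda>x. H (of_real x + \<i> * of_real \<epsilon>) v)" if "Im v \<noteq> 0" for v
        by (rule continuous_on_compose2[OF holomorphic_on_imp_continuous_on[OF H_hol1[OF that]]])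
          (use \<epsilon> in \<open>auto intro!: continuous_intros\<close>)
      then show "continuous_on UNIV (\<lambda>x. U (of_real x + \<i> * of_real \<epsilon>) (w + \<i> * of_real \<epsilon>))"
        unfolding U_def using \<epsilon> w by (intro continuous_intros) auto
    qed
    then show "(\<lambda>x. ennreal (poisson z x * U (of_real x + \<i> * of_real \<epsilon>) (w + \<i> * of_real \<epsilon>))) \<in> borel_measurable lborel"
      by simp
  qed (use U_poisson1[OF z \<epsilon>, of "w + \<i> * of_real \<epsilon>"] w \<epsilon> in simp)
  also have "\<dots> = ennreal (U (z + \<i> * of_real \<epsilon>) (w + \<i> * of_real \<epsilon>) / pi\<^sup>2)"
    using U_nonneg[of "z + \<i> * of_real \<epsilon>" "w + \<i> * of_real \<epsilon>"] z w \<epsilon> by (simp add: ennreal_mult[symmetric])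
  finally show ?thesis .
qed

text \<open>After multiplication by y, each term of U has a limit given by the transform of p1 at z
  or at cnj z; their combination extracts the imaginary part.\<close>

lemma U_limit:
  assumes z: "Im z > 0"
  shows "((\<lambda>y. y * U z (\<i> * of_real y)) \<longlongrightarrow> - Im (cauchy_transform p1 z)) at_top"
proof -
  have z0: "Im z \<noteq> 0" "Im (cnj z) \<noteq> 0" using z by auto
  have l1: "((\<lambda>y. Re (\<i> * (\<i> * of_real y * H z (\<i> * of_real y)))) \<longlongrightarrow> Re (\<i> * cauchy_transform p1 z)) at_top"
    by (intro tendsto_intros H_lim1 z0)
  have l2: "((\<lambda>y. Re (\<i> * (\<i> * of_real y * H (cnj z) (\<i> * of_real y)))) \<longlongrightarrow> Re (\<i> * cauchy_transform p1 (cnj z))) at_top"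
    by (intro tendsto_intros H_lim1 z0)
  have A: "((\<lambda>y. (Re (\<i> * (\<i> * of_real y * H z (\<i> * of_real y))) - Re (\<i> * (\<i> * of_real y * H (cnj z) (\<i> * of_real y)))) / 2)
      \<longlongrightarrow> (Re (\<i> * cauchy_transform p1 z) - Re (\<i> * cauchy_transform p1 (cnj z))) / 2) at_top"
    by (intro tendsto_intros l1 l2) simp
  have B: "(Re (\<i> * cauchy_transform p1 z) - Re (\<i> * cauchy_transform p1 (cnj z))) / 2 = - Im (cauchy_transform p1 z)"
    by (simp add: p1.cauchy_cnj)
  have ev: "eventually (\<lambda>y. (Re (\<i> * (\<i> * of_real y * H z (\<i> * of_real y))) - Re (\<i> * (\<i> * of_real y * H (cnj z) (\<i> * of_real y)))) / 2
      = y * U z (\<i> * of_real y)) at_top"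
    using eventually_gt_at_top[of 0]
  proof eventually_elim
    case (elim y)
    then have "U z (\<i> * of_real y) = Re (H (cnj z) (\<i> * of_real y) - H z (\<i> * of_real y)) / 2"
      using z by (intro U_alt) auto
    moreover have "Re (\<i> * (\<i> * of_real y * v)) = - (y * Re v)" for v by simp
    ultimately show ?case by (simp only: minus_complex.sel) (simp add: algebra_simps diff_divide_distrib)
  qed
  show ?thesis by (rule Lim_transform_eventually[OF A[unfolded B] ev])
qed

end

text \<open>A multiple of the Poisson kernel at i y that increases to 1 with y. Integrals of
  products of such weights against \<open>law\<close> are known, and monotone convergence turns them
  into masses.\<close>

definition cauchy_weight :: "real \<Rightarrow> real \<Rightarrow> real" where
  "cauchy_weight y s = y\<^sup>2 / (s\<^sup>2 + y\<^sup>2)"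

lemma cauchy_weight_poisson: "y > 0 \<Longrightarrow> cauchy_weight y s = pi * y * poisson (\<i> * of_real y) s"
  unfolding cauchy_weight_def poisson_def cmod_of_real_diff_square by (simp add: power2_eq_square)

lemma cauchy_weight_mono:
  assumes "0 < y" "y \<le> y'"
  shows "cauchy_weight y s \<le> cauchy_weight y' s"
proof -
  have "y\<^sup>2 \<le> y'\<^sup>2" using assms by (intro power_mono) auto
  then have "y\<^sup>2 * (s\<^sup>2 + y'\<^sup>2) \<le> y'\<^sup>2 * (s\<^sup>2 + y\<^sup>2)"
    using mult_right_mono[of "y\<^sup>2" "y'\<^sup>2" "s\<^sup>2"] by (simp add: algebra_simps)
  moreover have "s\<^sup>2 + y\<^sup>2 > 0" "s\<^sup>2 + y'\<^sup>2 > 0" using assms by (auto intro!: add_nonneg_pos)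
  ultimately show ?thesis by (simp add: cauchy_weight_def divide_simps)
qed

lemma cauchy_weight_nonneg: "cauchy_weight y s \<ge> 0"
  by (simp add: cauchy_weight_def)

lemma cauchy_weight_limit: "(\<lambda>n. cauchy_weight (real (Suc n)) s) \<longlonglongrightarrow> 1"
  unfolding cauchy_weight_def by real_asymp

lemma cauchy_weight_measurable [measurable]: "cauchy_weight y \<in> borel_measurable borel"
  unfolding cauchy_weight_def[abs_def] by measurable

context plane_transform
begin

lemma law_sets: "sets (law \<epsilon>) = sets borel"
  by (simp add: law_def)

lemma law_measurable: "f \<in> borel_measurable borel \<Longrightarrow> f \<in> borel_measurable (law \<epsilon>)"
  by (simp add: measurable_cong_sets[OF law_sets refl])

lemma fst_snd_measurable:
  fixes f :: "real \<Rightarrow> real"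
  assumes "f \<in> borel_measurable borel"
  shows "(\<lambda>p::real \<times> real. f (fst p)) \<in> borel_measurable borel" "(\<lambda>p::real \<times> real. f (snd p)) \<in> borel_measurable borel"
  by (rule measurable_compose[where f = fst, OF _ assms] measurable_compose[where f = snd, OF _ assms];
      intro borel_measurable_continuous_onI continuous_intros)+

text \<open>The weight in the second coordinate increases to 1, and \<open>U_limit\<close> evaluates
  the limit.\<close>

lemma law_marginal_mass:
  assumes \<epsilon>: "\<epsilon> > 0" and y: "y > 0"
  shows "(\<integral>\<^sup>+p. ennreal (cauchy_weight y (fst p)) \<partial>law \<epsilon>) = ennreal (- y * Im (cauchy_transform p1 (\<i> * of_real (y + \<epsilon>))))"
proof -
  define g where "g = (\<lambda>m p. ennreal (cauchy_weight y (fst p) * cauchy_weight (real (Suc m)) (snd p)))"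
  have gint: "integral\<^sup>N (law \<epsilon>) (g m) = ennreal (y * (real (Suc m) * U (\<i> * of_real (y + \<epsilon>)) (\<i> * of_real (real (Suc m) + \<epsilon>))))" for m
  proof -
    have U0: "U (\<i> * of_real (y + \<epsilon>)) (\<i> * of_real (real (Suc m) + \<epsilon>)) \<ge> 0"
      by (rule U_nonneg) (use y \<epsilon> in auto)
    have gp: "g m p = ennreal (pi\<^sup>2 * y * real (Suc m)) * ennreal (poisson (\<i> * of_real y) (fst p) * poisson (\<i> * of_real (real (Suc m))) (snd p))" for p
      unfolding g_def using y poisson_nonneg[of "\<i> * of_real y"] poisson_nonneg[of "\<i> * of_real (real (Suc m))"]
      by (subst cauchy_weight_poisson; simp add: ennreal_mult[symmetric] power2_eq_square mult_ac cauchy_weight_poisson del: of_nat_Suc)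
    have pm: "(\<lambda>p. ennreal (poisson (\<i> * of_real y) (fst p) * poisson (\<i> * of_real (real (Suc m))) (snd p))) \<in> borel_measurable (law \<epsilon>)"
      by (intro law_measurable measurable_compose[OF _ measurable_ennreal] borel_measurable_times fst_snd_measurable poisson_measurable)
    have "integral\<^sup>N (law \<epsilon>) (g m) = ennreal (pi\<^sup>2 * y * real (Suc m)) *
        (\<integral>\<^sup>+p. ennreal (poisson (\<i> * of_real y) (fst p) * poisson (\<i> * of_real (real (Suc m))) (snd p)) \<partial>law \<epsilon>)"
      unfolding nn_integral_cmult[OF pm, symmetric] gp ..
    also have "\<dots> = ennreal (pi\<^sup>2 * y * real (Suc m)) * ennreal (U (\<i> * of_real y + \<i> * of_real \<epsilon>) (\<i> * of_real (real (Suc m)) + \<i> * of_real \<epsilon>) / pi\<^sup>2)"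
      by (subst law_poisson[OF \<epsilon>]) (use y in auto)
    also have "\<i> * of_real y + \<i> * of_real \<epsilon> = \<i> * of_real (y + \<epsilon>)" by (simp add: algebra_simps)
    also have "\<i> * of_real (real (Suc m)) + \<i> * of_real \<epsilon> = \<i> * of_real (real (Suc m) + \<epsilon>)" by (simp add: algebra_simps)
    finally show ?thesis using U0 y by (simp add: ennreal_mult[symmetric] mult_ac del: of_nat_Suc of_real_add)
  qed
  have "(\<lambda>m. integral\<^sup>N (law \<epsilon>) (g m)) \<longlonglongrightarrow> (\<integral>\<^sup>+p. ennreal (cauchy_weight y (fst p)) \<partial>law \<epsilon>)"
  proof (rule nn_integral_LIMSEQ)
    show "incseq g" unfolding g_def
      by (intro incseq_SucI le_funI ennreal_leI mult_left_mono cauchy_weight_mono cauchy_weight_nonneg) auto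
    show "g m \<in> borel_measurable (law \<epsilon>)" for m
      unfolding g_def by (intro law_measurable measurable_compose[OF _ measurable_ennreal] borel_measurable_times fst_snd_measurable cauchy_weight_measurable)
    show "(\<lambda>m. g m p) \<longlonglongrightarrow> ennreal (cauchy_weight y (fst p))" for p
    proof -
      have "(\<lambda>m. cauchy_weight y (fst p) * cauchy_weight (real (Suc m)) (snd p)) \<longlonglongrightarrow> cauchy_weight y (fst p) * 1"
        by (intro tendsto_intros cauchy_weight_limit)
      then show ?thesis unfolding g_def by (intro tendsto_ennrealI) simp
    qed
  qed
  moreover have "(\<lambda>m. integral\<^sup>N (law \<epsilon>) (g m)) \<longlonglongrightarrow> ennreal (y * (1 * - Im (cauchy_transform p1 (\<i> * of_real (y + \<epsilon>)))))"
    unfolding gint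
  proof (rule tendsto_ennrealI, rule tendsto_mult[OF tendsto_const])
    have *: "filterlim (\<lambda>m. real (Suc m) + \<epsilon>) at_top sequentially" by real_asymp
    have "(\<lambda>m. (real (Suc m) + \<epsilon>) * U (\<i> * of_real (y + \<epsilon>)) (\<i> * of_real (real (Suc m) + \<epsilon>)))
      \<longlonglongrightarrow> - Im (cauchy_transform p1 (\<i> * of_real (y + \<epsilon>)))"
      using filterlim_compose[OF U_limit *] y \<epsilon> by simp
    moreover have "(\<lambda>m. real (Suc m) / (real (Suc m) + \<epsilon>)) \<longlonglongrightarrow> 1" by real_asymp
    ultimately have "(\<lambda>m. real (Suc m) / (real (Suc m) + \<epsilon>) * ((real (Suc m) + \<epsilon>) * U (\<i> * of_real (y + \<epsilon>)) (\<i> * of_real (real (Suc m) + \<epsilon>))))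
      \<longlonglongrightarrow> 1 * - Im (cauchy_transform p1 (\<i> * of_real (y + \<epsilon>)))" by (intro tendsto_mult)
    moreover have "real (Suc m) / (real (Suc m) + \<epsilon>) * ((real (Suc m) + \<epsilon>) * u) = real (Suc m) * u" for m u
      using \<epsilon> by (simp add: field_simps del: of_nat_Suc)
    ultimately show "(\<lambda>m. real (Suc m) * U (\<i> * of_real (y + \<epsilon>)) (\<i> * of_real (real (Suc m) + \<epsilon>)))
      \<longlonglongrightarrow> 1 * - Im (cauchy_transform p1 (\<i> * of_real (y + \<epsilon>)))" by simp
  qed
  ultimately show ?thesis using LIMSEQ_unique by fastforce
qed

lemma borel_law2_law:
  assumes \<epsilon>: "\<epsilon> > 0"
  shows "borel_law2 (law \<epsilon>)"
proof -
  have "(\<lambda>n. \<integral>\<^sup>+p. ennreal (cauchy_weight (real (Suc n)) (fst p)) \<partial>law \<epsilon>) \<longlonglongrightarrow> (\<integral>\<^sup>+p. 1 \<partial>law \<epsilon>)"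
  proof (rule nn_integral_LIMSEQ)
    show "incseq (\<lambda>n p. ennreal (cauchy_weight (real (Suc n)) (fst p)))"
      by (intro incseq_SucI le_funI ennreal_leI cauchy_weight_mono) auto
    show "(\<lambda>p. ennreal (cauchy_weight (real (Suc n)) (fst p))) \<in> borel_measurable (law \<epsilon>)" for n
      by (intro law_measurable measurable_compose[OF _ measurable_ennreal] fst_snd_measurable cauchy_weight_measurable)
    show "(\<lambda>n. ennreal (cauchy_weight (real (Suc n)) (fst p))) \<longlonglongrightarrow> 1" for p
      using tendsto_ennrealI[OF cauchy_weight_limit] by simp
  qed
  moreover have "(\<lambda>n. \<integral>\<^sup>+p. ennreal (cauchy_weight (real (Suc n)) (fst p)) \<partial>law \<epsilon>) \<longlonglongrightarrow> ennreal 1"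
  proof -
    define Z where "Z = (\<lambda>n. \<i> * complex_of_real (real (Suc n) + \<epsilon>))"
    have nZ: "cmod (Z n) = real (Suc n) + \<epsilon>" for n
      unfolding Z_def norm_mult norm_of_real using \<epsilon> by simp
    have "(\<lambda>n. Z n * cauchy_transform p1 (Z n)) \<longlonglongrightarrow> 1"
    proof (rule p1.cauchy_times_limit[where C = 1])
      show "filterlim Z at_infinity sequentially"
        unfolding filterlim_at_infinity_conv_norm_at_top nZ by real_asymp
      show "cmod (Z n) \<le> 1 * \<bar>Im (Z n)\<bar>" for n unfolding nZ using \<epsilon> by (simp add: Z_def)
    qed
    then have "(\<lambda>n. Re (Z n * cauchy_transform p1 (Z n))) \<longlonglongrightarrow> Re 1" by (intro tendsto_intros)
    moreover have "(\<lambda>n. real (Suc n) / (real (Suc n) + \<epsilon>)) \<longlonglongrightarrow> 1" by real_asymp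
    ultimately have "(\<lambda>n. real (Suc n) / (real (Suc n) + \<epsilon>) * Re (Z n * cauchy_transform p1 (Z n))) \<longlonglongrightarrow> 1 * Re 1"
      by (intro tendsto_mult)
    moreover have "real (Suc n) / (real (Suc n) + \<epsilon>) * Re (Z n * cauchy_transform p1 (Z n)) = - real (Suc n) * Im (cauchy_transform p1 (Z n))" for n
    proof -
      have "Re (Z n * cauchy_transform p1 (Z n)) = - ((real (Suc n) + \<epsilon>) * Im (cauchy_transform p1 (Z n)))"
        by (simp add: Z_def)
      moreover have "real (Suc n) + \<epsilon> \<noteq> 0" using \<epsilon> by (simp add: add_pos_pos less_imp_neq[symmetric])
      ultimately show ?thesis by (simp del: of_nat_Suc)
    qed
    ultimately have "(\<lambda>n. - real (Suc n) * Im (cauchy_transform p1 (Z n))) \<longlonglongrightarrow> 1" by simp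
    moreover have "(\<integral>\<^sup>+p. ennreal (cauchy_weight (real (Suc n)) (fst p)) \<partial>law \<epsilon>) = ennreal (- real (Suc n) * Im (cauchy_transform p1 (Z n)))" for n
      unfolding Z_def by (rule law_marginal_mass[OF \<epsilon>]) simp
    ultimately show ?thesis by (simp only: tendsto_ennrealI)
  qed
  ultimately have "(\<integral>\<^sup>+p. 1 \<partial>law \<epsilon>) = ennreal 1" by (rule LIMSEQ_unique)
  then have "emeasure (law \<epsilon>) (space (law \<epsilon>)) = 1" by simp
  then show ?thesis using law_sets by (auto simp: borel_law2_def intro: prob_spaceI)
qed

text \<open>For the difference D of the two sides, D(z, cnj w) - D(z, w) has real part 0, since both
  sides have the same Poisson integrals. Holomorphy and decay in z make this difference vanish;
  conjugation symmetry then permits the same argument in w, which gives D = 0.\<close>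

lemma law_cauchy_transform:
  assumes \<epsilon>: "\<epsilon> > 0" and z: "Im z \<noteq> 0" and w: "Im w \<noteq> 0"
  shows "cauchy_transform2 (law \<epsilon>) z w = H (shift \<epsilon> z) (shift \<epsilon> w)"
proof -
  note L = borel_law2_law[OF \<epsilon>]
  interpret L: prob_space "law \<epsilon>" using L by (simp add: borel_law2_def)
  define D where "D = (\<lambda>z w. cauchy_transform2 (law \<epsilon>) z w - H (shift \<epsilon> z) (shift \<epsilon> w))"
  have e0: "\<epsilon> \<ge> 0" using \<epsilon> by simp
  have Dcnj: "D (cnj z) (cnj w) = cnj (D z w)" if "Im z \<noteq> 0" "Im w \<noteq> 0" for z w
    unfolding D_def shift_cnj cauchy_transform2_cnj[OF L] using that shift_nonreal[OF e0]
    by (subst H_conj) auto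
  have Dle: "cmod (D z w) \<le> (1 + C) / \<bar>Im w\<bar> / \<bar>Im z\<bar>" if "Im z \<noteq> 0" "Im w \<noteq> 0" for z w
  proof -
    have "cmod (D z w) \<le> 1 / (\<bar>Im z\<bar> * \<bar>Im w\<bar>) + C / (\<bar>Im (shift \<epsilon> z)\<bar> * \<bar>Im (shift \<epsilon> w)\<bar>)"
      unfolding D_def using that shift_nonreal[OF e0]
      by (intro order_trans[OF norm_triangle_ineq4] add_mono cauchy_transform2_norm_le[OF L] H_bound) auto
    also have "C / (\<bar>Im (shift \<epsilon> z)\<bar> * \<bar>Im (shift \<epsilon> w)\<bar>) \<le> C / (\<bar>Im z\<bar> * \<bar>Im w\<bar>)"
      unfolding shift_nonreal(1)[OF e0 that(1)] shift_nonreal(1)[OF e0 that(2)]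
      using that e0 C_nonneg by (intro divide_left_mono mult_mono) auto
    finally show ?thesis by (simp add: add_divide_distrib mult.commute)
  qed
  have Dhol1: "(\<lambda>z. D z w) holomorphic_on {z. Im z > 0}" if "Im w \<noteq> 0" for w
  proof -
    have "(\<lambda>z. H (shift \<epsilon> z) (shift \<epsilon> w)) holomorphic_on {z. Im z > 0}"
      using holomorphic_on_compose_gen[OF shift_holomorphic H_hol1[OF shift_nonreal(2)[OF e0 that]], of \<epsilon>] shift_nonreal(2)[OF e0]
      by (auto simp: comp_def image_subset_iff)
    moreover have "(\<lambda>z. cauchy_transform2 (law \<epsilon>) z w) holomorphic_on {z. Im z > 0}"
      by (rule holomorphic_on_subset[OF cauchy_transform2_holomorphic(2)[OF L that]]) auto
    ultimately show ?thesis unfolding D_def by (intro holomorphic_intros)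
  qed
  have Dhol2: "D z holomorphic_on {w. Im w > 0}" if "Im z \<noteq> 0" for z
  proof -
    have "(\<lambda>w. H (shift \<epsilon> z) (shift \<epsilon> w)) holomorphic_on {z. Im z > 0}"
      using holomorphic_on_compose_gen[OF shift_holomorphic H_hol2[OF shift_nonreal(2)[OF e0 that]], of \<epsilon>] shift_nonreal(2)[OF e0]
      by (auto simp: comp_def image_subset_iff)
    moreover have "cauchy_transform2 (law \<epsilon>) z holomorphic_on {z. Im z > 0}"
      by (rule holomorphic_on_subset[OF cauchy_transform2_holomorphic(1)[OF L that]]) auto
    ultimately show ?thesis unfolding D_def by (intro holomorphic_intros)
  qed
  have Re0: "Re (D z (cnj w) - D z w) = 0" if z: "Im z > 0" and w: "Im w > 0" for z w
  proof -
    have z0: "Im z \<noteq> 0" "Im w \<noteq> 0" "Im (cnj w) \<noteq> 0" using z w by auto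
    define k where "k = (\<lambda>v p. 1 / ((z - complex_of_real (fst p)) * (v - complex_of_real (snd p))))"
    have ik: "integrable (law \<epsilon>) (k v)" if "Im v \<noteq> 0" for v
      using weighted_variable.integrable_divide[OF law_weight1[OF L z0(1)] that] unfolding k_def by simp
    have kc: "cauchy_transform2 (law \<epsilon>) z v = (LINT p|law \<epsilon>. k v p)" for v
      by (simp add: cauchy_transform2_def k_def)
    have pt: "Re (k (cnj w) p - k w p) = 2 * (pi\<^sup>2 * (poisson z (fst p) * poisson w (snd p)))" for p
    proof -
      define a where "a = z - of_real (fst p)"
      define b where "b = w - of_real (snd p)"
      have ab: "Im a = Im z" "Im b = Im w" "a \<noteq> 0" "b \<noteq> 0" using z w by (auto simp: a_def b_def complex_eq_iff)
      have "k (cnj w) p - k w p = 1 / a * (1 / cnj b - 1 / b)"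
        by (simp add: k_def a_def b_def right_diff_distrib)
      also have "1 / cnj b - 1 / b = (b - cnj b) / (b * cnj b)" using ab by (simp add: field_simps)
      also have "\<dots> = 2 * \<i> * of_real (Im w / (cmod b)\<^sup>2)"
        unfolding complex_norm_square[symmetric] complex_diff_cnj ab by simp
      also have "1 / a * (2 * \<i> * of_real (Im w / (cmod b)\<^sup>2)) = of_real (2 * (Im w / (cmod b)\<^sup>2)) * (\<i> / a)" by (simp add: mult_ac)
      finally have kk: "k (cnj w) p - k w p = of_real (2 * (Im w / (cmod b)\<^sup>2)) * (\<i> / a)" .
      have "Re (of_real r * u) = r * Re u" for r u by simp
      then have "Re (k (cnj w) p - k w p) = 2 * (Im w / (cmod b)\<^sup>2) * Re (\<i> / a)" by (simp only: kk)
      also have "Re (\<i> / a) = Im z / (cmod a)\<^sup>2" using ab by (simp add: Re_divide cmod_power2)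
      finally show ?thesis
        unfolding poisson_def by (simp add: a_def b_def norm_minus_commute power2_eq_square mult_ac)
    qed
    have pos: "U (z + \<i> * of_real \<epsilon>) (w + \<i> * of_real \<epsilon>) \<ge> 0" by (rule U_nonneg) (use z w \<epsilon> in auto)
    have i: "integrable (law \<epsilon>) (\<lambda>p. Re (k (cnj w) p - k w p))"
      by (intro integrable_Re Bochner_Integration.integrable_diff ik z0)
    have i': "integrable (law \<epsilon>) (\<lambda>p. poisson z (fst p) * poisson w (snd p))"
      using i unfolding pt by simp
    have "ennreal (LINT p|law \<epsilon>. poisson z (fst p) * poisson w (snd p)) = ennreal (U (z + \<i> * of_real \<epsilon>) (w + \<i> * of_real \<epsilon>) / pi\<^sup>2)"
      unfolding law_poisson[OF \<epsilon> z w, symmetric]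
      by (rule nn_integral_eq_integral[symmetric, OF i']) (use poisson_nonneg z w in auto)
    then have int: "(LINT p|law \<epsilon>. poisson z (fst p) * poisson w (snd p)) = U (z + \<i> * of_real \<epsilon>) (w + \<i> * of_real \<epsilon>) / pi\<^sup>2"
      using pos poisson_nonneg z w by (subst (asm) ennreal_inj) (auto intro!: integral_nonneg_AE)
    have "Re (cauchy_transform2 (law \<epsilon>) z (cnj w) - cauchy_transform2 (law \<epsilon>) z w) = (LINT p|law \<epsilon>. Re (k (cnj w) p - k w p))"
      unfolding kc using ik[OF z0(2)] ik[OF z0(3)] by (subst integral_Re) auto
    also have "\<dots> = 2 * U (z + \<i> * of_real \<epsilon>) (w + \<i> * of_real \<epsilon>)"
      unfolding pt by (simp add: int)
    also have "\<dots> = Re (H (shift \<epsilon> z) (shift \<epsilon> (cnj w)) - H (shift \<epsilon> z) (shift \<epsilon> w))"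
      unfolding shift_cnj shift_upper[OF z] shift_upper[OF w] U_def by simp
    finally show ?thesis by (simp add: D_def)
  qed
  have upper: "D z (cnj w) = D z w" if z: "Im z > 0" and w: "Im w > 0" for z w
  proof -
    have w0: "Im w \<noteq> 0" "Im (cnj w) \<noteq> 0" using w by auto
    have "D z (cnj w) - D z w = 0"
    proof (rule zero_real_part_decay_imp_zero[where f = "\<lambda>z. D z (cnj w) - D z w" and K = "2 * ((1 + C) / Im w)", OF _ _ _ z])
      show "(\<lambda>z. D z (cnj w) - D z w) holomorphic_on {z. Im z > 0}"
        by (intro holomorphic_intros Dhol1 w0)
      show "Re (D z (cnj w) - D z w) = 0" if "Im z > 0" for z by (rule Re0[OF that w])
      show "cmod (D z (cnj w) - D z w) \<le> 2 * ((1 + C) / Im w) / Im z" if "Im z > 0" for z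
      proof -
        have "cmod (D z (cnj w)) + cmod (D z w) \<le> (1 + C) / \<bar>Im (cnj w)\<bar> / \<bar>Im z\<bar> + (1 + C) / \<bar>Im w\<bar> / \<bar>Im z\<bar>"
          using that w by (intro add_mono Dle) auto
        also have "\<dots> = 2 * ((1 + C) / Im w) / Im z" using that w by simp
        finally show ?thesis by (rule order_trans[OF norm_triangle_ineq4])
      qed
    qed
    then show ?thesis by simp
  qed
  \<comment> \<open>By \<open>upper\<close> and conjugation, D(z, w) and D(cnj z, w) are conjugate
    for all w in the upper half-plane, so their difference is imaginary and their sum real. Both are
    holomorphic in w and decay, hence both vanish.\<close>
  have zero: "D z w = 0 \<and> D (cnj z) w = 0" if z: "Im z > 0" and w: "Im w > 0" for z w
  proof -
    have z0: "Im z \<noteq> 0" "Im (cnj z) \<noteq> 0" using z by auto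
    have conj: "D z w = cnj (D (cnj z) w)" if "Im w > 0" for w
      using upper[OF z that] Dcnj[of "cnj z" w] z that by simp
    have b: "cmod (D z w) + cmod (D (cnj z) w) \<le> 2 * ((1 + C) / Im z) / Im w" if "Im w > 0" for w
    proof -
      have "cmod (D z w) + cmod (D (cnj z) w) \<le> (1 + C) / \<bar>Im w\<bar> / \<bar>Im z\<bar> + (1 + C) / \<bar>Im w\<bar> / \<bar>Im (cnj z)\<bar>"
        using that z by (intro add_mono Dle) auto
      also have "\<dots> = 2 * ((1 + C) / Im z) / Im w" using that z by (simp add: mult.commute)
      finally show ?thesis .
    qed
    have "D z w - D (cnj z) w = 0"
    proof (rule zero_real_part_decay_imp_zero[where f = "\<lambda>w. D z w - D (cnj z) w" and K = "2 * ((1 + C) / Im z)", OF _ _ _ w])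
      show "(\<lambda>w. D z w - D (cnj z) w) holomorphic_on {z. Im z > 0}"
        by (intro holomorphic_intros Dhol2 z0)
      show "Re (D z w - D (cnj z) w) = 0" if "Im w > 0" for w using conj[OF that] by simp
      show "cmod (D z w - D (cnj z) w) \<le> 2 * ((1 + C) / Im z) / Im w" if "Im w > 0" for w
        by (rule order_trans[OF norm_triangle_ineq4 b[OF that]])
    qed
    moreover have "\<i> * (D z w + D (cnj z) w) = 0"
    proof (rule zero_real_part_decay_imp_zero[where f = "\<lambda>w. \<i> * (D z w + D (cnj z) w)" and K = "2 * ((1 + C) / Im z)", OF _ _ _ w])
      show "(\<lambda>w. \<i> * (D z w + D (cnj z) w)) holomorphic_on {z. Im z > 0}"
        by (intro holomorphic_intros Dhol2 z0)
      show "Re (\<i> * (D z w + D (cnj z) w)) = 0" if "Im w > 0" for w using conj[OF that] by simp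
      show "cmod (\<i> * (D z w + D (cnj z) w)) \<le> 2 * ((1 + C) / Im z) / Im w" if "Im w > 0" for w
        using order_trans[OF norm_triangle_ineq b[OF that]] by (simp add: norm_mult)
    qed
    ultimately show ?thesis by (simp add: add_eq_0_iff)
  qed
  have "D z w = 0"
    using zero[of z w] zero[of "cnj z" w] zero[of z "cnj w"] zero[of "cnj z" "cnj w"] Dcnj[of z "cnj w"] Dcnj[OF z w] Dcnj[of "cnj z" w] z w
    by (cases "Im z > 0"; cases "Im w > 0"; simp)
  then show ?thesis by (simp add: D_def)
qed

end

section \<open>Compactness\<close>

text \<open>
  Schoenberg's space-filling curve. It serves to deduce sequential compactness of laws on the square
  from Helly's theorem on the line.
\<close>

definition schoenberg_bump :: "real \<Rightarrow> real" where
  "schoenberg_bump t = max 0 (min 1 (1 / 2 - cos (pi * t)))"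

text \<open>Coordinate j reads the base 3 digits of t at positions 2 n + j. The bump has period 2,
  is 0 on [0, 1/3] and 1 on [2/3, 1], and joins these values continuously.\<close>

definition schoenberg :: "nat \<Rightarrow> real \<Rightarrow> real" where
  "schoenberg j t = (\<Sum>n. (1 / 2) ^ Suc n * schoenberg_bump (3 ^ (2 * n + j) * t))"

lemma schoenberg_bump_bounds: "0 \<le> schoenberg_bump t" "schoenberg_bump t \<le> 1"
  by (auto simp: schoenberg_bump_def)

lemma continuous_schoenberg: "continuous_on UNIV (schoenberg j)"
proof -
  have b: "continuous_on UNIV (\<lambda>t. schoenberg_bump (a * t))" for a
    unfolding schoenberg_bump_def by (intro continuous_intros)
  have ul: "uniform_limit UNIV (\<lambda>N t. \<Sum>n<N. (1 / 2) ^ Suc n * schoenberg_bump (3 ^ (2 * n + j) * t)) (schoenberg j) sequentially"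
    unfolding schoenberg_def[abs_def]
  proof (rule Weierstrass_m_test)
    show "norm ((1 / 2) ^ Suc n * schoenberg_bump (3 ^ (2 * n + j) * t)) \<le> (1 / 2) ^ Suc n" for n t
      using schoenberg_bump_bounds[of "3 ^ (2 * n + j) * t"] by (simp add: abs_mult mult_le_one)
    show "summable (\<lambda>n. (1 / 2 :: real) ^ Suc n)" by (subst summable_Suc_iff) (simp add: summable_geometric)
  qed
  show ?thesis
    by (rule uniform_limit_theorem[OF _ ul]) (auto intro!: always_eventually continuous_intros b)
qed

locale ternary_digits =
  fixes b :: "nat \<Rightarrow> real"
  assumes digit: "b n = 0 \<or> b n = 1"
begin

definition tail :: "nat \<Rightarrow> real" where "tail k = (\<Sum>i. 2 * b (k + i) / 3 ^ Suc i)"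

lemma geo: "(\<lambda>i. 2 / 3 ^ Suc i :: real) sums 1"
proof -
  have "(\<lambda>i. 2 / 3 * (1 / 3 :: real) ^ i) sums (2 / 3 * (1 / (1 - 1 / 3)))"
    by (intro sums_mult geometric_sums) auto
  then show ?thesis by (simp add: power_divide)
qed

lemma summable_tail: "summable (\<lambda>i. 2 * b (k + i) / 3 ^ Suc i)"
proof (rule summable_comparison_test'[OF sums_summable[OF geo]])
  show "norm (2 * b (k + n) / 3 ^ Suc n) \<le> 2 / 3 ^ Suc n" for n
    using digit[of "k + n"] by auto
qed

lemma tail_bounds: "0 \<le> tail k" "tail k \<le> 1"
proof -
  have b: "0 \<le> b n" "b n \<le> 1" for n using digit[of n] by auto
  show "0 \<le> tail k" unfolding tail_def by (intro suminf_nonneg summable_tail) (simp add: b)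
  have "tail k \<le> (\<Sum>i. 2 / 3 ^ Suc i)"
    unfolding tail_def by (intro suminf_le summable_tail sums_summable[OF geo]) (simp add: b divide_right_mono)
  then show "tail k \<le> 1" using sums_unique[OF geo] by simp
qed

lemma tail_Suc: "3 * tail k = 2 * b k + tail (Suc k)"
proof -
  have "tail k = (\<Sum>i. 2 * b (k + Suc i) / 3 ^ Suc (Suc i)) + 2 * b (k + 0) / 3 ^ Suc 0"
    unfolding tail_def using suminf_split_head[OF summable_tail[of k]] by simp
  also have "(\<Sum>i. 2 * b (k + Suc i) / 3 ^ Suc (Suc i)) = (\<Sum>i. 2 * b (Suc k + i) / 3 ^ Suc i / 3)"
    by simp
  also have "\<dots> = tail (Suc k) / 3"
    unfolding tail_def by (rule suminf_divide[OF summable_tail])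
  finally show ?thesis by simp
qed

text \<open>The base 3 digits are 2 b and hence even, so multiplication by 3^k splits off an even
  integer, which the bump with period 2 does not see.\<close>

lemma scaled: "\<exists>m::nat. 3 ^ k * tail 0 = 2 * real m + tail k"
proof (induction k)
  case 0
  show ?case by (intro exI[of _ 0]) simp
next
  case (Suc k)
  then obtain m where m: "3 ^ k * tail 0 = 2 * real m + tail k" by blast
  obtain d :: nat where d: "b k = real d" using digit[of k] by (metis of_nat_0 of_nat_1)
  have "3 ^ Suc k * tail 0 = 2 * real (3 * m + d) + tail (Suc k)"
    using m tail_Suc[of k] d by simp
  then show ?case by blast
qed

text \<open>A leading digit 0 puts the tail into [0, 1/3], a leading digit 2 into [2/3, 1]; the bump
  is constant on each.\<close>

lemma bump_scaled: "schoenberg_bump (3 ^ k * tail 0) = b k"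
proof -
  obtain m :: nat where m: "3 ^ k * tail 0 = 2 * real m + tail k" using scaled by blast
  have "cos (pi * (2 * real m + tail k)) = cos (pi * tail k + of_int (int m) * (2 * pi))"
    by (simp add: algebra_simps)
  also have "\<dots> = cos (pi * tail k)"
    unfolding cos_add by (simp only: cos_int_2pin sin_int_2pin mult.commute[of "of_int _"])
  finally have c: "cos (pi * (3 ^ k * tail 0)) = cos (pi * tail k)" unfolding m .
  show ?thesis
  proof (cases "b k = 0")
    case True
    then have "tail k \<le> 1 / 3" using tail_Suc[of k] tail_bounds[of "Suc k"] by simp
    then have "cos (pi * (1 / 3)) \<le> cos (pi * tail k)"
      using tail_bounds[of k] by (intro cos_monotone_0_pi_le) auto
    then show ?thesis unfolding schoenberg_bump_def c using True cos_60 by simp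
  next
    case False
    then have b: "b k = 1" using digit by blast
    then have "tail k \<ge> 2 / 3" using tail_Suc[of k] tail_bounds[of "Suc k"] by simp
    then have "cos (pi * tail k) \<le> cos (pi * (2 / 3))"
      using tail_bounds[of k] by (intro cos_monotone_0_pi_le) auto
    also have "cos (pi * (2 / 3)) = - (1 / 2)"
      using cos_pi_minus[of "pi / 3"] cos_60 by (simp add: field_simps)
    finally show ?thesis unfolding schoenberg_bump_def c using b by simp
  qed
qed

end

section \<open>A measurable section of the space-filling curve\<close>

definition bindigit :: "nat \<Rightarrow> real \<Rightarrow> real" where
  "bindigit n u = of_int \<lfloor>2 ^ Suc n * u\<rfloor> - 2 * of_int \<lfloor>2 ^ n * u\<rfloor>"

lemma bindigit_cases: "bindigit n u = 0 \<or> bindigit n u = 1"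
proof -
  define m where "m = \<lfloor>2 ^ n * u\<rfloor>"
  have "of_int m \<le> 2 ^ n * u" "2 ^ n * u < of_int m + 1" unfolding m_def by linarith+
  then have "of_int (2 * m) \<le> 2 ^ Suc n * u" "2 ^ Suc n * u < of_int (2 * m + 1 + 1)" by simp_all
  then have "2 * m \<le> \<lfloor>2 ^ Suc n * u\<rfloor>" "\<lfloor>2 ^ Suc n * u\<rfloor> < 2 * m + 1 + 1"
    by (simp_all only: le_floor_iff floor_less_iff)
  then have "\<lfloor>2 ^ Suc n * u\<rfloor> = 2 * m \<or> \<lfloor>2 ^ Suc n * u\<rfloor> = 2 * m + 1" by linarith
  then show ?thesis unfolding bindigit_def m_def[symmetric] by auto
qed

lemma bindigit_sums:
  assumes "0 \<le> u" "u < 1"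
  shows "(\<lambda>n. (1 / 2) ^ Suc n * bindigit n u) sums u"
proof -
  have "(\<Sum>n<N. (1 / 2) ^ Suc n * bindigit n u) = of_int \<lfloor>2 ^ N * u\<rfloor> / 2 ^ N" for N
  proof (induction N)
    case 0
    have "\<lfloor>u\<rfloor> = 0" using assms by (simp add: floor_eq_iff)
    then show ?case by simp
  next
    case (Suc N)
    have "(\<Sum>n<Suc N. (1 / 2) ^ Suc n * bindigit n u)
        = of_int \<lfloor>2 ^ N * u\<rfloor> / 2 ^ N + (1 / 2) ^ Suc N * bindigit N u"
      by (simp only: sum.lessThan_Suc Suc)
    also have "\<dots> = of_int \<lfloor>2 ^ Suc N * u\<rfloor> / 2 ^ Suc N"
      by (simp add: bindigit_def power_divide diff_divide_distrib)
    finally show ?case .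
  qed
  moreover have "(\<lambda>N. of_int \<lfloor>2 ^ N * u\<rfloor> / 2 ^ N) \<longlonglongrightarrow> u"
  proof (rule LIM_zero_cancel, rule Lim_null_comparison)
    show "eventually (\<lambda>N. norm (of_int \<lfloor>2 ^ N * u\<rfloor> / 2 ^ N - u) \<le> (1 / 2) ^ N) sequentially"
    proof (rule always_eventually, rule allI)
      fix N :: nat
      have "\<bar>of_int \<lfloor>2 ^ N * u\<rfloor> - 2 ^ N * u\<bar> \<le> 1" by linarith
      then have "\<bar>of_int \<lfloor>2 ^ N * u\<rfloor> - 2 ^ N * u\<bar> / 2 ^ N \<le> 1 / 2 ^ N" by (intro divide_right_mono) auto
      moreover have "of_int \<lfloor>2 ^ N * u\<rfloor> / 2 ^ N - u = (of_int \<lfloor>2 ^ N * u\<rfloor> - 2 ^ N * u) / 2 ^ N"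
        by (simp add: field_simps)
      ultimately show "norm (of_int \<lfloor>2 ^ N * u\<rfloor> / 2 ^ N - u) \<le> (1 / 2) ^ N"
        by (simp add: power_divide)
    qed
    show "(\<lambda>N. (1 / 2 :: real) ^ N) \<longlonglongrightarrow> 0" by (rule LIMSEQ_power_zero) simp
  qed
  ultimately show ?thesis by (simp add: sums_def)
qed

definition interleave :: "real \<Rightarrow> real \<Rightarrow> nat \<Rightarrow> real" where
  "interleave u v i = (if even i then bindigit (i div 2) u else bindigit (i div 2) v)"

text \<open>A parameter that the curve sends back to p, for p in the half-open unit square: the
  binary digits of both coordinates are interleaved and doubled into base 3 digits. Measurability is
  enough to transport laws along it.\<close>

definition schoenberg_section :: "real \<times> real \<Rightarrow> real" where
  "schoenberg_section p = (\<Sum>i. 2 * interleave (fst p) (snd p) i / 3 ^ Suc i)"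

lemma ternary_digits_interleave: "ternary_digits (interleave u v)"
  by unfold_locales (use bindigit_cases in \<open>auto simp: interleave_def\<close>)

lemma schoenberg_section_tail: "schoenberg_section (u, v) = ternary_digits.tail (interleave u v) 0"
  by (simp add: schoenberg_section_def ternary_digits.tail_def[OF ternary_digits_interleave])

lemma schoenberg_section_bounds: "0 \<le> schoenberg_section p" "schoenberg_section p \<le> 1"
  using ternary_digits.tail_bounds[OF ternary_digits_interleave, of "fst p" "snd p" 0]
  by (simp_all flip: schoenberg_section_tail)

lemma schoenberg_of_section:
  assumes "0 \<le> u" "u < 1" "0 \<le> v" "v < 1"
  shows "schoenberg 0 (schoenberg_section (u, v)) = u" "schoenberg 1 (schoenberg_section (u, v)) = v"
  using sums_unique[OF bindigit_sums[OF assms(1,2)]] sums_unique[OF bindigit_sums[OF assms(3,4)]]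
  unfolding schoenberg_def schoenberg_section_tail ternary_digits.bump_scaled[OF ternary_digits_interleave]
  by (simp_all add: interleave_def)

lemma schoenberg_section_measurable: "schoenberg_section \<in> borel_measurable borel"
proof -
  have d: "bindigit n \<in> borel_measurable borel" for n
    unfolding bindigit_def[abs_def] by measurable
  have "(\<lambda>p. bindigit n (fst p)) \<in> borel_measurable borel" "(\<lambda>p. bindigit n (snd p)) \<in> borel_measurable borel" for n
    by (rule measurable_compose[where f = fst, OF _ d] measurable_compose[where f = snd, OF _ d];
        intro borel_measurable_continuous_onI continuous_intros)+
  then have "(\<lambda>p. interleave (fst p) (snd p) i) \<in> borel_measurable borel" for i
    unfolding interleave_def by (cases "even i") simp_all
  then show ?thesis
    unfolding schoenberg_section_def[abs_def] by (intro borel_measurable_suminf) simp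
qed

section \<open>Resolvent kernels on the compactified line\<close>

definition compactify :: "real \<Rightarrow> real" where "compactify s = 1 / 2 + arctan s / pi"

definition decompactify :: "real \<Rightarrow> real" where "decompactify u = - cos (pi * u) / sin (pi * u)"

text \<open>The resolvent 1 / (z - s) in the coordinate u = \<open>compactify s\<close>. Cleared of
  the cotangent it is continuous on the whole line and vanishes at u = 0 and u = 1, which stand for
  infinite s.\<close>

definition ckernel :: "complex \<Rightarrow> real \<Rightarrow> complex" where
  "ckernel z u = of_real (sin (pi * u)) / (z * of_real (sin (pi * u)) + of_real (cos (pi * u)))"

lemma compactify_bounds: "0 < compactify s" "compactify s < 1"
  using arctan_bounded[of s] by (simp_all add: compactify_def field_simps)

lemma ckernel_denominator:
  assumes "Im z \<noteq> 0"
  shows "z * of_real (sin (pi * u)) + of_real (cos (pi * u)) \<noteq> 0"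
proof
  assume *: "z * of_real (sin (pi * u)) + of_real (cos (pi * u)) = 0"
  then have "Im (z * of_real (sin (pi * u)) + of_real (cos (pi * u))) = 0" by simp
  then have s: "sin (pi * u) = 0" using assms by simp
  with * have "cos (pi * u) = 0" by (simp flip: of_real_add)
  with s sin_cos_squared_add[of "pi * u"] show False by simp
qed

lemma continuous_ckernel: "Im z \<noteq> 0 \<Longrightarrow> continuous_on UNIV (ckernel z)"
  unfolding ckernel_def[abs_def] by (intro continuous_intros ballI ckernel_denominator)

lemma ckernel_bound:
  assumes "Im z \<noteq> 0"
  shows "cmod (ckernel z u) \<le> 1 / \<bar>Im z\<bar>"
proof (cases "sin (pi * u) = 0")
  case False
  have "\<bar>Im z\<bar> * \<bar>sin (pi * u)\<bar> \<le> cmod (z * of_real (sin (pi * u)) + of_real (cos (pi * u)))"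
    using abs_Im_le_cmod[of "z * of_real (sin (pi * u)) + of_real (cos (pi * u))"] by (simp add: abs_mult)
  then have "\<bar>sin (pi * u)\<bar> / cmod (z * of_real (sin (pi * u)) + of_real (cos (pi * u))) \<le> \<bar>sin (pi * u)\<bar> / (\<bar>Im z\<bar> * \<bar>sin (pi * u)\<bar>)"
    using False assms ckernel_denominator[OF assms, of u] by (intro divide_left_mono mult_pos_pos) auto
  then show ?thesis using False by (simp add: ckernel_def norm_divide)
qed (simp add: ckernel_def)

lemma ckernel_decompactify:
  assumes "sin (pi * u) \<noteq> 0"
  shows "ckernel z u = 1 / (z - of_real (decompactify u))"
proof -
  have "z - of_real (decompactify u) = (z * of_real (sin (pi * u)) + of_real (cos (pi * u))) / of_real (sin (pi * u))"
    using assms by (simp add: decompactify_def add_divide_distrib)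
  then show ?thesis by (simp add: ckernel_def)
qed

lemma ckernel_compactify: "ckernel z (compactify s) = 1 / (z - of_real s)"
proof -
  have a: "pi * compactify s = pi / 2 + arctan s" by (simp add: compactify_def algebra_simps)
  have sc: "sin (pi * compactify s) = cos (arctan s)" "cos (pi * compactify s) = - sin (arctan s)"
    unfolding a by (simp_all add: sin_add cos_add)
  have "cos (arctan s) \<noteq> 0" by (rule cos_arctan_not_zero)
  moreover have "decompactify (compactify s) = s"
    unfolding decompactify_def sc using tan_arctan[of s] by (simp add: tan_def)
  ultimately show ?thesis using ckernel_decompactify[of "compactify s" z] sc by simp
qed

lemma decompactify_measurable [measurable]: "decompactify \<in> borel_measurable borel"
  unfolding decompactify_def[abs_def] by measurable

text \<open>The convergence of the marginals rules out an escape of mass to infinity.\<close>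

lemma boundary_null:
  assumes M: "prob_space M" and X [measurable]: "X \<in> borel_measurable M" and q: "real_distribution q"
    and eq: "\<And>z. Im z \<noteq> 0 \<Longrightarrow> (LINT t|M. ckernel z (X t)) = cauchy_transform q z"
  shows "AE t in M. sin (pi * X t) \<noteq> 0"
proof -
  interpret M: prob_space M by fact
  interpret q: real_distribution q by fact
  define z where "z = (\<lambda>n. \<i> * complex_of_real (real (Suc n)))"
  have z: "Im (z n) = real (Suc n)" "cmod (z n) = real (Suc n)" "Im (z n) \<noteq> 0" for n
    by (simp_all add: z_def norm_mult del: of_nat_Suc)
  have zinf: "filterlim z at_infinity sequentially"
    unfolding filterlim_at_infinity_conv_norm_at_top z by real_asymp
  have "(\<lambda>n. z n * cauchy_transform q (z n)) \<longlonglongrightarrow> 1"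
    by (rule q.cauchy_times_limit[where C = 1]) (use zinf z in auto)
  \<comment> \<open>Pointwise, z times the kernel tends to 1 off the boundary and is 0 on it, so
    this limit is the mass off the boundary; for the law q the same limit is 1.\<close>
  moreover have "(\<lambda>n. z n * cauchy_transform q (z n)) \<longlonglongrightarrow> (LINT t|M. indicator {t. sin (pi * X t) \<noteq> 0} t)"
  proof -
    have "(\<lambda>n. LINT t|M. z n * ckernel (z n) (X t)) \<longlonglongrightarrow> (LINT t|M. indicator {t. sin (pi * X t) \<noteq> 0} t)"
    proof (rule integral_dominated_convergence[where w = "\<lambda>_. 1"])
      show "AE t in M. (\<lambda>n. z n * ckernel (z n) (X t)) \<longlonglongrightarrow> indicator {t. sin (pi * X t) \<noteq> 0} t"
      proof (rule AE_I2, rename_tac t)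
        fix t
        show "(\<lambda>n. z n * ckernel (z n) (X t)) \<longlonglongrightarrow> indicator {t. sin (pi * X t) \<noteq> 0} t"
        proof (cases "sin (pi * X t) = 0")
          case True
          then show ?thesis by (simp add: ckernel_def)
        next
          case False
          define s where "s = complex_of_real (sin (pi * X t))"
          define c where "c = complex_of_real (cos (pi * X t))"
          have s: "s \<noteq> 0" using False by (simp add: s_def)
          have "(\<lambda>n. inverse (z n)) \<longlonglongrightarrow> 0"
            by (rule filterlim_compose[OF tendsto_inverse_0 zinf])
          then have "(\<lambda>n. s / (s + c * inverse (z n))) \<longlonglongrightarrow> s / (s + c * 0)"
            using s by (intro tendsto_intros) auto
          moreover have "s / (s + c * inverse (z n)) = z n * ckernel (z n) (X t)" for n
          proof -
            have "z n \<noteq> 0" using z(3)[of n] by auto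
            then have "s + c * inverse (z n) = (z n * s + c) / z n" by (simp add: field_simps)
            then show ?thesis by (simp add: ckernel_def s_def c_def)
          qed
          ultimately show ?thesis using s False by simp
        qed
      qed
      show "AE t in M. cmod (z n * ckernel (z n) (X t)) \<le> 1" for n
      proof (rule AE_I2)
        fix t
        have "cmod (z n * ckernel (z n) (X t)) \<le> real (Suc n) * (1 / real (Suc n))"
          unfolding norm_mult z(2) using ckernel_bound[OF z(3)[of n], of "X t"] unfolding z(1)
          by (intro mult_left_mono) (simp_all del: of_nat_Suc)
        then show "cmod (z n * ckernel (z n) (X t)) \<le> 1" by (simp del: of_nat_Suc)
      qed
      have "ckernel (z n) \<in> borel_measurable borel" for n
        by (intro borel_measurable_continuous_onI continuous_ckernel z)
      then show "(\<lambda>t. z n * ckernel (z n) (X t)) \<in> borel_measurable M" for n by measurable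
    qed auto
    then show ?thesis by (simp add: eq[OF z(3)])
  qed
  ultimately have "(LINT t|M. indicator {t. sin (pi * X t) \<noteq> 0} t) = (1::complex)" by (metis LIMSEQ_unique)
  also have "(LINT t|M. indicator {t. sin (pi * X t) \<noteq> 0} t :: complex) = (LINT t|M. of_real (indicator {t. sin (pi * X t) \<noteq> 0} t))"
    by (intro Bochner_Integration.integral_cong) (auto simp: indicator_def)
  also have "\<dots> = of_real (measure M ({t. sin (pi * X t) \<noteq> 0} \<inter> space M))"
    unfolding integral_complex_of_real by simp
  finally have "measure M ({t. sin (pi * X t) \<noteq> 0} \<inter> space M) = 1" by simp
  moreover have "{t \<in> space M. sin (pi * X t) \<noteq> 0} \<in> sets M" by measurable
  ultimately show ?thesis
    using M.prob_eq_1[of "{t \<in> space M. sin (pi * X t) \<noteq> 0}"] by (auto simp: Int_def conj_commute elim: AE_mp)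
qed

text \<open>The plane is squeezed into the square, and the square into the line by the section,
  where Helly applies. Weak convergence comes back through the curve: its coordinates X and Y are
  continuous and undo the section, so products of kernels in X and Y are bounded continuous test
  functions on the line.\<close>

theorem law2_compactness:
  fixes \<Lambda> :: "nat \<Rightarrow> (real \<times> real) measure"
  assumes L: "\<And>n. borel_law2 (\<Lambda> n)" and q1: "real_distribution q1" and q2: "real_distribution q2"
    and lim1: "\<And>z. Im z \<noteq> 0 \<Longrightarrow> (\<lambda>n. cauchy_transform (marginal1 (\<Lambda> n)) z) \<longlonglongrightarrow> cauchy_transform q1 z"
    and lim2: "\<And>z. Im z \<noteq> 0 \<Longrightarrow> (\<lambda>n. cauchy_transform (marginal2 (\<Lambda> n)) z) \<longlonglongrightarrow> cauchy_transform q2 z"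
  obtains r \<nu> where "strict_mono r" "borel_law2 \<nu>"
    "\<And>z w. Im z \<noteq> 0 \<Longrightarrow> Im w \<noteq> 0 \<Longrightarrow> (\<lambda>n. cauchy_transform2 (\<Lambda> (r n)) z w) \<longlonglongrightarrow> cauchy_transform2 \<nu> z w"
    "\<And>z. Im z \<noteq> 0 \<Longrightarrow> cauchy_transform (marginal1 \<nu>) z = cauchy_transform q1 z"
    "\<And>z. Im z \<noteq> 0 \<Longrightarrow> cauchy_transform (marginal2 \<nu>) z = cauchy_transform q2 z"
proof -
  define \<psi> where "\<psi> = (\<lambda>p. schoenberg_section (compactify (fst p), compactify (snd p)))"
  have cc: "continuous_on UNIV compactify" unfolding compactify_def[abs_def] by (intro continuous_intros) auto
  have \<psi>_meas: "\<psi> \<in> borel_measurable borel"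
    unfolding \<psi>_def
    by (rule measurable_compose[OF _ schoenberg_section_measurable])
      (intro borel_measurable_continuous_onI continuous_intros continuous_on_compose2[OF cc]; simp)
  have \<psi>_meas' [measurable]: "\<psi> \<in> borel_measurable (\<Lambda> n)" for n
    by (rule borel_law2_measurable[OF L \<psi>_meas])
  have \<psi>: "schoenberg 0 (\<psi> p) = compactify (fst p)" "schoenberg 1 (\<psi> p) = compactify (snd p)" for p
    unfolding \<psi>_def using compactify_bounds[of "fst p"] compactify_bounds[of "snd p"]
    by (intro schoenberg_of_section; simp)+
  define m where "m = (\<lambda>n. distr (\<Lambda> n) borel \<psi>)"
  have m: "real_distribution (m n)" for n
  proof -
    interpret prob_space "\<Lambda> n" using L by (simp add: borel_law2_def)
    show ?thesis unfolding m_def by (rule real_distribution_distr) simp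
  qed
  have "tight m"
    unfolding tight_def
  proof (intro conjI allI impI)
    fix e :: real assume "e > 0"
    \<comment> \<open>The intervals in \<open>tight\<close> are open on the left, while the values
      of \<psi> fill a part of [0, 1] that may contain 0.\<close>
    have "measure (m n) {-1<..1} = 1" for n
    proof -
      interpret prob_space "\<Lambda> n" using L by (simp add: borel_law2_def)
      have "-1 < \<psi> p" "\<psi> p \<le> 1" for p
        unfolding \<psi>_def using schoenberg_section_bounds[of "(compactify (fst p), compactify (snd p))"] by linarith+
      then have "\<psi> -` {-1<..1} \<inter> space (\<Lambda> n) = space (\<Lambda> n)" by auto
      then show ?thesis unfolding m_def by (subst measure_distr) (simp_all add: prob_space)
    qed
    then show "\<exists>a b. a < b \<and> (\<forall>n. 1 - e < measure (m n) {a<..b})"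
      using \<open>e > 0\<close> by (intro exI[of _ "-1"] exI[of _ 1]) auto
  qed (rule m)
  then obtain r M where r: "strict_mono r" and M: "real_distribution M" and conv: "weak_conv_m (m \<circ> id \<circ> r) M"
    using tight_imp_convergent_subsubsequence[of m id] strict_mono_id by blast
  interpret M: real_distribution M by fact
  define X where "X = schoenberg 0"
  define Y where "Y = schoenberg 1"
  have XY: "continuous_on UNIV X" "continuous_on UNIV Y"
    unfolding X_def Y_def by (rule continuous_schoenberg)+
  have XYm [measurable]: "X \<in> borel_measurable borel" "Y \<in> borel_measurable borel"
    by (intro borel_measurable_continuous_onI XY)+
  have ck: "continuous_on UNIV (\<lambda>t. ckernel z (X t))" "continuous_on UNIV (\<lambda>t. ckernel z (Y t))" if "Im z \<noteq> 0" for z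
    by (intro continuous_on_compose2[OF continuous_ckernel[OF that]] XY; simp)+
  have lim: "(\<lambda>n. LINT t|m (r n). f t) \<longlonglongrightarrow> (LINT t|M. f t)"
    if "continuous_on UNIV f" "\<And>t. cmod (f t) \<le> B" for f :: "real \<Rightarrow> complex" and B
    using weak_conv_imp_integral_bdd_continuous_conv[of "m \<circ> id \<circ> r" M f B] m M conv that
    by (simp add: continuous_on_eq_continuous_within)
  have int: "(LINT t|m n. f t) = (LINT p|\<Lambda> n. f (\<psi> p))" if "continuous_on UNIV f" for f :: "real \<Rightarrow> complex" and n
    unfolding m_def by (rule integral_distr) (auto intro: borel_measurable_continuous_onI that)
  have marg: "cauchy_transform (marginal1 \<mu>) z = (LINT p|\<mu>. 1 / (z - of_real (fst p)))"
    "cauchy_transform (marginal2 \<mu>) z = (LINT p|\<mu>. 1 / (z - of_real (snd p)))" if "borel_law2 \<mu>" for \<mu> z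
  proof -
    interpret real_pair \<mu> fst snd by (rule borel_law2_real_pair[OF that])
    show "cauchy_transform (marginal1 \<mu>) z = (LINT p|\<mu>. 1 / (z - of_real (fst p)))"
      unfolding cauchy_transform_def marginal1_def by (subst integral_distr) auto
    show "cauchy_transform (marginal2 \<mu>) z = (LINT p|\<mu>. 1 / (z - of_real (snd p)))"
      unfolding cauchy_transform_def marginal2_def by (subst integral_distr) auto
  qed
  have E1: "(LINT t|M. ckernel z (X t)) = cauchy_transform q1 z" if z: "Im z \<noteq> 0" for z
  proof -
    have "(LINT t|m n. ckernel z (X t)) = cauchy_transform (marginal1 (\<Lambda> n)) z" for n
      unfolding int[OF ck(1)[OF z]] marg(1)[OF L] unfolding X_def \<psi> ckernel_compactify ..
    then have "(\<lambda>n. cauchy_transform (marginal1 (\<Lambda> (r n))) z) \<longlonglongrightarrow> (LINT t|M. ckernel z (X t))"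
      using lim[OF ck(1)[OF z] ckernel_bound[OF z]] by simp
    then show ?thesis using LIMSEQ_subseq_LIMSEQ[OF lim1[OF z] r] by (auto simp: comp_def intro: LIMSEQ_unique)
  qed
  have E2: "(LINT t|M. ckernel z (Y t)) = cauchy_transform q2 z" if z: "Im z \<noteq> 0" for z
  proof -
    have "(LINT t|m n. ckernel z (Y t)) = cauchy_transform (marginal2 (\<Lambda> n)) z" for n
      unfolding int[OF ck(2)[OF z]] marg(2)[OF L] unfolding Y_def \<psi> ckernel_compactify ..
    then have "(\<lambda>n. cauchy_transform (marginal2 (\<Lambda> (r n))) z) \<longlonglongrightarrow> (LINT t|M. ckernel z (Y t))"
      using lim[OF ck(2)[OF z] ckernel_bound[OF z]] by simp
    then show ?thesis using LIMSEQ_subseq_LIMSEQ[OF lim2[OF z] r] by (auto simp: comp_def intro: LIMSEQ_unique)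
  qed
  have XYM: "X \<in> borel_measurable M" "Y \<in> borel_measurable M" by simp_all
  have ae1: "AE t in M. sin (pi * X t) \<noteq> 0" by (rule boundary_null[OF M.prob_space_axioms XYM(1) q1 E1])
  have ae2: "AE t in M. sin (pi * Y t) \<noteq> 0" by (rule boundary_null[OF M.prob_space_axioms XYM(2) q2 E2])
  \<comment> \<open>At boundary points \<open>decompactify\<close> has the value 0 of a division by
    zero; by \<open>ae1\<close> and \<open>ae2\<close> this concerns only a null set.\<close>
  define \<nu> where "\<nu> = distr M borel (\<lambda>t. (decompactify (X t), decompactify (Y t)))"
  have Dm: "(\<lambda>t. (decompactify (X t), decompactify (Y t))) \<in> borel_measurable M" by measurable
  have \<nu>: "borel_law2 \<nu>"
    unfolding borel_law2_def \<nu>_def using M.prob_space_distr[OF Dm] by simp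
  have f1: "(\<lambda>p. 1 / (z - complex_of_real (fst p))) \<in> borel_measurable (borel :: (real \<times> real) measure)"
    "(\<lambda>p. 1 / (z - complex_of_real (snd p))) \<in> borel_measurable (borel :: (real \<times> real) measure)" for z
    unfolding borel_prod[symmetric] by measurable
  have m1: "(\<lambda>t. ckernel z (X t)) \<in> borel_measurable M" "(\<lambda>t. ckernel z (Y t)) \<in> borel_measurable M" if "Im z \<noteq> 0" for z
    using ck[OF that] by (simp_all add: borel_measurable_continuous_onI)
  show ?thesis
  proof (rule that[OF r \<nu>])
    fix z w assume z: "Im z \<noteq> 0" and w: "Im w \<noteq> 0"
    have b: "cmod (ckernel z (X t) * ckernel w (Y t)) \<le> 1 / \<bar>Im z\<bar> * (1 / \<bar>Im w\<bar>)" for t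
      unfolding norm_mult by (intro mult_mono ckernel_bound z w) auto
    have c: "continuous_on UNIV (\<lambda>t. ckernel z (X t) * ckernel w (Y t))" by (intro continuous_intros ck z w)
    have "(LINT t|m n. ckernel z (X t) * ckernel w (Y t)) = cauchy_transform2 (\<Lambda> n) z w" for n
      unfolding int[OF c] cauchy_transform2_def unfolding X_def Y_def \<psi> ckernel_compactify by simp
    then have "(\<lambda>n. cauchy_transform2 (\<Lambda> (r n)) z w) \<longlonglongrightarrow> (LINT t|M. ckernel z (X t) * ckernel w (Y t))"
      using lim[OF c b] by simp
    also have "(LINT t|M. ckernel z (X t) * ckernel w (Y t)) = cauchy_transform2 \<nu> z w"
    proof -
      have fm: "(\<lambda>p. 1 / ((z - complex_of_real (fst p)) * (w - complex_of_real (snd p)))) \<in> borel_measurable (borel :: (real \<times> real) measure)"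
        unfolding borel_prod[symmetric] by measurable
      have "cauchy_transform2 \<nu> z w = (LINT t|M. 1 / ((z - of_real (decompactify (X t))) * (w - of_real (decompactify (Y t)))))"
        unfolding cauchy_transform2_def \<nu>_def by (subst integral_distr[OF Dm fm]) simp
      also have "\<dots> = (LINT t|M. ckernel z (X t) * ckernel w (Y t))"
      proof (rule integral_cong_AE)
        show "AE t in M. 1 / ((z - of_real (decompactify (X t))) * (w - of_real (decompactify (Y t)))) = ckernel z (X t) * ckernel w (Y t)"
          using ae1 ae2 by eventually_elim (simp add: ckernel_decompactify)
      qed (use m1 z w in measurable)
      finally show ?thesis by simp
    qed
    finally show "(\<lambda>n. cauchy_transform2 (\<Lambda> (r n)) z w) \<longlonglongrightarrow> cauchy_transform2 \<nu> z w" .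
  next
    fix z assume z: "Im z \<noteq> 0"
    have "cauchy_transform (marginal1 \<nu>) z = (LINT t|M. 1 / (z - of_real (decompactify (X t))))"
      unfolding marg(1)[OF \<nu>] unfolding \<nu>_def by (subst integral_distr[OF Dm f1(1)]) simp
    also have "\<dots> = (LINT t|M. ckernel z (X t))"
    proof (rule integral_cong_AE)
      show "AE t in M. 1 / (z - of_real (decompactify (X t))) = ckernel z (X t)"
        using ae1 by eventually_elim (simp add: ckernel_decompactify)
    qed (use m1 z in measurable)
    finally show "cauchy_transform (marginal1 \<nu>) z = cauchy_transform q1 z" using E1[OF z] by simp
  next
    fix z assume z: "Im z \<noteq> 0"
    have "cauchy_transform (marginal2 \<nu>) z = (LINT t|M. 1 / (z - of_real (decompactify (Y t))))"
      unfolding marg(2)[OF \<nu>] unfolding \<nu>_def by (subst integral_distr[OF Dm f1(2)]) simp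
    also have "\<dots> = (LINT t|M. ckernel z (Y t))"
    proof (rule integral_cong_AE)
      show "AE t in M. 1 / (z - of_real (decompactify (Y t))) = ckernel z (Y t)"
        using ae2 by eventually_elim (simp add: ckernel_decompactify)
    qed (use m1 z in measurable)
    finally show "cauchy_transform (marginal2 \<nu>) z = cauchy_transform q2 z" using E2[OF z] by simp
  qed
qed

section \<open>Asymptotics along the imaginary axis and the marginals\<close>

lemma (in real_distribution) cauchy_axis_limit:
  "((\<lambda>y. \<i> * of_real y * cauchy_transform M (\<i> * of_real y)) \<longlongrightarrow> 1) at_top"
proof (rule tendsto_at_topI_sequentially)
  fix X :: "nat \<Rightarrow> real" assume X: "filterlim X at_top sequentially"
  show "(\<lambda>n. \<i> * of_real (X n) * cauchy_transform M (\<i> * of_real (X n))) \<longlonglongrightarrow> 1"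
  proof (rule cauchy_times_limit[where C = 1])
    show "filterlim (\<lambda>n. \<i> * complex_of_real (X n)) at_infinity sequentially"
      unfolding filterlim_at_infinity_conv_norm_at_top norm_mult norm_of_real
      using filterlim_compose[OF filterlim_abs_real X] by simp
  qed (simp add: norm_mult)
qed

lemma (in real_distribution) rvariance_axis_limit:
  "((\<lambda>y. rvariance M (\<i> * of_real y)) \<longlongrightarrow> 0) at_top"
proof -
  have "((\<lambda>y. Re (1 / (\<i> * of_real y * cauchy_transform M (\<i> * of_real y))) - 1) \<longlongrightarrow> Re (1 / 1) - 1) at_top"
    by (intro tendsto_intros cauchy_axis_limit) simp
  moreover have "eventually (\<lambda>y. Re (1 / (\<i> * of_real y * cauchy_transform M (\<i> * of_real y))) - 1 = rvariance M (\<i> * of_real y)) at_top"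
    using eventually_gt_at_top[of 0]
  proof eventually_elim
    case (elim y)
    have "1 / (\<i> * of_real y * cauchy_transform M (\<i> * of_real y)) = rcauchy M (\<i> * of_real y) / (\<i> * of_real y)"
      by (simp add: rcauchy_def mult.commute)
    then show ?case using elim by (simp add: rvariance_def Re_divide power2_eq_square)
  qed
  ultimately show ?thesis by (simp add: Lim_transform_eventually)
qed

lemma cauchy_transform2_axis_limit:
  assumes L: "borel_law2 \<nu>" and z: "Im z \<noteq> 0"
  shows "((\<lambda>y. \<i> * of_real y * cauchy_transform2 \<nu> z (\<i> * of_real y)) \<longlongrightarrow> cauchy_transform (marginal1 \<nu>) z) at_top"
    "((\<lambda>y. \<i> * of_real y * cauchy_transform2 \<nu> (\<i> * of_real y) z) \<longlongrightarrow> cauchy_transform (marginal2 \<nu>) z) at_top"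
proof -
  interpret real_pair \<nu> fst snd by (rule borel_law2_real_pair[OF L])
  have Z: "filterlim (\<lambda>n. \<i> * complex_of_real (X n)) at_infinity sequentially" if "filterlim X at_top sequentially" for X
    unfolding filterlim_at_infinity_conv_norm_at_top norm_mult norm_of_real
    using filterlim_compose[OF filterlim_abs_real that] by simp
  show "((\<lambda>y. \<i> * of_real y * cauchy_transform2 \<nu> z (\<i> * of_real y)) \<longlongrightarrow> cauchy_transform (marginal1 \<nu>) z) at_top"
  proof (rule tendsto_at_topI_sequentially)
    fix X :: "nat \<Rightarrow> real" assume X: "filterlim X at_top sequentially"
    have "cauchy_transform (marginal1 \<nu>) z = (LINT p|\<nu>. 1 / (z - of_real (fst p)))"
      unfolding real_pair_G(1)[OF L, symmetric] A.G_def wct_def ..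
    then show "(\<lambda>n. \<i> * of_real (X n) * cauchy_transform2 \<nu> z (\<i> * of_real (X n))) \<longlonglongrightarrow> cauchy_transform (marginal1 \<nu>) z"
      using weighted_variable.wct_nontangential_limit[OF law_weight1[OF L z] Z[OF X], where C = 1]
      by (simp add: cauchy_transform2_wct(1)[OF L] norm_mult)
  qed
  show "((\<lambda>y. \<i> * of_real y * cauchy_transform2 \<nu> (\<i> * of_real y) z) \<longlongrightarrow> cauchy_transform (marginal2 \<nu>) z) at_top"
  proof (rule tendsto_at_topI_sequentially)
    fix X :: "nat \<Rightarrow> real" assume X: "filterlim X at_top sequentially"
    have "cauchy_transform (marginal2 \<nu>) z = (LINT p|\<nu>. 1 / (z - of_real (snd p)))"
      unfolding real_pair_G(2)[OF L, symmetric] B.G_def wct_def ..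
    then show "(\<lambda>n. \<i> * of_real (X n) * cauchy_transform2 \<nu> (\<i> * of_real (X n)) z) \<longlonglongrightarrow> cauchy_transform (marginal2 \<nu>) z"
      using weighted_variable.wct_nontangential_limit[OF law_weight2[OF L z] Z[OF X], where C = 1]
      by (simp add: cauchy_transform2_wct(2)[OF L] norm_mult)
  qed
qed

context plane_transform
begin

lemma H_axis_shift_limit:
  assumes \<epsilon>: "\<epsilon> > 0" and z: "Im z \<noteq> 0"
  shows "((\<lambda>y. \<i> * of_real y * H z (\<i> * of_real (y + \<epsilon>))) \<longlongrightarrow> cauchy_transform p1 z) at_top"
    "((\<lambda>y. \<i> * of_real y * H (\<i> * of_real (y + \<epsilon>)) z) \<longlongrightarrow> cauchy_transform p2 z) at_top"
proof -
  have sh: "filterlim (\<lambda>y. y + \<epsilon>) at_top at_top" by real_asymp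
  have q: "((\<lambda>y. complex_of_real (y / (y + \<epsilon>))) \<longlongrightarrow> of_real 1) at_top"
    by (intro tendsto_of_real) real_asymp
  have ev: "eventually (\<lambda>y. of_real (y / (y + \<epsilon>)) * (\<i> * of_real (y + \<epsilon>) * v y) = \<i> * of_real y * v y) at_top" for v :: "real \<Rightarrow> complex"
    using eventually_gt_at_top[of 0]
  proof eventually_elim
    case (elim y)
    then have "complex_of_real (y + \<epsilon>) \<noteq> 0" using \<epsilon> by (simp only: of_real_eq_0_iff)
    then show ?case by (simp add: of_real_divide del: of_real_add)
  qed
  show "((\<lambda>y. \<i> * of_real y * H z (\<i> * of_real (y + \<epsilon>))) \<longlongrightarrow> cauchy_transform p1 z) at_top"
    by (rule Lim_transform_eventually[OF _ ev])
      (use tendsto_mult[OF q filterlim_compose[OF H_lim1[OF z] sh]] in simp)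
  show "((\<lambda>y. \<i> * of_real y * H (\<i> * of_real (y + \<epsilon>)) z) \<longlongrightarrow> cauchy_transform p2 z) at_top"
    by (rule Lim_transform_eventually[OF _ ev])
      (use tendsto_mult[OF q filterlim_compose[OF H_lim2[OF z] sh]] in simp)
qed

lemma law_marginals:
  assumes \<epsilon>: "\<epsilon> > 0" and z: "Im z \<noteq> 0"
  shows "cauchy_transform (marginal1 (law \<epsilon>)) z = cauchy_transform p1 (shift \<epsilon> z)"
    "cauchy_transform (marginal2 (law \<epsilon>)) z = cauchy_transform p2 (shift \<epsilon> z)"
proof -
  note L = borel_law2_law[OF \<epsilon>]
  have z': "Im (shift \<epsilon> z) \<noteq> 0" using \<epsilon> z by (intro shift_nonreal) auto
  have sy: "shift \<epsilon> (\<i> * of_real y) = \<i> * of_real (y + \<epsilon>)" if "y > 0" for y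
    using that by (simp add: shift_def complex_eq_iff)
  have "((\<lambda>y. \<i> * of_real y * cauchy_transform2 (law \<epsilon>) z (\<i> * of_real y)) \<longlongrightarrow> cauchy_transform p1 (shift \<epsilon> z)) at_top"
  proof (rule Lim_transform_eventually[OF H_axis_shift_limit(1)[OF \<epsilon> z']])
    show "eventually (\<lambda>y. \<i> * of_real y * H (shift \<epsilon> z) (\<i> * of_real (y + \<epsilon>)) = \<i> * of_real y * cauchy_transform2 (law \<epsilon>) z (\<i> * of_real y)) at_top"
      using eventually_gt_at_top[of 0]
      by eventually_elim (subst law_cauchy_transform[OF \<epsilon> z]; simp add: sy del: of_real_add)
  qed
  then show "cauchy_transform (marginal1 (law \<epsilon>)) z = cauchy_transform p1 (shift \<epsilon> z)"
    using cauchy_transform2_axis_limit(1)[OF L z] by (intro tendsto_unique[OF trivial_limit_at_top_linorder])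
  have "((\<lambda>y. \<i> * of_real y * cauchy_transform2 (law \<epsilon>) (\<i> * of_real y) z) \<longlongrightarrow> cauchy_transform p2 (shift \<epsilon> z)) at_top"
  proof (rule Lim_transform_eventually[OF H_axis_shift_limit(2)[OF \<epsilon> z']])
    show "eventually (\<lambda>y. \<i> * of_real y * H (\<i> * of_real (y + \<epsilon>)) (shift \<epsilon> z) = \<i> * of_real y * cauchy_transform2 (law \<epsilon>) (\<i> * of_real y) z) at_top"
      using eventually_gt_at_top[of 0]
      by eventually_elim (subst law_cauchy_transform[OF \<epsilon> _ z]; simp add: sy del: of_real_add)
  qed
  then show "cauchy_transform (marginal2 (law \<epsilon>)) z = cauchy_transform p2 (shift \<epsilon> z)"
    using cauchy_transform2_axis_limit(2)[OF L z] by (intro tendsto_unique[OF trivial_limit_at_top_linorder])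
qed

text \<open>Compactness undoes the shift: as \<epsilon> tends to 0 the marginal transforms of
  \<open>law \<epsilon>\<close> converge to those of p1 and p2, and joint continuity of H identifies
  the transform of the limit.\<close>

theorem plane_transform_law:
  obtains \<nu> where "borel_law2 \<nu>"
    "\<And>z w. Im z \<noteq> 0 \<Longrightarrow> Im w \<noteq> 0 \<Longrightarrow> cauchy_transform2 \<nu> z w = H z w"
    "\<And>z. Im z \<noteq> 0 \<Longrightarrow> cauchy_transform (marginal1 \<nu>) z = cauchy_transform p1 z"
    "\<And>z. Im z \<noteq> 0 \<Longrightarrow> cauchy_transform (marginal2 \<nu>) z = cauchy_transform p2 z"
proof -
  define e where "e = (\<lambda>n. 1 / real (Suc n))"
  have e: "e n > 0" for n by (simp add: e_def)
  have e0: "e \<longlonglongrightarrow> 0" unfolding e_def by real_asymp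
  have sh: "(\<lambda>n. shift (e n) z) \<longlonglongrightarrow> z" for z
  proof -
    have "(\<lambda>n. z + \<i> * of_real (e n * sgn (Im z))) \<longlonglongrightarrow> z + \<i> * of_real (0 * sgn (Im z))"
      by (intro tendsto_intros e0)
    moreover have "shift (e n) z = z + \<i> * of_real (e n * sgn (Im z))" for n by (simp add: shift_def complex_eq_iff)
    ultimately show ?thesis by simp
  qed
  have nr: "Im (shift (e n) z) \<noteq> 0" if "Im z \<noteq> 0" for n z
    by (rule shift_nonreal(2)[OF less_imp_le[OF e] that])
  have lim1: "(\<lambda>n. cauchy_transform (marginal1 (law (e n))) z) \<longlonglongrightarrow> cauchy_transform p1 z" if z: "Im z \<noteq> 0" for z
    unfolding law_marginals[OF e z]
    by (rule continuous_on_tendsto_compose[OF holomorphic_on_imp_continuous_on[OF p1.cauchy_holomorphic] sh])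
      (use z nr in auto)
  have lim2: "(\<lambda>n. cauchy_transform (marginal2 (law (e n))) z) \<longlonglongrightarrow> cauchy_transform p2 z" if z: "Im z \<noteq> 0" for z
    unfolding law_marginals[OF e z]
    by (rule continuous_on_tendsto_compose[OF holomorphic_on_imp_continuous_on[OF p2.cauchy_holomorphic] sh])
      (use z nr in auto)
  obtain r \<nu> where r: "strict_mono r" and \<nu>: "borel_law2 \<nu>"
    and G: "\<And>z w. Im z \<noteq> 0 \<Longrightarrow> Im w \<noteq> 0 \<Longrightarrow> (\<lambda>n. cauchy_transform2 (law (e (r n))) z w) \<longlonglongrightarrow> cauchy_transform2 \<nu> z w"
    and m: "\<And>z. Im z \<noteq> 0 \<Longrightarrow> cauchy_transform (marginal1 \<nu>) z = cauchy_transform p1 z"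
      "\<And>z. Im z \<noteq> 0 \<Longrightarrow> cauchy_transform (marginal2 \<nu>) z = cauchy_transform p2 z"
    by (rule law2_compactness[OF borel_law2_law[OF e] rd1 rd2 lim1 lim2], assumption, assumption, rule that)
  show ?thesis
  proof (rule that[OF \<nu> _ m])
    fix z w assume z: "Im z \<noteq> 0" and w: "Im w \<noteq> 0"
    have "(\<lambda>n. H (shift (e n) z) (shift (e n) w)) \<longlonglongrightarrow> H z w"
      using continuous_on_tendsto_compose[OF sep.jointly_continuous tendsto_Pair[OF sh[of z] sh[of w]]] z w nr by simp
    then have "(\<lambda>n. cauchy_transform2 (law (e n)) z w) \<longlonglongrightarrow> H z w"
      unfolding law_cauchy_transform[OF e z w] .
    from LIMSEQ_subseq_LIMSEQ[OF this r] show "cauchy_transform2 \<nu> z w = H z w"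
      using G[OF z w] by (auto simp: comp_def intro: LIMSEQ_unique)
  qed
qed

end

context bifree_power
begin

text \<open>In \<open>c_le\<close> one factor is below 1. The other is 1 - Im z / Im u, with u
  subordinated to the point z on the axis, and tends to 0 together with the variance of the
  power.\<close>

lemma c_axis_limit:
  assumes z: "Im z \<noteq> 0"
  shows "((\<lambda>y. c z (\<i> * of_real y)) \<longlongrightarrow> 0) at_top" "((\<lambda>y. c (\<i> * of_real y) z) \<longlongrightarrow> 0) at_top"
proof -
  have v0: "((\<lambda>y. sqrt (1 - 1 / (1 + (1 - 1 / real k) * rvariance p (\<i> * of_real y)))) \<longlongrightarrow> sqrt (1 - 1 / (1 + (1 - 1 / real k) * 0))) at_top"
    if "real_distribution p" for p
    by (intro tendsto_intros real_distribution.rvariance_axis_limit[OF that]) simp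
  have v: "(real k - 1) * rvariance m (subord k p (\<i> * of_real y)) = 1 - 1 / (1 + (1 - 1 / real k) * rvariance p (\<i> * of_real y))"
    if "real_distribution m" "real_distribution p" "y > 0"
      "cauchy_transform m (subord k p (\<i> * of_real y)) = cauchy_transform p (\<i> * of_real y)" for m p y
  proof -
    have y0: "Im (\<i> * of_real y) \<noteq> 0" using that by simp
    have "(real k - 1) * rvariance m (subord k p (\<i> * of_real y)) = 1 - Im (\<i> * of_real y) / Im (subord k p (\<i> * of_real y))"
      using subord_variance(1)[OF that(1,2) y0 that(4)] by linarith
    then show ?thesis unfolding subord_Im(1)[OF that(2) k1 y0] using that(3) by simp
  qed
  have key: "cmod u \<le> sqrt Y" if "((real k - 1) * cmod u)\<^sup>2 \<le> X * Y" "0 \<le> X" "X < 1" "0 \<le> Y" for u X Y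
  proof -
    have "(cmod u)\<^sup>2 \<le> ((real k - 1) * cmod u)\<^sup>2"
      using k mult_right_mono[of 1 "real k - 1" "cmod u"] by (intro power_mono) auto
    also have "\<dots> \<le> X * Y" by fact
    also have "\<dots> \<le> 1 * Y" using that by (intro mult_right_mono) auto
    finally show ?thesis by (simp add: real_le_rsqrt)
  qed
  show "((\<lambda>y. c z (\<i> * of_real y)) \<longlongrightarrow> 0) at_top"
  proof (rule Lim_null_comparison)
    show "eventually (\<lambda>y. cmod (c z (\<i> * of_real y)) \<le> sqrt (1 - 1 / (1 + (1 - 1 / real k) * rvariance p2 (\<i> * of_real y)))) at_top"
      using eventually_gt_at_top[of 0]
    proof eventually_elim
      case (elim y)
      then have y0: "Im (\<i> * of_real y) \<noteq> 0" by simp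
      show ?case
        unfolding v[OF m2.real_distribution_axioms rd2 elim subordination2[OF y0], symmetric]
        by (rule key[OF c_le[OF z y0]]) (use variance1[OF z z] variance2[OF y0 y0] in auto)
    qed
  qed (use v0[OF rd2] in simp)
  show "((\<lambda>y. c (\<i> * of_real y) z) \<longlongrightarrow> 0) at_top"
  proof (rule Lim_null_comparison)
    show "eventually (\<lambda>y. cmod (c (\<i> * of_real y) z) \<le> sqrt (1 - 1 / (1 + (1 - 1 / real k) * rvariance p1 (\<i> * of_real y)))) at_top"
      using eventually_gt_at_top[of 0]
    proof eventually_elim
      case (elim y)
      then have y0: "Im (\<i> * of_real y) \<noteq> 0" by simp
      show ?case
        unfolding v[OF m1.real_distribution_axioms rd1 elim subordination1[OF y0], symmetric]
        by (rule key[OF c_le[OF y0 z, unfolded mult.commute[of "(real k - 1) * rvariance (marginal1 \<mu>) _"]]])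
          (use variance2[OF z z] variance1[OF y0 y0] in auto)
    qed
  qed (use v0[OF rd1] in simp)
qed

sublocale plane_transform H 2 p1 p2
proof unfold_locales
  fix z :: complex assume z: "Im z \<noteq> 0"
  have "((\<lambda>y. cauchy_transform p1 z * (\<i> * of_real y * cauchy_transform p2 (\<i> * of_real y))
      * ((1 + c z (\<i> * of_real y)) / (1 - of_real (real k - 1) * c z (\<i> * of_real y))))
    \<longlongrightarrow> cauchy_transform p1 z * 1 * ((1 + 0) / (1 - of_real (real k - 1) * 0))) at_top"
    by (intro tendsto_intros p2.cauchy_axis_limit c_axis_limit z) simp
  then show "((\<lambda>y. \<i> * of_real y * H z (\<i> * of_real y)) \<longlongrightarrow> cauchy_transform p1 z) at_top"
    by (simp add: H_def mult_ac)
  have "((\<lambda>y. (\<i> * of_real y * cauchy_transform p1 (\<i> * of_real y)) * cauchy_transform p2 z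
      * ((1 + c (\<i> * of_real y) z) / (1 - of_real (real k - 1) * c (\<i> * of_real y) z)))
    \<longlongrightarrow> 1 * cauchy_transform p2 z * ((1 + 0) / (1 - of_real (real k - 1) * 0))) at_top"
    by (intro tendsto_intros p1.cauchy_axis_limit c_axis_limit z) simp
  then show "((\<lambda>y. \<i> * of_real y * H (\<i> * of_real y) z) \<longlongrightarrow> cauchy_transform p2 z) at_top"
    by (simp add: H_def mult_ac)
qed (use H_norm_le H_cnj H_holomorphic1 H_holomorphic2 H_nonneg rd1 rd2 in auto)

end

lemma (in real_distribution) rvariance_cnj: "rvariance M (cnj z) = rvariance M z"
  by (simp add: rvariance_def rcauchy_cnj)

lemma weak_conv_cauchy_transform:
  assumes "\<And>n. real_distribution (p n)" "real_distribution q" "weak_conv_m p q" and z: "Im z \<noteq> 0"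
  shows "(\<lambda>n. cauchy_transform (p n) z) \<longlonglongrightarrow> cauchy_transform q z"
  unfolding cauchy_transform_def
proof (rule weak_conv_imp_integral_bdd_continuous_conv[OF assms(1-3)])
  show "isCont (\<lambda>x. 1 / (z - complex_of_real x)) x" for x
    using diff_of_real_nonzero[OF z, of x] by (intro continuous_intros) auto
  show "cmod (1 / (z - of_real x)) \<le> 1 / \<bar>Im z\<bar>" for x
    by (rule norm_divide_diff_of_real_le[OF z]) simp
qed

section \<open>Uniform inversion of reciprocal Cauchy transforms\<close>

text \<open>Harnack and the displacement estimate, started from one reference point w. For z in the
  cone at height at least \<delta>, Im w / Im z is at most b / \<delta> and |z - w| / Im z at most L
  + b / \<delta>, which explains C1. The factor |z - w| grows linearly in |z|, so the displacement
  is bounded relative to |z|. The lower half-plane follows by conjugation.\<close>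

lemma (in real_distribution) cone_estimate:
  fixes k b \<delta> L :: real
  assumes k: "k > 0" and w: "1 \<le> Im w" "cmod w \<le> b" and v: "rvariance M w \<le> b / k"
    and E: "cmod (rcauchy M w - w) \<le> b / k"
    and z: "\<delta> > 0" "\<delta> \<le> \<bar>Im z\<bar>" "cmod z \<le> L * \<bar>Im z\<bar>"
  defines "C1 \<equiv> 2 * (b / \<delta> + (L + b / \<delta>)\<^sup>2) * b"
  shows "rvariance M z \<le> C1 / k" "cmod (rcauchy M z - z) \<le> (b / \<delta> + (1 + b / \<delta>) * (C1 + b)) / k * cmod z"
proof -
  have "rvariance M z \<le> C1 / k \<and> cmod (rcauchy M z - z) \<le> (b / \<delta> + (1 + b / \<delta>) * (C1 + b)) / k * cmod z"
    if z: "\<delta> \<le> Im z" "cmod z \<le> L * Im z" for z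
  proof -
    have y: "Im z > 0" using z \<open>\<delta> > 0\<close> by linarith
    have w0: "Im w > 0" using w by linarith
    have b: "b \<ge> 1" using w abs_Im_le_cmod[of w] by linarith
    have d: "cmod (z - w) \<le> cmod z + b" using norm_triangle_ineq4[of z w] w by linarith
    have by': "b / Im z \<le> b / \<delta>" using z \<open>\<delta> > 0\<close> y b by (intro divide_left_mono) auto
    have "cmod (z - w) / Im z \<le> (cmod z + b) / Im z" using d y by (intro divide_right_mono) auto
    also have "\<dots> \<le> L + b / \<delta>" using z(2) y by' by (simp add: add_divide_distrib pos_divide_le_eq[symmetric] add_mono)
    finally have q: "cmod (z - w) / Im z \<le> L + b / \<delta>" .
    have vw0: "rvariance M w \<ge> 0" by (rule rvariance_nonneg) (use w0 in simp)
    have vz0: "rvariance M z \<ge> 0" by (rule rvariance_nonneg) (use y in simp)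
    have "Im z * rvariance M z \<le> 2 * (Im w + (cmod (z - w))\<^sup>2 / Im z) * rvariance M w"
      by (rule rvariance_Harnack[OF y w0])
    then have "rvariance M z \<le> 2 * (Im w + (cmod (z - w))\<^sup>2 / Im z) * rvariance M w / Im z"
      using y by (simp add: pos_le_divide_eq mult.commute)
    also have "\<dots> = 2 * (Im w / Im z + (cmod (z - w) / Im z)\<^sup>2) * rvariance M w"
      using y by (simp add: field_simps power2_eq_square)
    also have "\<dots> \<le> 2 * (b / \<delta> + (L + b / \<delta>)\<^sup>2) * (b / k)"
    proof (intro mult_mono mult_left_mono add_mono power_mono q v)
      have "Im w \<le> b" using w(2) abs_Im_le_cmod[of w] by linarith
      then have "Im w / Im z \<le> b / Im z" using y by (intro divide_right_mono) auto
      then show "Im w / Im z \<le> b / \<delta>" using by' by linarith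
    qed (use y w0 b \<open>\<delta> > 0\<close> vw0 in \<open>auto intro!: add_nonneg_nonneg\<close>)
    finally have v1: "rvariance M z \<le> C1 / k" by (simp add: C1_def)
    have C1: "C1 \<ge> 0" unfolding C1_def using b \<open>\<delta> > 0\<close> by (intro mult_nonneg_nonneg add_nonneg_nonneg) auto
    have "sqrt (rvariance M z * rvariance M w) \<le> (rvariance M z + rvariance M w) / 2"
      by (rule arith_geo_mean_sqrt[OF vz0 vw0])
    also have "\<dots> \<le> rvariance M z + rvariance M w" using vz0 vw0 by simp
    also have "\<dots> \<le> (C1 + b) / k" using v1 v by (simp add: add_divide_distrib)
    finally have sq: "sqrt (rvariance M z * rvariance M w) \<le> (C1 + b) / k" .
    have zn: "cmod z \<ge> \<delta>" using z(1) abs_Im_le_cmod[of z] by linarith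
    have "\<delta> * b \<le> b * cmod z" using zn b by (simp add: mult.commute mult_left_mono)
    then have bz: "b \<le> b / \<delta> * cmod z" using \<open>\<delta> > 0\<close> by (simp add: field_simps)
    have "cmod (rcauchy M z - z) \<le> cmod (rcauchy M w - w) + cmod ((rcauchy M z - z) - (rcauchy M w - w))"
      by (rule norm_triangle_sub)
    also have "\<dots> \<le> b / k + cmod (z - w) * sqrt (rvariance M z * rvariance M w)"
      using y w0 by (intro add_mono E rcauchy_displacement_diff) auto
    also have "\<dots> \<le> (b / \<delta> * cmod z) / k + ((1 + b / \<delta>) * cmod z) * ((C1 + b) / k)"
    proof (intro add_mono mult_mono sq divide_right_mono bz)
      show "cmod (z - w) \<le> (1 + b / \<delta>) * cmod z" using d bz by (simp add: algebra_simps)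
    qed (use k vz0 vw0 \<open>\<delta> > 0\<close> b in auto)
    also have "\<dots> = (b / \<delta> + (1 + b / \<delta>) * (C1 + b)) / k * cmod z"
      by (simp add: add_divide_distrib algebra_simps)
    finally show ?thesis using v1 by simp
  qed
  note up = this
  show "rvariance M z \<le> C1 / k" "cmod (rcauchy M z - z) \<le> (b / \<delta> + (1 + b / \<delta>) * (C1 + b)) / k * cmod z"
    using up[of z] up[of "cnj z"] z complex_mod_cnj[of "rcauchy M z - z"]
    by (cases "Im z > 0"; simp add: rvariance_cnj rcauchy_cnj)+
qed

text \<open>
  Only boundedness of the reciprocal Cauchy transforms of the convolution powers at one point is
  used: Harnack's inequality spreads it to whole cones, up to infinity.
\<close>

lemma conv_power_cone_estimate:
  fixes m p :: "nat \<Rightarrow> real measure" and k :: "nat \<Rightarrow> nat"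
  assumes conv: "\<And>n. is_free_conv_power (m n) (k n) (p n)" and q: "real_distribution q" "weak_conv_m p q"
    and \<delta>: "\<delta> > 0"
  obtains C where "C > 0"
    "\<And>n z. k n \<ge> 2 \<Longrightarrow> \<delta> \<le> \<bar>Im z\<bar> \<Longrightarrow> cmod z \<le> L * \<bar>Im z\<bar> \<Longrightarrow> rvariance (m n) z \<le> C / real (k n)"
    "\<And>n z. k n \<ge> 2 \<Longrightarrow> \<delta> \<le> \<bar>Im z\<bar> \<Longrightarrow> cmod z \<le> L * \<bar>Im z\<bar> \<Longrightarrow> cmod (rcauchy (m n) z - z) \<le> C / real (k n) * cmod z"
proof -
  have m: "real_distribution (m n)" and p: "real_distribution (p n)" for n
    using free_conv_power_R_transform[OF conv[of n]] by simp_all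
  have "(\<lambda>n. rcauchy (p n) \<i>) \<longlonglongrightarrow> rcauchy q \<i>"
    unfolding rcauchy_def using real_distribution.cauchy_nonzero[OF q(1), of \<i>]
    by (intro tendsto_intros weak_conv_cauchy_transform p q) auto
  then have "Bseq (\<lambda>n. rcauchy (p n) \<i>)" by (intro convergent_imp_Bseq convergentI)
  then obtain B where B: "B > 0" "\<And>n. cmod (rcauchy (p n) \<i>) \<le> B" by (auto simp: Bseq_def)
  define b where "b = 1 + B"
  define C1 where "C1 = 2 * (b / \<delta> + (L + b / \<delta>)\<^sup>2) * b"
  define C2 where "C2 = b / \<delta> + (1 + b / \<delta>) * (C1 + b)"
  have b: "b \<ge> 1" using B by (simp add: b_def)
  have C1: "C1 \<ge> 0" unfolding C1_def using b \<delta> by (intro mult_nonneg_nonneg add_nonneg_nonneg) auto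
  have C2: "C2 > 0" unfolding C2_def using b \<delta> C1 by (intro add_pos_nonneg divide_pos_pos mult_nonneg_nonneg) auto
  have main: "rvariance (m n) z \<le> C1 / real (k n) \<and> cmod (rcauchy (m n) z - z) \<le> C2 / real (k n) * cmod z"
    if k: "k n \<ge> 2" and z: "\<delta> \<le> \<bar>Im z\<bar>" "cmod z \<le> L * \<bar>Im z\<bar>" for n z
  proof -
    interpret real_distribution "m n" by (rule m)
    \<comment> \<open>The reference point. There F of the base law equals F of the power at i, and k
      (F(w) - w) = F(i) - i: a bounded value for the power becomes a displacement of order 1 / k for
      the base law.\<close>
    define w where "w = subord (k n) (p n) \<i>"
    have k1: "k n \<ge> 1" "real (k n) > 0" using k by auto
    have Imw: "1 \<le> Im w"
      using subord_Im(3,4)[OF p[of n] k1(1), of \<i>] by (simp add: w_def)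
    have Fw: "rcauchy (m n) w = rcauchy (p n) \<i>"
      unfolding rcauchy_def w_def using free_conv_power_subordination[OF conv k, of \<i>] by simp
    have kw: "of_nat (k n) * (rcauchy (m n) w - w) = rcauchy (p n) \<i> - \<i>"
    proof -
      have "of_nat (k n) * w = \<i> + (of_nat (k n) - 1) * rcauchy (p n) \<i>"
        using k1 by (simp add: w_def subord_def)
      then show ?thesis unfolding Fw right_diff_distrib by (simp add: algebra_simps)
    qed
    have "real (k n) * cmod (rcauchy (m n) w - w) = cmod (rcauchy (p n) \<i> - \<i>)"
      unfolding kw[symmetric] by (simp add: norm_mult)
    also have "\<dots> \<le> b" using norm_triangle_ineq4[of "rcauchy (p n) \<i>" \<i>] B(2)[of n] by (simp add: b_def)
    finally have E: "cmod (rcauchy (m n) w - w) \<le> b / real (k n)" using k1 by (simp add: field_simps)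
    have "Im w * rvariance (m n) w = Im (rcauchy (m n) w - w)"
      using Im_rcauchy[of w] Imw by (simp add: algebra_simps)
    also have "\<dots> \<le> b / real (k n)" using E abs_Im_le_cmod[of "rcauchy (m n) w - w"] by linarith
    finally have "Im w * rvariance (m n) w \<le> b / real (k n)" .
    moreover have "1 * rvariance (m n) w \<le> Im w * rvariance (m n) w"
      using Imw rvariance_nonneg[of w] by (intro mult_right_mono) auto
    ultimately have v: "rvariance (m n) w \<le> b / real (k n)" by linarith
    have "cmod w \<le> b"
    proof -
      have "real (k n) * cmod w = cmod (\<i> + (of_nat (k n) - 1) * rcauchy (p n) \<i>)"
        using k1 by (simp add: w_def subord_def norm_divide)
      also have "\<dots> \<le> 1 + cmod (of_nat (k n) - 1) * cmod (rcauchy (p n) \<i>)"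
        using norm_triangle_ineq[of \<i>] by (simp add: norm_mult[symmetric])
      also have "cmod (of_nat (k n) - 1) = real (k n) - 1"
        using k1 by (metis norm_of_nat of_nat_1 of_nat_diff)
      also have "1 + (real (k n) - 1) * cmod (rcauchy (p n) \<i>) \<le> real (k n) + real (k n) * B"
        using k1 B(2)[of n] B(1) by (intro add_mono mult_mono) auto
      also have "\<dots> = real (k n) * b" by (simp add: b_def algebra_simps)
      finally show ?thesis using k1 by simp
    qed
    then show ?thesis
      using cone_estimate[OF k1(2) Imw _ v E \<delta> z] unfolding C1_def C2_def by simp
  qed
  show ?thesis
  proof (rule that[of "C1 + C2"])
    show "C1 + C2 > 0" using C1 C2 by linarith
    fix n z assume a: "k n \<ge> 2" "\<delta> \<le> \<bar>Im z\<bar>" "cmod z \<le> L * \<bar>Im z\<bar>"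
    have "C1 / real (k n) \<le> (C1 + C2) / real (k n)" "C2 / real (k n) \<le> (C1 + C2) / real (k n)"
      using C1 C2 a by (intro divide_right_mono; simp)+
    then show "rvariance (m n) z \<le> (C1 + C2) / real (k n)"
      "cmod (rcauchy (m n) z - z) \<le> (C1 + C2) / real (k n) * cmod z"
      using main[OF a] mult_right_mono[OF \<open>C2 / real (k n) \<le> (C1 + C2) / real (k n)\<close> norm_ge_zero[of z]] by linarith+
  qed
qed

text \<open>Brouwer's theorem for the map z -> \<zeta> - (F(z) - z). It preserves the closed ball of
  radius r |\<zeta>|, because |z| is at most 2 |\<zeta>| there and so the displacement is at most 2
  e |\<zeta>|.\<close>

lemma (in real_distribution) rcauchy_solution:
  assumes r: "0 < r" "r \<le> 1" "2 * e \<le> r" and e: "e \<ge> 0" and \<zeta>: "\<zeta> \<noteq> 0"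
    and E: "\<And>z. cmod (z - \<zeta>) \<le> r * cmod \<zeta> \<Longrightarrow> Im z \<noteq> 0 \<and> cmod (rcauchy M z - z) \<le> e * cmod z"
  obtains z where "rcauchy M z = \<zeta>" "cmod (z - \<zeta>) \<le> 2 * e * cmod \<zeta>" "cmod (z - \<zeta>) \<le> r * cmod \<zeta>"
proof -
  have bound: "cmod (rcauchy M z - z) \<le> 2 * e * cmod \<zeta>" if "cmod (z - \<zeta>) \<le> r * cmod \<zeta>" for z
  proof -
    have "cmod z \<le> cmod \<zeta> + cmod (z - \<zeta>)" by (rule norm_triangle_sub)
    also have "\<dots> \<le> cmod \<zeta> + 1 * cmod \<zeta>" using that r mult_right_mono[of r 1 "cmod \<zeta>"] by simp
    finally have "e * cmod z \<le> e * (2 * cmod \<zeta>)" using e by (intro mult_left_mono) auto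
    then show ?thesis using E[OF that] by simp
  qed
  have b1: "0 < r * cmod \<zeta>" using r \<zeta> by simp
  have "cball \<zeta> (r * cmod \<zeta>) \<subseteq> {z. Im z \<noteq> 0}"
      using E by (auto simp: dist_norm norm_minus_commute)
  then have b2: "continuous_on (cball \<zeta> (r * cmod \<zeta>)) (\<lambda>z. \<zeta> - (rcauchy M z - z))"
      by (intro continuous_intros continuous_on_subset[OF holomorphic_on_imp_continuous_on[OF rcauchy_holomorphic]])
  have b3: "(\<lambda>z. \<zeta> - (rcauchy M z - z)) ` cball \<zeta> (r * cmod \<zeta>) \<subseteq> cball \<zeta> (r * cmod \<zeta>)"
    proof safe
      fix z assume "z \<in> cball \<zeta> (r * cmod \<zeta>)"
      then have "cmod (rcauchy M z - z) \<le> 2 * e * cmod \<zeta>" by (intro bound) (auto simp: dist_norm norm_minus_commute)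
      also have "\<dots> \<le> r * cmod \<zeta>" using r by (intro mult_right_mono) auto
      finally show "\<zeta> - (rcauchy M z - z) \<in> cball \<zeta> (r * cmod \<zeta>)" by (simp add: dist_norm)
    qed
  obtain z where z: "z \<in> cball \<zeta> (r * cmod \<zeta>)" "\<zeta> - (rcauchy M z - z) = z"
    by (rule brouwer_ball[OF b1 b2 b3[unfolded image_subset_iff_funcset]], rule that)
  have zr: "cmod (z - \<zeta>) \<le> r * cmod \<zeta>" using z(1) by (simp add: dist_norm norm_minus_commute)
  have F: "rcauchy M z = \<zeta>" using z(2) by (simp add: algebra_simps)
  then have "cmod (z - \<zeta>) \<le> 2 * e * cmod \<zeta>" using bound[OF zr] by (simp add: norm_minus_commute)
  then show ?thesis using that F zr by blast
qed

text \<open>The modulus of 1/z is at most 1 + \<alpha> times its imaginary part in absolute value,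
  so a relative perturbation by 1 / (2 (1 + \<alpha>)) costs at most half of that imaginary part.
  The lower bound then comes from |z| < (1 + \<alpha>) \<beta>.\<close>

lemma stolz_cone_ball:
  assumes z: "z \<in> stolz_pair \<alpha> \<beta>" and u: "cmod (u - 1 / z) \<le> 1 / (2 * (1 + \<alpha>)) * cmod (1 / z)"
  shows "1 / (2 * (1 + \<alpha>)\<^sup>2 * \<beta>) \<le> \<bar>Im u\<bar>" "cmod u \<le> 4 * (1 + \<alpha>) * \<bar>Im u\<bar>"
proof -
  define \<zeta> where "\<zeta> = 1 / z"
  have pos: "\<alpha> > 0" "\<beta> > 0" "z \<noteq> 0" "Im z \<noteq> 0" using stolz_pair_alpha_pos[OF z] z by (auto simp: stolz_pair_iff)
  have \<zeta>: "cmod \<zeta> \<le> (1 + \<alpha>) * \<bar>Im \<zeta>\<bar>" unfolding \<zeta>_def by (rule norm_inverse_le_Im_inverse[OF z])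
  have "\<bar>Im \<zeta>\<bar> - \<bar>Im u\<bar> \<le> cmod (u - \<zeta>)" using abs_Im_le_cmod[of "u - \<zeta>"] by simp
  also have "\<dots> \<le> 1 / (2 * (1 + \<alpha>)) * ((1 + \<alpha>) * \<bar>Im \<zeta>\<bar>)"
    using u \<zeta> pos by (intro order_trans[OF u[folded \<zeta>_def]] mult_left_mono) auto
  also have "\<dots> = \<bar>Im \<zeta>\<bar> / 2"
  proof -
    have "1 / (2 * c) * (c * a) = a / 2" if "c \<noteq> 0" for a c :: real using that by simp
    then show ?thesis using pos by (metis add_pos_pos less_irrefl zero_less_one)
  qed
  finally have half: "\<bar>Im \<zeta>\<bar> \<le> 2 * \<bar>Im u\<bar>" by (simp add: field_simps)
  have "(1 + \<alpha>) * \<bar>Im z\<bar> < (1 + \<alpha>) * \<beta>"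
    using z pos by (intro mult_strict_left_mono) (auto simp: stolz_pair_iff)
  then have "cmod z < (1 + \<alpha>) * \<beta>" using stolz_pair_norm_le[OF z] by (rule le_less_trans[rotated])
  then have "1 / ((1 + \<alpha>) * \<beta>) \<le> cmod \<zeta>" unfolding \<zeta>_def norm_divide using pos by (auto intro!: divide_left_mono)
  also have "\<dots> \<le> (1 + \<alpha>) * (2 * \<bar>Im u\<bar>)" using \<zeta> half pos mult_left_mono[OF half, of "1 + \<alpha>"] by linarith
  finally have "1 / ((1 + \<alpha>) * \<beta>) / (2 * (1 + \<alpha>)) \<le> \<bar>Im u\<bar>" using pos by (simp add: pos_divide_le_eq mult_ac)
  then show "1 / (2 * (1 + \<alpha>)\<^sup>2 * \<beta>) \<le> \<bar>Im u\<bar>" by (simp add: power2_eq_square mult_ac)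
  have "cmod u \<le> cmod \<zeta> + cmod (u - \<zeta>)" by (rule norm_triangle_sub)
  also have "\<dots> \<le> cmod \<zeta> + 1 * cmod \<zeta>"
  proof -
    have "1 / (2 * (1 + \<alpha>)) * cmod \<zeta> \<le> 1 * cmod \<zeta>" using pos by (intro mult_right_mono) auto
    then show ?thesis using u[folded \<zeta>_def] by linarith
  qed
  also have "\<dots> \<le> 2 * ((1 + \<alpha>) * (2 * \<bar>Im u\<bar>))" using \<zeta> mult_left_mono[OF half, of "1 + \<alpha>"] pos by linarith
  finally show "cmod u \<le> 4 * (1 + \<alpha>) * \<bar>Im u\<bar>" by (simp add: algebra_simps)
qed

text \<open>F is injective on the open set of variance below 1, so it has a holomorphic inverse g
  there, and R(z) = g(1/z) - 1/z. Any R-transform on a smaller pair enters the same set near 0 and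
  hence agrees with R.\<close>

lemma (in real_distribution) R_transform_global:
  assumes sol: "\<And>z. z \<in> stolz_pair \<alpha> \<beta> \<Longrightarrow> \<exists>u. Im u \<noteq> 0 \<and> rvariance M u < 1 \<and> rcauchy M u = 1 / z"
  obtains R where "R holomorphic_on stolz_pair \<alpha> \<beta>"
    "\<And>z. z \<in> stolz_pair \<alpha> \<beta> \<Longrightarrow> Im (1 / z + R z) \<noteq> 0 \<and> rvariance M (1 / z + R z) < 1 \<and> rcauchy M (1 / z + R z) = 1 / z"
    "\<And>\<alpha>' \<beta>' S z. \<alpha>' \<le> \<alpha> \<Longrightarrow> \<beta>' \<le> \<beta> \<Longrightarrow> is_R_transform M \<alpha>' \<beta>' S \<Longrightarrow> z \<in> stolz_pair \<alpha>' \<beta>' \<Longrightarrow> S z = R z"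
proof -
  define V where "V = {u. Im u \<noteq> 0 \<and> rvariance M u < 1}"
  have vc: "continuous_on {u. Im u \<noteq> 0} (rvariance M)"
    unfolding rvariance_def[abs_def]
    by (intro continuous_intros holomorphic_on_imp_continuous_on rcauchy_holomorphic) auto
  have "open ({u. Im u \<noteq> 0} \<inter> rvariance M -` {..<1})"
    by (rule continuous_open_preimage[OF vc open_Im_nonzero]) simp
  moreover have "V = {u. Im u \<noteq> 0} \<inter> rvariance M -` {..<1}" by (auto simp: V_def)
  ultimately have V: "open V" by simp
  have hol: "rcauchy M holomorphic_on V" by (rule holomorphic_on_subset[OF rcauchy_holomorphic]) (auto simp: V_def)
  have inj: "inj_on (rcauchy M) V" by (auto simp: inj_on_def V_def intro: rcauchy_injective)
  obtain g where g: "g holomorphic_on (rcauchy M ` V)" "\<And>u. u \<in> V \<Longrightarrow> g (rcauchy M u) = u"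
    by (rule holomorphic_has_inverse[OF hol V inj], rule that)
  define R where "R = (\<lambda>z. g (1 / z) - 1 / z)"
  have img: "1 / z \<in> rcauchy M ` V" if zS: "z \<in> stolz_pair \<alpha> \<beta>" for z
  proof -
    obtain u where "u \<in> V" "rcauchy M u = 1 / z" using sol[OF zS] by (auto simp: V_def)
    then show ?thesis by (intro image_eqI[of _ _ u]) simp_all
  qed
  have R1: "R holomorphic_on stolz_pair \<alpha> \<beta>"
  proof -
    have i: "(\<lambda>z. 1 / z) holomorphic_on stolz_pair \<alpha> \<beta>"
      by (intro holomorphic_intros) (auto simp: stolz_pair_iff)
    have "(g \<circ> (\<lambda>z. 1 / z)) holomorphic_on stolz_pair \<alpha> \<beta>"
      by (rule holomorphic_on_compose_gen[OF i g(1)]) (use img in auto)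
    then show ?thesis unfolding R_def comp_def by (intro holomorphic_on_diff i)
  qed
  have R2: "Im (1 / z + R z) \<noteq> 0 \<and> rvariance M (1 / z + R z) < 1 \<and> rcauchy M (1 / z + R z) = 1 / z" if zS: "z \<in> stolz_pair \<alpha> \<beta>" for z
  proof -
    obtain u where u: "u \<in> V" "rcauchy M u = 1 / z" using sol[OF zS] by (auto simp: V_def)
    then have "1 / z + R z = u" using g(2)[OF u(1)] by (simp add: R_def)
    then show ?thesis using u by (simp add: V_def)
  qed
  show ?thesis
  proof (rule that[OF R1 R2])
    fix \<alpha>' \<beta>' S z assume le: "\<alpha>' \<le> \<alpha>" "\<beta>' \<le> \<beta>" and S: "is_R_transform M \<alpha>' \<beta>' S" and z: "z \<in> stolz_pair \<alpha>' \<beta>'"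
    have pos: "\<alpha>' > 0" "\<beta>' > 0" using stolz_pair_alpha_pos[OF z] z by (auto simp: stolz_pair_iff)
    obtain \<delta> where \<delta>: "0 < \<delta>" "\<delta> \<le> \<beta>'" "\<And>z. z \<in> stolz_pair \<alpha>' \<delta> \<Longrightarrow> rvariance M (1 / z + S z) < 1"
      by (rule R_transform_rvariance_small[OF S pos], rule that)
    have sub: "stolz_pair \<alpha>' \<beta>' \<subseteq> stolz_pair \<alpha> \<beta>" by (rule stolz_pair_mono[OF le])
    have eq: "S u = R u" if u: "u \<in> stolz_pair \<alpha>' \<delta>" for u
    proof -
      have u': "u \<in> stolz_pair \<alpha>' \<beta>'" using stolz_pair_mono[OF order_refl \<delta>(2)] u by blast
      note r2 = R2[OF subsetD[OF sub u']]
      have "1 / u + S u = 1 / u + R u"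
        by (rule rcauchy_injective[OF R_transform_rcauchy(1)[OF S u'] r2[THEN conjunct1] \<delta>(3)[OF u] r2[THEN conjunct2, THEN conjunct1]])
          (simp only: R_transform_rcauchy(3)[OF S u'] r2)
      then show ?thesis by simp
    qed
    show "S z = R z"
      by (rule stolz_pair_identity[where f = S and g = R, OF _ holomorphic_on_subset[OF R1 sub] pos(1) order_refl \<delta>(1,2) eq z])
        (use S in \<open>auto simp: is_R_transform_def\<close>)
  qed
qed

text \<open>The domain is prescribed and only n is taken large: the points 1/z stay in a cone at
  positive distance from the real axis, where the displacement of F eventually becomes small enough
  for the fixed point argument.\<close>

theorem conv_power_R_transform_global:
  fixes m p :: "nat \<Rightarrow> real measure" and k :: "nat \<Rightarrow> nat"
  assumes conv: "\<And>n. is_free_conv_power (m n) (k n) (p n)" and q: "real_distribution q" "weak_conv_m p q"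
    and k: "filterlim k at_top sequentially" and pos: "\<alpha> > 0" "\<beta> > 0"
  obtains C N R where "C > 0"
    "\<And>n. n \<ge> N \<Longrightarrow> R n holomorphic_on stolz_pair \<alpha> \<beta>"
    "\<And>n z. n \<ge> N \<Longrightarrow> z \<in> stolz_pair \<alpha> \<beta> \<Longrightarrow> Im (1 / z + R n z) \<noteq> 0 \<and> rvariance (m n) (1 / z + R n z) < 1
       \<and> rcauchy (m n) (1 / z + R n z) = 1 / z \<and> rvariance (m n) (1 / z + R n z) \<le> C / real (k n)
       \<and> cmod (z * R n z) \<le> C / real (k n)"
    "\<And>n \<alpha>' \<beta>' S z. n \<ge> N \<Longrightarrow> \<alpha>' \<le> \<alpha> \<Longrightarrow> \<beta>' \<le> \<beta> \<Longrightarrow> is_R_transform (m n) \<alpha>' \<beta>' S \<Longrightarrow> z \<in> stolz_pair \<alpha>' \<beta>' \<Longrightarrow> S z = R n z"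
proof -
  have m: "real_distribution (m n)" for n
    using free_conv_power_R_transform[OF conv[of n]] by simp
  define \<delta> where "\<delta> = 1 / (2 * (1 + \<alpha>)\<^sup>2 * \<beta>)"
  define r where "r = 1 / (2 * (1 + \<alpha>))"
  have \<delta>: "\<delta> > 0" and r: "0 < r" "r \<le> 1" using pos by (auto simp: \<delta>_def r_def)
  obtain C where C: "C > 0"
    and Cv: "\<And>n z. k n \<ge> 2 \<Longrightarrow> \<delta> \<le> \<bar>Im z\<bar> \<Longrightarrow> cmod z \<le> 4 * (1 + \<alpha>) * \<bar>Im z\<bar> \<Longrightarrow> rvariance (m n) z \<le> C / real (k n)"
    and CE: "\<And>n z. k n \<ge> 2 \<Longrightarrow> \<delta> \<le> \<bar>Im z\<bar> \<Longrightarrow> cmod z \<le> 4 * (1 + \<alpha>) * \<bar>Im z\<bar> \<Longrightarrow> cmod (rcauchy (m n) z - z) \<le> C / real (k n) * cmod z"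
    by (rule conv_power_cone_estimate[OF conv q \<delta>], rule that)
  \<comment> \<open>K > C brings the variance below 1, K > 2 C / r gives the inequality 2 e <= r of
    the fixed point argument, and K >= 2 is the range of the cone estimate.\<close>
  obtain K :: nat where K: "real K > C" "real K > 2 * C / r" "K \<ge> 2"
  proof -
    obtain K :: nat where "real K > max (max C (2 * C / r)) 2" using reals_Archimedean2 by blast
    then show ?thesis by (intro that[of K]) auto
  qed
  obtain N where N: "\<And>n. n \<ge> N \<Longrightarrow> k n \<ge> K"
    using k unfolding filterlim_at_top eventually_sequentially by meson
  have sol: "\<exists>u. Im u \<noteq> 0 \<and> rvariance (m n) u < 1 \<and> rcauchy (m n) u = 1 / z \<and> rvariance (m n) u \<le> C / real (k n)
      \<and> cmod (u - 1 / z) \<le> 2 * C / real (k n) * cmod (1 / z)"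
    if n: "n \<ge> N" and z: "z \<in> stolz_pair \<alpha> \<beta>" for n z
  proof -
    interpret real_distribution "m n" by (rule m)
    have kn: "k n \<ge> 2" "real (k n) > C" "real (k n) > 2 * C / r" using N[OF n] K by linarith+
    have e: "C / real (k n) < 1" "2 * (C / real (k n)) \<le> r" "C / real (k n) \<ge> 0"
      using kn C r by (simp_all add: field_simps)
    have z0: "1 / z \<noteq> 0" using z by (auto simp: stolz_pair_iff)
    have cone: "\<delta> \<le> \<bar>Im u\<bar>" "cmod u \<le> 4 * (1 + \<alpha>) * \<bar>Im u\<bar>" if "cmod (u - 1 / z) \<le> r * cmod (1 / z)" for u
      using stolz_cone_ball[OF z that[unfolded r_def]] by (simp_all add: \<delta>_def)
    obtain u where u: "rcauchy (m n) u = 1 / z" "cmod (u - 1 / z) \<le> 2 * (C / real (k n)) * cmod (1 / z)" "cmod (u - 1 / z) \<le> r * cmod (1 / z)"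
    proof (rule rcauchy_solution[OF r e(2,3) z0])
      fix v assume v: "cmod (v - 1 / z) \<le> r * cmod (1 / z)"
      show "Im v \<noteq> 0 \<and> cmod (rcauchy (m n) v - v) \<le> C / real (k n) * cmod v"
        using cone[OF v] CE[OF kn(1) cone[OF v]] \<delta> by auto
    qed
    have "rvariance (m n) u \<le> C / real (k n)" by (rule Cv[OF kn(1) cone[OF u(3)]])
    then show ?thesis using u cone(1)[OF u(3)] \<delta> e by (intro exI[of _ u]) auto
  qed
  have ex: "\<exists>R. R holomorphic_on stolz_pair \<alpha> \<beta> \<and>
      (\<forall>z\<in>stolz_pair \<alpha> \<beta>. Im (1 / z + R z) \<noteq> 0 \<and> rvariance (m n) (1 / z + R z) < 1 \<and> rcauchy (m n) (1 / z + R z) = 1 / z) \<and>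
      (\<forall>\<alpha>' \<beta>' S z. \<alpha>' \<le> \<alpha> \<longrightarrow> \<beta>' \<le> \<beta> \<longrightarrow> is_R_transform (m n) \<alpha>' \<beta>' S \<longrightarrow> z \<in> stolz_pair \<alpha>' \<beta>' \<longrightarrow> S z = R z)"
    if n: "n \<ge> N" for n
  proof -
    interpret real_distribution "m n" by (rule m)
    have sol': "\<exists>u. Im u \<noteq> 0 \<and> rvariance (m n) u < 1 \<and> rcauchy (m n) u = 1 / z" if "z \<in> stolz_pair \<alpha> \<beta>" for z
      using sol[OF n that] by blast
    obtain R where "R holomorphic_on stolz_pair \<alpha> \<beta>"
    "\<And>z. z \<in> stolz_pair \<alpha> \<beta> \<Longrightarrow> Im (1 / z + R z) \<noteq> 0 \<and> rvariance (m n) (1 / z + R z) < 1 \<and> rcauchy (m n) (1 / z + R z) = 1 / z"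
    "\<And>\<alpha>' \<beta>' S z. \<alpha>' \<le> \<alpha> \<Longrightarrow> \<beta>' \<le> \<beta> \<Longrightarrow> is_R_transform (m n) \<alpha>' \<beta>' S \<Longrightarrow> z \<in> stolz_pair \<alpha>' \<beta>' \<Longrightarrow> S z = R z"
      by (rule R_transform_global[OF sol'], assumption, rule that)
    then show ?thesis by (intro exI[of _ R]) simp
  qed
  define R where "R = (\<lambda>n. SOME R. R holomorphic_on stolz_pair \<alpha> \<beta> \<and>
      (\<forall>z\<in>stolz_pair \<alpha> \<beta>. Im (1 / z + R z) \<noteq> 0 \<and> rvariance (m n) (1 / z + R z) < 1 \<and> rcauchy (m n) (1 / z + R z) = 1 / z) \<and>
      (\<forall>\<alpha>' \<beta>' S z. \<alpha>' \<le> \<alpha> \<longrightarrow> \<beta>' \<le> \<beta> \<longrightarrow> is_R_transform (m n) \<alpha>' \<beta>' S \<longrightarrow> z \<in> stolz_pair \<alpha>' \<beta>' \<longrightarrow> S z = R z))"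
  have R: "R n holomorphic_on stolz_pair \<alpha> \<beta>"
    "\<And>z. z \<in> stolz_pair \<alpha> \<beta> \<Longrightarrow> Im (1 / z + R n z) \<noteq> 0 \<and> rvariance (m n) (1 / z + R n z) < 1 \<and> rcauchy (m n) (1 / z + R n z) = 1 / z"
    "\<And>\<alpha>' \<beta>' S z. \<alpha>' \<le> \<alpha> \<Longrightarrow> \<beta>' \<le> \<beta> \<Longrightarrow> is_R_transform (m n) \<alpha>' \<beta>' S \<Longrightarrow> z \<in> stolz_pair \<alpha>' \<beta>' \<Longrightarrow> S z = R n z"
    if "n \<ge> N" for n
    using someI_ex[OF ex[OF that]] unfolding R_def by blast+
  show ?thesis
  \<comment> \<open>The variance is bounded by C / k and |z R(z)| by 2 C / k; the constant 2 C
    serves both.\<close>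
  proof (rule that[of "2 * C" N R])
    show "2 * C > 0" using C by simp
    fix n z assume n: "n \<ge> N" and z: "z \<in> stolz_pair \<alpha> \<beta>"
    obtain u where u: "Im u \<noteq> 0" "rvariance (m n) u < 1" "rcauchy (m n) u = 1 / z" "rvariance (m n) u \<le> C / real (k n)"
      "cmod (u - 1 / z) \<le> 2 * C / real (k n) * cmod (1 / z)"
      using sol[OF n z] by blast
    note r2 = R(2)[OF n z]
    have eq: "1 / z + R n z = u"
      by (rule real_distribution.rcauchy_injective[OF m r2[THEN conjunct1] u(1) r2[THEN conjunct2, THEN conjunct1] u(2)])
        (simp only: r2 u(3))
    have z0: "z \<noteq> 0" using z by (auto simp: stolz_pair_iff)
    have "R n z = u - 1 / z" using eq by (simp add: algebra_simps)
    then have "cmod (z * R n z) = cmod z * cmod (u - 1 / z)" by (simp only: norm_mult)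
    also have "\<dots> \<le> cmod z * (2 * C / real (k n) * cmod (1 / z))"
      by (rule mult_left_mono[OF u(5)]) simp
    also have "\<dots> = 2 * C / real (k n)" using z0 by (simp add: norm_divide)
    finally have "cmod (z * R n z) \<le> 2 * C / real (k n)" .
    moreover have "rvariance (m n) u \<le> 2 * C / real (k n)"
      using u(4) C by (intro order_trans[OF u(4)] divide_right_mono) auto
    ultimately show "Im (1 / z + R n z) \<noteq> 0 \<and> rvariance (m n) (1 / z + R n z) < 1
       \<and> rcauchy (m n) (1 / z + R n z) = 1 / z \<and> rvariance (m n) (1 / z + R n z) \<le> 2 * C / real (k n)
       \<and> cmod (z * R n z) \<le> 2 * C / real (k n)"
      unfolding eq using u by simp
  qed (use R in auto)
qed

section \<open>Limits and identity theorem for functions of two complex variables\<close>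

text \<open>Montel gives a subsequence with a holomorphic limit, and the pointwise limit must
  coincide with it.\<close>

lemma bounded_pointwise_limit_holomorphic:
  assumes S: "open S" and f: "\<And>n. f n holomorphic_on S" and B: "\<And>n z. z \<in> S \<Longrightarrow> cmod (f n z) \<le> B"
    and lim: "\<And>z. z \<in> S \<Longrightarrow> (\<lambda>n. f n z) \<longlonglongrightarrow> g z"
  shows "g holomorphic_on S"
proof -
  have hol: "h holomorphic_on S" if "h \<in> range f" for h using that f by auto
  have bd: "\<exists>B. \<forall>h\<in>range f. \<forall>z\<in>K. cmod (h z) \<le> B" if "compact K" "K \<subseteq> S" for K
    using B that by (intro exI[of _ B]) auto
  obtain h r where h: "h holomorphic_on S" and r: "strict_mono (r :: nat \<Rightarrow> nat)"
    and hr: "\<And>x. x \<in> S \<Longrightarrow> (\<lambda>n. f (r n) x) \<longlonglongrightarrow> h x"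
    by (rule Montel[OF S hol bd order_refl], assumption, assumption, assumption, rule that)
  have "h z = g z" if "z \<in> S" for z
    using LIMSEQ_unique[OF hr[OF that]] LIMSEQ_subseq_LIMSEQ[OF lim[OF that] r] by (simp add: comp_def)
  then show ?thesis using holomorphic_transform[OF h] by blast
qed

lemma holomorphic2_on_separately:
  assumes F: "holomorphic2_on F (A \<times> B)" and A: "open A" and B: "open B"
  shows "w \<in> B \<Longrightarrow> (\<lambda>z. F (z, w)) holomorphic_on A" "z \<in> A \<Longrightarrow> (\<lambda>w. F (z, w)) holomorphic_on B"
proof -
  have D: "\<exists>a b. (F has_derivative (\<lambda>(u, v). a * u + b * v)) (at (z, w))" if "z \<in> A" "w \<in> B" for z w
  proof -
    have "(z, w) \<in> A \<times> B" using that by simp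
    moreover have "at (z, w) within A \<times> B = at (z, w)"
      using that A B by (intro at_within_open open_Times) auto
    ultimately show ?thesis using F unfolding holomorphic2_on_def by metis
  qed
  show "(\<lambda>z. F (z, w)) holomorphic_on A" if w: "w \<in> B"
  proof (subst holomorphic_on_open[OF A], intro ballI)
    fix z assume "z \<in> A"
    then obtain a b where d: "(F has_derivative (\<lambda>(u, v). a * u + b * v)) (at (z, w))" using D w by blast
    have "((\<lambda>z. (z, w)) has_derivative (\<lambda>u. (u, 0))) (at z)" by (auto intro!: derivative_eq_intros)
    from has_derivative_compose[OF this d] show "\<exists>f'. ((\<lambda>z. F (z, w)) has_field_derivative f') (at z)"
      by (auto simp: has_field_derivative_def)
  qed
  show "(\<lambda>w. F (z, w)) holomorphic_on B" if z: "z \<in> A"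
  proof (subst holomorphic_on_open[OF B], intro ballI)
    fix w assume "w \<in> B"
    then obtain a b where d: "(F has_derivative (\<lambda>(u, v). a * u + b * v)) (at (z, w))" using D z by blast
    have "((\<lambda>w. (z, w)) has_derivative (\<lambda>u. (0, u))) (at w)" by (auto intro!: derivative_eq_intros)
    from has_derivative_compose[OF this d] show "\<exists>f'. ((\<lambda>w. F (z, w)) has_field_derivative f') (at w)"
      by (auto simp: has_field_derivative_def)
  qed
qed

lemma separately_holomorphic_imp_holomorphic2_on:
  assumes "separately_holomorphic (\<lambda>z w. F (z, w)) A B"
  shows "holomorphic2_on F (A \<times> B)"
  unfolding holomorphic2_on_def
proof
  fix p assume p: "p \<in> A \<times> B"
  interpret separately_holomorphic "\<lambda>z w. F (z, w)" A B by fact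
  have "(F has_derivative (\<lambda>q. deriv (\<lambda>z. F (z, snd p)) (fst p) * fst q + deriv (\<lambda>w. F (fst p, w)) (snd p) * snd q)) (at p within A \<times> B)"
    using jointly_differentiable[of "fst p" "snd p"] p by (auto intro: has_derivative_at_withinI)
  then show "\<exists>a b. (F has_derivative (\<lambda>(u, v). a * u + b * v)) (at p within A \<times> B)"
    unfolding case_prod_beta by blast
qed

lemma stolz_product_identity:
  assumes f: "\<And>w. w \<in> stolz_pair \<alpha> \<beta> \<Longrightarrow> (\<lambda>z. f z w) holomorphic_on stolz_pair \<alpha> \<beta>"
      "\<And>z. z \<in> stolz_pair \<alpha> \<beta> \<Longrightarrow> f z holomorphic_on stolz_pair \<alpha> \<beta>"
    and g: "\<And>w. w \<in> stolz_pair \<alpha> \<beta> \<Longrightarrow> (\<lambda>z. g z w) holomorphic_on stolz_pair \<alpha> \<beta>"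
      "\<And>z. z \<in> stolz_pair \<alpha> \<beta> \<Longrightarrow> g z holomorphic_on stolz_pair \<alpha> \<beta>"
    and pos: "0 < \<alpha>'" "\<alpha>' \<le> \<alpha>" "0 < \<beta>'" "\<beta>' \<le> \<beta>"
    and eq: "\<And>z w. z \<in> stolz_pair \<alpha>' \<beta>' \<Longrightarrow> w \<in> stolz_pair \<alpha>' \<beta>' \<Longrightarrow> f z w = g z w"
    and z: "z \<in> stolz_pair \<alpha> \<beta>" and w: "w \<in> stolz_pair \<alpha> \<beta>"
  shows "f z w = g z w"
proof (rule stolz_pair_identity[where f = "\<lambda>z. f z w" and g = "\<lambda>z. g z w", OF f(1)[OF w] g(1)[OF w] pos _ z])
  fix u assume u: "u \<in> stolz_pair \<alpha>' \<beta>'"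
  then have u': "u \<in> stolz_pair \<alpha> \<beta>" using stolz_pair_mono pos by blast
  show "f u w = g u w"
    by (rule stolz_pair_identity[where f = "f u" and g = "g u", OF f(2)[OF u'] g(2)[OF u'] pos eq[OF u] w])
qed

section \<open>Holomorphic extension of the bi-free R-transform\<close>

lemma bifree_h_eq:
  assumes L: "borel_law2 \<mu>" and A: "Im (1 / z + R1 z) \<noteq> 0" "rcauchy (marginal1 \<mu>) (1 / z + R1 z) = 1 / z"
    and B: "Im (1 / w + R2 w) \<noteq> 0" "rcauchy (marginal2 \<mu>) (1 / w + R2 w) = 1 / w" and nz: "z \<noteq> 0" "w \<noteq> 0"
  shows "bifree_h \<mu> R1 R2 z w = 1 + bicov \<mu> (1 / z + R1 z) (1 / w + R2 w)"
proof -
  have "cauchy_transform (marginal1 \<mu>) (1 / z + R1 z) = z" "cauchy_transform (marginal2 \<mu>) (1 / w + R2 w) = w"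
    using A(2) B(2) unfolding rcauchy_def by (metis div_by_1 divide_divide_eq_right mult_1)+
  then show ?thesis unfolding bifree_h_def cauchy_transform2_eq[OF L A(1) B(1)] using nz by simp
qed

text \<open>The defining formula with 1 + \<open>bicov\<close> in place of h. Where both variances
  are below 1, the covariance is below 1 in modulus, so the formula makes sense on the whole domain
  and provides the holomorphic extension.\<close>

definition bifree_ext :: "(real \<times> real) measure \<Rightarrow> (complex \<Rightarrow> complex) \<Rightarrow> (complex \<Rightarrow> complex) \<Rightarrow> complex \<Rightarrow> complex \<Rightarrow> complex" where
  "bifree_ext \<mu> R1 R2 z w = z * R1 z + w * R2 w + (1 - 1 / (1 + bicov \<mu> (1 / z + R1 z) (1 / w + R2 w)))"

locale bifree_global =
  fixes \<mu> :: "(real \<times> real) measure" and \<alpha> \<beta> :: real and R1 R2 :: "complex \<Rightarrow> complex"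
  assumes L: "borel_law2 \<mu>"
    and hol1: "R1 holomorphic_on stolz_pair \<alpha> \<beta>" and hol2: "R2 holomorphic_on stolz_pair \<alpha> \<beta>"
    and R1: "z \<in> stolz_pair \<alpha> \<beta> \<Longrightarrow> Im (1 / z + R1 z) \<noteq> 0 \<and> rvariance (marginal1 \<mu>) (1 / z + R1 z) < 1
      \<and> rcauchy (marginal1 \<mu>) (1 / z + R1 z) = 1 / z"
    and R2: "z \<in> stolz_pair \<alpha> \<beta> \<Longrightarrow> Im (1 / z + R2 z) \<noteq> 0 \<and> rvariance (marginal2 \<mu>) (1 / z + R2 z) < 1
      \<and> rcauchy (marginal2 \<mu>) (1 / z + R2 z) = 1 / z"
begin

lemma bicov_small:
  assumes "z \<in> stolz_pair \<alpha> \<beta>" "w \<in> stolz_pair \<alpha> \<beta>"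
  shows "cmod (bicov \<mu> (1 / z + R1 z) (1 / w + R2 w)) < 1"
proof -
  note r1 = R1[OF assms(1)] and r2 = R2[OF assms(2)]
  have "(cmod (bicov \<mu> (1 / z + R1 z) (1 / w + R2 w)))\<^sup>2
      \<le> rvariance (marginal1 \<mu>) (1 / z + R1 z) * rvariance (marginal2 \<mu>) (1 / w + R2 w)"
    by (rule bicov_le[OF L r1[THEN conjunct1] r2[THEN conjunct1]])
  also have "\<dots> < 1 * 1"
    using real_distribution.rvariance_nonneg[OF marginal_real_distribution(1)[OF L] r1[THEN conjunct1]]
      real_distribution.rvariance_nonneg[OF marginal_real_distribution(2)[OF L] r2[THEN conjunct1]] r1 r2
    by (intro mult_strict_mono') auto
  finally show ?thesis by (simp add: abs_square_less_1)
qed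

lemma one_plus_bicov_nonzero:
  assumes "z \<in> stolz_pair \<alpha> \<beta>" "w \<in> stolz_pair \<alpha> \<beta>"
  shows "1 + bicov \<mu> (1 / z + R1 z) (1 / w + R2 w) \<noteq> 0"
  using bicov_small[OF assms] by (metis add_eq_0_iff less_irrefl norm_minus_cancel norm_one)

lemma inverse_holomorphic:
  assumes "R holomorphic_on stolz_pair \<alpha> \<beta>"
  shows "(\<lambda>z. 1 / z + R z) holomorphic_on stolz_pair \<alpha> \<beta>"
  by (intro holomorphic_intros assms) (auto simp: stolz_pair_iff)

lemma bifree_ext_holomorphic:
  "w \<in> stolz_pair \<alpha> \<beta> \<Longrightarrow> (\<lambda>z. bifree_ext \<mu> R1 R2 z w) holomorphic_on stolz_pair \<alpha> \<beta>"
  "z \<in> stolz_pair \<alpha> \<beta> \<Longrightarrow> bifree_ext \<mu> R1 R2 z holomorphic_on stolz_pair \<alpha> \<beta>"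
proof -
  assume w: "w \<in> stolz_pair \<alpha> \<beta>"
  have "((\<lambda>z. bicov \<mu> z (1 / w + R2 w)) \<circ> (\<lambda>z. 1 / z + R1 z)) holomorphic_on stolz_pair \<alpha> \<beta>"
    by (rule holomorphic_on_compose_gen[OF inverse_holomorphic[OF hol1] bicov_holomorphic(2)[OF L R2[OF w, THEN conjunct1]]])
      (use R1 in blast)
  then show "(\<lambda>z. bifree_ext \<mu> R1 R2 z w) holomorphic_on stolz_pair \<alpha> \<beta>"
    unfolding bifree_ext_def comp_def by (intro holomorphic_intros hol1 one_plus_bicov_nonzero w)
next
  assume z: "z \<in> stolz_pair \<alpha> \<beta>"
  have "(bicov \<mu> (1 / z + R1 z) \<circ> (\<lambda>w. 1 / w + R2 w)) holomorphic_on stolz_pair \<alpha> \<beta>"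
    by (rule holomorphic_on_compose_gen[OF inverse_holomorphic[OF hol2] bicov_holomorphic(1)[OF L R1[OF z, THEN conjunct1]]])
      (use R2 in blast)
  then show "bifree_ext \<mu> R1 R2 z holomorphic_on stolz_pair \<alpha> \<beta>"
    unfolding bifree_ext_def[abs_def] comp_def by (intro holomorphic_intros hol2 one_plus_bicov_nonzero z)
qed

text \<open>On the small domain of the formula the R-transforms are restrictions of R1 and R2, so
  both sides agree there; both are holomorphic in each variable on the large domain.\<close>

lemma bifree_R_transform_eq_ext:
  assumes F: "is_bifree_R_transform \<mu> \<alpha> \<beta> F"
    and u1: "\<And>\<alpha>' \<beta>' S z. \<alpha>' \<le> \<alpha> \<Longrightarrow> \<beta>' \<le> \<beta> \<Longrightarrow> is_R_transform (marginal1 \<mu>) \<alpha>' \<beta>' S \<Longrightarrow> z \<in> stolz_pair \<alpha>' \<beta>' \<Longrightarrow> S z = R1 z"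
    and u2: "\<And>\<alpha>' \<beta>' S z. \<alpha>' \<le> \<alpha> \<Longrightarrow> \<beta>' \<le> \<beta> \<Longrightarrow> is_R_transform (marginal2 \<mu>) \<alpha>' \<beta>' S \<Longrightarrow> z \<in> stolz_pair \<alpha>' \<beta>' \<Longrightarrow> S z = R2 z"
    and zw: "z \<in> stolz_pair \<alpha> \<beta>" "w \<in> stolz_pair \<alpha> \<beta>"
  shows "F (z, w) = bifree_ext \<mu> R1 R2 z w"
proof -
  have F2: "holomorphic2_on F (stolz_pair \<alpha> \<beta> \<times> stolz_pair \<alpha> \<beta>)"
    using F by (simp add: is_bifree_R_transform_def product_domain_def)
  obtain \<alpha>' \<beta>' S1 S2 where pos: "0 < \<alpha>'" "\<alpha>' \<le> \<alpha>" "0 < \<beta>'" "\<beta>' \<le> \<beta>"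
    and S: "is_R_transform (marginal1 \<mu>) \<alpha>' \<beta>' S1" "is_R_transform (marginal2 \<mu>) \<alpha>' \<beta>' S2"
    and formula: "\<And>z w. z \<in> stolz_pair \<alpha>' \<beta>' \<Longrightarrow> w \<in> stolz_pair \<alpha>' \<beta>' \<Longrightarrow>
      F (z, w) = z * S1 z + w * S2 w + (1 - 1 / bifree_h \<mu> S1 S2 z w)"
    using F unfolding is_bifree_R_transform_def bifree_R_formula_on_def product_domain_def by auto
  show ?thesis
  proof (rule stolz_product_identity[where f = "\<lambda>z w. F (z, w)" and g = "bifree_ext \<mu> R1 R2", OF _ _ _ _ pos _ zw])
    fix z w assume z: "z \<in> stolz_pair \<alpha>' \<beta>'" and w: "w \<in> stolz_pair \<alpha>' \<beta>'"
    have z': "z \<in> stolz_pair \<alpha> \<beta>" and w': "w \<in> stolz_pair \<alpha> \<beta>" using z w stolz_pair_mono[OF pos(2,4)] by auto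
    note r1 = R1[OF z'] and r2 = R2[OF w']
    have eq: "S1 z = R1 z" "S2 w = R2 w" using u1[OF pos(2,4) S(1) z] u2[OF pos(2,4) S(2) w] .
    have "z \<noteq> 0" "w \<noteq> 0" using z w by (auto simp: stolz_pair_iff)
    then have h: "bifree_h \<mu> S1 S2 z w = 1 + bicov \<mu> (1 / z + R1 z) (1 / w + R2 w)"
      using bifree_h_eq[OF L, of z S1 w S2] r1 r2 unfolding eq by blast
    show "F (z, w) = bifree_ext \<mu> R1 R2 z w"
      unfolding formula[OF z w] h eq bifree_ext_def ..
  qed (use holomorphic2_on_separately[OF F2 open_stolz_pair open_stolz_pair] bifree_ext_holomorphic in blast)+
qed

text \<open>The covariance c is at most C / k in modulus, and 1 - 1 / (1 + c) = c / (1 + c) at most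
  twice that, since C / k is at most 1/2. With the two marginal terms this adds up to C + C + 2
  C.\<close>

lemma bifree_ext_bound:
  assumes zw: "z \<in> stolz_pair \<alpha> \<beta>" "w \<in> stolz_pair \<alpha> \<beta>" and k: "k > 0" "2 * C \<le> k"
    and b1: "rvariance (marginal1 \<mu>) (1 / z + R1 z) \<le> C / k" "cmod (z * R1 z) \<le> C / k"
    and b2: "rvariance (marginal2 \<mu>) (1 / w + R2 w) \<le> C / k" "cmod (w * R2 w) \<le> C / k"
  shows "cmod (of_real k * bifree_ext \<mu> R1 R2 z w) \<le> 4 * C"
proof -
  note r1 = R1[OF zw(1), THEN conjunct1] and r2 = R2[OF zw(2), THEN conjunct1]
  define c where "c = bicov \<mu> (1 / z + R1 z) (1 / w + R2 w)"
  have Ck: "C / k \<ge> 0" by (rule order_trans[OF norm_ge_zero b1(2)])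
  have half: "C / k \<le> 1 / 2" using k by (simp add: field_simps)
  have "(cmod c)\<^sup>2 \<le> rvariance (marginal1 \<mu>) (1 / z + R1 z) * rvariance (marginal2 \<mu>) (1 / w + R2 w)"
    unfolding c_def by (rule bicov_le[OF L r1 r2])
  also have "\<dots> \<le> C / k * (C / k)"
    using b1 b2 Ck real_distribution.rvariance_nonneg[OF marginal_real_distribution(2)[OF L] r2] by (intro mult_mono) auto
  finally have "(cmod c)\<^sup>2 \<le> (C / k)\<^sup>2" by (simp only: power2_eq_square)
  then have c: "cmod c \<le> C / k" by (rule power2_le_imp_le[OF _ Ck])
  have "1 - cmod c \<le> cmod (1 + c)" using norm_triangle_ineq2[of 1 "- c"] by simp
  then have "1 / 2 \<le> cmod (1 + c)" using c half by linarith
  have nz: "1 + c \<noteq> 0" unfolding c_def by (rule one_plus_bicov_nonzero[OF zw])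
  then have "1 - 1 / (1 + c) = c / (1 + c)" by (simp add: field_simps)
  then have "cmod (1 - 1 / (1 + c)) = cmod c / cmod (1 + c)" by (simp add: norm_divide)
  also have "\<dots> \<le> (C / k) / (1 / 2)" using c \<open>1 / 2 \<le> cmod (1 + c)\<close> Ck by (intro frac_le) auto
  finally have h: "cmod (1 - 1 / (1 + c)) \<le> 2 * (C / k)" by (simp add: mult.commute)
  have "cmod (bifree_ext \<mu> R1 R2 z w) \<le> cmod (z * R1 z) + cmod (w * R2 w) + cmod (1 - 1 / (1 + c))"
    unfolding bifree_ext_def c_def by (intro order_trans[OF norm_triangle_ineq] add_mono norm_triangle_ineq order_refl)
  also have "\<dots> \<le> C / k + C / k + 2 * (C / k)" by (intro add_mono b1 b2 h)
  finally have "cmod (bifree_ext \<mu> R1 R2 z w) \<le> 4 * (C / k)" by simp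
  then have "k * cmod (bifree_ext \<mu> R1 R2 z w) \<le> k * (4 * (C / k))" using k by (intro mult_left_mono) auto
  then show ?thesis using k by (simp add: norm_mult)
qed

text \<open>The scaling of the R-transform by k, written at (A, B) as an identity for H, so that no
  R-transform of the power enters. At u = G(A) for the power, 1/u + R1(u) is the subordinated point
  by injectivity of F, whence k u R1(u) = u A - 1.\<close>

lemma bifree_ext_power:
  assumes P: "bifree_power \<mu> k p1 p2" and A: "Im A \<noteq> 0" and B: "Im B \<noteq> 0"
    and z: "cauchy_transform p1 A \<in> stolz_pair \<alpha> \<beta>" and w: "cauchy_transform p2 B \<in> stolz_pair \<alpha> \<beta>"
  shows "cauchy_transform p1 A * cauchy_transform p2 B = bifree_power.H \<mu> k p1 p2 A B *
    (1 - (of_nat k * bifree_ext \<mu> R1 R2 (cauchy_transform p1 A) (cauchy_transform p2 B)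
      - (cauchy_transform p1 A * A - 1) - (cauchy_transform p2 B * B - 1)))"
proof -
  interpret bifree_power \<mu> k p1 p2 by (rule P)
  define u where "u = cauchy_transform p1 A"
  define v where "v = cauchy_transform p2 B"
  have uv: "u \<noteq> 0" "v \<noteq> 0" using p1.cauchy_nonzero[OF A] p2.cauchy_nonzero[OF B] by (simp_all add: u_def v_def)
  have small: "x < 1" if "0 \<le> x" "(real k - 1) * x < 1" for x
  proof -
    have "1 * x \<le> (real k - 1) * x" using k that(1) by (intro mult_right_mono) auto
    then show ?thesis using that(2) by linarith
  qed
  note r1 = R1[OF z, folded u_def] and r2 = R2[OF w, folded v_def]
  have s1: "1 / u + R1 u = subord k p1 A"
  proof (rule m1.rcauchy_injective)
    show "rvariance (marginal1 \<mu>) (subord k p1 A) < 1"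
      by (rule small[OF m1.rvariance_nonneg[OF subord_nonreal(1)[OF A]] variance1(3)[OF A A]])
    show "rcauchy (marginal1 \<mu>) (1 / u + R1 u) = rcauchy (marginal1 \<mu>) (subord k p1 A)"
      using r1 subordination1[OF A] by (simp add: rcauchy_def u_def)
  qed (use r1 subord_nonreal(1)[OF A] in blast)+
  have s2: "1 / v + R2 v = subord k p2 B"
  proof (rule m2.rcauchy_injective)
    show "rvariance (marginal2 \<mu>) (subord k p2 B) < 1"
      by (rule small[OF m2.rvariance_nonneg[OF subord_nonreal(2)[OF B]] variance2(3)[OF B B]])
    show "rcauchy (marginal2 \<mu>) (1 / v + R2 v) = rcauchy (marginal2 \<mu>) (subord k p2 B)"
      using r2 subordination2[OF B] by (simp add: rcauchy_def v_def)
  qed (use r2 subord_nonreal(2)[OF B] in blast)+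
  have kk: "of_nat k * (x * r) = x * X - 1" if "1 / x + r = subord k p X" "rcauchy p X = 1 / x" "x \<noteq> 0" for x r X p
  proof -
    have "of_nat k * subord k p X = X + (of_nat k - 1) / x"
      unfolding subord_def that(2) using k by simp
    then have "of_nat k * (1 / x + r) * x = (X + (of_nat k - 1) / x) * x" unfolding that(1) by simp
    moreover have "(X + (of_nat k - 1) / x) * x = X * x + (of_nat k - 1)"
      using that(3) by (simp add: distrib_right)
    ultimately have "of_nat k * (1 / x + r) * x = X * x + (of_nat k - 1)" by simp
    then show ?thesis using that(3) by (simp add: algebra_simps)
  qed
  have k1: "of_nat k * (u * R1 u) = u * A - 1" by (rule kk[OF s1]) (use uv in \<open>simp_all add: rcauchy_def u_def\<close>)
  have k2: "of_nat k * (v * R2 v) = v * B - 1" by (rule kk[OF s2]) (use uv in \<open>simp_all add: rcauchy_def v_def\<close>)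
  have cc: "bicov \<mu> (1 / u + R1 u) (1 / v + R2 v) = c A B" unfolding s1 s2 c_def ..
  have nz: "1 + c A B \<noteq> 0" unfolding cc[symmetric] u_def v_def by (rule one_plus_bicov_nonzero[OF z w])
  have "of_nat k * bifree_ext \<mu> R1 R2 u v = (u * A - 1) + (v * B - 1) + of_nat k * (1 - 1 / (1 + c A B))"
    unfolding bifree_ext_def cc distrib_left k1 k2 ..
  then have "1 - (of_nat k * bifree_ext \<mu> R1 R2 u v - (u * A - 1) - (v * B - 1)) = 1 - of_nat k * (1 - 1 / (1 + c A B))"
    by simp
  also have "\<dots> = (1 - of_real (real k - 1) * c A B) / (1 + c A B)"
    using nz by (simp add: field_simps)
  finally have e: "1 - (of_nat k * bifree_ext \<mu> R1 R2 u v - (u * A - 1) - (v * B - 1)) = (1 - of_real (real k - 1) * c A B) / (1 + c A B)" .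
  have "u * v = u * v * ((1 + c A B) / (1 - of_real (real k - 1) * c A B)) * ((1 - of_real (real k - 1) * c A B) / (1 + c A B))"
    using nz c_small(3)[OF A B] by simp
  then show ?thesis
    unfolding H_def u_def[symmetric] v_def[symmetric] e .
qed

end

section \<open>Uniqueness\<close>

text \<open>The Poisson kernel of width \<epsilon> integrated over [a, b]: a smooth version of the
  indicator of the interval.\<close>

definition arctan_step :: "real \<Rightarrow> real \<Rightarrow> real \<Rightarrow> real \<Rightarrow> real" where
  "arctan_step \<epsilon> a b s = (arctan ((b - s) / \<epsilon>) - arctan ((a - s) / \<epsilon>)) / pi"

text \<open>The difference of the transform between the lines at height -\<epsilon> and \<epsilon>
  is a weighted Poisson integral; Fubini with the finite measure on [a, b] exchanges the two
  integrations.\<close>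

lemma (in weighted_variable) wct_arctan_step:
  assumes \<epsilon>: "\<epsilon> > 0" and ab: "a \<le> b"
  shows "(LINT p|M. \<phi> p * of_real (arctan_step \<epsilon> a b (X p))) =
    (LINT x|density lborel (indicator {a..b}).
      (wct M X \<phi> (Complex x (- \<epsilon>)) - wct M X \<phi> (Complex x \<epsilon>)) / (2 * \<i> * of_real pi))"
proof -
  define Q where "Q = density lborel (indicator {a..b} :: real \<Rightarrow> ennreal)"
  have Qs: "sets Q = sets borel" by (simp add: Q_def)
  have Qm: "borel_measurable Q = borel_measurable borel" by (rule measurable_cong_sets[OF Qs refl])
  have "finite_measure Q"
  proof (rule finite_measureI)
    have "emeasure Q (space Q) = emeasure lborel {a..b}"
      unfolding Q_def by (simp add: emeasure_density)
    then show "emeasure Q (space Q) \<noteq> \<infinity>" using ab by simp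
  qed
  then interpret Q: finite_measure Q .
  interpret P: pair_sigma_finite M Q by unfold_locales
  define K where "K = (\<lambda>p x. \<epsilon> / (pi * ((x - X p)\<^sup>2 + \<epsilon>\<^sup>2)))"
  have den: "(x - s)\<^sup>2 + \<epsilon>\<^sup>2 > 0" for x s using \<epsilon> by (auto intro!: add_nonneg_pos)
  have K0: "K p x \<ge> 0" for p x unfolding K_def using \<epsilon> den[of x "X p"] by simp
  have Kle: "K p x \<le> 1 / (pi * \<epsilon>)" for p x
  proof -
    have "K p x \<le> \<epsilon> / (pi * \<epsilon>\<^sup>2)" unfolding K_def using \<epsilon> by (intro divide_left_mono mult_left_mono mult_pos_pos den) auto
    then show ?thesis using \<epsilon> by (simp add: power2_eq_square)
  qed
  have xm: "(\<lambda>z. snd z) \<in> borel_measurable (M \<Otimes>\<^sub>M Q)"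
    using measurable_snd[of M Q] measurable_cong_sets[OF refl Qs, of "M \<Otimes>\<^sub>M Q"] by simp
  have fm: "(\<lambda>(p, x). \<phi> p * of_real (K p x)) \<in> borel_measurable (M \<Otimes>\<^sub>M Q)"
    unfolding K_def case_prod_beta using xm by measurable
  interpret MQ: finite_measure "M \<Otimes>\<^sub>M Q"
    by (rule finite_measure_pair_measure) unfold_locales
  have int: "integrable (M \<Otimes>\<^sub>M Q) (\<lambda>(p, x). \<phi> p * of_real (K p x))"
  proof (rule MQ.integrable_const_bound[OF _ fm])
    show "AE z in M \<Otimes>\<^sub>M Q. cmod (case z of (p, x) \<Rightarrow> \<phi> p * of_real (K p x)) \<le> B * (1 / (pi * \<epsilon>))"
      using K0 Kle \<phi>_bound B_nonneg by (intro AE_I2) (auto simp: norm_mult simp del: times_divide_eq_right intro!: mult_mono)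
  qed
  have inner1: "(LINT p|M. \<phi> p * of_real (K p x)) = (wct M X \<phi> (Complex x (- \<epsilon>)) - wct M X \<phi> (Complex x \<epsilon>)) / (2 * \<i> * of_real pi)" for x
  proof -
    have i: "integrable M (\<lambda>p. \<phi> p / (Complex x (- \<epsilon>) - of_real (X p)))" "integrable M (\<lambda>p. \<phi> p / (Complex x \<epsilon> - of_real (X p)))"
      using \<epsilon> by (intro integrable_divide; simp)+
    have "\<phi> p * of_real (K p x) = (\<phi> p / (Complex x (- \<epsilon>) - of_real (X p)) - \<phi> p / (Complex x \<epsilon> - of_real (X p))) / (2 * \<i> * of_real pi)" for p
    proof -
      define d where "d = x - X p"
      have c: "Complex x (- \<epsilon>) - of_real (X p) = Complex d (- \<epsilon>)" "Complex x \<epsilon> - of_real (X p) = Complex d \<epsilon>"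
        by (simp_all add: complex_eq_iff d_def)
      have nz: "Complex d (- \<epsilon>) \<noteq> 0" "Complex d \<epsilon> \<noteq> 0" using \<epsilon> by (simp_all add: complex_eq_iff)
      have prod: "Complex d (- \<epsilon>) * Complex d \<epsilon> = of_real (d\<^sup>2 + \<epsilon>\<^sup>2)" by (simp add: complex_eq_iff power2_eq_square)
      have "\<phi> p / Complex d (- \<epsilon>) - \<phi> p / Complex d \<epsilon> = \<phi> p * (Complex d \<epsilon> - Complex d (- \<epsilon>)) / (Complex d (- \<epsilon>) * Complex d \<epsilon>)"
        using nz by (simp add: field_simps)
      also have "\<dots> = \<phi> p * (2 * \<i> * of_real \<epsilon>) / of_real (d\<^sup>2 + \<epsilon>\<^sup>2)"
      proof -
        have "Complex d \<epsilon> - Complex d (- \<epsilon>) = 2 * \<i> * of_real \<epsilon>" by (simp add: complex_eq_iff)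
        then show ?thesis unfolding prod by simp
      qed
      finally have e: "\<phi> p / Complex d (- \<epsilon>) - \<phi> p / Complex d \<epsilon> = \<phi> p * (2 * \<i> * of_real \<epsilon>) / of_real (d\<^sup>2 + \<epsilon>\<^sup>2)" .
      have "v * (2 * \<i> * e) / D / (2 * \<i> * p) = v * (e / (p * D))" for v e p D :: complex by simp
      then have "(\<phi> p / Complex d (- \<epsilon>) - \<phi> p / Complex d \<epsilon>) / (2 * \<i> * of_real pi) = \<phi> p * of_real (\<epsilon> / (pi * (d\<^sup>2 + \<epsilon>\<^sup>2)))"
        unfolding e of_real_divide of_real_mult by blast
      then show ?thesis unfolding c K_def d_def by simp
    qed
    then show ?thesis using i by (simp add: wct_def)
  qed
  have inner2: "(LINT x|Q. \<phi> p * of_real (K p x)) = \<phi> p * of_real (arctan_step \<epsilon> a b (X p))" for p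
  proof -
    have D: "((\<lambda>x. arctan ((x - X p) / \<epsilon>) / pi) has_real_derivative K p x) (at x)" for x
    proof -
      have "((\<lambda>x. (x - X p) / \<epsilon>) has_real_derivative 1 / \<epsilon>) (at x)"
        using \<epsilon> by (auto intro!: derivative_eq_intros)
      from DERIV_cdivide[OF DERIV_chain'[OF this DERIV_arctan], of pi]
      have "((\<lambda>x. arctan ((x - X p) / \<epsilon>) / pi) has_real_derivative (1 / (1 + ((x - X p) / \<epsilon>)\<^sup>2) * (1 / \<epsilon>)) / pi) (at x)"
        by (simp add: inverse_eq_divide mult.commute)
      also have "(1 / (1 + ((x - X p) / \<epsilon>)\<^sup>2) * (1 / \<epsilon>)) / pi = K p x"
      proof -
        have "1 + ((x - X p) / \<epsilon>)\<^sup>2 = ((x - X p)\<^sup>2 + \<epsilon>\<^sup>2) / \<epsilon>\<^sup>2" using \<epsilon> by (simp add: power_divide add_divide_distrib)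
        then show ?thesis unfolding K_def using \<epsilon> den[of x "X p"] by (simp add: power2_eq_square)
      qed
      finally show ?thesis .
    qed
    have cont: "isCont (K p) x" for x
      unfolding K_def using den[of x "X p"] by (intro continuous_intros) auto
    have Km: "K p \<in> borel_measurable borel" unfolding K_def by measurable
    have ind: "(indicator {a..b} :: real \<Rightarrow> ennreal) = (\<lambda>x. ennreal (indicator {a..b} x))"
      by (simp add: fun_eq_iff indicator_def)
    have "(LINT x|Q. K p x) = (LINT x|lborel. indicator {a..b} x *\<^sub>R K p x)"
      unfolding Q_def ind using Km by (subst integral_density) auto
    also have "\<dots> = (LINT x|lborel. K p x * indicator {a..b} x)" by (simp add: mult.commute)
    also have "\<dots> = arctan ((b - X p) / \<epsilon>) / pi - arctan ((a - X p) / \<epsilon>) / pi"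
      by (rule integral_FTC_Icc_real[OF ab D cont])
    also have "\<dots> = arctan_step \<epsilon> a b (X p)" by (simp add: arctan_step_def diff_divide_distrib)
    finally have "(LINT x|Q. K p x) = arctan_step \<epsilon> a b (X p)" .
    then show ?thesis by simp
  qed
  have "(LINT p|M. LINT x|Q. \<phi> p * of_real (K p x)) = (LINT x|Q. LINT p|M. \<phi> p * of_real (K p x))"
    using P.Fubini_integral[OF int] by simp
  then show ?thesis unfolding inner1 inner2[unfolded Q_def] Q_def .
qed

lemma arctan_step_bound: "\<bar>arctan_step \<epsilon> a b s\<bar> \<le> 1"
proof -
  have "\<bar>arctan ((b - s) / \<epsilon>) - arctan ((a - s) / \<epsilon>)\<bar> \<le> pi"
    using arctan_bounded[of "(b - s) / \<epsilon>"] arctan_bounded[of "(a - s) / \<epsilon>"] by linarith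
  then show ?thesis by (simp add: arctan_step_def abs_divide)
qed

text \<open>The width shrinks like 1 / n^2 while the end points move inwards by 1 / n. At s = a and
  s = b the arctan arguments therefore still diverge, with equal signs, so the limit is exactly the
  open interval's indicator, even where an atom may sit.\<close>

lemma arctan_step_limit:
  assumes "a < b"
  shows "(\<lambda>n. arctan_step (1 / real (Suc n) ^ 2) (a + 1 / real (Suc n)) (b - 1 / real (Suc n)) s)
    \<longlonglongrightarrow> indicator {a<..<b} s"
proof -
  have l1: "(\<lambda>n. arctan ((a + 1 / real (Suc n) - s) / (1 / real (Suc n) ^ 2))) \<longlonglongrightarrow> (if s \<le> a then pi / 2 else - (pi / 2))"
  proof (cases "s \<le> a")
    case True
    have "filterlim (\<lambda>n. (d + 1 / real (Suc n)) / (1 / real (Suc n) ^ 2)) at_top sequentially" if "d \<ge> 0" for d :: real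
      using that by (cases "d = 0") real_asymp+
    from filterlim_compose[OF tendsto_arctan_at_top this[of "a - s"]] True show ?thesis
      by (simp add: algebra_simps)
  next
    case False
    have "filterlim (\<lambda>n. (d + 1 / real (Suc n)) / (1 / real (Suc n) ^ 2)) at_bot sequentially" if "d < 0" for d :: real
      using that by real_asymp
    from filterlim_compose[OF tendsto_arctan_at_bot this[of "a - s"]] False show ?thesis
      by (simp add: algebra_simps)
  qed
  have l2: "(\<lambda>n. arctan ((b - 1 / real (Suc n) - s) / (1 / real (Suc n) ^ 2))) \<longlonglongrightarrow> (if s < b then pi / 2 else - (pi / 2))"
  proof (cases "s < b")
    case True
    have "filterlim (\<lambda>n. (d - 1 / real (Suc n)) / (1 / real (Suc n) ^ 2)) at_top sequentially" if "d > 0" for d :: real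
      using that by real_asymp
    from filterlim_compose[OF tendsto_arctan_at_top this[of "b - s"]] True show ?thesis
      by (simp add: algebra_simps)
  next
    case False
    have "filterlim (\<lambda>n. (d - 1 / real (Suc n)) / (1 / real (Suc n) ^ 2)) at_bot sequentially" if "d \<le> 0" for d :: real
      using that by (cases "d = 0") real_asymp+
    from filterlim_compose[OF tendsto_arctan_at_bot this[of "b - s"]] False show ?thesis
      by (simp add: algebra_simps)
  qed
  have "(\<lambda>n. arctan_step (1 / real (Suc n) ^ 2) (a + 1 / real (Suc n)) (b - 1 / real (Suc n)) s)
    \<longlonglongrightarrow> ((if s < b then pi / 2 else - (pi / 2)) - (if s \<le> a then pi / 2 else - (pi / 2))) / pi"
    unfolding arctan_step_def by (intro tendsto_intros l1 l2) simp
  moreover have "((if s < b then pi / 2 else - (pi / 2)) - (if s \<le> a then pi / 2 else - (pi / 2))) / pi = indicator {a<..<b} s"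
    using assms by (auto simp: indicator_def)
  ultimately show ?thesis by simp
qed

lemma wct_inversion:
  assumes M: "weighted_variable M X \<phi> B" and N: "weighted_variable N Y \<psi> B'"
    and eq: "\<And>z. Im z \<noteq> 0 \<Longrightarrow> wct M X \<phi> z = wct N Y \<psi> z" and ab: "a < b"
  shows "(LINT p|M. \<phi> p * indicator {a<..<b} (X p)) = (LINT p|N. \<psi> p * indicator {a<..<b} (Y p))"
proof -
  define st where "st = (\<lambda>n. arctan_step (1 / real (Suc n) ^ 2) (a + 1 / real (Suc n)) (b - 1 / real (Suc n)))"
  have st_meas: "st n \<in> borel_measurable borel" for n
    unfolding st_def arctan_step_def[abs_def] by measurable
  have lim: "(\<lambda>n. LINT p|M. \<phi> p * of_real (st n (X p))) \<longlonglongrightarrow> (LINT p|M. \<phi> p * indicator {a<..<b} (X p))"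
    if "weighted_variable M X \<phi> B" for M :: "'c measure" and X \<phi> B
  proof -
    interpret weighted_variable M X \<phi> B by fact
    have i: "indicator {a<..<b} s = complex_of_real (indicator {a<..<b} s)" for s by (simp add: indicator_def)
    note [measurable] = st_meas
    show ?thesis
      unfolding i
    proof (rule integral_dominated_convergence[where w = "\<lambda>_. B"])
      show "AE p in M. (\<lambda>n. \<phi> p * of_real (st n (X p))) \<longlonglongrightarrow> \<phi> p * of_real (indicator {a<..<b} (X p))"
        unfolding st_def by (intro AE_I2 tendsto_intros arctan_step_limit ab)
      show "AE p in M. cmod (\<phi> p * of_real (st n (X p))) \<le> B" for n
      proof (rule AE_I2)
        fix p
        have "cmod (\<phi> p) * \<bar>st n (X p)\<bar> \<le> B * 1"
          unfolding st_def by (intro mult_mono \<phi>_bound arctan_step_bound) (use B_nonneg in auto)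
        then show "cmod (\<phi> p * of_real (st n (X p))) \<le> B" by (simp add: norm_mult)
      qed
    qed measurable
  qed
  \<comment> \<open>Beyond this index the end points moved inwards are still in order.\<close>
  obtain K :: nat where K: "real K > 2 / (b - a)" using reals_Archimedean2 by blast
  have "eventually (\<lambda>n. (LINT p|M. \<phi> p * of_real (st n (X p))) = (LINT p|N. \<psi> p * of_real (st n (Y p)))) sequentially"
    using eventually_ge_at_top[of K]
  proof eventually_elim
    case (elim n)
    have "2 / (b - a) < real (Suc n)" using K elim by linarith
    then have "2 < (b - a) * real (Suc n)" using ab by (simp add: pos_divide_less_eq mult.commute)
    then have "2 / real (Suc n) < b - a" by (simp add: pos_divide_less_eq del: of_nat_Suc)
    then have le: "a + 1 / real (Suc n) \<le> b - 1 / real (Suc n)" by (simp del: of_nat_Suc)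
    have pos: "1 / real (Suc n) ^ 2 > 0" by simp
    show ?case
      unfolding st_def weighted_variable.wct_arctan_step[OF M pos le] weighted_variable.wct_arctan_step[OF N pos le]
      by (subst (1 2) eq) (use pos in auto)
  qed
  from Lim_transform_eventually[OF lim[OF M] this] show ?thesis
    using lim[OF N] by (rule LIMSEQ_unique)
qed

text \<open>Inversion in the first coordinate with the resolvent of the second as weight, then in
  the second with an indicator of the first as weight. This gives equal masses of open rectangles,
  which generate the Borel sets and are stable under intersection.\<close>

theorem cauchy_transform2_determines_law:
  assumes L: "borel_law2 \<mu>" "borel_law2 \<nu>"
    and eq: "\<And>z w. Im z \<noteq> 0 \<Longrightarrow> Im w \<noteq> 0 \<Longrightarrow> cauchy_transform2 \<mu> z w = cauchy_transform2 \<nu> z w"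
  shows "\<mu> = \<nu>"
proof -
  define ind :: "real \<Rightarrow> real \<Rightarrow> real \<Rightarrow> complex" where "ind = (\<lambda>a b. indicator {a<..<b})"
  have E1: "(LINT p|\<mu>. 1 / (w - of_real (snd p)) * ind a b (fst p)) = (LINT p|\<nu>. 1 / (w - of_real (snd p)) * ind a b (fst p))"
    if "a < b" "Im w \<noteq> 0" for a b w
    unfolding ind_def
    by (rule wct_inversion[OF law_weight2[OF L(1) that(2)] law_weight2[OF L(2) that(2)] _ that(1)])
      (simp add: eq that(2) flip: cauchy_transform2_wct(2)[OF L(1)] cauchy_transform2_wct(2)[OF L(2)])
  have wv: "weighted_variable \<eta> snd (\<lambda>p. ind a b (fst p)) 1" if "borel_law2 \<eta>" for \<eta> a b
  proof -
    interpret real_pair \<eta> fst snd by (rule borel_law2_real_pair[OF that])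
    show ?thesis
      by unfold_locales (auto simp: ind_def indicator_def)
  qed
  have E2: "(LINT p|\<mu>. ind a b (fst p) * ind c d (snd p)) = (LINT p|\<nu>. ind a b (fst p) * ind c d (snd p))"
    if "a < b" "c < d" for a b c d
    unfolding ind_def
    by (rule wct_inversion[OF wv[OF L(1), unfolded ind_def] wv[OF L(2), unfolded ind_def] _ that(2)])
      (use E1[OF that(1)] in \<open>simp add: wct_def ind_def mult.commute\<close>)
  have mass: "(LINT p|\<eta>. ind a b (fst p) * ind c d (snd p)) = of_real (measure \<eta> ({a<..<b} \<times> {c<..<d}))" if "borel_law2 \<eta>" for \<eta> a b c d
  proof -
    interpret prob_space \<eta> using that by (simp add: borel_law2_def)
    have sp: "space \<eta> = UNIV" using that sets_eq_imp_space_eq[of \<eta> borel] by (simp add: borel_law2_def)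
    have "(LINT p|\<eta>. ind a b (fst p) * ind c d (snd p)) = (LINT p|\<eta>. of_real (indicator ({a<..<b} \<times> {c<..<d}) p))"
      by (intro Bochner_Integration.integral_cong) (auto simp: ind_def indicator_def)
    then show ?thesis unfolding integral_complex_of_real by (simp add: sp)
  qed
  have rect: "emeasure \<mu> ({a<..<b} \<times> {c<..<d}) = emeasure \<nu> ({a<..<b} \<times> {c<..<d})" for a b c d
  proof (cases "a < b \<and> c < d")
    case True
    interpret m: prob_space \<mu> using L by (simp add: borel_law2_def)
    interpret n: prob_space \<nu> using L by (simp add: borel_law2_def)
    have "measure \<mu> ({a<..<b} \<times> {c<..<d}) = measure \<nu> ({a<..<b} \<times> {c<..<d})"
      using E2[of a b c d] True unfolding mass[OF L(1)] mass[OF L(2)] by simp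
    then show ?thesis by (simp add: m.emeasure_eq_measure n.emeasure_eq_measure)
  next
    case False
    then have "{a<..<b} \<times> {c<..<d} = {}" by auto
    then show ?thesis by (simp only: emeasure_empty)
  qed
  show ?thesis
  proof (rule measure_eqI_generator_eq)
    let ?E = "range (\<lambda>(a, b). box a b :: (real \<times> real) set)"
    let ?A = "\<lambda>n::nat. box (- (real n *\<^sub>R One)) (real n *\<^sub>R One) :: (real \<times> real) set"
    show "Int_stable ?E" by (auto simp: Int_stable_def box_Int_box)
    show "?E \<subseteq> Pow UNIV" "sets \<mu> = sigma_sets UNIV ?E" "sets \<nu> = sigma_sets UNIV ?E"
      using L by (simp_all add: borel_eq_box borel_law2_def)
    show "range ?A \<subseteq> ?E" "(\<Union>i. ?A i) = UNIV" unfolding UN_box_eq_UNIV by auto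
    show "emeasure \<mu> (?A i) \<noteq> \<infinity>" for i
    proof -
      interpret m: prob_space \<mu> using L by (simp add: borel_law2_def)
      show ?thesis by simp
    qed
    show "emeasure \<mu> X = emeasure \<nu> X" if "X \<in> ?E" for X
    proof -
      obtain a b c d where "X = box (a, c) (b, d)" using \<open>X \<in> ?E\<close> by auto
      moreover have "box (a, c) (b, d) = {a<..<b} \<times> {c<..<d}"
        by (auto simp: box_def Basis_prod_def inner_Pair_0)
      ultimately show ?thesis using rect by simp
    qed
  qed
qed

text \<open>Letting one variable tend to zero radially isolates the $R$-transform of a marginal.\<close>

lemma R_transform_radial:
  assumes R: "is_R_transform m \<alpha> \<beta> R" and \<delta>: "0 < \<delta>" "\<delta> \<le> \<beta>" "\<alpha> > 0"
    and small: "\<And>w. w \<in> stolz_pair \<alpha> \<delta> \<Longrightarrow> cmod (w * R w) < 1 / 2"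
  defines "w \<equiv> \<lambda>n. Complex 0 (- \<delta> / real (Suc (Suc n)))"
  shows "w n \<in> stolz_pair \<alpha> \<delta>" "(\<lambda>n. w n * R (w n)) \<longlonglongrightarrow> 0"
    "filterlim (\<lambda>n. 1 / w n + R (w n)) at_infinity sequentially"
    "\<And>n. cmod (1 / w n + R (w n)) \<le> 3 * \<bar>Im (1 / w n + R (w n))\<bar>"
proof -
  have ws: "w n \<in> stolz_pair \<alpha> \<delta>" for n
  proof -
    \<comment> \<open>The denominators start at 2, so that the height stays strictly below
      \<delta>.\<close>
    have "\<delta> / real (Suc (Suc n)) < \<delta> / 1" using \<delta> by (intro divide_strict_left_mono) auto
    then show ?thesis using \<delta> by (simp add: w_def stolz_pair_iff del: of_nat_Suc)
  qed
  then show "w n \<in> stolz_pair \<alpha> \<delta>" .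
  have w0: "w n \<noteq> 0" for n using ws[of n] by (auto simp: stolz_pair_iff)
  have wlim: "w \<longlonglongrightarrow> 0"
  proof -
    have "(\<lambda>n. of_real (- \<delta> / real (Suc (Suc n))) * \<i>) \<longlonglongrightarrow> of_real 0 * \<i>"
      by (intro tendsto_intros tendsto_of_real) real_asymp
    then show ?thesis by (simp add: w_def Complex_eq mult.commute)
  qed
  have sub: "stolz_pair \<alpha> \<delta> \<subseteq> stolz_pair \<alpha> \<beta>" using \<delta> by (intro stolz_pair_mono) auto
  have lim: "((\<lambda>z. z * R z) \<longlongrightarrow> 0) (at 0 within stolz_pair \<alpha> \<beta>)" using R by (simp add: is_R_transform_def)
  show wR: "(\<lambda>n. w n * R (w n)) \<longlonglongrightarrow> 0"
    by (rule filterlim_compose[OF lim]) (use wlim w0 subsetD[OF sub ws] in \<open>auto simp: filterlim_at\<close>)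
  have eq: "1 / w n + R (w n) = (1 + w n * R (w n)) * (1 / w n)" for n using w0[of n] by (simp add: field_simps)
  have iw: "1 / w n = Complex 0 (real (Suc (Suc n)) / \<delta>)" for n
    using \<delta> by (simp add: w_def complex_eq_iff Re_divide Im_divide power2_eq_square del: of_nat_Suc)
  have niw: "cmod (1 / w n) = real (Suc (Suc n)) / \<delta>" for n unfolding iw using \<delta> by (simp add: norm_complex_def del: of_nat_Suc)
  have lower: "(1 / 2) * (real (Suc (Suc n)) / \<delta>) \<le> \<bar>Im (1 / w n + R (w n))\<bar>" for n
  proof -
    have "Im (1 / w n + R (w n)) = (1 + Re (w n * R (w n))) * (real (Suc (Suc n)) / \<delta>)"
    proof -
      have "1 / w n + R (w n) = (1 + w n * R (w n)) * Complex 0 (real (Suc (Suc n)) / \<delta>)"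
        by (subst eq) (simp only: iw)
      moreover have "Im (a * Complex 0 r) = Re a * r" for a r by simp
      ultimately show ?thesis by (simp only: plus_complex.sel one_complex.sel)
    qed
    moreover have "\<bar>Re (w n * R (w n))\<bar> \<le> 1 / 2" using small[OF ws[of n]] abs_Re_le_cmod[of "w n * R (w n)"] by linarith
    then have "1 / 2 \<le> \<bar>1 + Re (w n * R (w n))\<bar>" by linarith
    ultimately show ?thesis using \<delta> by (simp only: abs_mult) (intro mult_mono, auto)
  qed
  \<comment> \<open>The constant 3 is the quotient of the upper bound 3/2 for |1 + w R(w)| and the
    lower bound 1/2 for |1 + Re (w R(w))|.\<close>
  show "cmod (1 / w n + R (w n)) \<le> 3 * \<bar>Im (1 / w n + R (w n))\<bar>" for n
  proof -
    have "cmod (1 / w n + R (w n)) = cmod (1 + w n * R (w n)) * (real (Suc (Suc n)) / \<delta>)"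
      unfolding eq norm_mult niw ..
    also have "\<dots> \<le> (3 / 2) * (real (Suc (Suc n)) / \<delta>)"
      using norm_triangle_ineq[of 1 "w n * R (w n)"] small[OF ws[of n]] \<delta> by (intro mult_right_mono) auto
    also have "\<dots> \<le> 3 * \<bar>Im (1 / w n + R (w n))\<bar>" using lower[of n] by linarith
    finally show ?thesis .
  qed
  show "filterlim (\<lambda>n. 1 / w n + R (w n)) at_infinity sequentially"
    unfolding filterlim_at_infinity_conv_norm_at_top
  proof (rule filterlim_at_top_mono)
    show "filterlim (\<lambda>n. (1 / 2) * (real (Suc (Suc n)) / \<delta>)) at_top sequentially" using \<delta> by real_asymp
    show "eventually (\<lambda>n. (1 / 2) * (real (Suc (Suc n)) / \<delta>) \<le> cmod (1 / w n + R (w n))) sequentially"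
      using lower abs_Im_le_cmod by (intro always_eventually allI) (meson order_trans)
  qed
qed

lemma R_transform_times:
  assumes "is_R_transform m \<alpha> \<beta> R" "z \<in> stolz_pair \<alpha> \<beta>"
  shows "z * (1 / z + R z) = 1 + z * R z"
proof -
  have "z \<noteq> 0" using assms(2) by (auto simp: stolz_pair_iff)
  then show ?thesis by (simp add: distrib_left)
qed

text \<open>As B = 1/w + R2(w) goes to infinity in a cone, B G(A, B) tends to the marginal transform
  at A = 1/z + R1(z), that is to z, while w B tends to 1. The other variable is symmetric.\<close>

lemma bifree_h_radial:
  assumes L: "borel_law2 \<mu>"
    and S1: "is_R_transform (marginal1 \<mu>) \<alpha> \<beta> R1" and S2: "is_R_transform (marginal2 \<mu>) \<alpha> \<beta> R2"
    and \<delta>: "0 < \<delta>" "\<delta> \<le> \<beta>" "\<alpha> > 0"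
    and small: "\<And>w. w \<in> stolz_pair \<alpha> \<delta> \<Longrightarrow> cmod (w * R1 w) < 1 / 2" "\<And>w. w \<in> stolz_pair \<alpha> \<delta> \<Longrightarrow> cmod (w * R2 w) < 1 / 2"
    and z: "z \<in> stolz_pair \<alpha> \<beta>"
  defines "w \<equiv> \<lambda>n. Complex 0 (- \<delta> / real (Suc (Suc n)))"
  shows "(\<lambda>n. bifree_h \<mu> R1 R2 z (w n)) \<longlonglongrightarrow> 1" "(\<lambda>n. bifree_h \<mu> R1 R2 (w n) z) \<longlonglongrightarrow> 1"
proof -
  interpret real_pair \<mu> fst snd by (rule borel_law2_real_pair[OF L])
  have z0: "z \<noteq> 0" using z by (auto simp: stolz_pair_iff)
  have sub: "w n \<in> stolz_pair \<alpha> \<beta>" for n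
    using R_transform_radial(1)[OF S2 \<delta> small(2)] stolz_pair_mono[OF order_refl \<delta>(2), of \<alpha>] unfolding w_def by blast
  note A1 = R_transform_rcauchy[OF S1 z] and A2 = R_transform_rcauchy[OF S2 z]
  have "(LINT p|\<mu>. 1 / (1 / z + R1 z - of_real (fst p))) = cauchy_transform (marginal1 \<mu>) (1 / z + R1 z)"
    unfolding real_pair_G(1)[OF L, symmetric] A.G_def wct_def ..
  then have m1: "(LINT p|\<mu>. 1 / (1 / z + R1 z - of_real (fst p))) = z" using A1(2) by simp
  have "(LINT p|\<mu>. 1 / (1 / z + R2 z - of_real (snd p))) = cauchy_transform (marginal2 \<mu>) (1 / z + R2 z)"
    unfolding real_pair_G(2)[OF L, symmetric] B.G_def wct_def ..
  then have m2: "(LINT p|\<mu>. 1 / (1 / z + R2 z - of_real (snd p))) = z" using A2(2) by simp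
  have l1: "(\<lambda>n. (1 / w n + R2 (w n)) * cauchy_transform2 \<mu> (1 / z + R1 z) (1 / w n + R2 (w n))) \<longlonglongrightarrow> z"
    using weighted_variable.wct_nontangential_limit[OF law_weight1[OF L A1(1)] R_transform_radial(3,4)[OF S2 \<delta> small(2)]]
    unfolding w_def m1 cauchy_transform2_wct(1)[OF L] .
  have l2: "(\<lambda>n. (1 / w n + R1 (w n)) * cauchy_transform2 \<mu> (1 / w n + R1 (w n)) (1 / z + R2 z)) \<longlonglongrightarrow> z"
    using weighted_variable.wct_nontangential_limit[OF law_weight2[OF L A2(1)] R_transform_radial(3,4)[OF S1 \<delta> small(1)]]
    unfolding w_def m2 cauchy_transform2_wct(2)[OF L] .
  have t1: "(\<lambda>n. w n * (1 / w n + R1 (w n))) \<longlonglongrightarrow> 1 + 0"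
    unfolding R_transform_times[OF S1 sub]
    unfolding w_def by (rule tendsto_add[OF tendsto_const R_transform_radial(2)[OF S1 \<delta> small(1)]])
  have t2: "(\<lambda>n. w n * (1 / w n + R2 (w n))) \<longlonglongrightarrow> 1 + 0"
    unfolding R_transform_times[OF S2 sub]
    unfolding w_def by (rule tendsto_add[OF tendsto_const R_transform_radial(2)[OF S2 \<delta> small(2)]])
  have nz: "1 / w n + R1 (w n) \<noteq> 0" "1 / w n + R2 (w n) \<noteq> 0" for n
    using R_transform_rcauchy(1)[OF S1 sub] R_transform_rcauchy(1)[OF S2 sub] by (metis zero_complex.sel(2))+
  have "(\<lambda>n. (1 / w n + R2 (w n)) * cauchy_transform2 \<mu> (1 / z + R1 z) (1 / w n + R2 (w n)) / (z * (w n * (1 / w n + R2 (w n)))))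
      \<longlonglongrightarrow> z / (z * (1 + 0))"
    using z0 by (intro tendsto_intros l1 t2) simp
  moreover have "a * b / (z * (w * a)) = b / (z * w)" if "a \<noteq> 0" for a b w :: complex using that by simp
  ultimately show "(\<lambda>n. bifree_h \<mu> R1 R2 z (w n)) \<longlonglongrightarrow> 1"
    unfolding bifree_h_def using nz z0 by simp
  have "(\<lambda>n. (1 / w n + R1 (w n)) * cauchy_transform2 \<mu> (1 / w n + R1 (w n)) (1 / z + R2 z) / ((w n * (1 / w n + R1 (w n))) * z))
      \<longlonglongrightarrow> z / ((1 + 0) * z)"
    using z0 by (intro tendsto_intros l2 t1) simp
  moreover have "a * b / ((w * a) * z) = b / (w * z)" if "a \<noteq> 0" for a b w :: complex using that by simp
  ultimately show "(\<lambda>n. bifree_h \<mu> R1 R2 (w n) z) \<longlonglongrightarrow> 1"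
    unfolding bifree_h_def using nz z0 by simp
qed

theorem bifree_R_transform_determines_law:
  assumes L: "borel_law2 \<mu>" "borel_law2 \<nu>"
    and F: "is_bifree_R_transform \<mu> \<alpha> \<beta> F" "is_bifree_R_transform \<nu> \<alpha> \<beta> F"
  shows "\<mu> = \<nu>"
proof -
  obtain a1 b1 R1 R2 where p1: "0 < a1" "0 < b1"
    and R: "is_R_transform (marginal1 \<mu>) a1 b1 R1" "is_R_transform (marginal2 \<mu>) a1 b1 R2"
    and FR: "\<And>z w. z \<in> stolz_pair a1 b1 \<Longrightarrow> w \<in> stolz_pair a1 b1 \<Longrightarrow>
      bifree_h \<mu> R1 R2 z w \<noteq> 0 \<and> F (z, w) = z * R1 z + w * R2 w + (1 - 1 / bifree_h \<mu> R1 R2 z w)"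
    using F(1) unfolding is_bifree_R_transform_def bifree_R_formula_on_def product_domain_def by auto
  obtain a2 b2 S1 S2 where p2: "0 < a2" "0 < b2"
    and S: "is_R_transform (marginal1 \<nu>) a2 b2 S1" "is_R_transform (marginal2 \<nu>) a2 b2 S2"
    and FS: "\<And>z w. z \<in> stolz_pair a2 b2 \<Longrightarrow> w \<in> stolz_pair a2 b2 \<Longrightarrow>
      bifree_h \<nu> S1 S2 z w \<noteq> 0 \<and> F (z, w) = z * S1 z + w * S2 w + (1 - 1 / bifree_h \<nu> S1 S2 z w)"
    using F(2) unfolding is_bifree_R_transform_def bifree_R_formula_on_def product_domain_def by auto
  define a where "a = min a1 a2"
  define b where "b = min b1 b2"
  have ab: "a > 0" "b > 0" "a \<le> a1" "a \<le> a2" "b \<le> b1" "b \<le> b2" using p1 p2 by (auto simp: a_def b_def)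
  note R' = is_R_transform_mono[OF R(1) ab(3,5)] is_R_transform_mono[OF R(2) ab(3,5)]
  note S' = is_R_transform_mono[OF S(1) ab(4,6)] is_R_transform_mono[OF S(2) ab(4,6)]
  have sub: "stolz_pair a b \<subseteq> stolz_pair a1 b1" "stolz_pair a b \<subseteq> stolz_pair a2 b2"
    by (rule stolz_pair_mono[OF ab(3,5)] stolz_pair_mono[OF ab(4,6)])+
  have h: "(0::real) < 1 / 2" by simp
  obtain d1 where d1: "0 < d1" "d1 \<le> b" "\<And>w. w \<in> stolz_pair a d1 \<Longrightarrow> cmod (w * R1 w) < 1 / 2"
    by (rule R_transform_eventually_small[OF R'(1) h ab(1,2)], rule that)
  obtain d2 where d2: "0 < d2" "d2 \<le> b" "\<And>w. w \<in> stolz_pair a d2 \<Longrightarrow> cmod (w * R2 w) < 1 / 2"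
    by (rule R_transform_eventually_small[OF R'(2) h ab(1,2)], rule that)
  obtain d3 where d3: "0 < d3" "d3 \<le> b" "\<And>w. w \<in> stolz_pair a d3 \<Longrightarrow> cmod (w * S1 w) < 1 / 2"
    by (rule R_transform_eventually_small[OF S'(1) h ab(1,2)], rule that)
  obtain d4 where d4: "0 < d4" "d4 \<le> b" "\<And>w. w \<in> stolz_pair a d4 \<Longrightarrow> cmod (w * S2 w) < 1 / 2"
    by (rule R_transform_eventually_small[OF S'(2) h ab(1,2)], rule that)
  define d where "d = min (min d1 d2) (min d3 d4)"
  have d: "0 < d" "d \<le> b" "d \<le> d1" "d \<le> d2" "d \<le> d3" "d \<le> d4" using d1 d2 d3 d4 by (auto simp: d_def)
  have sm: "cmod (w * R1 w) < 1 / 2" "cmod (w * R2 w) < 1 / 2" "cmod (w * S1 w) < 1 / 2" "cmod (w * S2 w) < 1 / 2"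
    if w: "w \<in> stolz_pair a d" for w
    using subsetD[OF stolz_pair_mono[OF order_refl d(3)] w] subsetD[OF stolz_pair_mono[OF order_refl d(4)] w]
      subsetD[OF stolz_pair_mono[OF order_refl d(5)] w] subsetD[OF stolz_pair_mono[OF order_refl d(6)] w] d1(3) d2(3) d3(3) d4(3)
    by blast+
  define w where "w = (\<lambda>n. Complex 0 (- d / real (Suc (Suc n))))"
  have ws: "w n \<in> stolz_pair a b" for n
    using R_transform_radial(1)[OF R'(1) d(1,2) ab(1) sm(1)] stolz_pair_mono[OF order_refl d(2), of a] unfolding w_def by blast
  \<comment> \<open>In F(z, w n) every term except z R1(z) vanishes in the limit, because h tends to
    1. So F determines R1, and symmetrically R2.\<close>
  have eq1: "R1 z = S1 z" and eq2: "R2 z = S2 z" if z: "z \<in> stolz_pair a b" for z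
  proof -
    have z0: "z \<noteq> 0" using z by (auto simp: stolz_pair_iff)
    have hR: "(\<lambda>n. bifree_h \<mu> R1 R2 z (w n)) \<longlonglongrightarrow> 1" "(\<lambda>n. bifree_h \<mu> R1 R2 (w n) z) \<longlonglongrightarrow> 1"
      unfolding w_def by (rule bifree_h_radial[OF L(1) R' d(1,2) ab(1) sm(1,2) z], assumption, assumption)+
    have hS: "(\<lambda>n. bifree_h \<nu> S1 S2 z (w n)) \<longlonglongrightarrow> 1" "(\<lambda>n. bifree_h \<nu> S1 S2 (w n) z) \<longlonglongrightarrow> 1"
      unfolding w_def by (rule bifree_h_radial[OF L(2) S' d(1,2) ab(1) sm(3,4) z], assumption, assumption)+
    have rR: "(\<lambda>n. w n * R1 (w n)) \<longlonglongrightarrow> 0" "(\<lambda>n. w n * R2 (w n)) \<longlonglongrightarrow> 0"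
      unfolding w_def
      by (rule R_transform_radial(2)[OF R'(1) d(1,2) ab(1) sm(1)] R_transform_radial(2)[OF R'(2) d(1,2) ab(1) sm(2)], assumption)+
    have rS: "(\<lambda>n. w n * S1 (w n)) \<longlonglongrightarrow> 0" "(\<lambda>n. w n * S2 (w n)) \<longlonglongrightarrow> 0"
      unfolding w_def
      by (rule R_transform_radial(2)[OF S'(1) d(1,2) ab(1) sm(3)] R_transform_radial(2)[OF S'(2) d(1,2) ab(1) sm(4)], assumption)+
    note zs = subsetD[OF sub(1) z] subsetD[OF sub(2) z] and wss = subsetD[OF sub(1) ws] subsetD[OF sub(2) ws]
    have "(\<lambda>n. z * R1 z + w n * R2 (w n) + (1 - 1 / bifree_h \<mu> R1 R2 z (w n))) \<longlonglongrightarrow> z * R1 z + 0 + (1 - 1 / 1)"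
      by (intro tendsto_add tendsto_diff tendsto_divide tendsto_const hR rR one_neq_zero)
    then have "(\<lambda>n. F (z, w n)) \<longlonglongrightarrow> z * R1 z" using FR[OF zs(1) wss(1)] by simp
    moreover have "(\<lambda>n. z * S1 z + w n * S2 (w n) + (1 - 1 / bifree_h \<nu> S1 S2 z (w n))) \<longlonglongrightarrow> z * S1 z + 0 + (1 - 1 / 1)"
      by (intro tendsto_add tendsto_diff tendsto_divide tendsto_const hS rS one_neq_zero)
    then have "(\<lambda>n. F (z, w n)) \<longlonglongrightarrow> z * S1 z" using FS[OF zs(2) wss(2)] by simp
    ultimately show "R1 z = S1 z" using z0 LIMSEQ_unique by fastforce
    have "(\<lambda>n. w n * R1 (w n) + z * R2 z + (1 - 1 / bifree_h \<mu> R1 R2 (w n) z)) \<longlonglongrightarrow> 0 + z * R2 z + (1 - 1 / 1)"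
      by (intro tendsto_add tendsto_diff tendsto_divide tendsto_const hR rR one_neq_zero)
    then have "(\<lambda>n. F (w n, z)) \<longlonglongrightarrow> z * R2 z" using FR[OF wss(1) zs(1)] by simp
    moreover have "(\<lambda>n. w n * S1 (w n) + z * S2 z + (1 - 1 / bifree_h \<nu> S1 S2 (w n) z)) \<longlonglongrightarrow> 0 + z * S2 z + (1 - 1 / 1)"
      by (intro tendsto_add tendsto_diff tendsto_divide tendsto_const hS rS one_neq_zero)
    then have "(\<lambda>n. F (w n, z)) \<longlonglongrightarrow> z * S2 z" using FS[OF wss(2) zs(2)] by simp
    ultimately show "R2 z = S2 z" using z0 LIMSEQ_unique by fastforce
  qed
  have G: "cauchy_transform2 \<mu> (1 / z + R1 z) (1 / w + R2 w) = cauchy_transform2 \<nu> (1 / z + R1 z) (1 / w + R2 w)"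
    if z: "z \<in> stolz_pair a b" and w: "w \<in> stolz_pair a b" for z w
  proof -
    have nz: "z \<noteq> 0" "w \<noteq> 0" using z w by (auto simp: stolz_pair_iff)
    note 1 = FR[OF subsetD[OF sub(1) z] subsetD[OF sub(1) w]] and 2 = FS[OF subsetD[OF sub(2) z] subsetD[OF sub(2) w]]
    have "1 / bifree_h \<mu> R1 R2 z w = 1 / bifree_h \<nu> S1 S2 z w"
      using 1 2 eq1[OF z] eq2[OF w] by simp
    then have "bifree_h \<mu> R1 R2 z w = bifree_h \<nu> S1 S2 z w" using 1 2 by simp
    then show ?thesis using nz eq1[OF z] eq2[OF w] by (simp add: bifree_h_def)
  qed
  \<comment> \<open>Equality on the images of the Stolz pair spreads to the half-planes one variable
    at a time.\<close>
  have G1: "cauchy_transform2 \<mu> u (1 / w + R2 w) = cauchy_transform2 \<nu> u (1 / w + R2 w)"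
    if u: "Im u \<noteq> 0" and w: "w \<in> stolz_pair a b" for u w
    by (rule R_transform_image_identity[where f = "\<lambda>u. cauchy_transform2 \<mu> u (1 / w + R2 w)" and g = "\<lambda>u. cauchy_transform2 \<nu> u (1 / w + R2 w)",
          OF R'(1) ab(1,2) cauchy_transform2_holomorphic(2)[OF L(1) R_transform_rcauchy(1)[OF R'(2) w]]
          cauchy_transform2_holomorphic(2)[OF L(2) R_transform_rcauchy(1)[OF R'(2) w]] marginal_real_distribution(1)[OF L(1)] G[OF _ w] u])
  have "cauchy_transform2 \<mu> u v = cauchy_transform2 \<nu> u v" if u: "Im u \<noteq> 0" and v: "Im v \<noteq> 0" for u v
    by (rule R_transform_image_identity[where f = "cauchy_transform2 \<mu> u" and g = "cauchy_transform2 \<nu> u",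
          OF R'(2) ab(1,2) cauchy_transform2_holomorphic(1)[OF L(1) u] cauchy_transform2_holomorphic(1)[OF L(2) u]
          marginal_real_distribution(2)[OF L(1)] G1[OF u] v])
  then show ?thesis by (rule cauchy_transform2_determines_law[OF L])
qed

section \<open>The limit law\<close>

lemma is_R_transform_cauchy_cong:
  assumes "is_R_transform m \<alpha> \<beta> R" "\<And>z. Im z \<noteq> 0 \<Longrightarrow> cauchy_transform m' z = cauchy_transform m z"
  shows "is_R_transform m' \<alpha> \<beta> R"
  using assms by (auto simp: is_R_transform_def complex_is_Real_iff)

theorem bifree_limit_law_exists:
  fixes \<mu> :: "nat \<Rightarrow> (real \<times> real) measure" and k :: "nat \<Rightarrow> nat"
  assumes L: "\<And>n. borel_law2 (\<mu> n)" and k: "filterlim k at_top sequentially"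
    and conv1: "\<And>n. is_free_conv_power (marginal1 (\<mu> n)) (k n) (p1 n)"
    and conv2: "\<And>n. is_free_conv_power (marginal2 (\<mu> n)) (k n) (p2 n)"
    and \<nu>1: "real_distribution \<nu>1" "weak_conv_m p1 \<nu>1" "a1 > 0" "b1 > 0" "is_R_transform \<nu>1 a1 b1 L1"
    and \<nu>2: "real_distribution \<nu>2" "weak_conv_m p2 \<nu>2" "a2 > 0" "b2 > 0" "is_R_transform \<nu>2 a2 b2 L2"
    and pos: "\<alpha> > 0" "\<beta> > 0"
    and R\<mu>: "\<And>n. is_bifree_R_transform (\<mu> n) \<alpha> \<beta> (R\<mu> n)"
    and R: "\<And>x. x \<in> product_domain \<alpha> \<beta> \<Longrightarrow> (\<lambda>n. of_nat (k n) * R\<mu> n x) \<longlonglongrightarrow> R x"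
  shows "\<exists>\<nu>. borel_law2 \<nu> \<and> is_bifree_R_transform \<nu> \<alpha> \<beta> R"
proof -
  define P where "P = stolz_pair \<alpha> \<beta>"
  obtain C1 N1 R1 where C1: "C1 > 0"
    and hol1: "\<And>n. n \<ge> N1 \<Longrightarrow> R1 n holomorphic_on stolz_pair \<alpha> \<beta>"
    and R1: "\<And>n z. n \<ge> N1 \<Longrightarrow> z \<in> stolz_pair \<alpha> \<beta> \<Longrightarrow> Im (1 / z + R1 n z) \<noteq> 0 \<and> rvariance (marginal1 (\<mu> n)) (1 / z + R1 n z) < 1
       \<and> rcauchy (marginal1 (\<mu> n)) (1 / z + R1 n z) = 1 / z \<and> rvariance (marginal1 (\<mu> n)) (1 / z + R1 n z) \<le> C1 / real (k n)
       \<and> cmod (z * R1 n z) \<le> C1 / real (k n)"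
    and u1: "\<And>n \<alpha>' \<beta>' S z. n \<ge> N1 \<Longrightarrow> \<alpha>' \<le> \<alpha> \<Longrightarrow> \<beta>' \<le> \<beta> \<Longrightarrow> is_R_transform (marginal1 (\<mu> n)) \<alpha>' \<beta>' S \<Longrightarrow> z \<in> stolz_pair \<alpha>' \<beta>' \<Longrightarrow> S z = R1 n z"
    by (rule conv_power_R_transform_global[OF conv1 \<nu>1(1,2) k pos], rule that)
  obtain C2 N2 R2 where C2: "C2 > 0"
    and hol2: "\<And>n. n \<ge> N2 \<Longrightarrow> R2 n holomorphic_on stolz_pair \<alpha> \<beta>"
    and R2: "\<And>n z. n \<ge> N2 \<Longrightarrow> z \<in> stolz_pair \<alpha> \<beta> \<Longrightarrow> Im (1 / z + R2 n z) \<noteq> 0 \<and> rvariance (marginal2 (\<mu> n)) (1 / z + R2 n z) < 1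
       \<and> rcauchy (marginal2 (\<mu> n)) (1 / z + R2 n z) = 1 / z \<and> rvariance (marginal2 (\<mu> n)) (1 / z + R2 n z) \<le> C2 / real (k n)
       \<and> cmod (z * R2 n z) \<le> C2 / real (k n)"
    and u2: "\<And>n \<alpha>' \<beta>' S z. n \<ge> N2 \<Longrightarrow> \<alpha>' \<le> \<alpha> \<Longrightarrow> \<beta>' \<le> \<beta> \<Longrightarrow> is_R_transform (marginal2 (\<mu> n)) \<alpha>' \<beta>' S \<Longrightarrow> z \<in> stolz_pair \<alpha>' \<beta>' \<Longrightarrow> S z = R2 n z"
    by (rule conv_power_R_transform_global[OF conv2 \<nu>2(1,2) k pos], rule that)
  define C where "C = max C1 C2"
  obtain K :: nat where K: "real K \<ge> 2 * C" using real_arch_simple by blast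
  obtain N3 where N3: "\<And>n. n \<ge> N3 \<Longrightarrow> k n \<ge> max 2 K"
    using k unfolding filterlim_at_top eventually_sequentially by meson
  define N where "N = max N1 (max N2 N3)"
  \<comment> \<open>Indices are shifted past N, so that the estimates hold for every j.\<close>
  define s where "s = (\<lambda>j. j + N)"
  have sN: "s j \<ge> N1" "s j \<ge> N2" "s j \<ge> N3" for j by (auto simp: s_def N_def)
  have k2: "k (s j) \<ge> 2" "real (k (s j)) \<ge> 2 * C" "real (k (s j)) > 0" for j
    using N3[OF sN(3), of j] K by auto
  have glob: "bifree_global (\<mu> (s j)) \<alpha> \<beta> (R1 (s j)) (R2 (s j))" for j
    using L hol1[OF sN(1)] hol2[OF sN(2)] R1[OF sN(1)] R2[OF sN(2)] by unfold_locales blast+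
  define f where "f = (\<lambda>j z w. of_nat (k (s j)) * bifree_ext (\<mu> (s j)) (R1 (s j)) (R2 (s j)) z w)"
  have f_eq: "of_nat (k (s j)) * R\<mu> (s j) (z, w) = f j z w" if "z \<in> P" "w \<in> P" for j z w
    unfolding f_def P_def
    by (rule arg_cong[OF bifree_global.bifree_R_transform_eq_ext[OF glob R\<mu>]])
      (use u1[OF sN(1)] u2[OF sN(2)] that in \<open>simp_all add: P_def\<close>)
  have f_lim: "(\<lambda>j. f j z w) \<longlonglongrightarrow> R (z, w)" if "z \<in> P" "w \<in> P" for z w
  proof -
    have "(z, w) \<in> product_domain \<alpha> \<beta>" using that by (simp add: product_domain_def P_def)
    from LIMSEQ_ignore_initial_segment[OF R[OF this], of N] show ?thesis
      using f_eq[OF that] by (simp add: s_def)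
  qed
  have f_bound: "cmod (f j z w) \<le> 4 * C" if "z \<in> P" "w \<in> P" for j z w
  proof -
    have le: "C1 / real (k (s j)) \<le> C / real (k (s j))" "C2 / real (k (s j)) \<le> C / real (k (s j))"
      using k2(3)[of j] by (auto simp: C_def intro!: divide_right_mono)
    have "cmod (of_real (real (k (s j))) * bifree_ext (\<mu> (s j)) (R1 (s j)) (R2 (s j)) z w) \<le> 4 * C"
      using R1[OF sN(1)[of j], of z] R2[OF sN(2)[of j], of w] le that
      by (intro bifree_global.bifree_ext_bound[OF glob]) (use k2[of j] in \<open>auto simp: P_def intro: order_trans\<close>)
    then show ?thesis by (simp add: f_def)
  qed
  have f_hol: "w \<in> P \<Longrightarrow> (\<lambda>z. f j z w) holomorphic_on P" "z \<in> P \<Longrightarrow> f j z holomorphic_on P" for j z w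
    unfolding f_def[abs_def] P_def
    by (intro holomorphic_intros bifree_global.bifree_ext_holomorphic[OF glob]; assumption)+
  have oP: "open P" unfolding P_def by (rule open_stolz_pair)
  have R_hol: "holomorphic2_on R (product_domain \<alpha> \<beta>)"
  proof -
    have "separately_holomorphic (\<lambda>z w. R (z, w)) P P"
    proof unfold_locales
      show "(\<lambda>z. R (z, w)) holomorphic_on P" if w: "w \<in> P" for w
        by (rule bounded_pointwise_limit_holomorphic[OF oP f_hol(1)[OF w] f_bound[OF _ w] f_lim[OF _ w]])
      show "(\<lambda>w. R (z, w)) holomorphic_on P" if z: "z \<in> P" for z
        by (rule bounded_pointwise_limit_holomorphic[OF oP f_hol(2)[OF z] f_bound[OF z] f_lim[OF z]])
      have "cmod (R (z, w)) \<le> 4 * C" if "z \<in> P" "w \<in> P" for z w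
        using tendsto_norm[OF f_lim[OF that]] f_bound[OF that] by (intro LIMSEQ_le_const2) auto
      then show "\<exists>r>0. \<exists>M. \<forall>z'\<in>P. \<forall>w'\<in>P. dist z z' < r \<longrightarrow> dist w w' < r \<longrightarrow> cmod (R (z', w')) \<le> M" for z w
        by (intro exI[of _ 1] conjI exI[of _ "4 * C"]) auto
    qed (rule oP oP)+
    then show ?thesis
      unfolding product_domain_def P_def[symmetric] by (rule separately_holomorphic_imp_holomorphic2_on)
  qed
  have pow: "bifree_power (\<mu> (s j)) (k (s j)) (p1 (s j)) (p2 (s j))" for j
    using L k2(1) conv1 conv2 by unfold_locales
  have pt: "plane_transform (bifree_power.H (\<mu> (s j)) (k (s j)) (p1 (s j)) (p2 (s j))) 2 (p1 (s j)) (p2 (s j))" for j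
  proof -
    interpret bifree_power "\<mu> (s j)" "k (s j)" "p1 (s j)" "p2 (s j)" by (rule pow)
    show ?thesis by (rule plane_transform_axioms)
  qed
  have "\<exists>\<eta>. borel_law2 \<eta> \<and>
      (\<forall>z w. Im z \<noteq> 0 \<longrightarrow> Im w \<noteq> 0 \<longrightarrow> cauchy_transform2 \<eta> z w = bifree_power.H (\<mu> (s j)) (k (s j)) (p1 (s j)) (p2 (s j)) z w) \<and>
      (\<forall>z. Im z \<noteq> 0 \<longrightarrow> cauchy_transform (marginal1 \<eta>) z = cauchy_transform (p1 (s j)) z) \<and>
      (\<forall>z. Im z \<noteq> 0 \<longrightarrow> cauchy_transform (marginal2 \<eta>) z = cauchy_transform (p2 (s j)) z)" for j
    by (rule plane_transform.plane_transform_law[OF pt]) blast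
  then obtain \<Lambda> where \<Lambda>: "\<And>j. borel_law2 (\<Lambda> j)"
    "\<And>j z w. Im z \<noteq> 0 \<Longrightarrow> Im w \<noteq> 0 \<Longrightarrow> cauchy_transform2 (\<Lambda> j) z w = bifree_power.H (\<mu> (s j)) (k (s j)) (p1 (s j)) (p2 (s j)) z w"
    "\<And>j z. Im z \<noteq> 0 \<Longrightarrow> cauchy_transform (marginal1 (\<Lambda> j)) z = cauchy_transform (p1 (s j)) z"
    "\<And>j z. Im z \<noteq> 0 \<Longrightarrow> cauchy_transform (marginal2 (\<Lambda> j)) z = cauchy_transform (p2 (s j)) z"
    by metis
  have rd: "real_distribution (p1 n)" "real_distribution (p2 n)" for n
    using free_conv_power_R_transform[OF conv1[of n]] free_conv_power_R_transform[OF conv2[of n]] by simp_all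
  have lim1: "(\<lambda>j. cauchy_transform (p1 (s j)) z) \<longlonglongrightarrow> cauchy_transform \<nu>1 z" if "Im z \<noteq> 0" for z
    unfolding s_def by (rule LIMSEQ_ignore_initial_segment[OF weak_conv_cauchy_transform[OF rd(1) \<nu>1(1,2) that]])
  have lim2: "(\<lambda>j. cauchy_transform (p2 (s j)) z) \<longlonglongrightarrow> cauchy_transform \<nu>2 z" if "Im z \<noteq> 0" for z
    unfolding s_def by (rule LIMSEQ_ignore_initial_segment[OF weak_conv_cauchy_transform[OF rd(2) \<nu>2(1,2) that]])
  have lim1': "(\<lambda>j. cauchy_transform (marginal1 (\<Lambda> j)) z) \<longlonglongrightarrow> cauchy_transform \<nu>1 z" if "Im z \<noteq> 0" for z
    using lim1[OF that] \<Lambda>(3)[OF that] by simp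
  have lim2': "(\<lambda>j. cauchy_transform (marginal2 (\<Lambda> j)) z) \<longlonglongrightarrow> cauchy_transform \<nu>2 z" if "Im z \<noteq> 0" for z
    using lim2[OF that] \<Lambda>(4)[OF that] by simp
  obtain r \<nu> where r: "strict_mono r" and \<nu>: "borel_law2 \<nu>"
    and G: "\<And>z w. Im z \<noteq> 0 \<Longrightarrow> Im w \<noteq> 0 \<Longrightarrow> (\<lambda>j. cauchy_transform2 (\<Lambda> (r j)) z w) \<longlonglongrightarrow> cauchy_transform2 \<nu> z w"
    and m: "\<And>z. Im z \<noteq> 0 \<Longrightarrow> cauchy_transform (marginal1 \<nu>) z = cauchy_transform \<nu>1 z"
      "\<And>z. Im z \<noteq> 0 \<Longrightarrow> cauchy_transform (marginal2 \<nu>) z = cauchy_transform \<nu>2 z"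
    by (rule law2_compactness[OF \<Lambda>(1) \<nu>1(1) \<nu>2(1) lim1' lim2'], assumption, assumption, rule that)
  define a where "a = min \<alpha> (min a1 a2)"
  define b where "b = min \<beta> (min b1 b2)"
  have ab: "0 < a" "a \<le> \<alpha>" "a \<le> a1" "a \<le> a2" "0 < b" "b \<le> \<beta>" "b \<le> b1" "b \<le> b2"
    using pos \<nu>1 \<nu>2 by (auto simp: a_def b_def)
  note T1 = is_R_transform_mono[OF \<nu>1(5) ab(3,7)] and T2 = is_R_transform_mono[OF \<nu>2(5) ab(4,8)]
  have formula: "bifree_h \<nu> L1 L2 z w \<noteq> 0 \<and> R (z, w) = z * L1 z + w * L2 w + (1 - 1 / bifree_h \<nu> L1 L2 z w)"
    if z: "z \<in> stolz_pair a b" and w: "w \<in> stolz_pair a b" for z w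
  proof -
    have zP: "z \<in> P" and wP: "w \<in> P" using z w stolz_pair_mono[OF ab(2,6)] by (auto simp: P_def)
    have nz: "z \<noteq> 0" "w \<noteq> 0" using z w by (auto simp: stolz_pair_iff)
    define A where "A = 1 / z + L1 z"
    define B where "B = 1 / w + L2 w"
    have A: "Im A \<noteq> 0" "cauchy_transform \<nu>1 A = z" using R_transform_rcauchy[OF T1 z] by (simp_all add: A_def)
    have B: "Im B \<noteq> 0" "cauchy_transform \<nu>2 B = w" using R_transform_rcauchy[OF T2 w] by (simp_all add: B_def)
    \<comment> \<open>The identity for the powers at the fixed point (A, B) evaluates k times the
      R-transform at the transforms of the marginal powers. These arguments move with j and converge
      to z and w.\<close>
    define x where "x = (\<lambda>j. cauchy_transform (p1 (s j)) A)"
    define y where "y = (\<lambda>j. cauchy_transform (p2 (s j)) B)"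
    have x: "x \<longlonglongrightarrow> z" and y: "y \<longlonglongrightarrow> w"
      using lim1[OF A(1)] lim2[OF B(1)] A(2) B(2) by (simp_all add: x_def y_def)
    obtain e1 where e1: "e1 > 0" "ball z e1 \<subseteq> P" using oP zP by (auto elim: openE)
    obtain e2 where e2: "e2 > 0" "ball w e2 \<subseteq> P" using oP wP by (auto elim: openE)
    define e where "e = min e1 e2"
    have e: "e > 0" "ball z e \<subseteq> P" "ball w e \<subseteq> P" using e1 e2 by (auto simp: e_def)
    have evx: "eventually (\<lambda>j. x j \<in> ball z (e / 2)) sequentially" and evy: "eventually (\<lambda>j. y j \<in> ball w (e / 2)) sequentially"
      using topological_tendstoD[OF x, of "ball z (e / 2)"] topological_tendstoD[OF y, of "ball w (e / 2)"] e by auto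
    \<comment> \<open>The uniform bound 4 C makes the functions f j equi-Lipschitz near (z, w), so
      the moving arguments may be replaced by their limits.\<close>
    have f_diff: "(\<lambda>j. f j (x j) (y j) - f j z w) \<longlonglongrightarrow> 0"
    proof (rule Lim_null_comparison)
      show "eventually (\<lambda>j. cmod (f j (x j) (y j) - f j z w) \<le> 4 * (4 * C) / e * cmod (x j - z) + 4 * (4 * C) / e * cmod (y j - w)) sequentially"
        using evx evy
      proof eventually_elim
        case (elim j)
        have yP: "y j \<in> P" using elim(2) e by auto
        have 1: "cmod (f j (x j) (y j) - f j z (y j)) \<le> 4 * (4 * C) / e * cmod (x j - z)"
        proof (rule holomorphic_bounded_Lipschitz[of "\<lambda>z. f j z (y j)" z e])
          show "(\<lambda>z. f j z (y j)) holomorphic_on ball z e" by (rule holomorphic_on_subset[OF f_hol(1)[OF yP] e(2)])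
          show "cmod (f j u (y j)) \<le> 4 * C" if "u \<in> ball z e" for u by (rule f_bound[OF subsetD[OF e(2) that] yP])
        qed (use elim(1) e in auto)
        have 2: "cmod (f j z (y j) - f j z w) \<le> 4 * (4 * C) / e * cmod (y j - w)"
        proof (rule holomorphic_bounded_Lipschitz[of "f j z" w e])
          show "f j z holomorphic_on ball w e" by (rule holomorphic_on_subset[OF f_hol(2)[OF zP] e(3)])
          show "cmod (f j z u) \<le> 4 * C" if "u \<in> ball w e" for u by (rule f_bound[OF zP subsetD[OF e(3) that]])
        qed (use elim(2) e in auto)
        show ?case
          by (rule order_trans[OF norm_diff_triangle_ineq[of "f j (x j) (y j)" "f j z (y j)" "f j z (y j)" "f j z w", simplified] add_mono[OF 1 2]])
      qed
      have "(\<lambda>j. 4 * (4 * C) / e * cmod (x j - z) + 4 * (4 * C) / e * cmod (y j - w)) \<longlonglongrightarrow> 4 * (4 * C) / e * cmod (z - z) + 4 * (4 * C) / e * cmod (w - w)"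
        by (intro tendsto_intros x y)
      then show "(\<lambda>j. 4 * (4 * C) / e * cmod (x j - z) + 4 * (4 * C) / e * cmod (y j - w)) \<longlonglongrightarrow> 0" by simp
    qed
    have fxy: "(\<lambda>j. f j (x j) (y j)) \<longlonglongrightarrow> R (z, w)"
      using tendsto_add[OF f_diff f_lim[OF zP wP]] by simp
    have rhs: "(\<lambda>j. cauchy_transform2 (\<Lambda> (r j)) A B * (1 - (f (r j) (x (r j)) (y (r j)) - (x (r j) * A - 1) - (y (r j) * B - 1))))
       \<longlonglongrightarrow> cauchy_transform2 \<nu> A B * (1 - (R (z, w) - (z * A - 1) - (w * B - 1)))"
      using LIMSEQ_subseq_LIMSEQ[OF fxy r] LIMSEQ_subseq_LIMSEQ[OF x r] LIMSEQ_subseq_LIMSEQ[OF y r]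
      unfolding comp_def by (intro tendsto_intros G[OF A(1) B(1)])
    have lhs: "(\<lambda>j. x (r j) * y (r j)) \<longlonglongrightarrow> z * w"
      using LIMSEQ_subseq_LIMSEQ[OF x r] LIMSEQ_subseq_LIMSEQ[OF y r] unfolding comp_def by (intro tendsto_intros)
    have "eventually (\<lambda>j. x j * y j = cauchy_transform2 (\<Lambda> j) A B * (1 - (f j (x j) (y j) - (x j * A - 1) - (y j * B - 1)))) sequentially"
      using evx evy
    proof eventually_elim
      case (elim j)
      have "ball z (e / 2) \<subseteq> P" "ball w (e / 2) \<subseteq> P" using e subset_ball[of "e / 2" e] by fastforce+
      then have "x j \<in> stolz_pair \<alpha> \<beta>" "y j \<in> stolz_pair \<alpha> \<beta>" using elim by (auto simp: P_def)
      then show ?case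
        unfolding \<Lambda>(2)[OF A(1) B(1)] f_def x_def y_def
        by (rule bifree_global.bifree_ext_power[OF glob pow A(1) B(1)])
    qed
    then have "eventually (\<lambda>j. x (r j) * y (r j) = cauchy_transform2 (\<Lambda> (r j)) A B * (1 - (f (r j) (x (r j)) (y (r j)) - (x (r j) * A - 1) - (y (r j) * B - 1)))) sequentially"
      using eventually_subseq[OF r] by fastforce
    from LIMSEQ_unique[OF Lim_transform_eventually[OF lhs this] rhs]
    have zw: "z * w = cauchy_transform2 \<nu> A B * (1 - (R (z, w) - (z * A - 1) - (w * B - 1)))" .
    define t where "t = 1 - (R (z, w) - z * L1 z - w * L2 w)"
    have "z * A - 1 = z * L1 z" "w * B - 1 = w * L2 w" using nz by (simp_all add: A_def B_def distrib_left)
    then have zw: "z * w = cauchy_transform2 \<nu> A B * t" using zw by (simp add: t_def)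
    \<comment> \<open>The limit identity is in product form; as z w is nonzero, neither factor
      vanishes, and h = 1 / t is nonzero as well.\<close>
    have t0: "t \<noteq> 0" "cauchy_transform2 \<nu> A B \<noteq> 0" using zw nz by auto
    have h: "bifree_h \<nu> L1 L2 z w = 1 / t"
      unfolding bifree_h_def A_def[symmetric] B_def[symmetric] zw using t0 by simp
    show ?thesis unfolding h using t0 by (simp add: t_def)
  qed
  have "bifree_R_formula_on \<nu> a b R"
    unfolding bifree_R_formula_on_def product_domain_def
    using is_R_transform_cauchy_cong[OF T1 m(1)] is_R_transform_cauchy_cong[OF T2 m(2)] formula
    by (intro exI[of _ L1] exI[of _ L2]) auto
  then have "is_bifree_R_transform \<nu> \<alpha> \<beta> R"
    unfolding is_bifree_R_transform_def using R_hol ab by blast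
  with \<nu> show ?thesis by blast
qed

theorem theorem3p6:
  fixes \<mu> :: "nat \<Rightarrow> (real \<times> real) measure"
    and k :: "nat \<Rightarrow> nat"
    and p1 p2 :: "nat \<Rightarrow> real measure"
    and \<gamma>1 \<gamma>2 :: real
    and \<sigma>1 \<sigma>2 \<nu>1 \<nu>2 :: "real measure"
    and \<alpha> \<beta> :: real
    and R\<mu> :: "nat \<Rightarrow> complex \<times> complex \<Rightarrow> complex"
    and R :: "complex \<times> complex \<Rightarrow> complex"
  assumes "\<And>n. borel_law2 (\<mu> n)"
    and "\<And>n. k n > 0"
    and "filterlim k at_top sequentially"
    and "\<And>n. is_free_conv_power (marginal1 (\<mu> n)) (k n) (p1 n)"
    and "\<And>n. is_free_conv_power (marginal2 (\<mu> n)) (k n) (p2 n)"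
    and "is_free_levy_law \<gamma>1 \<sigma>1 \<nu>1"
    and "is_free_levy_law \<gamma>2 \<sigma>2 \<nu>2"
    and "weak_conv_m p1 \<nu>1"
    and "weak_conv_m p2 \<nu>2"
    and "\<alpha> > 0" and "\<beta> > 0"
    and "\<And>n. is_bifree_R_transform (\<mu> n) \<alpha> \<beta> (R\<mu> n)"
    and "\<And>x. x \<in> product_domain \<alpha> \<beta> \<Longrightarrow> (\<lambda>n. of_nat (k n) * R\<mu> n x) \<longlonglongrightarrow> R x"
  shows "\<exists>!\<nu>. borel_law2 \<nu> \<and> is_bifree_R_transform \<nu> \<alpha> \<beta> R"
proof -
  obtain a1 b1 where \<nu>1: "real_distribution \<nu>1" "a1 > 0" "b1 > 0" "is_R_transform \<nu>1 a1 b1 (free_levy_R \<gamma>1 \<sigma>1)"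
    using assms(6) unfolding is_free_levy_law_def free_infinitely_divisible_def by blast
  obtain a2 b2 where \<nu>2: "real_distribution \<nu>2" "a2 > 0" "b2 > 0" "is_R_transform \<nu>2 a2 b2 (free_levy_R \<gamma>2 \<sigma>2)"
    using assms(7) unfolding is_free_levy_law_def free_infinitely_divisible_def by blast
  have "\<exists>\<nu>. borel_law2 \<nu> \<and> is_bifree_R_transform \<nu> \<alpha> \<beta> R"
    by (rule bifree_limit_law_exists[OF assms(1,3,4,5) \<nu>1(1) assms(8) \<nu>1(2-4) \<nu>2(1) assms(9) \<nu>2(2-4) assms(10-13)])
  then show ?thesis
    using bifree_R_transform_determines_law by blast
qed

end
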